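(* Let $0\le\gamma_i<1<\alpha_i\le 2$ for $i=1,2$, let $\varphi,\psi\in L^1(\mathbb{R})$ with $\varphi,\psi\neq 0$ be fixed, and let $X_T=(X_T(s,t))_{s,t\ge 0}$ be the rescaled occupation time fluctuation process of the two-type particle system (defined in the context) with norming $$F_T=\prod_{i=1}^2 T^{1-(1+\gamma_i)/(2\alpha_i)}.$$ Then, as $T\to\infty$, the finite-dimensional distributions of $X_T$ converge to the finite-dimensional distributions of $DW$, where $W$ is the weighted fractional Brownian sheet with parameters $a_1=-\gamma_1/\alpha_1$, $b_1=1-1/\alpha_1$, $a_2=-\gamma_2/\alpha_2$, $b_2=1-1/\alpha_2$, and $D$ is the constant $$D=\int_{\mathbb{R}}\varphi(x)\,dx\int_{\mathbb{R}}\psi(x)\,dx\left(\prod_{i=1}^{2}\frac{1}{1-1/\alpha_i}\,p_1^{\alpha_i}(0)\int_{\mathbb{R}}\frac{p_1^{\alpha_i}(x)}{|x|^{\gamma_i}}\,dx\right)^{1/2},$$ with $$p_t^{\alpha}(x)=\frac{1}{2\pi}\int_{\mathbb{R}}\exp\{-(ixy+t|y|^{\alpha})\}\,dy$$ the transition density of the symmetric $\alpha$-stable Lévy process.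
   Context: Weighted fractional Brownian sheet: for parameters $(a_i,b_i)$, $i=1,2$, with $a_i>-1$, $-1<b_i\le 1$, $|b_i|\le 1+a_i$, it is the centered Gaussian random field $W=(W_{s,t})_{s,t\ge 0}$ with covariance $E(W_{s,t}W_{s',t'})=C^{(1)}(s,s')C^{(2)}(t,t')$, where $$C^{(i)}(u,v)=\int_0^{u\wedge v} r^{a_i}\left[(u-r)^{b_i}+(v-r)^{b_i}\right]dr .$$ Particle system: let $\mu_i(dx)=dx/|x|^{\gamma_i}$ on $\mathbb{R}$, $i=1,2$, and let $N_{0,0}$ be a Poisson random measure on $\mathbb{R}\times\mathbb{R}$ with intensity $\mu_1\otimes\mu_2$. From each point $(x_1,x_2)$ of $N_{0,0}$ start two independent Lévy processes: $\xi^{x_1}$, symmetric $\alpha_1$-stable started at $x_1$, and $\zeta^{x_2}$, symmetric $\alpha_2$-stable started at $x_2$ (with transition densities $p_t^{\alpha_1}$, $p_t^{\alpha_2}$); the pairs attached to different points are independent of each other and, given the starting points, of $N_{0,0}$. For $u,v\ge 0$ put $$\langle N_{u,v},\varphi\otimes\psi\rangle=\sum_{(x_1,x_2)\in N_{0,0}}\varphi(\xi^{x_1}_u)\,\psi(\zeta^{x_2}_v),$$ and define the occupation time process $$\langle L_{s,t},\varphi\otimes\psi\rangle=\int_0^s\int_0^t\langle N_{u,v},\varphi\otimes\psi\rangle\,dv\,du,\qquad s,t\ge 0.$$ The rescaled occupation time fluctuation process is $$X_T(s,t)=\frac{1}{F_T}\Big(\langle L_{Ts,Tt},\varphi\otimes\psi\rangle-E\langle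 L_{Ts,Tt},\varphi\otimes\psi\rangle\Big),\qquad s,t\ge 0 .$$ *)

theory Defs
  imports "HOL-Probability.Probability"
begin

section \<open>Symmetric stable Levy processes\<close>

text \<open>The integral below is real, by symmetry of the integrand in \<open>y\<close>.\<close>

definition stable_density :: "real \<Rightarrow> real \<Rightarrow> real \<Rightarrow> real" where
  "stable_density \<alpha> t x =
     Re (1 / (2 * pi) *
         (LINT y|lborel. exp (- (\<i> * complex_of_real (x * y) + complex_of_real (t * \<bar>y\<bar> powr \<alpha>)))))"

definition cadlag :: "(real \<Rightarrow> real) \<Rightarrow> bool" where
  "cadlag f \<longleftrightarrow> (\<forall>t\<ge>0. continuous (at_right t) f) \<and> (\<forall>t>0. \<exists>l. (f \<longlongrightarrow> l) (at_left t))"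

definition levy_process :: "'a measure \<Rightarrow> (real \<Rightarrow> 'a \<Rightarrow> real) \<Rightarrow> bool" where
  "levy_process M X \<longleftrightarrow>
     prob_space M \<and>
     (\<forall>t\<ge>0. X t \<in> borel_measurable M) \<and>
     (AE \<omega> in M. X 0 \<omega> = 0) \<and>
     (\<forall>n::nat. \<forall>r::nat \<Rightarrow> real. 0 \<le> r 0 \<and> (\<forall>k<n. r k \<le> r (Suc k)) \<longrightarrow>
        prob_space.indep_vars M (\<lambda>_. borel) (\<lambda>k \<omega>. X (r (Suc k)) \<omega> - X (r k) \<omega>) {..<n}) \<and>
     (\<forall>r\<ge>0. \<forall>t\<ge>0. distr M borel (\<lambda>\<omega>. X (r + t) \<omega> - X r \<omega>) = distr M borel (X t)) \<and>
     (\<forall>\<omega>\<in>space M. cadlag (\<lambda>t. X t \<omega>))"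

definition symmetric_stable_process :: "'a measure \<Rightarrow> real \<Rightarrow> (real \<Rightarrow> 'a \<Rightarrow> real) \<Rightarrow> bool" where
  "symmetric_stable_process M \<alpha> X \<longleftrightarrow>
     levy_process M X \<and>
     (\<forall>t>0. distributed M lborel (X t) (\<lambda>x. ennreal (stable_density \<alpha> t x)))"

section \<open>Poisson random measures\<close>

definition poisson_random_measure :: "'a measure \<Rightarrow> 'b measure \<Rightarrow> ('a \<Rightarrow> 'b measure) \<Rightarrow> bool" where
  "poisson_random_measure M \<nu> N \<longleftrightarrow>
     prob_space M \<and>
     (\<forall>\<omega>\<in>space M. sets (N \<omega>) = sets \<nu>) \<and>
     (\<forall>B\<in>sets \<nu>. (\<lambda>\<omega>. emeasure (N \<omega>) B) \<in> borel_measurable M) \<and>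
     (\<forall>B\<in>sets \<nu>. emeasure \<nu> B < \<infinity> \<longrightarrow>
        (\<forall>k::nat. measure M {\<omega>\<in>space M. emeasure (N \<omega>) B = of_nat k} =
                  measure \<nu> B ^ k / fact k * exp (- measure \<nu> B))) \<and>
     (\<forall>B\<in>sets \<nu>. emeasure \<nu> B = \<infinity> \<longrightarrow> (AE \<omega> in M. emeasure (N \<omega>) B = \<infinity>)) \<and>
     (\<forall>n::nat. \<forall>B::nat \<Rightarrow> 'b set. (\<forall>i<n. B i \<in> sets \<nu>) \<and> disjoint_family_on B {..<n} \<longrightarrow>
        prob_space.indep_vars M (\<lambda>_. borel) (\<lambda>i \<omega>. emeasure (N \<omega>) (B i)) {..<n})"

section \<open>The two-type particle system\<close>

definition power_intensity :: "real \<Rightarrow> real measure" where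
  "power_intensity \<gamma> = density lborel (\<lambda>x. ennreal (1 / \<bar>x\<bar> powr \<gamma>))"

definition displacement :: "(real \<Rightarrow> 'a \<Rightarrow> real) \<Rightarrow> real \<Rightarrow> 'a \<Rightarrow> real" where
  "displacement X t \<omega> = X t \<omega> - X 0 \<omega>"

definition sample_path :: "(real \<Rightarrow> 'a \<Rightarrow> real) \<Rightarrow> 'a \<Rightarrow> real \<Rightarrow> real" where
  "sample_path X \<omega> = (\<lambda>t\<in>{0..}. X t \<omega>)"

abbreviation path_space :: "(real \<Rightarrow> real) measure" where
  "path_space \<equiv> PiM {0..} (\<lambda>_. borel)"

text \<open>
  The intensity measure is infinite, so the Poisson configuration almost surely has infinitely
  many points and is enumerated by the naturals: its \<open>n\<close>-th point is \<open>(\<xi> n 0, \<zeta> n 0)\<close>, and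
  \<open>\<xi> n\<close>, \<open>\<zeta> n\<close> are the two motions started there. A Levy process started at \<open>x\<close> is \<open>x\<close> plus a
  Levy process started at 0, so that independence of the motions given the starting points is
  independence of their displacements from the starting points.
\<close>

definition initial_configuration ::
    "(nat \<Rightarrow> real \<Rightarrow> 'a \<Rightarrow> real) \<Rightarrow> (nat \<Rightarrow> real \<Rightarrow> 'a \<Rightarrow> real) \<Rightarrow> 'a \<Rightarrow> (real \<times> real) measure" where
  "initial_configuration \<xi> \<zeta> \<omega> =
     distr (count_space UNIV) (borel \<Otimes>\<^sub>M borel) (\<lambda>n. (\<xi> n 0 \<omega>, \<zeta> n 0 \<omega>))"

definition two_type_particle_system ::
    "'a measure \<Rightarrow> (nat \<Rightarrow> real) \<Rightarrow> (nat \<Rightarrow> real) \<Rightarrow>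
     (nat \<Rightarrow> real \<Rightarrow> 'a \<Rightarrow> real) \<Rightarrow> (nat \<Rightarrow> real \<Rightarrow> 'a \<Rightarrow> real) \<Rightarrow> bool" where
  "two_type_particle_system M \<gamma> \<alpha> \<xi> \<zeta> \<longleftrightarrow>
     prob_space M \<and>
     (\<forall>n. \<xi> n 0 \<in> borel_measurable M \<and> \<zeta> n 0 \<in> borel_measurable M) \<and>
     poisson_random_measure M (power_intensity (\<gamma> 1) \<Otimes>\<^sub>M power_intensity (\<gamma> 2))
       (initial_configuration \<xi> \<zeta>) \<and>
     (\<forall>n. symmetric_stable_process M (\<alpha> 1) (displacement (\<xi> n)) \<and>
          symmetric_stable_process M (\<alpha> 2) (displacement (\<zeta> n)) \<and>
          prob_space.indep_var M path_space (sample_path (displacement (\<xi> n)))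
                                 path_space (sample_path (displacement (\<zeta> n)))) \<and>
     prob_space.indep_vars M (\<lambda>_. path_space \<Otimes>\<^sub>M path_space)
       (\<lambda>n \<omega>. (sample_path (displacement (\<xi> n)) \<omega>, sample_path (displacement (\<zeta> n)) \<omega>)) UNIV \<and>
     prob_space.indep_set M
       (sets (vimage_algebra (space M) (\<lambda>\<omega> n. (\<xi> n 0 \<omega>, \<zeta> n 0 \<omega>))
          (PiM UNIV (\<lambda>_. borel \<Otimes>\<^sub>M borel))))
       (sets (vimage_algebra (space M)
          (\<lambda>\<omega> n. (sample_path (displacement (\<xi> n)) \<omega>, sample_path (displacement (\<zeta> n)) \<omega>))
          (PiM UNIV (\<lambda>_. path_space \<Otimes>\<^sub>M path_space))))"

definition particle_sum ::
    "(nat \<Rightarrow> real \<Rightarrow> 'a \<Rightarrow> real) \<Rightarrow> (nat \<Rightarrow> real \<Rightarrow> 'a \<Rightarrow> real) \<Rightarrow>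
     (real \<Rightarrow> real) \<Rightarrow> (real \<Rightarrow> real) \<Rightarrow> real \<Rightarrow> real \<Rightarrow> 'a \<Rightarrow> real" where
  "particle_sum \<xi> \<zeta> \<phi> \<psi> u v \<omega> = (\<Sum>\<^sub>\<infinity>n. \<phi> (\<xi> n u \<omega>) * \<psi> (\<zeta> n v \<omega>))"

definition occupation_time ::
    "(nat \<Rightarrow> real \<Rightarrow> 'a \<Rightarrow> real) \<Rightarrow> (nat \<Rightarrow> real \<Rightarrow> 'a \<Rightarrow> real) \<Rightarrow>
     (real \<Rightarrow> real) \<Rightarrow> (real \<Rightarrow> real) \<Rightarrow> real \<Rightarrow> real \<Rightarrow> 'a \<Rightarrow> real" where
  "occupation_time \<xi> \<zeta> \<phi> \<psi> s t \<omega> =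
     (LINT u:{0..s}|lborel. (LINT v:{0..t}|lborel. particle_sum \<xi> \<zeta> \<phi> \<psi> u v \<omega>))"

definition norming :: "(nat \<Rightarrow> real) \<Rightarrow> (nat \<Rightarrow> real) \<Rightarrow> real \<Rightarrow> real" where
  "norming \<gamma> \<alpha> T = (\<Prod>i\<in>{1,2}. T powr (1 - (1 + \<gamma> i) / (2 * \<alpha> i)))"

definition occupation_fluctuation ::
    "'a measure \<Rightarrow> (nat \<Rightarrow> real) \<Rightarrow> (nat \<Rightarrow> real) \<Rightarrow>
     (nat \<Rightarrow> real \<Rightarrow> 'a \<Rightarrow> real) \<Rightarrow> (nat \<Rightarrow> real \<Rightarrow> 'a \<Rightarrow> real) \<Rightarrow>
     (real \<Rightarrow> real) \<Rightarrow> (real \<Rightarrow> real) \<Rightarrow> real \<Rightarrow> real \<Rightarrow> real \<Rightarrow> 'a \<Rightarrow> real" where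
  "occupation_fluctuation M \<gamma> \<alpha> \<xi> \<zeta> \<phi> \<psi> T s t \<omega> =
     1 / norming \<gamma> \<alpha> T *
     (occupation_time \<xi> \<zeta> \<phi> \<psi> (T * s) (T * t) \<omega>
      - prob_space.expectation M (occupation_time \<xi> \<zeta> \<phi> \<psi> (T * s) (T * t)))"

definition limit_constant ::
    "(nat \<Rightarrow> real) \<Rightarrow> (nat \<Rightarrow> real) \<Rightarrow> (real \<Rightarrow> real) \<Rightarrow> (real \<Rightarrow> real) \<Rightarrow> real" where
  "limit_constant \<gamma> \<alpha> \<phi> \<psi> =
     (LINT x|lborel. \<phi> x) * (LINT x|lborel. \<psi> x) *
     sqrt (\<Prod>i\<in>{1,2}. 1 / (1 - 1 / \<alpha> i) * stable_density (\<alpha> i) 1 0 *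
                     (LINT x|lborel. stable_density (\<alpha> i) 1 x / \<bar>x\<bar> powr \<gamma> i))"

section \<open>The weighted fractional Brownian sheet\<close>

definition wfb_covariance :: "real \<Rightarrow> real \<Rightarrow> real \<Rightarrow> real \<Rightarrow> real" where
  "wfb_covariance a b u v =
     (LINT r:{0..min u v}|lborel. r powr a * ((u - r) powr b + (v - r) powr b))"

text \<open>Gaussian laws are allowed to be degenerate.\<close>

definition centered_gaussian :: "'a measure \<Rightarrow> ('a \<Rightarrow> real) \<Rightarrow> bool" where
  "centered_gaussian M X \<longleftrightarrow>
     X \<in> borel_measurable M \<and>
     ((AE \<omega> in M. X \<omega> = 0) \<or> (\<exists>\<sigma>>0. distributed M lborel X (normal_density 0 \<sigma>)))"

definition centered_gaussian_field :: "'a measure \<Rightarrow> 'i set \<Rightarrow> ('i \<Rightarrow> 'a \<Rightarrow> real) \<Rightarrow> bool" where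
  "centered_gaussian_field M I X \<longleftrightarrow>
     prob_space M \<and>
     (\<forall>J c. finite J \<and> J \<subseteq> I \<longrightarrow> centered_gaussian M (\<lambda>\<omega>. \<Sum>j\<in>J. c j * X j \<omega>))"

definition weighted_fractional_brownian_sheet ::
    "'a measure \<Rightarrow> (nat \<Rightarrow> real) \<Rightarrow> (nat \<Rightarrow> real) \<Rightarrow> (real \<Rightarrow> real \<Rightarrow> 'a \<Rightarrow> real) \<Rightarrow> bool" where
  "weighted_fractional_brownian_sheet M a b W \<longleftrightarrow>
     (\<forall>i\<in>{1,2}. a i > -1 \<and> -1 < b i \<and> b i \<le> 1 \<and> \<bar>b i\<bar> \<le> 1 + a i) \<and>
     centered_gaussian_field M ({0..} \<times> {0..}) (\<lambda>(s, t). W s t) \<and>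
     (\<forall>s\<ge>0. \<forall>t\<ge>0. \<forall>s'\<ge>0. \<forall>t'\<ge>0.
        prob_space.expectation M (\<lambda>\<omega>. W s t \<omega> * W s' t' \<omega>) =
        wfb_covariance (a 1) (b 1) s s' * wfb_covariance (a 2) (b 2) t t')"

section \<open>Convergence in distribution\<close>

text \<open>The limit may live on a different probability space.\<close>

definition converges_in_distribution ::
    "'a measure \<Rightarrow> ('t \<Rightarrow> 'a \<Rightarrow> 'v::topological_space) \<Rightarrow> 'b measure \<Rightarrow> ('b \<Rightarrow> 'v) \<Rightarrow>
     't filter \<Rightarrow> bool" where
  "converges_in_distribution M X N Y F \<longleftrightarrow>
     (\<forall>\<^sub>F T in F. X T \<in> borel_measurable M) \<and> Y \<in> borel_measurable N \<and>
     (\<forall>f::'v \<Rightarrow> real. continuous_on UNIV f \<and> bounded (range f) \<longrightarrow>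
        ((\<lambda>T. LINT \<omega>|M. f (X T \<omega>)) \<longlongrightarrow> (LINT \<omega>|N. f (Y \<omega>))) F)"

end

theory Submission
  imports Defs
begin

text \<open>
  Given the starting points, the characteristic function of a linear combination of the
  fluctuations is a product over the particles, so by the characteristic functional of the Poisson process
  it is the exponential of \<open>\<integral>(h - 1) d\<mu>\<close>, where \<open>h x\<close> is the characteristic function of the
  contribution \<open>H\<close> of one particle started at \<open>x\<close>. Centering cancels the first-order term in the expansion
  of \<open>h\<close>. The second-order term \<open>- \<integral>E(H\<^sup>2) d\<mu> / 2\<close> factorises over the two types, and each
  factor converges to the covariance of a weighted fractional Brownian motion by the
  self-similarity of the stable density and dominated convergence. The third-order remainder is
  negligible: by the Markov property and \<open>p\<^sub>t \<le> t\<^bsup>-1/\<alpha>\<^esup> p\<^sub>1(0)\<close>, the third absolute moment of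
  an occupation time is at most the first moment times the square of \<open>O(T\<^bsup>1-1/\<alpha>\<^esup>)\<close>.
  The particles need not share a common law on path space for the product
  formula: their functions \<open>h\<close> agree up to the third-order error, which is all that is used.
  Convergence of characteristic functions is turned into weak convergence by Gaussian smoothing.
\<close>

section \<open>The stable density\<close>

text \<open>The assumed laws have density \<open>ennreal\<close> of a Fourier integral, and
  \<open>ennreal\<close> clips negative values; nonnegativity of the integral itself therefore does
  not come with the laws and is proved analytically. The enumeration says nothing about the joint
  law of the positions beyond the Poisson law of the configuration. Sums over particles are
  therefore handled by Campbell's formula, and products by a telescoping bound that is uniform in
  the number of factors. Powers of T, for one type: integrated over the starting points, the first
  moment of an occupation time is of order T^(1-\<gamma>/\<alpha>); each further factor costs
  T^(1-1/\<alpha>), finite because t^(-1/\<alpha>) is integrable at 0 for \<alpha> > 1; the norming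
  is T^(1-(1+\<gamma>)/(2\<alpha>)). At second order the exponents cancel: (1-\<gamma>/\<alpha>) +
  (1-1/\<alpha>) = 2 (1-(1+\<gamma>)/(2\<alpha>)). At third order there remains
  (\<gamma>-1)/(2\<alpha>), negative exactly because \<gamma> < 1; this is what makes the limit
  Gaussian.\<close>

lemma nn_integral_powr_from_0:
  assumes "a > (-1::real)" "c \<ge> 0"
  shows "(\<integral>\<^sup>+x. ennreal (x powr a * indicator {0..c} x) \<partial>lborel) = ennreal (c powr (a+1) / (a+1))"
  using nn_integral_has_integral_lebesgue[OF _ has_integral_powr_from_0[OF assms]]
  by (simp add: mult.commute)

lemma nn_integral_powr_to_inf:
  assumes "e < (-1::real)" "a > 0"
  shows "(\<integral>\<^sup>+x. ennreal (x powr e * indicator {a..} x) \<partial>lborel) = ennreal (-(a powr (e+1)) / (e+1))"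
  using nn_integral_has_integral_lebesgue[OF _ has_integral_powr_to_inf[OF assms]]
  by (simp add: mult.commute)

text \<open>An inequality is enough for the finiteness claims below and spares a discussion of the
  point 0, which belongs to both half-lines.\<close>

lemma nn_integral_abs_le:
  fixes g :: "real \<Rightarrow> ennreal"
  assumes [measurable]: "g \<in> borel_measurable borel"
  shows "(\<integral>\<^sup>+x. g \<bar>x\<bar> \<partial>lborel) \<le> 2 * (\<integral>\<^sup>+x. g x * indicator {0..} x \<partial>lborel)"
proof -
  have "(\<integral>\<^sup>+x. g \<bar>x\<bar> \<partial>lborel)
      \<le> (\<integral>\<^sup>+x. g x * indicator {0..} x + g (-x) * indicator {0..} (-x) \<partial>lborel)"
    by (intro nn_integral_mono) (auto simp: indicator_def abs_if)
  also have "\<dots> = (\<integral>\<^sup>+x. g x * indicator {0..} x \<partial>lborel)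
      + (\<integral>\<^sup>+x. g (-x) * indicator {0..} (-x) \<partial>lborel)"
    by (intro nn_integral_add) auto
  also have "(\<integral>\<^sup>+x. g (-x) * indicator {0..} (-x) \<partial>lborel) = (\<integral>\<^sup>+x. g x * indicator {0..} x \<partial>lborel)"
    by (subst nn_integral_real_affine[of "\<lambda>x. g x * indicator {0..} x" "-1" 0]) (simp_all add: one_ennreal_def[symmetric])
  finally show ?thesis by (simp add: mult_2)
qed

lemma integrable_abs_powr_near_0:
  assumes "a > (-1::real)" "c \<ge> 0"
  shows "integrable lborel (\<lambda>x::real. \<bar>x\<bar> powr a * indicator {-c..c} x)"
proof (rule integrableI_nonneg)
  have "(\<integral>\<^sup>+x. ennreal (\<bar>x\<bar> powr a * indicator {-c..c} x) \<partial>lborel)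
      = (\<integral>\<^sup>+x. ennreal (\<bar>x\<bar> powr a * indicator {0..c} \<bar>x\<bar>) \<partial>lborel)"
    by (intro nn_integral_cong) (auto simp: indicator_def abs_le_iff)
  also have "\<dots> \<le> 2 * (\<integral>\<^sup>+x. ennreal (x powr a * indicator {0..c} x) * indicator {0..} x \<partial>lborel)"
    by (rule nn_integral_abs_le) simp
  also have "\<dots> = 2 * (\<integral>\<^sup>+x. ennreal (x powr a * indicator {0..c} x) \<partial>lborel)"
    by (intro arg_cong2[where f="(*)"] nn_integral_cong) (auto simp: indicator_def)
  also have "\<dots> < \<infinity>" using assms
    by (subst nn_integral_powr_from_0) (auto simp: ennreal_mult_less_top)
  finally show "(\<integral>\<^sup>+x. ennreal (\<bar>x\<bar> powr a * indicator {-c..c} x) \<partial>lborel) < \<infinity>" .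
qed auto

lemma integrable_abs_powr_near_infinity:
  assumes "a < (-1::real)" "c > 0"
  shows "integrable lborel (\<lambda>x::real. \<bar>x\<bar> powr a * indicator {x. c \<le> \<bar>x\<bar>} x)"
proof (rule integrableI_nonneg)
  have "(\<integral>\<^sup>+x. ennreal (\<bar>x\<bar> powr a * indicator {x. c \<le> \<bar>x\<bar>} x) \<partial>lborel)
      = (\<integral>\<^sup>+x. ennreal (\<bar>x\<bar> powr a * indicator {c..} \<bar>x\<bar>) \<partial>lborel)"
    by (intro nn_integral_cong) (auto simp: indicator_def)
  also have "\<dots> \<le> 2 * (\<integral>\<^sup>+x. ennreal (x powr a * indicator {c..} x) * indicator {0..} x \<partial>lborel)"
    by (rule nn_integral_abs_le) simp
  also have "\<dots> = 2 * (\<integral>\<^sup>+x. ennreal (x powr a * indicator {c..} x) \<partial>lborel)"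
    using assms by (intro arg_cong2[where f="(*)"] nn_integral_cong) (auto simp: indicator_def)
  also have "\<dots> < \<infinity>" using assms
    by (subst nn_integral_powr_to_inf) (auto simp: ennreal_mult_less_top)
  finally show "(\<integral>\<^sup>+x. ennreal (\<bar>x\<bar> powr a * indicator {x. c \<le> \<bar>x\<bar>} x) \<partial>lborel) < \<infinity>" .
qed auto

lemma integrable_exp_neg_abs_powr:
  assumes "t > 0" "a \<ge> 1"
  shows "integrable lborel (\<lambda>y::real. exp (- (t * \<bar>y\<bar> powr a)))"
proof (rule integrableI_nonneg)
  \<comment> \<open>From |y| \<le> 1 + |y|^a, which is where a \<ge> 1 enters. The bound exp (t - t
    |y|) is a multiple of an exponential density, whose mass is known.\<close>
  have le: "exp (- (t * \<bar>y\<bar> powr a)) \<le> exp t / t * exponential_density t \<bar>y\<bar>" for y :: real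
  proof -
    have "\<bar>y\<bar> \<le> 1 + \<bar>y\<bar> powr a"
    proof (cases "\<bar>y\<bar> \<le> 1")
      case False
      then have "\<bar>y\<bar> powr 1 \<le> \<bar>y\<bar> powr a" using assms by (intro powr_mono) auto
      then show ?thesis by simp
    qed (simp add: add_increasing2)
    then have "t * \<bar>y\<bar> \<le> t * (1 + \<bar>y\<bar> powr a)" using assms by (intro mult_left_mono) auto
    then have "exp (- (t * \<bar>y\<bar> powr a)) \<le> exp (t - t * \<bar>y\<bar>)" by (simp add: algebra_simps)
    also have "\<dots> = exp t / t * exponential_density t \<bar>y\<bar>"
      using assms by (simp add: exponential_density_def exp_diff exp_minus field_simps)
    finally show ?thesis .
  qed
  have "(\<integral>\<^sup>+y. ennreal (exp (- (t * \<bar>y\<bar> powr a))) \<partial>lborel)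
      \<le> (\<integral>\<^sup>+y. ennreal (exp t / t) * ennreal (exponential_density t \<bar>y\<bar>) \<partial>lborel)"
    using le assms by (intro nn_integral_mono) (simp add: ennreal_mult'[symmetric])
  also have "\<dots> = ennreal (exp t / t) * (\<integral>\<^sup>+y. ennreal (exponential_density t \<bar>y\<bar>) \<partial>lborel)"
    by (rule nn_integral_cmult) simp
  also have "\<dots> \<le> ennreal (exp t / t) *
      (2 * (\<integral>\<^sup>+y. ennreal (exponential_density t y) * indicator {0..} y \<partial>lborel))"
    by (intro mult_left_mono nn_integral_abs_le) auto
  also have "\<dots> \<le> ennreal (exp t / t) * (2 * (\<integral>\<^sup>+y. ennreal (exponential_density t y) \<partial>lborel))"
    by (intro mult_left_mono nn_integral_mono) (auto simp: indicator_def)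
  also have "(\<integral>\<^sup>+y. ennreal (exponential_density t y) \<partial>lborel) = 1"
    using prob_space.emeasure_space_1[OF prob_space_exponential_density[OF assms(1)]]
    by (simp add: emeasure_density)
  also have "ennreal (exp t / t) * (2 * 1) < \<infinity>"
    by (simp add: ennreal_mult_less_top)
  finally show "(\<integral>\<^sup>+y. ennreal (exp (- (t * \<bar>y\<bar> powr a))) \<partial>lborel) < \<infinity>" .
qed auto

section \<open>Cosine form, scaling and boundedness of the density\<close>

lemma stable_density_eq:
  assumes "t > 0" "a \<ge> 1"
  shows "stable_density a t x = (LINT y|lborel. cos (x * y) * exp (- (t * \<bar>y\<bar> powr a))) / (2 * pi)"
proof -
  let ?f = "\<lambda>y. exp (- (\<i> * complex_of_real (x * y) + complex_of_real (t * \<bar>y\<bar> powr a)))"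
  have eq: "?f y = cis (- (x * y)) * complex_of_real (exp (- (t * \<bar>y\<bar> powr a)))" for y
  proof -
    have "- (\<i> * complex_of_real (x * y) + complex_of_real (t * \<bar>y\<bar> powr a))
      = \<i> * complex_of_real (- (x * y)) + complex_of_real (- (t * \<bar>y\<bar> powr a))"
      by simp
    then show ?thesis by (simp only: exp_add cis_conv_exp exp_of_real)
  qed
  have int: "integrable lborel ?f"
    by (rule Bochner_Integration.integrable_bound[OF integrable_exp_neg_abs_powr[OF assms]]) (auto simp: eq norm_mult)
  have "Re (LINT y|lborel. ?f y) = (LINT y|lborel. Re (?f y))"
    using int by (rule integral_Re[symmetric])
  also have "\<dots> = (LINT y|lborel. cos (x * y) * exp (- (t * \<bar>y\<bar> powr a)))"
    unfolding eq by simp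
  finally have *: "Re (LINT y|lborel. ?f y) = (LINT y|lborel. cos (x * y) * exp (- (t * \<bar>y\<bar> powr a)))" .
  have "stable_density a t x = Re (complex_of_real (1/(2*pi)) * (LINT y|lborel. ?f y))"
    unfolding stable_density_def by simp
  also have "\<dots> = 1/(2*pi) * Re (LINT y|lborel. ?f y)"
    by (subst Re_complex_of_real[symmetric]) simp
  finally show ?thesis using * by simp
qed

lemma integrable_cos_mult:
  assumes "integrable lborel f"
  shows "integrable lborel (\<lambda>y::real. cos (a * y) * f y :: real)"
  by (rule Bochner_Integration.integrable_bound[OF assms])
     (use assms in \<open>auto simp: abs_mult intro!: mult_left_le_one_le\<close>)

text \<open>The substitution y -> t^(-1/a) y in the cosine integral. This self-similarity is the
  source of the powers of T in the scaling limits.\<close>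

lemma stable_density_scaling:
  assumes "t > 0" "a \<ge> 1"
  shows "stable_density a t x = t powr (-1/a) * stable_density a 1 (t powr (-1/a) * x)"
proof -
  let ?c = "t powr (-1/a)"
  have "?c > 0" using assms by simp
  have "(LINT y|lborel. cos (x * y) * exp (- (t * \<bar>y\<bar> powr a)))
      = ?c * (LINT y|lborel. cos (x * (?c * y)) * exp (- (t * \<bar>?c * y\<bar> powr a)))"
    using lborel_integral_real_affine[of ?c "\<lambda>y. cos (x * y) * exp (- (t * \<bar>y\<bar> powr a))" 0] \<open>?c > 0\<close>
    by simp
  also have "?c powr a = inverse t"
    using assms powr_powr[of t "-1/a" a] powr_minus[of t 1] by simp
  then have "t * \<bar>?c * y\<bar> powr a = 1 * \<bar>y\<bar> powr a" for y
    using assms by (simp add: abs_mult powr_mult)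
  then have "(LINT y|lborel. cos (x * (?c * y)) * exp (- (t * \<bar>?c * y\<bar> powr a)))
    = (LINT y|lborel. cos ((?c * x) * y) * exp (- (1 * \<bar>y\<bar> powr a)))"
    by (intro Bochner_Integration.integral_cong) (auto simp: mult_ac)
  finally show ?thesis
    using assms by (simp add: stable_density_eq)
qed

lemma stable_density_at_0:
  assumes "t > 0" "a \<ge> 1"
  shows "stable_density a t 0 = t powr (-1/a) * stable_density a 1 0"
  using stable_density_scaling[OF assms, of 0] by simp

lemma stable_density_minus:
  assumes "t > 0" "a \<ge> 1"
  shows "stable_density a t (- x) = stable_density a t x"
  using assms by (simp add: stable_density_eq)

text \<open>The cosine has modulus at most 1 and is identically 1 for x = 0, so the maximum sits at
  the origin, where the scaling relation applies.\<close>

lemma stable_density_abs_le: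
  assumes "t > 0" "a \<ge> 1"
  shows "\<bar>stable_density a t x\<bar> \<le> t powr (-1/a) * stable_density a 1 0"
proof -
  have "\<bar>LINT y|lborel. cos (x * y) * exp (- (t * \<bar>y\<bar> powr a))\<bar>
     \<le> (LINT y|lborel. \<bar>cos (x * y) * exp (- (t * \<bar>y\<bar> powr a))\<bar>)"
    by (rule integral_abs_bound)
  also have "\<dots> \<le> (LINT y|lborel. cos (0 * y) * exp (- (t * \<bar>y\<bar> powr a)))"
    using integrable_exp_neg_abs_powr[OF assms]
    by (intro integral_mono integrable_abs integrable_cos_mult) (auto simp: abs_mult)
  finally show ?thesis
    using assms unfolding stable_density_at_0[OF assms, symmetric]
    by (simp add: stable_density_eq abs_divide divide_right_mono)
qed

lemma stable_density_tendsto: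
  assumes "t > 0" "a \<ge> 1" "X \<longlonglongrightarrow> x"
  shows "(\<lambda>n. stable_density a t (X n)) \<longlonglongrightarrow> stable_density a t x"
proof -
  have "(\<lambda>n. LINT y|lborel. cos (X n * y) * exp (- (t * \<bar>y\<bar> powr a)))
      \<longlonglongrightarrow> (LINT y|lborel. cos (x * y) * exp (- (t * \<bar>y\<bar> powr a)))"
    by (rule integral_dominated_convergence[OF _ _ integrable_exp_neg_abs_powr[OF assms(1,2)]])
       (auto intro!: tendsto_intros assms simp: abs_mult)
  then show ?thesis using assms by (simp add: stable_density_eq tendsto_divide)
qed

section \<open>Positivity of the stable density\<close>

text \<open>Positivity of a density is expressed through its characteristic function f, so that no
  limiting law has to be constructed. Integrability is part of the notion because the integral of a
  nonintegrable function is 0 by convention, which would make the second condition empty.\<close>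

definition cos_positive :: "(real \<Rightarrow> real) \<Rightarrow> bool" where
  "cos_positive f \<longleftrightarrow> integrable lborel f \<and> (\<forall>a. 0 \<le> (LINT y|lborel. cos (a * y) * f y))"

lemma cos_positive_limit:
  assumes "\<And>n. cos_positive (f n)" "f' \<in> borel_measurable lborel" "integrable lborel w"
    "\<And>y. (\<lambda>n. f n y) \<longlonglongrightarrow> f' y" "\<And>n y. \<bar>f n y\<bar> \<le> w y"
  shows "cos_positive f'"
  unfolding cos_positive_def
proof safe
  have f [measurable]: "f n \<in> borel_measurable lborel" for n
    using assms(1)[of n] by (auto simp: cos_positive_def)
  note [measurable] = assms(2)
  show "integrable lborel f'"
    by (rule integrable_dominated_convergence[OF _ _ assms(3), of _ f]) (use assms in auto)
  fix a
  have "(\<lambda>n. LINT y|lborel. cos (a * y) * f n y) \<longlonglongrightarrow> (LINT y|lborel. cos (a * y) * f' y)"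
  proof (rule integral_dominated_convergence[OF _ _ assms(3)])
    show "AE y in lborel. norm (cos (a * y) * f n y) \<le> w y" for n
      using assms(5)[of n] order_trans[OF mult_left_le_one_le assms(5)]
      by (auto simp: abs_mult)
  qed (use assms in \<open>auto intro!: tendsto_intros\<close>)
  then show "0 \<le> (LINT y|lborel. cos (a * y) * f' y)"
    using assms(1) by (intro LIMSEQ_le_const) (auto simp: cos_positive_def)
qed

lemma cos_positive_add:
  assumes "cos_positive f" "cos_positive g"
  shows "cos_positive (\<lambda>y. f y + g y)"
  using assms by (auto simp: cos_positive_def distrib_left integrable_cos_mult)

lemma cos_positive_cmult:
  assumes "cos_positive f" "c \<ge> 0"
  shows "cos_positive (\<lambda>y. c * f y)"
  using assms by (auto simp: cos_positive_def mult.left_commute[of _ c])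

text \<open>The transform of a Gaussian is again a Gaussian. It is read off from the characteristic
  function of the standard normal law and rescaled by \<sigma>.\<close>

lemma cos_positive_gaussian:
  assumes "\<sigma> > 0"
  shows "cos_positive (\<lambda>y. exp (- (\<sigma> * y)\<^sup>2 / 2))"
  unfolding cos_positive_def
proof safe
  have std: "exp (- x\<^sup>2 / 2) = sqrt (2 * pi) * std_normal_density x" for x :: real
    by (simp add: std_normal_density_def)
  have int0: "integrable lborel (\<lambda>x::real. exp (- x\<^sup>2 / 2))"
    unfolding std by (intro integrable_mult_right) (simp add: integrable_normal_density)
  show "integrable lborel (\<lambda>y. exp (- (\<sigma> * y)\<^sup>2 / 2))"
    using lborel_integrable_real_affine[OF int0, of \<sigma> 0] assms by simp
  fix a
  have "exp (- ((a/\<sigma>)\<^sup>2) / 2) = Re (char std_normal_distribution (a/\<sigma>))"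
    by (simp add: char_std_normal_distribution)
  also have "\<dots> = Re (LINT x|lborel. std_normal_density x *\<^sub>R iexp ((a/\<sigma>) * x))"
    unfolding char_def by (subst integral_density) auto
  also have "\<dots> = (LINT x|lborel. Re (std_normal_density x *\<^sub>R iexp ((a/\<sigma>) * x)))"
    by (intro integral_Re[symmetric] Bochner_Integration.integrable_bound[OF integrable_normal_density[of 1 0]])
       (auto simp: normal_density_nonneg)
  also have "\<dots> = (LINT x|lborel. cos (a * (x/\<sigma>)) * std_normal_density x)"
    by (intro Bochner_Integration.integral_cong) (auto simp: Re_exp)
  finally have *: "0 \<le> (LINT x|lborel. cos (a * (x/\<sigma>)) * std_normal_density x)"
    by (metis exp_ge_zero)
  have "(LINT y|lborel. cos (a * y) * exp (- (\<sigma> * y)\<^sup>2 / 2))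
      = \<bar>1/\<sigma>\<bar> * (LINT y|lborel. cos (a * (y/\<sigma>)) * exp (- y\<^sup>2 / 2))"
    using assms lborel_integral_real_affine[of "1/\<sigma>" "\<lambda>y. cos (a * y) * exp (- (\<sigma> * y)\<^sup>2 / 2)" 0]
    by simp
  also have "(LINT y|lborel. cos (a * (y/\<sigma>)) * exp (- y\<^sup>2 / 2))
     = sqrt (2 * pi) * (LINT x|lborel. cos (a * (x/\<sigma>)) * std_normal_density x)"
    unfolding std by (simp add: mult.left_commute)
  finally show "0 \<le> (LINT y|lborel. cos (a * y) * exp (- (\<sigma> * y)\<^sup>2 / 2))"
    using * assms by simp
qed

text \<open>The formula cos A cos B = (cos (A - B) + cos (A + B)) / 2 turns the transform at a into
  a \<nu>-average of transforms at a - x and a + x. On the side of densities this is convolution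
  with the symmetrisation of \<nu>.\<close>

lemma cos_positive_mult:
  assumes f: "cos_positive f" and "finite_measure \<nu>" and [measurable_cong]: "sets \<nu> = sets borel"
  shows "cos_positive (\<lambda>y. (LINT x|\<nu>. cos (x * y)) * f y)"
proof -
  interpret \<nu>: finite_measure \<nu> by fact
  interpret pair_sigma_finite lborel \<nu> ..
  have intf: "integrable lborel f" and [measurable]: "f \<in> borel_measurable borel"
    using f by (auto simp: cos_positive_def)
  have intc: "integrable \<nu> (\<lambda>x. cos (x * y))" for y
    by (rule \<nu>.integrable_const_bound[of _ 1]) auto
  have b: "\<bar>LINT x|\<nu>. cos (x * y)\<bar> \<le> measure \<nu> (space \<nu>)" for y
  proof -
    have "\<bar>LINT x|\<nu>. cos (x * y)\<bar> \<le> (LINT x|\<nu>. \<bar>cos (x * y)\<bar>)" by (rule integral_abs_bound)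
    also have "\<dots> \<le> (LINT x|\<nu>. 1)"
      using intc by (intro integral_mono) auto
    finally show ?thesis by simp
  qed
  show ?thesis unfolding cos_positive_def
  proof safe
    show "integrable lborel (\<lambda>y. (LINT x|\<nu>. cos (x * y)) * f y)"
      by (rule Bochner_Integration.integrable_bound[OF integrable_mult_right[OF intf, of "measure \<nu> (space \<nu>)"]])
         (use b in \<open>auto simp: abs_mult intro!: mult_right_mono\<close>)
    fix a
    have I: "integrable (lborel \<Otimes>\<^sub>M \<nu>) (\<lambda>(y, x). cos (a * y) * cos (x * y) * f y)"
    proof (rule Fubini_integrable)
      have "integrable \<nu> (\<lambda>x. cos (a * y) * cos (x * y) * f y)" for y
        by (rule \<nu>.integrable_const_bound[of _ "\<bar>f y\<bar>"])
           (auto simp: abs_mult intro!: mult_left_le_one_le mult_le_one)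
      then show "AE y in lborel. integrable \<nu> (\<lambda>x. case (y, x) of (y, x) \<Rightarrow> cos (a * y) * cos (x * y) * f y)"
        by auto
      show "integrable lborel (\<lambda>y. LINT x|\<nu>. norm (case (y, x) of (y, x) \<Rightarrow> cos (a * y) * cos (x * y) * f y))"
      proof (rule Bochner_Integration.integrable_bound[OF integrable_mult_right[OF intf, of "measure \<nu> (space \<nu>)"]], simp, rule AE_I2)
        fix y
        have "(LINT x|\<nu>. \<bar>cos (a * y) * cos (x * y) * f y\<bar>) \<le> (LINT x|\<nu>. \<bar>f y\<bar>)"
          by (intro integral_mono \<nu>.integrable_const_bound[of _ "\<bar>f y\<bar>"])
             (auto simp: abs_mult intro!: mult_left_le_one_le mult_le_one)
        then show "norm (LINT x|\<nu>. norm (case (y, x) of (y, x) \<Rightarrow> cos (a * y) * cos (x * y) * f y))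
            \<le> norm (measure \<nu> (space \<nu>) * f y)"
          by (simp add: abs_mult)
      qed
    qed simp
    have "(LINT y|lborel. cos (a * y) * ((LINT x|\<nu>. cos (x * y)) * f y))
        = (LINT y|lborel. LINT x|\<nu>. cos (a * y) * cos (x * y) * f y)"
      using intc by (intro Bochner_Integration.integral_cong) (auto simp: mult_ac)
    also have "\<dots> = (LINT x|\<nu>. LINT y|lborel. cos (a * y) * cos (x * y) * f y)"
      using Fubini_integral[OF I] by simp
    also have "(\<lambda>x. LINT y|lborel. cos (a * y) * cos (x * y) * f y)
      = (\<lambda>x. ((LINT y|lborel. cos ((a - x) * y) * f y) + (LINT y|lborel. cos ((a + x) * y) * f y)) / 2)"
    proof
      fix x
      have "cos (a * y) * cos (x * y) * f y = (cos ((a - x) * y) * f y + cos ((a + x) * y) * f y) / 2" for y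
        by (simp add: cos_times_cos algebra_simps) 
      then have "(LINT y|lborel. cos (a * y) * cos (x * y) * f y)
        = (LINT y|lborel. (cos ((a - x) * y) * f y + cos ((a + x) * y) * f y) / 2)"
        by presburger
      also have "\<dots> = ((LINT y|lborel. cos ((a - x) * y) * f y) + (LINT y|lborel. cos ((a + x) * y) * f y)) / 2"
        using intf by (simp add: integrable_cos_mult del: distrib_right)
      finally show "(LINT y|lborel. cos (a * y) * cos (x * y) * f y) = \<dots>" .
    qed
    also have "0 \<le> (LINT x|\<nu>. ((LINT y|lborel. cos ((a - x) * y) * f y) + (LINT y|lborel. cos ((a + x) * y) * f y)) / 2)"
      using f by (intro integral_nonneg_AE AE_I2) (simp add: cos_positive_def)
    finally show "0 \<le> (LINT y|lborel. cos (a * y) * ((LINT x|\<nu>. cos (x * y)) * f y))" .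
  qed
qed

text \<open>With L the mass of \<nu> and m its cosine transform, exp (- (L - m)) is exp (-L) times a
  power series in m with nonnegative coefficients, and \<open>cos_positive_mult\<close> applies to
  each power. The exponential is the characteristic function of a compound Poisson law; the factor f
  keeps every term integrable.\<close>

lemma cos_positive_exp_mult:
  assumes f: "cos_positive f" and fm: "finite_measure \<nu>" and s [measurable_cong]: "sets \<nu> = sets borel"
  shows "cos_positive (\<lambda>y. exp (- (LINT x|\<nu>. 1 - cos (x * y))) * f y)"
proof -
  interpret \<nu>: finite_measure \<nu> by fact
  define L where "L = measure \<nu> (space \<nu>)"
  define m where "m = (\<lambda>y. LINT x|\<nu>. cos (x * y))"
  have [measurable]: "m \<in> borel_measurable borel" unfolding m_def by measurable
  have intf: "integrable lborel f" and [measurable]: "f \<in> borel_measurable borel"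
    using f by (auto simp: cos_positive_def)
  have intc: "integrable \<nu> (\<lambda>x. cos (x * y))" for y
    by (rule \<nu>.integrable_const_bound[of _ 1]) auto
  have b: "\<bar>m y\<bar> \<le> L" for y
  proof -
    have "\<bar>m y\<bar> \<le> (LINT x|\<nu>. \<bar>cos (x * y)\<bar>)" unfolding m_def by (rule integral_abs_bound)
    also have "\<dots> \<le> (LINT x|\<nu>. 1)"
      using intc by (intro integral_mono) auto
    finally show ?thesis by (simp add: L_def)
  qed
  have pow: "cos_positive (\<lambda>y. m y ^ k * f y)" for k
  proof (induction k)
    case (Suc k)
    show ?case using cos_positive_mult[OF Suc fm s] by (simp add: m_def mult_ac)
  qed (use f in simp)
  have sums: "cos_positive (\<lambda>y. \<Sum>k<n. (m y ^ k * f y) / fact k)" for n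
  proof (induction n)
    case 0 then show ?case by (simp add: cos_positive_def)
  next
    case (Suc n)
    show ?case using cos_positive_add[OF Suc cos_positive_cmult[OF pow[of n], of "1 / fact n"]]
      by (simp add: field_simps)
  qed
  have "cos_positive (\<lambda>y. exp (m y) * f y)"
  proof (rule cos_positive_limit[OF sums])
    show "(\<lambda>y. exp (m y) * f y) \<in> borel_measurable lborel" by simp
    show "integrable lborel (\<lambda>y. exp L * \<bar>f y\<bar>)" using intf by simp
    fix y
    have "(\<lambda>k. m y ^ k /\<^sub>R fact k * f y) sums (exp (m y) * f y)"
      by (intro sums_mult2 exp_converges)
    then show "(\<lambda>n. \<Sum>k<n. (m y ^ k * f y) / fact k) \<longlonglongrightarrow> exp (m y) * f y"
      unfolding sums_def by (simp add: field_simps)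
    fix n
    have "\<bar>\<Sum>k<n. (m y ^ k * f y) / fact k\<bar> \<le> (\<Sum>k<n. \<bar>(m y ^ k * f y) / fact k\<bar>)" by (rule sum_abs)
    also have "\<dots> = (\<Sum>k<n. \<bar>m y\<bar> ^ k /\<^sub>R fact k) * \<bar>f y\<bar>"
      unfolding sum_distrib_right
      by (intro sum.cong) (auto simp: abs_mult power_abs field_simps)
    also have "\<dots> \<le> exp \<bar>m y\<bar> * \<bar>f y\<bar>"
      using sum_le_suminf[OF summable_exp_generic[of "\<bar>m y\<bar>"], of "{..<n}"]
      by (intro mult_right_mono) (auto simp: exp_def)
    also have "\<dots> \<le> exp L * \<bar>f y\<bar>" using b by (intro mult_right_mono) auto
    finally show "\<bar>\<Sum>k<n. (m y ^ k * f y) / fact k\<bar> \<le> exp L * \<bar>f y\<bar>" .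
  qed
  from cos_positive_cmult[OF this, of "exp (-L)"]
  have "cos_positive (\<lambda>y. exp (- (L - m y)) * f y)"
    by (simp add: exp_diff exp_minus field_simps)
  also have "(\<lambda>y. exp (- (L - m y)) * f y) = (\<lambda>y. exp (- (LINT x|\<nu>. 1 - cos (x * y))) * f y)"
    using intc by (simp add: L_def m_def)
  finally show ?thesis .
qed

text \<open>Split at |x| = 1. Inside, 1 - cos (x y) \<le> x^2 y^2 leaves |x|^(1-a), integrable
  because a < 2; outside, 1 - cos \<le> 2 leaves |x|^(-1-a), integrable because a > 0.\<close>

lemma integrable_one_minus_cos_powr:
  assumes "0 < a" "a < 2"
  shows "integrable lborel (\<lambda>x::real. (1 - cos (x * y)) * \<bar>x\<bar> powr (-1-a))"
proof -
  have 1: "integrable lborel (\<lambda>x::real. y\<^sup>2 * (\<bar>x\<bar> powr (1-a) * indicator {-1..1} x)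
      + 2 * (\<bar>x\<bar> powr (-1-a) * indicator {x. 1 \<le> \<bar>x\<bar>} x))"
    using assms by (intro Bochner_Integration.integrable_add integrable_mult_right
        integrable_abs_powr_near_0 integrable_abs_powr_near_infinity) auto
  show ?thesis
  proof (rule Bochner_Integration.integrable_bound[OF 1])
    have "norm ((1 - cos (x * y)) * \<bar>x\<bar> powr (-1-a)) \<le> norm (y\<^sup>2 * (\<bar>x\<bar> powr (1-a) * indicator {-1..1} x)
      + 2 * (\<bar>x\<bar> powr (-1-a) * indicator {x. 1 \<le> \<bar>x\<bar>} x))" for x
    proof (cases "\<bar>x\<bar> \<le> 1")
      case True
      show ?thesis
      proof (cases "x = 0")
        case False
        have "1 - cos (x * y) \<le> x\<^sup>2 * y\<^sup>2"
        proof -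
          have "1 - cos (x * y) = 2 * (sin (x * y / 2))\<^sup>2"
            using cos_double_sin[of "x * y / 2"] by simp
          also have "\<dots> \<le> 2 * (x * y / 2)\<^sup>2"
            using abs_sin_x_le_abs_x[of "x * y / 2"] unfolding abs_le_square_iff
            by (intro mult_left_mono) auto
          also have "\<dots> \<le> x\<^sup>2 * y\<^sup>2" by (simp add: power_mult_distrib power_divide)
          finally show ?thesis .
        qed
        then have "(1 - cos (x * y)) * \<bar>x\<bar> powr (-1-a) \<le> (x\<^sup>2 * y\<^sup>2) * \<bar>x\<bar> powr (-1-a)"
          by (intro mult_right_mono) auto
        also have "x\<^sup>2 = \<bar>x\<bar> powr 2" using False by simp
        also have "\<bar>x\<bar> powr 2 * y\<^sup>2 * \<bar>x\<bar> powr (-1-a) = y\<^sup>2 * \<bar>x\<bar> powr (1-a)"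
          using powr_add[of "\<bar>x\<bar>" 2 "-1-a"] by (simp add: algebra_simps)
        finally have "(1 - cos (x * y)) * \<bar>x\<bar> powr (-1-a) \<le> y\<^sup>2 * \<bar>x\<bar> powr (1-a)" .
        moreover have "0 \<le> (1 - cos (x * y)) * \<bar>x\<bar> powr (-1-a)" by simp
        ultimately show ?thesis using True by (simp add: abs_le_iff add_increasing2 indicator_def)
      qed simp
    next
      case False
      have "(1 - cos (x * y)) * \<bar>x\<bar> powr (-1-a) \<le> 2 * \<bar>x\<bar> powr (-1-a)"
        using cos_ge_minus_one[of "x * y"] by (intro mult_right_mono) (linarith | simp)+
      moreover have "\<not> (-1 \<le> x \<and> x \<le> 1)" using False by auto
      ultimately show ?thesis using False by (auto simp: indicator_def abs_mult)
    qed
    then show "AE x in lborel. norm ((1 - cos (x * y)) * \<bar>x\<bar> powr (-1-a)) \<le> norm (y\<^sup>2 * (\<bar>x\<bar> powr (1-a) * indicator {-1..1} x)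
      + 2 * (\<bar>x\<bar> powr (-1-a) * indicator {x. 1 \<le> \<bar>x\<bar>} x))"
      by (intro AE_I2)
  qed simp
qed

text \<open>The substitution x -> x / y. Up to the constant this is the Levy-Khintchine
  representation of |y|^a with jump density |x|^(-1-a).\<close>

lemma integral_one_minus_cos_powr:
  fixes a y :: real
  assumes "0 < a" "a < 2"
  shows "(LINT x|lborel. (1 - cos (x * y)) * \<bar>x\<bar> powr (-1-a))
    = \<bar>y\<bar> powr a * (LINT x|lborel. (1 - cos x) * \<bar>x\<bar> powr (-1-a))"
proof (cases "y = 0")
  case False
  have "(LINT x|lborel. (1 - cos (x * y)) * \<bar>x\<bar> powr (-1-a))
    = \<bar>1/y\<bar> * (LINT x|lborel. (1 - cos x) * \<bar>x / y\<bar> powr (-1-a))"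
    using lborel_integral_real_affine[of "1/y" "\<lambda>x. (1 - cos (x * y)) * \<bar>x\<bar> powr (-1-a)" 0] False
    by simp
  also have "(LINT x|lborel. (1 - cos x) * \<bar>x / y\<bar> powr (-1-a))
     = (LINT x|lborel. \<bar>y\<bar> powr (1+a) * ((1 - cos x) * \<bar>x\<bar> powr (-1-a)))"
  proof (rule Bochner_Integration.integral_cong[OF refl])
    fix x
    have "\<bar>x / y\<bar> powr (-1-a) = \<bar>x\<bar> powr (-1-a) / \<bar>y\<bar> powr (-1-a)"
      by (simp add: powr_divide)
    also have "\<bar>y\<bar> powr (-1-a) = inverse (\<bar>y\<bar> powr (1+a))"
      using powr_minus[of "\<bar>y\<bar>" "1+a"] by (simp add: algebra_simps)
    finally show "(1 - cos x) * \<bar>x / y\<bar> powr (-1-a) = \<bar>y\<bar> powr (1+a) * ((1 - cos x) * \<bar>x\<bar> powr (-1-a))"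
      by (simp add: divide_inverse)
  qed
  also have "\<bar>1/y\<bar> * (LINT x|lborel. \<bar>y\<bar> powr (1+a) * ((1 - cos x) * \<bar>x\<bar> powr (-1-a)))
     = \<bar>1/y\<bar> * \<bar>y\<bar> powr (1+a) * (LINT x|lborel. (1 - cos x) * \<bar>x\<bar> powr (-1-a))"
    by simp
  also have "\<bar>1/y\<bar> * \<bar>y\<bar> powr (1+a) = \<bar>y\<bar> powr a"
    using False by (simp add: powr_add abs_divide)
  finally show ?thesis .
qed simp

text \<open>The constant will be divided by. Were it 0, then cos x = 1 for almost every x, which
  fails on (0, 1).\<close>

lemma integral_one_minus_cos_powr_pos:
  fixes a :: real
  assumes "0 < a" "a < 2"
  shows "0 < (LINT x|lborel. (1 - cos x) * \<bar>x\<bar> powr (-1-a))"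
proof -
  let ?f = "\<lambda>x::real. (1 - cos x) * \<bar>x\<bar> powr (-1-a)"
  have int: "integrable lborel ?f"
    using integrable_one_minus_cos_powr[OF assms, of 1] by simp
  have "(LINT x|lborel. ?f x) \<noteq> 0"
  proof
    assume "(LINT x|lborel. ?f x) = 0"
    then have "AE x in lborel. ?f x = 0"
      using integral_nonneg_eq_0_iff_AE[OF int] by auto
    then have *: "AE x::real in lborel. cos x = 1 \<or> x = 0" 
      by (rule AE_mp) (intro AE_I2, simp)
    have "AE x in lborel. x \<notin> {0<..<1::real}"
      using *
    proof eventually_elim
      case (elim x)
      have "cos x \<noteq> 1" if "0 < x" "x < 1"
        using cos_monotone_0_pi[of 0 x] that pi_gt3 by auto
      with elim show ?case by auto
    qed
    then have "{0<..<1::real} \<in> null_sets lborel"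
      by (subst AE_iff_null_sets) auto
    then show False by auto
  qed
  moreover have "0 \<le> (LINT x|lborel. ?f x)" by (intro integral_nonneg_AE AE_I2) simp
  ultimately show ?thesis by linarith
qed

text \<open>Removing the truncation of the jump density makes the compound Poisson exponents
  converge to t |y|^a. The Gaussian factor is the majorant: the truncated exponents are bounded, so
  their exponentials alone are not integrable.\<close>

lemma cos_positive_exp_neg_abs_powr_gaussian:
  assumes "0 < a" "a < 2" "t > 0" "\<sigma> > 0"
  shows "cos_positive (\<lambda>y. exp (- (t * \<bar>y\<bar> powr a)) * exp (- (\<sigma> * y)\<^sup>2 / 2))"
proof -
  define C where "C = (LINT x|lborel. (1 - cos x) * \<bar>x\<bar> powr (-1-a))"
  have "C > 0" unfolding C_def by (rule integral_one_minus_cos_powr_pos) fact+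
  \<comment> \<open>The jump density is cut off below 1/(n+1) to have finite mass; the factor t / C
    cancels the constant of \<open>integral_one_minus_cos_powr\<close>.\<close>
  define r where "r n x = t / C * (\<bar>x\<bar> powr (-1-a) * indicator {x. 1 / Suc n \<le> \<bar>x\<bar>} x)" for n and x :: real
  have r0: "0 \<le> r n x" for n x using assms \<open>C > 0\<close> by (simp add: r_def)
  have [measurable]: "r n \<in> borel_measurable borel" for n unfolding r_def by measurable
  have rint: "integrable lborel (r n)" for n
    unfolding r_def using assms by (intro integrable_mult_right integrable_abs_powr_near_infinity) auto
  define \<nu> where "\<nu> n = density lborel (\<lambda>x. ennreal (r n x))" for n
  have fin: "finite_measure (\<nu> n)" for n
    using r0 rint[of n] unfolding \<nu>_def real_integrable_def
    by (intro finite_measureI) (auto simp: emeasure_density less_top)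
  have sets: "sets (\<nu> n) = sets borel" for n by (simp add: \<nu>_def)
  define \<psi> where "\<psi> n y = (LINT x|\<nu> n. 1 - cos (x * y))" for n y
  have \<psi>: "\<psi> n y = (LINT x|lborel. r n x * (1 - cos (x * y)))" for n y
    unfolding \<psi>_def \<nu>_def using r0 by (subst integral_density) auto
  have lim: "(\<lambda>n. \<psi> n y) \<longlonglongrightarrow> t * \<bar>y\<bar> powr a" for y
  proof -
    have "(\<lambda>n. \<psi> n y) \<longlonglongrightarrow> (LINT x|lborel. t / C * ((1 - cos (x * y)) * \<bar>x\<bar> powr (-1-a)))"
      unfolding \<psi>
    proof (rule integral_dominated_convergence)
      show "integrable lborel (\<lambda>x. t / C * ((1 - cos (x * y)) * \<bar>x\<bar> powr (-1-a)))"
        using assms by (intro integrable_mult_right integrable_one_minus_cos_powr) auto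
      show "AE x in lborel. (\<lambda>n. r n x * (1 - cos (x * y))) \<longlonglongrightarrow> t / C * ((1 - cos (x * y)) * \<bar>x\<bar> powr (-1-a))"
      proof (rule AE_I2)
        fix x :: real
        show "(\<lambda>n. r n x * (1 - cos (x * y))) \<longlonglongrightarrow> t / C * ((1 - cos (x * y)) * \<bar>x\<bar> powr (-1-a))"
        proof (cases "x = 0")
          case False
          have "(\<lambda>n. 1 / Suc n) \<longlonglongrightarrow> 0" using LIMSEQ_inverse_real_of_nat by (simp add: inverse_eq_divide)
          then have "eventually (\<lambda>n. 1 / Suc n < \<bar>x\<bar>) sequentially"
            using False by (intro order_tendstoD(2)[where a="\<bar>x\<bar>"]) auto
          then show ?thesis
            by (intro tendsto_eventually) (erule eventually_mono, simp add: r_def less_imp_le)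
        qed (simp add: r_def)
      qed
      show "AE x in lborel. norm (r n x * (1 - cos (x * y))) \<le> t / C * ((1 - cos (x * y)) * \<bar>x\<bar> powr (-1-a))" for n
        using assms \<open>C > 0\<close> by (intro AE_I2) (auto simp: r_def abs_mult indicator_def mult_ac)
    qed auto
    also have "(LINT x|lborel. t / C * ((1 - cos (x * y)) * \<bar>x\<bar> powr (-1-a))) = t * \<bar>y\<bar> powr a"
      using \<open>C > 0\<close> by (simp add: integral_one_minus_cos_powr[OF assms(1,2)] C_def[symmetric])
    finally show ?thesis .
  qed
  have \<psi>0: "0 \<le> \<psi> n y" for n y
    unfolding \<psi>_def by (intro integral_nonneg_AE AE_I2) simp
  have g: "cos_positive (\<lambda>y. exp (- (\<sigma> * y)\<^sup>2 / 2))" using assms by (intro cos_positive_gaussian)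
  show ?thesis
  proof (rule cos_positive_limit)
    show "cos_positive (\<lambda>y. exp (- \<psi> n y) * exp (- (\<sigma> * y)\<^sup>2 / 2))" for n
      unfolding \<psi>_def by (rule cos_positive_exp_mult[OF g fin sets])
    show "(\<lambda>n. exp (- \<psi> n y) * exp (- (\<sigma> * y)\<^sup>2 / 2)) \<longlonglongrightarrow> exp (- (t * \<bar>y\<bar> powr a)) * exp (- (\<sigma> * y)\<^sup>2 / 2)" for y
      by (intro tendsto_intros lim)
    show "integrable lborel (\<lambda>y. exp (- (\<sigma> * y)\<^sup>2 / 2))" using g by (simp add: cos_positive_def)
    show "\<bar>exp (- \<psi> n y) * exp (- (\<sigma> * y)\<^sup>2 / 2)\<bar> \<le> exp (- (\<sigma> * y)\<^sup>2 / 2)" for n y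
      using \<psi>0[of n y] by (simp add: abs_mult)
  qed simp
qed

text \<open>
  A density with Fourier transform \<open>exp (- t |y|^a)\<close> is a limit of convolutions of compound
  Poisson laws, with jump measure proportional to \<open>|x|^(-1-a) dx\<close> off a neighbourhood of \<open>0\<close>,
  with Gaussian laws.
\<close>

lemma stable_density_nonneg:
  assumes "1 \<le> a" "a \<le> 2" "t > 0"
  shows "0 \<le> stable_density a t x"
proof -
  have "cos_positive (\<lambda>y. exp (- (t * \<bar>y\<bar> powr a)))"
  proof (cases "a = 2")
    \<comment> \<open>For a = 2 the density |x|^(-3) is too singular at 0 for the construction, but
      the function is itself Gaussian, of scale sqrt (2 t).\<close>
    case True
    have "t * \<bar>y\<bar> powr a = (sqrt (2 * t) * y)\<^sup>2 / 2" for y :: real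
      using assms True by (cases "y = 0") (auto simp: power_mult_distrib)
    then have eq: "(\<lambda>y. exp (- (t * \<bar>y\<bar> powr a))) = (\<lambda>y::real. exp (- (sqrt (2 * t) * y)\<^sup>2 / 2))"
      by auto
    show ?thesis unfolding eq using assms by (intro cos_positive_gaussian) simp
  next
    case False
    show ?thesis
    proof (rule cos_positive_limit)
      \<comment> \<open>The auxiliary Gaussian factor is flattened to 1; at this stage exp (- t
        |y|^a) itself is the majorant.\<close>
      show "cos_positive (\<lambda>y. exp (- (t * \<bar>y\<bar> powr a)) * exp (- (1 / Suc n * y)\<^sup>2 / 2))" for n
        using assms False by (intro cos_positive_exp_neg_abs_powr_gaussian) auto
      have 0: "(\<lambda>n. 1 / Suc n) \<longlonglongrightarrow> 0"
        using LIMSEQ_inverse_real_of_nat by (simp add: inverse_eq_divide)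
      fix y
      have "(\<lambda>n. exp (- (t * \<bar>y\<bar> powr a)) * exp (- (1 / Suc n * y)\<^sup>2 / 2))
         \<longlonglongrightarrow> exp (- (t * \<bar>y\<bar> powr a)) * exp (- (0 * y)\<^sup>2 / 2)"
        by (intro tendsto_intros 0) simp
      then show "(\<lambda>n. exp (- (t * \<bar>y\<bar> powr a)) * exp (- (1 / Suc n * y)\<^sup>2 / 2)) \<longlonglongrightarrow> exp (- (t * \<bar>y\<bar> powr a))"
        by simp
    next
      show "integrable lborel (\<lambda>y::real. exp (- (t * \<bar>y\<bar> powr a)))"
        using assms by (intro integrable_exp_neg_abs_powr) auto
    qed (auto simp: abs_mult)
  qed
  then show ?thesis using assms by (simp add: cos_positive_def stable_density_eq)
qed

section \<open>Weak convergence from characteristic functions\<close>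

text \<open>A three-epsilon argument in which the approximating family and its limit may depend on
  e. It serves twice: for Gaussian smoothing and for cutting off at infinity.\<close>

lemma tendsto_uniform_approx:
  fixes F :: "'a \<Rightarrow> 'b::metric_space"
  assumes "\<And>e. e > 0 \<Longrightarrow> \<exists>G l'. (G \<longlongrightarrow> l') A \<and> (\<forall>\<^sub>F T in A. dist (F T) (G T) \<le> e) \<and> dist l l' \<le> e"
  shows "(F \<longlongrightarrow> l) A"
proof (rule tendstoI)
  fix e :: real assume "e > 0"
  then obtain G l' where G: "(G \<longlongrightarrow> l') A" "\<forall>\<^sub>F T in A. dist (F T) (G T) \<le> e/4" "dist l l' \<le> e/4"
    using assms[of "e/4"] by auto
  have "\<forall>\<^sub>F T in A. dist (G T) l' < e/4"
    using G(1) \<open>e > 0\<close> by (intro tendstoD) auto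
  with G(2) show "\<forall>\<^sub>F T in A. dist (F T) l < e"
  proof eventually_elim
    case (elim T)
    have "dist (F T) l \<le> dist (F T) (G T) + dist (G T) l"
      by (rule dist_triangle)
    also have "dist (G T) l \<le> dist (G T) l' + dist l' l"
      by (rule dist_triangle)
    finally show ?case using elim G(3) \<open>e > 0\<close> by (simp add: dist_commute)
  qed
qed

section \<open>Gaussian kernels as averages of characters\<close>

lemma lborel_integral_affine:
  fixes f :: "'v::euclidean_space \<Rightarrow> real"
  assumes [measurable]: "f \<in> borel_measurable borel" and "c \<noteq> 0"
  shows "(LINT x|lborel. f x) = \<bar>c\<bar> ^ DIM('v) * (LINT x|lborel. f (t + c *\<^sub>R x))"
  by (subst lborel_affine[OF \<open>c \<noteq> 0\<close>, of t], subst integral_density) (auto simp: integral_distr)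

lemma borel_measurable_cis [measurable]: "cis \<in> borel_measurable borel"
  unfolding cis_conv_exp by measurable

definition gaussian_kernel :: "'v::euclidean_space \<Rightarrow> real" where
  "gaussian_kernel x = exp (- (norm x)\<^sup>2 / 2)"

lemma gaussian_kernel_pos: "0 < gaussian_kernel x"
  by (simp add: gaussian_kernel_def)

lemma gaussian_kernel_le_1: "gaussian_kernel x \<le> 1"
  by (simp add: gaussian_kernel_def)

lemma borel_measurable_gaussian_kernel [measurable]: "gaussian_kernel \<in> borel_measurable borel"
  unfolding gaussian_kernel_def by simp

lemma gaussian_kernel_prod:
  "gaussian_kernel (x::'v::euclidean_space) = (\<Prod>b\<in>Basis. exp (- (x \<bullet> b)\<^sup>2 / 2))"
proof -
  have "(norm x)\<^sup>2 = (\<Sum>b\<in>Basis. (x \<bullet> b)\<^sup>2)"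
    unfolding power2_norm_eq_inner by (subst euclidean_inner) (simp add: power2_eq_square)
  then show ?thesis
    by (simp add: gaussian_kernel_def exp_sum[symmetric] sum_negf sum_divide_distrib)
qed

lemma integrable_gaussian_kernel: "integrable lborel (gaussian_kernel :: 'v::euclidean_space \<Rightarrow> real)"
proof (rule integrableI_nonneg)
  have int: "integrable lborel (\<lambda>x::real. exp (- x\<^sup>2 / 2))"
  proof -
    have "exp (- x\<^sup>2 / 2) = sqrt (2 * pi) * std_normal_density x" for x :: real
      by (simp add: std_normal_density_def)
    then show ?thesis by simp
  qed
  have "(\<integral>\<^sup>+x. ennreal (gaussian_kernel (x::'v)) \<partial>lborel)
      = (\<integral>\<^sup>+x. (\<Prod>b\<in>Basis. ennreal (exp (- ((x::'v) \<bullet> b)\<^sup>2 / 2))) \<partial>lborel)"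
    by (simp add: gaussian_kernel_prod prod_ennreal)
  also have "\<dots> = (\<Prod>b\<in>(Basis::'v set). (\<integral>\<^sup>+x. ennreal (exp (- x\<^sup>2 / 2)) \<partial>lborel))"
    by (rule nn_integral_lborel_prod) auto
  also have "\<dots> < \<infinity>"
    using int by (simp add: nn_integral_eq_integral ennreal_power)
  finally show "(\<integral>\<^sup>+x. ennreal (gaussian_kernel (x::'v)) \<partial>lborel) < \<infinity>" .
qed (auto simp: less_imp_le[OF gaussian_kernel_pos])

text \<open>The law P is that of a standard normal vector. Through it, the expectation of a Gaussian
  kernel at X becomes an average of values of the characteristic function of X.\<close>

lemma gaussian_kernel_eq_char:
  obtains P :: "'v::euclidean_space measure" where "prob_space P" "sets P = sets borel"
    "\<And>x. (LINT z|P. cis (x \<bullet> z)) = complex_of_real (gaussian_kernel x)"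
proof
  interpret std: prob_space std_normal_distribution
    by (simp add: prob_space_normal_density)
  interpret product_prob_space "\<lambda>_. std_normal_distribution" "Basis :: 'v set" ..
  let ?Q = "PiM (Basis :: 'v set) (\<lambda>_. std_normal_distribution)"
  let ?g = "\<lambda>f. \<Sum>b\<in>Basis. f b *\<^sub>R b :: 'v"
  have m [measurable]: "?g \<in> measurable ?Q borel"
    by (intro borel_measurable_sum borel_measurable_scaleR) auto
  show "prob_space (distr ?Q borel ?g)"
    by (intro P.prob_space_distr m)
  show "sets (distr ?Q borel ?g) = sets borel" by simp
  fix x :: 'v
  have "(LINT z|distr ?Q borel ?g. cis (x \<bullet> z)) = (LINT f|?Q. cis (x \<bullet> ?g f))"
    by (subst integral_distr) auto
  also have "(\<lambda>f. cis (x \<bullet> ?g f)) = (\<lambda>f. \<Prod>b\<in>Basis. iexp ((x \<bullet> b) * f b))"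
    by (simp add: inner_sum_right cis_conv_exp exp_sum[symmetric] sum_distrib_left mult_ac)
  also have "(LINT f|?Q. (\<Prod>b\<in>Basis. iexp ((x \<bullet> b) * f b)))
     = (\<Prod>b\<in>Basis. LINT y|std_normal_distribution. iexp ((x \<bullet> b) * y))"
    by (rule product_integral_prod) (auto intro!: std.integrable_const_bound[of _ 1])
  also have "\<dots> = (\<Prod>b\<in>Basis. complex_of_real (exp (- (x \<bullet> b)\<^sup>2 / 2)))"
    by (simp only: char_def[symmetric] char_std_normal_distribution)
  also have "\<dots> = complex_of_real (gaussian_kernel x)"
    by (simp add: gaussian_kernel_prod)
  finally show "(LINT z|distr ?Q borel ?g. cis (x \<bullet> z)) = complex_of_real (gaussian_kernel x)" .
qed

locale char_convergence = M: prob_space M + N: prob_space N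
  for M :: "'a measure" and N :: "'b measure" +
  fixes X :: "real \<Rightarrow> 'a \<Rightarrow> 'v::euclidean_space" and Y :: "'b \<Rightarrow> 'v"
  assumes X [measurable]: "\<And>T. X T \<in> borel_measurable M"
    and Y [measurable]: "Y \<in> borel_measurable N"
    and char: "\<And>\<theta>. ((\<lambda>T. LINT \<omega>|M. cis (\<theta> \<bullet> X T \<omega>)) \<longlongrightarrow> (LINT \<omega>|N. cis (\<theta> \<bullet> Y \<omega>))) at_top"
begin

text \<open>By \<open>gaussian_kernel_eq_char\<close> and Fubini both sides are P-averages of
  characteristic functions at - c z. These converge pointwise and are bounded by 1.\<close>

lemma gaussian_kernel_tendsto:
  fixes c :: real
  shows "((\<lambda>T. LINT \<omega>|M. gaussian_kernel (c *\<^sub>R (y - X T \<omega>))) \<longlongrightarrow> (LINT \<omega>|N. gaussian_kernel (c *\<^sub>R (y - Y \<omega>)))) at_top"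
proof -
  obtain P :: "'v measure" where P: "prob_space P" and s [measurable_cong]: "sets P = sets borel"
    and ch: "\<And>x. (LINT z|P. cis (x \<bullet> z)) = complex_of_real (gaussian_kernel x)"
    using gaussian_kernel_eq_char by blast
  interpret G: prob_space P by fact
  have split: "complex_of_real (LINT \<omega>|Q. gaussian_kernel (c *\<^sub>R (y - Z \<omega>)))
    = (LINT z|P. cis ((c *\<^sub>R y) \<bullet> z) * (LINT \<omega>|Q. cis ((- c *\<^sub>R z) \<bullet> Z \<omega>)))"
    if "prob_space Q" and [measurable]: "Z \<in> borel_measurable Q" for Q :: "'c measure" and Z
  proof -
    interpret Q: prob_space Q by fact
    interpret pair_prob_space Q P ..
    have eq: "cis ((c *\<^sub>R (y - Z \<omega>)) \<bullet> z) = cis ((c *\<^sub>R y) \<bullet> z) * cis ((- c *\<^sub>R z) \<bullet> Z \<omega>)" for z \<omega>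
      by (simp add: cis_mult inner_diff_left inner_commute algebra_simps)
    have "complex_of_real (LINT \<omega>|Q. gaussian_kernel (c *\<^sub>R (y - Z \<omega>)))
      = (LINT \<omega>|Q. LINT z|P. cis ((c *\<^sub>R (y - Z \<omega>)) \<bullet> z))"
      unfolding ch by simp
    also have "\<dots> = (LINT z|P. LINT \<omega>|Q. cis ((c *\<^sub>R (y - Z \<omega>)) \<bullet> z))"
      by (intro Fubini_integral[symmetric] P.integrable_const_bound[of _ 1]) auto
    also have "\<dots> = (LINT z|P. cis ((c *\<^sub>R y) \<bullet> z) * (LINT \<omega>|Q. cis ((- c *\<^sub>R z) \<bullet> Z \<omega>)))"
      unfolding eq by simp
    finally show ?thesis .
  qed
  have "((\<lambda>T. LINT z|P. cis ((c *\<^sub>R y) \<bullet> z) * (LINT \<omega>|M. cis ((- c *\<^sub>R z) \<bullet> X T \<omega>)))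
     \<longlongrightarrow> (LINT z|P. cis ((c *\<^sub>R y) \<bullet> z) * (LINT \<omega>|N. cis ((- c *\<^sub>R z) \<bullet> Y \<omega>)))) at_top"
  proof (rule integral_dominated_convergence_at_top[where w="\<lambda>_. 1"])
    show "AE z in P. ((\<lambda>T. cis ((c *\<^sub>R y) \<bullet> z) * (LINT \<omega>|M. cis ((- c *\<^sub>R z) \<bullet> X T \<omega>)))
       \<longlongrightarrow> cis ((c *\<^sub>R y) \<bullet> z) * (LINT \<omega>|N. cis ((- c *\<^sub>R z) \<bullet> Y \<omega>))) at_top"
      by (intro AE_I2 tendsto_mult tendsto_const char)
    have "norm (cis ((c *\<^sub>R y) \<bullet> z) * (LINT \<omega>|M. cis ((- c *\<^sub>R z) \<bullet> X T \<omega>))) \<le> 1" for z T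
    proof -
      have "norm (LINT \<omega>|M. cis ((- c *\<^sub>R z) \<bullet> X T \<omega>)) \<le> (LINT \<omega>|M. norm (cis ((- c *\<^sub>R z) \<bullet> X T \<omega>)))"
        by (rule integral_norm_bound)
      then show ?thesis by (simp add: norm_mult M.prob_space)
    qed
    then show "\<forall>\<^sub>F T in at_top. AE z in P. norm (cis ((c *\<^sub>R y) \<bullet> z) * (LINT \<omega>|M. cis ((- c *\<^sub>R z) \<bullet> X T \<omega>))) \<le> 1"
      by simp
  qed auto
  then have "((\<lambda>T. complex_of_real (LINT \<omega>|M. gaussian_kernel (c *\<^sub>R (y - X T \<omega>))))
    \<longlongrightarrow> complex_of_real (LINT \<omega>|N. gaussian_kernel (c *\<^sub>R (y - Y \<omega>)))) at_top"
    by (subst (1 2) split) (auto intro: M.prob_space_axioms N.prob_space_axioms)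
  then show ?thesis by (subst (asm) tendsto_of_real_iff)
qed

text \<open>The mean of f (x + \<sigma> Z) for a standard Gaussian vector Z; dividing by the
  integral of the kernel avoids evaluating it.\<close>

definition smoothed :: "real \<Rightarrow> ('v \<Rightarrow> real) \<Rightarrow> 'v \<Rightarrow> real" where
  "smoothed \<sigma> f x = (LINT z|lborel. f (x + \<sigma> *\<^sub>R z) * gaussian_kernel z) / (LINT z|lborel. gaussian_kernel (z::'v))"

lemma smoothed_eq:
  assumes [measurable]: "f \<in> borel_measurable borel" and "\<sigma> > 0"
  shows "smoothed \<sigma> f x = (LINT y|lborel. f y * gaussian_kernel ((1/\<sigma>) *\<^sub>R (y - x))) /
     (\<sigma> ^ DIM('v) * (LINT z|lborel. gaussian_kernel (z::'v)))"
  using lborel_integral_affine[of "\<lambda>y. f y * gaussian_kernel ((1/\<sigma>) *\<^sub>R (y - x))" \<sigma> x] assms(2)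
  by (simp add: smoothed_def)

text \<open>Written as an integral over y against kernels centred at X T, the smoothing separates f
  from X T. Integrability of f then supplies the majorant |f|.\<close>

lemma smoothed_tendsto:
  fixes f :: "'v \<Rightarrow> real"
  assumes f: "integrable lborel f" and "\<sigma> > 0"
  shows "((\<lambda>T. LINT \<omega>|M. smoothed \<sigma> f (X T \<omega>)) \<longlongrightarrow> (LINT \<omega>|N. smoothed \<sigma> f (Y \<omega>))) at_top"
proof -
  have fm [measurable]: "f \<in> borel_measurable borel" using f by auto
  have split: "(LINT \<omega>|Q. LINT y|lborel. f y * gaussian_kernel ((1/\<sigma>) *\<^sub>R (y - Z \<omega>)))
    = (LINT y|lborel. f y * (LINT \<omega>|Q. gaussian_kernel ((1/\<sigma>) *\<^sub>R (y - Z \<omega>))))"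
    if "prob_space Q" and [measurable]: "Z \<in> borel_measurable Q" for Q :: "'c measure" and Z
  proof -
    interpret Q: prob_space Q by fact
    interpret pair_sigma_finite lborel Q ..
    have le: "\<bar>f y * gaussian_kernel ((1/\<sigma>) *\<^sub>R (y - Z \<omega>))\<bar> \<le> \<bar>f y\<bar>" for y \<omega>
      by (simp add: abs_mult mult_left_le gaussian_kernel_le_1 less_imp_le[OF gaussian_kernel_pos])
    have i1: "integrable Q (\<lambda>\<omega>. f y * gaussian_kernel ((1/\<sigma>) *\<^sub>R (y - Z \<omega>)))" for y
      using le by (intro Q.integrable_const_bound[of _ "\<bar>f y\<bar>"]) auto
    have I: "integrable (lborel \<Otimes>\<^sub>M Q) (\<lambda>(y, \<omega>). f y * gaussian_kernel ((1/\<sigma>) *\<^sub>R (y - Z \<omega>)))"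
    proof (rule Fubini_integrable)
      show "integrable lborel (\<lambda>y. LINT \<omega>|Q. norm (case (y, \<omega>) of (y, \<omega>) \<Rightarrow> f y * gaussian_kernel ((1/\<sigma>) *\<^sub>R (y - Z \<omega>))))"
      proof (rule Bochner_Integration.integrable_bound[OF f], simp, rule AE_I2)
        fix y
        have "(LINT \<omega>|Q. \<bar>f y * gaussian_kernel ((1/\<sigma>) *\<^sub>R (y - Z \<omega>))\<bar>) \<le> (LINT \<omega>|Q. \<bar>f y\<bar>)"
          by (intro integral_mono le integrable_abs i1) simp
        then show "norm (LINT \<omega>|Q. norm (case (y, \<omega>) of (y, \<omega>) \<Rightarrow> f y * gaussian_kernel ((1/\<sigma>) *\<^sub>R (y - Z \<omega>)))) \<le> norm (f y)"
          by (simp add: Q.prob_space)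
      qed
    qed (use i1 in auto)
    show ?thesis using Fubini_integral[OF I] by simp
  qed
  have "((\<lambda>T. LINT y|lborel. f y * (LINT \<omega>|M. gaussian_kernel ((1/\<sigma>) *\<^sub>R (y - X T \<omega>))))
    \<longlongrightarrow> (LINT y|lborel. f y * (LINT \<omega>|N. gaussian_kernel ((1/\<sigma>) *\<^sub>R (y - Y \<omega>))))) at_top"
  proof (rule integral_dominated_convergence_at_top[where w="\<lambda>y. \<bar>f y\<bar>"])
    show "AE y in lborel. ((\<lambda>T. f y * (LINT \<omega>|M. gaussian_kernel ((1/\<sigma>) *\<^sub>R (y - X T \<omega>))))
      \<longlongrightarrow> f y * (LINT \<omega>|N. gaussian_kernel ((1/\<sigma>) *\<^sub>R (y - Y \<omega>)))) at_top"
      by (intro AE_I2 tendsto_mult tendsto_const gaussian_kernel_tendsto)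
    have "\<bar>LINT \<omega>|M. gaussian_kernel ((1/\<sigma>) *\<^sub>R (y - X T \<omega>))\<bar> \<le> 1" for T y
    proof -
      have "(LINT \<omega>|M. gaussian_kernel ((1/\<sigma>) *\<^sub>R (y - X T \<omega>))) \<le> (LINT \<omega>|M. 1)"
        by (intro integral_mono M.integrable_const_bound[of _ 1])
           (auto simp: gaussian_kernel_le_1 less_imp_le[OF gaussian_kernel_pos])
      moreover have "0 \<le> (LINT \<omega>|M. gaussian_kernel ((1/\<sigma>) *\<^sub>R (y - X T \<omega>)))"
        by (intro integral_nonneg_AE AE_I2) (auto simp: less_imp_le[OF gaussian_kernel_pos])
      ultimately show ?thesis by (simp add: M.prob_space)
    qed
    then show "\<forall>\<^sub>F T in at_top. AE y in lborel. norm (f y * (LINT \<omega>|M. gaussian_kernel ((1/\<sigma>) *\<^sub>R (y - X T \<omega>)))) \<le> \<bar>f y\<bar>"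
      by (simp add: abs_mult mult_left_le)
  qed (use f in auto)
  then have "((\<lambda>T. LINT \<omega>|M. LINT y|lborel. f y * gaussian_kernel ((1/\<sigma>) *\<^sub>R (y - X T \<omega>)))
    \<longlongrightarrow> (LINT \<omega>|N. LINT y|lborel. f y * gaussian_kernel ((1/\<sigma>) *\<^sub>R (y - Y \<omega>)))) at_top"
    by (subst (1 2) split) (auto intro: M.prob_space_axioms N.prob_space_axioms)
  then have "((\<lambda>T. (LINT \<omega>|M. LINT y|lborel. f y * gaussian_kernel ((1/\<sigma>) *\<^sub>R (y - X T \<omega>))) / c)
    \<longlongrightarrow> (LINT \<omega>|N. LINT y|lborel. f y * gaussian_kernel ((1/\<sigma>) *\<^sub>R (y - Y \<omega>))) / c) at_top" for c
    unfolding divide_inverse by (intro tendsto_mult tendsto_const)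
  then show ?thesis by (simp add: smoothed_eq[OF fm \<open>\<sigma> > 0\<close>])
qed

text \<open>Uniform continuity handles displacements \<sigma> z shorter than d; the bound B handles
  the others, whose Gaussian mass is small once \<sigma> is small.\<close>

lemma smoothed_uniform_approx:
  assumes uc: "uniformly_continuous_on UNIV f" and b: "\<And>x. \<bar>f x\<bar> \<le> B" and "e > 0"
  shows "\<exists>\<sigma>>0. \<forall>x. \<bar>f x - smoothed \<sigma> f x\<bar> \<le> e"
proof -
  let ?g = "gaussian_kernel :: 'v \<Rightarrow> real"
  define c where "c = (LINT z|lborel. ?g z)"
  have fm [measurable]: "f \<in> borel_measurable borel"
    using uc by (intro borel_measurable_continuous_onI uniformly_continuous_imp_continuous)
  have "c > 0"
  proof -
    have "c \<noteq> 0"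
    proof
      assume "c = 0"
      then have "AE z in lborel. ?g z = 0"
        unfolding c_def using integral_nonneg_eq_0_iff_AE[OF integrable_gaussian_kernel]
        by (auto simp: less_imp_le[OF gaussian_kernel_pos])
      then have "AE z::'v in lborel. False"
        by (simp add: less_imp_neq[OF gaussian_kernel_pos, symmetric])
      then show False by (simp add: AE_iff_null null_sets_def)
    qed
    moreover have "c \<ge> 0" unfolding c_def
      by (intro integral_nonneg_AE AE_I2) (auto simp: less_imp_le[OF gaussian_kernel_pos])
    ultimately show ?thesis by simp
  qed
  have "B \<ge> 0" using b[of 0] by linarith
  have "\<exists>d>0. \<forall>x\<in>UNIV. \<forall>x'\<in>UNIV. dist x' x < d \<longrightarrow> dist (f x') (f x) < e/2"
    using uc \<open>e > 0\<close> unfolding uniformly_continuous_on_def by (drule_tac spec[of _ "e/2"]) simp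
  then obtain d where d: "d > 0" "\<And>x y. dist x y < d \<Longrightarrow> dist (f x) (f y) < e/2"
    by auto
  have "(\<lambda>n. LINT z|lborel. indicator {z. d \<le> norm ((1 / Suc n) *\<^sub>R z)} z * ?g z) \<longlonglongrightarrow> (LINT z::'v|lborel. (0::real))"
  proof (rule integral_dominated_convergence[where w="?g"])
    show "AE z in lborel. (\<lambda>n. indicator {z. d \<le> norm ((1 / Suc n) *\<^sub>R z)} z * ?g z) \<longlonglongrightarrow> 0"
    proof (rule AE_I2)
      fix z :: 'v
      have "(\<lambda>n. norm ((1 / real (Suc n)) *\<^sub>R z)) \<longlonglongrightarrow> norm ((0::real) *\<^sub>R z)"
        by (intro tendsto_intros LIMSEQ_Suc lim_1_over_n)
      then have "eventually (\<lambda>n. norm ((1 / real (Suc n)) *\<^sub>R z) < d) sequentially"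
        using \<open>d > 0\<close> by (intro order_tendstoD(2)[where a=d]) auto
      then show "(\<lambda>n. indicator {z. d \<le> norm ((1 / Suc n) *\<^sub>R z)} z * ?g z) \<longlonglongrightarrow> 0"
        by (intro tendsto_eventually) (erule eventually_mono, auto simp: indicator_def)
    qed
    show "AE z in lborel. norm (indicator {z. d \<le> norm ((1 / Suc n) *\<^sub>R z)} z * ?g z) \<le> ?g z" for n
      by (intro AE_I2) (auto simp: indicator_def less_imp_le[OF gaussian_kernel_pos])
  qed (auto simp: integrable_gaussian_kernel)
  \<comment> \<open>The threshold is chosen so that 2 B times it is at most e c / 2; B + 1 in place
    of B avoids a division by 0.\<close>
  then have "eventually (\<lambda>n. (LINT z|lborel. indicator {z. d \<le> norm ((1 / Suc n) *\<^sub>R z)} z * ?g z) < e * c / (4 * (B + 1))) sequentially"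
    using \<open>e > 0\<close> \<open>c > 0\<close> \<open>B \<ge> 0\<close> by (intro order_tendstoD(2)[where y="LINT z::'v|lborel. (0::real)"]) auto
  then obtain n where n: "(LINT z|lborel. indicator {z. d \<le> norm ((1 / Suc n) *\<^sub>R z)} z * ?g z) < e * c / (4 * (B + 1))"
    by (auto simp: eventually_sequentially)
  define \<sigma> where "\<sigma> = 1 / real (Suc n)"
  have "\<sigma> > 0" by (simp add: \<sigma>_def)
  have intI: "integrable lborel (\<lambda>z. indicator {z. d \<le> norm (\<sigma> *\<^sub>R z)} z * ?g z)"
    by (rule Bochner_Integration.integrable_bound[OF integrable_gaussian_kernel]) (auto simp: indicator_def)
  have "\<bar>f x - smoothed \<sigma> f x\<bar> \<le> e" for x
  proof -
    have i1: "integrable lborel (\<lambda>z. f (x + \<sigma> *\<^sub>R z) * ?g z)"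
      by (rule Bochner_Integration.integrable_bound[OF integrable_mult_right[OF integrable_gaussian_kernel, of B]])
         (auto simp: abs_mult less_imp_le[OF gaussian_kernel_pos] intro!: mult_right_mono order_trans[OF b] )
    have i2: "integrable lborel (\<lambda>z. f x * ?g z)"
      by (intro integrable_mult_right integrable_gaussian_kernel)
    have "c * f x - c * smoothed \<sigma> f x = (LINT z|lborel. (f x - f (x + \<sigma> *\<^sub>R z)) * ?g z)"
      using \<open>c > 0\<close> i1 i2 by (simp add: smoothed_def c_def[symmetric] left_diff_distrib)
    also have "\<bar>\<dots>\<bar> \<le> (LINT z|lborel. \<bar>(f x - f (x + \<sigma> *\<^sub>R z)) * ?g z\<bar>)"
      by (rule integral_abs_bound)
    also have "\<dots> \<le> (LINT z|lborel. e/2 * ?g z + 2 * B * (indicator {z. d \<le> norm (\<sigma> *\<^sub>R z)} z * ?g z))"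
    proof (rule integral_mono)
      show "integrable lborel (\<lambda>z. \<bar>(f x - f (x + \<sigma> *\<^sub>R z)) * ?g z\<bar>)"
        using i1 i2 by (intro integrable_abs) (simp add: left_diff_distrib)
      show "integrable lborel (\<lambda>z. e/2 * ?g z + 2 * B * (indicator {z. d \<le> norm (\<sigma> *\<^sub>R z)} z * ?g z))"
        by (intro Bochner_Integration.integrable_add integrable_mult_right integrable_gaussian_kernel intI)
      fix z
      have "\<bar>f x - f (x + \<sigma> *\<^sub>R z)\<bar> \<le> e/2 + 2 * B * indicator {z. d \<le> norm (\<sigma> *\<^sub>R z)} z"
      proof (cases "d \<le> norm (\<sigma> *\<^sub>R z)")
        case True
        have "\<bar>f x - f (x + \<sigma> *\<^sub>R z)\<bar> \<le> \<bar>f x\<bar> + \<bar>f (x + \<sigma> *\<^sub>R z)\<bar>" by linarith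
        also have "\<dots> \<le> 2 * B" using b[of x] b[of "x + \<sigma> *\<^sub>R z"] by linarith
        finally show ?thesis using True \<open>e > 0\<close> by (simp add: indicator_def)
      next
        case False
        then have "dist x (x + \<sigma> *\<^sub>R z) < d" by (simp add: dist_norm)
        from d(2)[OF this] show ?thesis using False by (simp add: dist_real_def indicator_def)
      qed
      then have "\<bar>f x - f (x + \<sigma> *\<^sub>R z)\<bar> * ?g z \<le> (e/2 + 2 * B * indicator {z. d \<le> norm (\<sigma> *\<^sub>R z)} z) * ?g z"
        by (intro mult_right_mono less_imp_le[OF gaussian_kernel_pos])
      then show "\<bar>(f x - f (x + \<sigma> *\<^sub>R z)) * ?g z\<bar> \<le> e/2 * ?g z + 2 * B * (indicator {z. d \<le> norm (\<sigma> *\<^sub>R z)} z * ?g z)"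
        unfolding abs_mult abs_of_pos[OF gaussian_kernel_pos] by (simp add: algebra_simps)
    qed
    also have "\<dots> = e/2 * c + 2 * B * (LINT z|lborel. indicator {z. d \<le> norm (\<sigma> *\<^sub>R z)} z * ?g z)"
      using Bochner_Integration.integral_add[OF
          integrable_mult_right[OF integrable_gaussian_kernel, of "e/2"] integrable_mult_right[OF intI, of "2 * B"]]
      by (simp only: integral_mult_right_zero c_def)
    also have "\<dots> \<le> e/2 * c + 2 * B * (e * c / (4 * (B + 1)))"
      using n \<open>B \<ge> 0\<close> by (intro add_left_mono mult_left_mono) (auto simp: \<sigma>_def)
    also have "2 * B * (e * c / (4 * (B + 1))) \<le> e * c / 2"
    proof -
      have "B / (B + 1) \<le> 1" using \<open>B \<ge> 0\<close> by simp
      then have "e * c / 2 * (B / (B + 1)) \<le> e * c / 2 * 1"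
        using \<open>e > 0\<close> \<open>c > 0\<close> by (intro mult_left_mono) auto
      moreover have "2 * B * (e * c / (4 * (B + 1))) = e * c / 2 * (B / (B + 1))"
        using \<open>B \<ge> 0\<close> by (simp add: field_simps)
      ultimately show ?thesis by simp
    qed
    finally have "\<bar>c * f x - c * smoothed \<sigma> f x\<bar> \<le> c * e" by (simp add: mult.commute)
    then have "c * \<bar>f x - smoothed \<sigma> f x\<bar> \<le> c * e"
      using \<open>c > 0\<close> abs_mult[of c "f x - smoothed \<sigma> f x"] by (simp add: right_diff_distrib)
    then show ?thesis using \<open>c > 0\<close> by simp
  qed
  with \<open>\<sigma> > 0\<close> show ?thesis by blast
qed

lemma integral_diff_bound:
  assumes "prob_space Q" "f \<in> borel_measurable Q" "g \<in> borel_measurable Q"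
    "\<And>x. \<bar>f x\<bar> \<le> B" "\<And>x. \<bar>f x - g x :: real\<bar> \<le> e"
  shows "dist (LINT x|Q. f x) (LINT x|Q. g x) \<le> e"
proof -
  interpret Q: prob_space Q by fact
  have i: "integrable Q f" using assms by (intro Q.integrable_const_bound[of _ B]) auto
  have g: "\<bar>g x\<bar> \<le> B + e" for x using assms(4,5)[of x] by linarith
  have ig: "integrable Q g" using assms g by (intro Q.integrable_const_bound[of _ "B + e"]) auto
  have "dist (LINT x|Q. f x) (LINT x|Q. g x) = \<bar>LINT x|Q. f x - g x\<bar>"
    using i ig by (simp add: dist_real_def)
  also have "\<dots> \<le> (LINT x|Q. \<bar>f x - g x\<bar>)" by (rule integral_abs_bound)
  also have "\<dots> \<le> (LINT x|Q. e)" using i ig assms by (intro integral_mono) auto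
  finally show ?thesis by (simp add: Q.prob_space)
qed

text \<open>Compact support yields everything that smoothing requires: boundedness, uniform
  continuity and integrability.\<close>

lemma compact_support_tendsto:
  fixes f :: "'v \<Rightarrow> real"
  assumes cont: "continuous_on UNIV f" and supp: "\<And>x. K \<le> norm x \<Longrightarrow> f x = 0"
  shows "((\<lambda>T. LINT \<omega>|M. f (X T \<omega>)) \<longlongrightarrow> (LINT \<omega>|N. f (Y \<omega>))) at_top"
proof -
  have fm [measurable]: "f \<in> borel_measurable borel" by (intro borel_measurable_continuous_onI cont)
  have "compact (f ` cball 0 K)"
    by (intro compact_continuous_image continuous_on_subset[OF cont]) auto
  then have "bounded (f ` cball 0 K)" by (rule compact_imp_bounded)
  then obtain B where "\<forall>x\<in>cball 0 K. \<bar>f x\<bar> \<le> B"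
    unfolding bounded_iff by auto
  then have B: "\<And>x. norm x \<le> K \<Longrightarrow> \<bar>f x\<bar> \<le> B" by auto
  have b: "\<bar>f x\<bar> \<le> max B 0" for x using B[of x] supp[of x] by (cases "K \<le> norm x") (auto simp: le_max_iff_disj)
  have uc: "uniformly_continuous_on UNIV f"
  proof -
    \<comment> \<open>The margin 1 matters: two points less than 1 apart lie either both in this
      larger ball or both where f vanishes.\<close>
    have "uniformly_continuous_on (cball 0 (K + 1)) f"
      by (intro compact_uniformly_continuous continuous_on_subset[OF cont]) auto
    show ?thesis unfolding uniformly_continuous_on_def
    proof safe
      fix e :: real assume "e > 0"
      then have "\<exists>d>0. \<forall>x\<in>cball 0 (K + 1). \<forall>x'\<in>cball 0 (K + 1). dist x' x < d \<longrightarrow> dist (f x') (f x) < e"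
        using \<open>uniformly_continuous_on (cball 0 (K + 1)) f\<close> unfolding uniformly_continuous_on_def
        by blast
      then obtain d where d: "d > 0" "\<And>x y. norm x \<le> K+1 \<Longrightarrow> norm y \<le> K+1 \<Longrightarrow> dist y x < d \<Longrightarrow> dist (f y) (f x) < e"
        by auto
      show "\<exists>d>0. \<forall>x\<in>UNIV. \<forall>x'\<in>UNIV. dist x' x < d \<longrightarrow> dist (f x') (f x) < e"
      proof (intro exI[of _ "min d 1"] conjI ballI impI)
        fix x y :: 'v assume xy: "dist y x < min d 1"
        then have "\<bar>norm y - norm x\<bar> < 1"
          using norm_triangle_ineq3[of y x] by (simp add: dist_norm)
        then show "dist (f y) (f x) < e"
          using d(2)[of x y] xy supp[of x] supp[of y] \<open>e > 0\<close>
          by (cases "norm x \<le> K + 1 \<and> norm y \<le> K + 1") auto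
      qed (use d in auto)
    qed
  qed
  have int: "integrable lborel f"
  proof -
    have "integrable lborel (\<lambda>x. indicator (cball 0 K) x *\<^sub>R f x)"
      using borel_integrable_compact[of "cball 0 K" f] continuous_on_subset[OF cont] by simp
    also have "(\<lambda>x. indicator (cball 0 K) x *\<^sub>R f x) = f"
      using supp by (auto simp: indicator_def fun_eq_iff)
    finally show ?thesis .
  qed
  show ?thesis
  proof (rule tendsto_uniform_approx)
    fix e :: real assume "e > 0"
    obtain \<sigma> where \<sigma>: "\<sigma> > 0" "\<And>x. \<bar>f x - smoothed \<sigma> f x\<bar> \<le> e"
      using smoothed_uniform_approx[OF uc b \<open>e > 0\<close>] by blast
    have [measurable]: "smoothed \<sigma> f \<in> borel_measurable borel"
      unfolding smoothed_def by measurable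
    show "\<exists>G l'. (G \<longlongrightarrow> l') at_top \<and> (\<forall>\<^sub>F T in at_top. dist (LINT \<omega>|M. f (X T \<omega>)) (G T) \<le> e) \<and> dist (LINT \<omega>|N. f (Y \<omega>)) l' \<le> e"
      by (intro exI conjI, rule smoothed_tendsto[OF int \<sigma>(1)])
         (auto intro!: always_eventually integral_diff_bound[where B="max B 0"] b \<sigma>(2)
           M.prob_space_axioms N.prob_space_axioms)
  qed
qed

text \<open>Tightness is obtained on the way. A cut-off is chosen for the limit Y; being compactly
  supported, its expectation under X T converges, so that X T eventually loses as little mass as Y
  does. This bounds the error of replacing f by its cut-off on both sides.\<close>

theorem converges_in_distribution: "converges_in_distribution M X N Y at_top"
  unfolding converges_in_distribution_def
proof safe
  show "\<forall>\<^sub>F T in at_top. X T \<in> borel_measurable M" by simp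
  fix f :: "'v \<Rightarrow> real" assume cont: "continuous_on UNIV f" and bd: "bounded (range f)"
  have fm [measurable]: "f \<in> borel_measurable borel" by (intro borel_measurable_continuous_onI cont)
  obtain B where B: "\<And>x. \<bar>f x\<bar> \<le> B" using bd unfolding bounded_iff by auto
  define cut :: "nat \<Rightarrow> 'v \<Rightarrow> real" where "cut k x = max 0 (min 1 (real k + 1 - norm x))" for k x
  have cutc: "continuous_on UNIV (cut k)" for k
    unfolding cut_def by (intro continuous_intros)
  have cutm [measurable]: "cut k \<in> borel_measurable borel" for k
    by (intro borel_measurable_continuous_onI cutc)
  have cut01: "0 \<le> cut k x" "cut k x \<le> 1" for k x by (auto simp: cut_def)
  have "(\<lambda>k. LINT \<omega>|N. cut k (Y \<omega>)) \<longlonglongrightarrow> (LINT \<omega>|N. 1)"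
  proof (rule integral_dominated_convergence[where w="\<lambda>_. 1"])
    show "AE \<omega> in N. (\<lambda>k. cut k (Y \<omega>)) \<longlonglongrightarrow> 1"
    proof (rule AE_I2)
      fix \<omega>
      obtain k0 where "norm (Y \<omega>) \<le> real k0" using real_arch_simple by blast
      then have "eventually (\<lambda>k. norm (Y \<omega>) \<le> real k) sequentially"
        by (intro eventually_mono[OF eventually_ge_at_top[of k0]]) simp
      then show "(\<lambda>k. cut k (Y \<omega>)) \<longlonglongrightarrow> 1"
        by (intro tendsto_eventually) (erule eventually_mono, auto simp: cut_def)
    qed
  qed (use cut01 in auto)
  then have lim1: "(\<lambda>k. LINT \<omega>|N. cut k (Y \<omega>)) \<longlonglongrightarrow> 1" by (simp add: N.prob_space)
  have "B \<ge> 0" using B[of 0] by linarith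
  have bound: "dist (LINT x|Q. f (Z x)) (LINT x|Q. f (Z x) * cut k (Z x)) \<le> B * (1 - (LINT x|Q. cut k (Z x)))"
    if "prob_space Q" and [measurable]: "Z \<in> borel_measurable Q" for Q :: "'c measure" and Z k
  proof -
    interpret Q: prob_space Q by fact
    have i1: "integrable Q (\<lambda>x. f (Z x))" using B by (intro Q.integrable_const_bound[of _ B]) auto
    have i2: "integrable Q (\<lambda>x. cut k (Z x))" using cut01 by (intro Q.integrable_const_bound[of _ 1]) auto
    have i3: "integrable Q (\<lambda>x. f (Z x) * cut k (Z x))"
    proof (rule Q.integrable_const_bound[of _ B])
      have "\<bar>f (Z x)\<bar> * \<bar>cut k (Z x)\<bar> \<le> B * 1" for x
        using cut01[of k "Z x"] B[of "Z x"] by (intro mult_mono) auto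
      then show "AE x in Q. norm (f (Z x) * cut k (Z x)) \<le> B"
        by (simp add: abs_mult)
    qed simp
    have "dist (LINT x|Q. f (Z x)) (LINT x|Q. f (Z x) * cut k (Z x)) = \<bar>LINT x|Q. f (Z x) - f (Z x) * cut k (Z x)\<bar>"
      using i1 i3 by (simp add: dist_real_def)
    also have "\<dots> \<le> (LINT x|Q. \<bar>f (Z x) - f (Z x) * cut k (Z x)\<bar>)" by (rule integral_abs_bound)
    also have "\<dots> \<le> (LINT x|Q. B * (1 - cut k (Z x)))"
    proof (rule integral_mono)
      fix x
      have "\<bar>f (Z x) - f (Z x) * cut k (Z x)\<bar> = \<bar>f (Z x)\<bar> * (1 - cut k (Z x))"
        using cut01(2)[of k "Z x"] abs_mult[of "f (Z x)" "1 - cut k (Z x)"]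
        by (simp add: right_diff_distrib)
      also have "\<dots> \<le> B * (1 - cut k (Z x))" using B cut01 by (intro mult_right_mono) auto
      finally show "\<bar>f (Z x) - f (Z x) * cut k (Z x)\<bar> \<le> B * (1 - cut k (Z x))" .
    qed (use i1 i2 i3 in auto)
    also have "\<dots> = B * (1 - (LINT x|Q. cut k (Z x)))" using i2 by (simp add: Q.prob_space)
    finally show ?thesis .
  qed
  show "((\<lambda>T. LINT \<omega>|M. f (X T \<omega>)) \<longlongrightarrow> (LINT \<omega>|N. f (Y \<omega>))) at_top"
  proof (rule tendsto_uniform_approx)
    fix e :: real assume "e > 0"
    have "eventually (\<lambda>k. 1 - e / (B + 1) < (LINT \<omega>|N. cut k (Y \<omega>))) sequentially"
      using lim1 \<open>e > 0\<close> \<open>B \<ge> 0\<close> by (intro order_tendstoD(1)) auto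
    then obtain k where k: "1 - e / (B + 1) < (LINT \<omega>|N. cut k (Y \<omega>))" by (auto simp: eventually_sequentially)
    have small: "B * (1 - a) \<le> e" if "1 - e / (B + 1) < a" for a
    proof -
      have "(B + 1) * (1 - a) \<le> e" using that \<open>B \<ge> 0\<close> by (simp add: field_simps)
      moreover have "B * (1 - a) \<le> e" if "a > 1" using that \<open>B \<ge> 0\<close> \<open>e > 0\<close> mult_nonneg_nonpos[of B "1 - a"] by linarith
      moreover have "B * (1 - a) \<le> (B + 1) * (1 - a)" if "a \<le> 1" using that by (intro mult_right_mono) auto
      ultimately show ?thesis by linarith
    qed
    have "((\<lambda>T. LINT \<omega>|M. cut k (X T \<omega>)) \<longlongrightarrow> (LINT \<omega>|N. cut k (Y \<omega>))) at_top"
      by (rule compact_support_tendsto[OF cutc, of "k + 1"]) (auto simp: cut_def)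
    then have ev: "\<forall>\<^sub>F T in at_top. 1 - e / (B + 1) < (LINT \<omega>|M. cut k (X T \<omega>))"
      using k by (intro order_tendstoD(1))
    have lim: "((\<lambda>T. LINT \<omega>|M. f (X T \<omega>) * cut k (X T \<omega>)) \<longlongrightarrow> (LINT \<omega>|N. f (Y \<omega>) * cut k (Y \<omega>))) at_top"
      by (rule compact_support_tendsto[of _ "k + 1"], intro continuous_on_mult cont cutc) (simp add: cut_def)
    show "\<exists>G l'. (G \<longlongrightarrow> l') at_top \<and> (\<forall>\<^sub>F T in at_top. dist (LINT \<omega>|M. f (X T \<omega>)) (G T) \<le> e) \<and> dist (LINT \<omega>|N. f (Y \<omega>)) l' \<le> e"
    proof (intro exI conjI, rule lim)
      show "\<forall>\<^sub>F T in at_top. dist (LINT \<omega>|M. f (X T \<omega>)) (LINT \<omega>|M. f (X T \<omega>) * cut k (X T \<omega>)) \<le> e"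
        using ev by eventually_elim (intro order_trans[OF bound] small M.prob_space_axioms X)
      show "dist (LINT \<omega>|N. f (Y \<omega>)) (LINT \<omega>|N. f (Y \<omega>) * cut k (Y \<omega>)) \<le> e"
        by (intro order_trans[OF bound] small N.prob_space_axioms Y k)
    qed
  qed
qed (rule Y)

end

section \<open>Functionals of a Poisson point process\<close>

locale poisson_points = prob_space M + \<nu>: sigma_finite_measure \<nu>
  for M :: "'a measure" and \<nu> :: "'b measure" +
  fixes x :: "nat \<Rightarrow> 'a \<Rightarrow> 'b"
  assumes x [measurable]: "\<And>n. x n \<in> measurable M \<nu>"
    and poisson: "poisson_random_measure M \<nu> (\<lambda>\<omega>. distr (count_space UNIV) \<nu> (\<lambda>n. x n \<omega>))"
begin

section \<open>Counts of points and Campbell's formula\<close>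

abbreviation config :: "'a \<Rightarrow> 'b measure" where
  "config \<omega> \<equiv> distr (count_space UNIV) \<nu> (\<lambda>n. x n \<omega>)"

text \<open>A natural number, to be used as an exponent. An infinite count would be sent to 0; by
  \<open>AE_points_in\<close> this has probability 0 for sets of finite intensity.\<close>

definition points_in :: "'b set \<Rightarrow> 'a \<Rightarrow> nat" where
  "points_in B \<omega> = nat \<lfloor>enn2real (emeasure (config \<omega>) B)\<rfloor>"

lemma emeasure_config:
  assumes "B \<in> sets \<nu>" "\<omega> \<in> space M"
  shows "emeasure (config \<omega>) B = emeasure (count_space UNIV) {n. x n \<omega> \<in> B}"
proof -
  have "(\<lambda>n. x n \<omega>) \<in> measurable (count_space UNIV) \<nu>"
    using assms(2) measurable_space[OF x] by auto
  then show ?thesis using assms by (simp add: emeasure_distr vimage_def)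
qed

lemma emeasure_config_eq_suminf:
  assumes "B \<in> sets \<nu>" "\<omega> \<in> space M"
  shows "emeasure (config \<omega>) B = (\<Sum>n. indicator B (x n \<omega>))"
proof -
  have "emeasure (count_space UNIV) {n. x n \<omega> \<in> B} = (\<integral>\<^sup>+n. indicator {n. x n \<omega> \<in> B} n \<partial>count_space UNIV)"
    by simp
  also have "\<dots> = (\<Sum>n. indicator {n. x n \<omega> \<in> B} n)"
    by (rule nn_integral_count_space_nat)
  also have "\<dots> = (\<Sum>n. indicator B (x n \<omega>))" by (simp add: indicator_def)
  finally show ?thesis by (simp add: emeasure_config[OF assms])
qed

lemma borel_measurable_config [measurable]:
  "B \<in> sets \<nu> \<Longrightarrow> (\<lambda>\<omega>. emeasure (config \<omega>) B) \<in> borel_measurable M"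
  using poisson by (auto simp: poisson_random_measure_def)

lemma measurable_points_in [measurable]:
  "B \<in> sets \<nu> \<Longrightarrow> points_in B \<in> measurable M (count_space UNIV)"
  unfolding points_in_def by measurable

lemma prob_config_eq:
  assumes "B \<in> sets \<nu>" "emeasure \<nu> B < \<infinity>"
  shows "prob {\<omega>\<in>space M. emeasure (config \<omega>) B = of_nat k} = measure \<nu> B ^ k / fact k * exp (- measure \<nu> B)"
  using poisson assms by (auto simp: poisson_random_measure_def)

text \<open>For finite intensity the definition prescribes the probabilities of the finite counts.
  These Poisson weights sum to 1, so nothing is left for the value infinity.\<close>

lemma AE_points_in:
  assumes [measurable]: "B \<in> sets \<nu>" and fin: "emeasure \<nu> B < \<infinity>"
  shows "AE \<omega> in M. emeasure (config \<omega>) B = of_nat (points_in B \<omega>)"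
proof -
  let ?A = "\<lambda>k. {\<omega>\<in>space M. emeasure (config \<omega>) B = of_nat k}"
  let ?l = "measure \<nu> B"
  have disj: "disjoint_family ?A" by (auto simp: disjoint_family_on_def)
  have "(\<lambda>k. prob (?A k)) sums prob (\<Union>k. ?A k)"
    by (rule finite_measure_UNION[OF _ disj]) auto
  moreover have "(\<lambda>k. prob (?A k)) sums 1"
  proof -
    have "(\<lambda>k. ?l ^ k /\<^sub>R fact k * exp (- ?l)) sums (exp ?l * exp (- ?l))"
      by (intro sums_mult2 exp_converges)
    then show ?thesis
      by (simp add: prob_config_eq[OF assms] exp_minus_inverse divide_inverse mult_ac)
  qed
  ultimately have "prob (\<Union>k. ?A k) = 1" by (rule sums_unique2)
  moreover have "(\<Union>k. ?A k) \<in> events" by measurable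
  ultimately have "AE \<omega> in M. \<omega> \<in> (\<Union>k. ?A k)" by (simp add: prob_eq_1)
  then show ?thesis
  proof eventually_elim
    case (elim \<omega>)
    then obtain k where "emeasure (config \<omega>) B = of_nat k" by auto
    moreover have "enn2real (of_nat k :: ennreal) = real k"
      by (metis enn2real_ennreal ennreal_of_nat_eq_real_of_nat of_nat_0_le_iff)
    ultimately show ?case by (simp add: points_in_def)
  qed
qed

lemma prob_points_in_eq:
  assumes [measurable]: "B \<in> sets \<nu>" and fin: "emeasure \<nu> B < \<infinity>"
  shows "prob {\<omega>\<in>space M. points_in B \<omega> = k} = measure \<nu> B ^ k / fact k * exp (- measure \<nu> B)"
proof -
  have "prob {\<omega>\<in>space M. points_in B \<omega> = k} = prob {\<omega>\<in>space M. emeasure (config \<omega>) B = of_nat k}"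
    using AE_points_in[OF assms] by (intro finite_measure_eq_AE) auto
  then show ?thesis by (simp add: prob_config_eq[OF assms])
qed

lemma nn_integral_config_finite:
  assumes [measurable]: "B \<in> sets \<nu>" and fin: "emeasure \<nu> B < \<infinity>"
  shows "(\<integral>\<^sup>+\<omega>. emeasure (config \<omega>) B \<partial>M) = emeasure \<nu> B"
proof -
  let ?l = "measure \<nu> B"
  have "(\<integral>\<^sup>+\<omega>. emeasure (config \<omega>) B \<partial>M)
      = (\<integral>\<^sup>+\<omega>. (\<Sum>k. of_nat k * indicator {\<omega>\<in>space M. points_in B \<omega> = k} \<omega>) \<partial>M)"
  proof (rule nn_integral_cong_AE)
    have "(\<Sum>k. of_nat k * indicator {\<omega>\<in>space M. points_in B \<omega> = k} \<omega> :: ennreal) = of_nat (points_in B \<omega>)"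
      if "\<omega> \<in> space M" for \<omega>
    proof -
      have "(\<Sum>k. of_nat k * indicator {\<omega>\<in>space M. points_in B \<omega> = k} \<omega> :: ennreal)
        = (\<Sum>k\<in>{points_in B \<omega>}. of_nat k * indicator {\<omega>\<in>space M. points_in B \<omega> = k} \<omega>)"
        by (rule suminf_finite) auto
      then show ?thesis using that by simp
    qed
    then show "AE \<omega> in M. emeasure (config \<omega>) B = (\<Sum>k. of_nat k * indicator {\<omega>\<in>space M. points_in B \<omega> = k} \<omega>)"
      using AE_points_in[OF assms] AE_space by (auto elim!: AE_mp)
  qed
  also have "\<dots> = (\<Sum>k. of_nat k * emeasure M {\<omega>\<in>space M. points_in B \<omega> = k})"
    by (subst nn_integral_suminf) (auto simp: nn_integral_cmult_indicator)
  also have "\<dots> = (\<Sum>k. ennreal (real k * (?l ^ k / fact k * exp (- ?l))))"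
    by (simp only: emeasure_eq_measure prob_points_in_eq[OF assms] ennreal_of_nat_eq_real_of_nat
        ennreal_mult'[OF of_nat_0_le_iff])
  also have "\<dots> = ennreal ?l"
  proof (rule suminf_ennreal_eq)
    \<comment> \<open>The mean is l times the exponential series shifted by one index; the term k =
      0 vanishes.\<close>
    have "(\<lambda>k. ?l * (?l ^ k /\<^sub>R fact k * exp (- ?l))) sums (?l * (exp ?l * exp (- ?l)))"
      by (intro sums_mult sums_mult2 exp_converges)
    moreover have "?l * (?l ^ k /\<^sub>R fact k * exp (- ?l)) = real (Suc k) * (?l ^ Suc k / fact (Suc k) * exp (- ?l))" for k
      by (simp add: field_simps del: of_nat_Suc)
    ultimately have "(\<lambda>k. real (Suc k) * (?l ^ Suc k / fact (Suc k) * exp (- ?l))) sums ?l"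
      by (simp add: exp_minus_inverse)
    then show "(\<lambda>k. real k * (?l ^ k / fact k * exp (- ?l))) sums ?l"
      by (subst (asm) sums_Suc_iff) simp
  qed simp
  also have "\<dots> = emeasure \<nu> B" using fin by (intro emeasure_eq_ennreal_measure[symmetric]) auto
  finally show ?thesis .
qed

lemma nn_integral_config:
  assumes [measurable]: "B \<in> sets \<nu>"
  shows "(\<integral>\<^sup>+\<omega>. emeasure (config \<omega>) B \<partial>M) = emeasure \<nu> B"
proof -
  obtain A :: "nat \<Rightarrow> 'b set" where A: "range A \<subseteq> sets \<nu>" "(\<Union>i. A i) = space \<nu>"
    "\<And>i. emeasure \<nu> (A i) \<noteq> \<infinity>" "disjoint_family A"
    using \<nu>.sigma_finite_disjoint by metis
  have [measurable]: "A i \<in> sets \<nu>" for i using A(1) by auto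
  have un: "(\<Union>i. B \<inter> A i) = B" using A(2) sets.sets_into_space[OF assms] by auto
  have disj: "disjoint_family (\<lambda>i. B \<inter> A i)" using A(4) by (auto simp: disjoint_family_on_def)
  have fin: "emeasure \<nu> (B \<inter> A i) < \<infinity>" for i
    using A(3)[of i] emeasure_mono[of "B \<inter> A i" "A i" \<nu>] by (auto simp: less_top[symmetric] top_unique)
  have "(\<integral>\<^sup>+\<omega>. emeasure (config \<omega>) B \<partial>M) = (\<integral>\<^sup>+\<omega>. (\<Sum>i. emeasure (config \<omega>) (B \<inter> A i)) \<partial>M)"
    using disj by (intro nn_integral_cong) (subst suminf_emeasure, simp_all add: un image_subset_iff del: UN_simps)
  also have "\<dots> = (\<Sum>i. \<integral>\<^sup>+\<omega>. emeasure (config \<omega>) (B \<inter> A i) \<partial>M)"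
    by (rule nn_integral_suminf) simp
  also have "\<dots> = (\<Sum>i. emeasure \<nu> (B \<inter> A i))"
    by (intro suminf_cong nn_integral_config_finite fin) simp
  also have "\<dots> = emeasure \<nu> B"
    using disj by (subst suminf_emeasure) (simp_all add: un image_subset_iff del: UN_simps)
  finally show ?thesis .
qed

lemma measurable_x_pair [measurable]: "(\<lambda>(n, \<omega>). x n \<omega>) \<in> measurable (count_space UNIV \<Otimes>\<^sub>M M) \<nu>"
  by (rule measurable_pair_measure_countable1) auto

text \<open>The intensity is the mean of the configuration, and therefore the image of counting
  measure times M under the enumeration. Both forms of Campbell's formula become Fubini over the
  pair of n and the outcome.\<close>

lemma intensity_eq_distr: "\<nu> = distr (count_space UNIV \<Otimes>\<^sub>M M) \<nu> (\<lambda>(n, \<omega>). x n \<omega>)"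
proof (rule measure_eqI)
  interpret c: sigma_finite_measure "count_space (UNIV::nat set)" by (rule sigma_finite_measure_count_space)
  interpret pair_sigma_finite "count_space (UNIV::nat set)" M ..
  fix B assume B [measurable]: "B \<in> sets \<nu>"
  have "emeasure (distr (count_space UNIV \<Otimes>\<^sub>M M) \<nu> (\<lambda>(n, \<omega>). x n \<omega>)) B
    = (\<integral>\<^sup>+p. indicator B (case p of (n, \<omega>) \<Rightarrow> x n \<omega>) \<partial>(count_space UNIV \<Otimes>\<^sub>M M))"
    by (subst nn_integral_indicator[symmetric], simp, subst nn_integral_distr) auto
  also have "\<dots> = (\<integral>\<^sup>+\<omega>. \<integral>\<^sup>+n. indicator B (x n \<omega>) \<partial>count_space UNIV \<partial>M)"
    by (subst nn_integral_snd[symmetric]) auto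
  also have "\<dots> = (\<integral>\<^sup>+\<omega>. emeasure (config \<omega>) B \<partial>M)"
    by (intro nn_integral_cong) (simp add: nn_integral_count_space_nat emeasure_config_eq_suminf)
  also have "\<dots> = emeasure \<nu> B" by (rule nn_integral_config) fact
  finally show "emeasure \<nu> B = emeasure (distr (count_space UNIV \<Otimes>\<^sub>M M) \<nu> (\<lambda>(n, \<omega>). x n \<omega>)) B" by simp
qed simp

lemma campbell_nn:
  assumes [measurable]: "f \<in> borel_measurable \<nu>"
  shows "(\<Sum>n. \<integral>\<^sup>+\<omega>. f (x n \<omega>) \<partial>M) = (\<integral>\<^sup>+y. f y \<partial>\<nu>)"
proof -
  have "(\<integral>\<^sup>+y. f y \<partial>\<nu>) = (\<integral>\<^sup>+p. f (case p of (n, \<omega>) \<Rightarrow> x n \<omega>) \<partial>(count_space UNIV \<Otimes>\<^sub>M M))"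
    by (subst intensity_eq_distr, subst nn_integral_distr) auto
  also have "\<dots> = (\<integral>\<^sup>+n. \<integral>\<^sup>+\<omega>. f (x n \<omega>) \<partial>M \<partial>count_space UNIV)"
    by (subst nn_integral_fst[symmetric]) auto
  finally show ?thesis by (simp add: nn_integral_count_space_nat)
qed

lemma campbell:
  fixes f :: "'b \<Rightarrow> 'c::{banach, second_countable_topology}"
  assumes f: "integrable \<nu> f"
  shows "\<And>n. integrable M (\<lambda>\<omega>. f (x n \<omega>))"
    and "(\<lambda>n. LINT \<omega>|M. f (x n \<omega>)) sums (LINT y|\<nu>. f y)"
    and "summable (\<lambda>n. LINT \<omega>|M. norm (f (x n \<omega>)))"
proof -
  interpret c: sigma_finite_measure "count_space (UNIV::nat set)" by (rule sigma_finite_measure_count_space)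
  interpret pair_sigma_finite "count_space (UNIV::nat set)" M ..
  have fm [measurable]: "f \<in> borel_measurable \<nu>" using f by auto
  have I: "integrable (count_space UNIV \<Otimes>\<^sub>M M) (\<lambda>(n, \<omega>). f (x n \<omega>))"
    using f by (subst (asm) intensity_eq_distr) (subst (asm) integrable_distr_eq, auto simp: split_beta')
  have "AE n in count_space UNIV. integrable M (\<lambda>\<omega>. f (x n \<omega>))"
    using AE_integrable_fst'[OF I] by simp
  then show int: "\<And>n. integrable M (\<lambda>\<omega>. f (x n \<omega>))"
    by (auto simp: AE_count_space)
  have "(LINT y|\<nu>. f y) = (LINT p|(count_space UNIV \<Otimes>\<^sub>M M). (case p of (n, \<omega>) \<Rightarrow> f (x n \<omega>)))"
    by (subst intensity_eq_distr, subst integral_distr) (auto simp: split_beta')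
  also have "\<dots> = (LINT n|count_space UNIV. LINT \<omega>|M. f (x n \<omega>))"
    using integral_fst'[OF I] by simp
  finally have eq: "(LINT y|\<nu>. f y) = (LINT n|count_space UNIV. LINT \<omega>|M. f (x n \<omega>))" .
  have i: "integrable (count_space UNIV) (\<lambda>n. LINT \<omega>|M. f (x n \<omega>))"
    using integrable_fst'[OF I] by simp
  show "(\<lambda>n. LINT \<omega>|M. f (x n \<omega>)) sums (LINT y|\<nu>. f y)"
    unfolding eq by (rule sums_integral_count_space_nat[OF i])
  have I': "integrable (count_space UNIV \<Otimes>\<^sub>M M) (\<lambda>(n, \<omega>). norm (f (x n \<omega>)))"
    using integrable_norm[OF I] by (simp add: split_beta')
  have "integrable (count_space UNIV) (\<lambda>n. LINT \<omega>|M. norm (f (x n \<omega>)))"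
    using integrable_fst'[OF I'] by simp
  then show "summable (\<lambda>n. LINT \<omega>|M. norm (f (x n \<omega>)))"
    using sums_integral_count_space_nat sums_summable by blast
qed

lemma sum_expectation_le:
  assumes f: "integrable \<nu> f" and nn: "\<And>y. 0 \<le> f y"
  shows "(\<Sum>n<L. LINT \<omega>|M. f (x n \<omega>)) \<le> (LINT y|\<nu>. f y :: real)"
  unfolding sums_unique[OF campbell(2)[OF f]]
  by (intro sum_le_suminf sums_summable[OF campbell(2)[OF f]]) (auto intro: integral_nonneg_AE nn)

text \<open>Telescoping products of numbers of modulus at most 1 bounds the difference by the sum of
  the differences of the factors; Campbell's formula bounds the expectation of that sum
  independently of L. The functions may vary with n, which later allows each particle its own
  characteristic function.\<close>

lemma expectation_prod_compare:
  fixes g h :: "nat \<Rightarrow> 'b \<Rightarrow> complex"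
  assumes [measurable]: "\<And>n. g n \<in> borel_measurable \<nu>" "\<And>n. h n \<in> borel_measurable \<nu>"
    and g: "\<And>n y. y \<in> space \<nu> \<Longrightarrow> norm (g n y) \<le> 1" and h: "\<And>n y. y \<in> space \<nu> \<Longrightarrow> norm (h n y) \<le> 1"
    and le: "\<And>n y. y \<in> space \<nu> \<Longrightarrow> norm (g n y - h n y) \<le> \<rho> y"
    and \<rho>: "integrable \<nu> \<rho>" "\<And>y. 0 \<le> \<rho> y"
  shows "norm ((LINT \<omega>|M. (\<Prod>n<L. g n (x n \<omega>))) - (LINT \<omega>|M. (\<Prod>n<L. h n (x n \<omega>)))) \<le> (LINT y|\<nu>. \<rho> y)"
proof -
  have sp: "x n \<omega> \<in> space \<nu>" if "\<omega> \<in> space M" for n \<omega> using that measurable_space[OF x] by auto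
  have int: "integrable M (\<lambda>\<omega>. \<Prod>n<L. k n (x n \<omega>))"
    if [measurable]: "\<And>n. k n \<in> borel_measurable \<nu>" and "\<And>n y. y \<in> space \<nu> \<Longrightarrow> norm (k n y :: complex) \<le> 1" for k
  proof (rule integrable_const_bound[of _ 1])
    show "AE \<omega> in M. norm (\<Prod>n<L. k n (x n \<omega>)) \<le> 1"
      using that(2) sp by (intro AE_I2) (auto simp: prod_norm[symmetric] intro!: prod_le_1)
  qed measurable
  have "norm ((LINT \<omega>|M. (\<Prod>n<L. g n (x n \<omega>))) - (LINT \<omega>|M. (\<Prod>n<L. h n (x n \<omega>))))
    = norm (LINT \<omega>|M. (\<Prod>n<L. g n (x n \<omega>)) - (\<Prod>n<L. h n (x n \<omega>)))"
    using int[of g] int[of h] g h by simp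
  also have "\<dots> \<le> (LINT \<omega>|M. norm ((\<Prod>n<L. g n (x n \<omega>)) - (\<Prod>n<L. h n (x n \<omega>))))"
    by (rule integral_norm_bound)
  also have "\<dots> \<le> (LINT \<omega>|M. (\<Sum>n<L. \<rho> (x n \<omega>)))"
  proof (rule integral_mono)
    show "integrable M (\<lambda>\<omega>. norm ((\<Prod>n<L. g n (x n \<omega>)) - (\<Prod>n<L. h n (x n \<omega>))))"
      using int[of g] int[of h] g h by auto
    show "integrable M (\<lambda>\<omega>. \<Sum>n<L. \<rho> (x n \<omega>))"
      using campbell(1)[OF \<rho>(1)] by auto
    fix \<omega> assume "\<omega> \<in> space M"
    then show "norm ((\<Prod>n<L. g n (x n \<omega>)) - (\<Prod>n<L. h n (x n \<omega>))) \<le> (\<Sum>n<L. \<rho> (x n \<omega>))"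
      by (intro order_trans[OF norm_prod_diff] sum_mono g h le sp)
  qed
  also have "\<dots> = (\<Sum>n<L. LINT \<omega>|M. \<rho> (x n \<omega>))"
    using campbell(1)[OF \<rho>(1)] by simp
  also have "\<dots> \<le> (LINT y|\<nu>. \<rho> y)" by (rule sum_expectation_le[OF \<rho>])
  finally show ?thesis .
qed

section \<open>The characteristic functional of the Poisson process\<close>

lemma poisson_generating_function:
  fixes v :: complex
  assumes [measurable]: "B \<in> sets \<nu>" and fin: "emeasure \<nu> B < \<infinity>" and v: "norm v \<le> 1"
  shows "(LINT \<omega>|M. v ^ points_in B \<omega>) = exp (measure \<nu> B * (v - 1))"
proof -
  let ?l = "measure \<nu> B" and ?K = "points_in B"
  have nv: "norm (v ^ k) \<le> 1" for k using v by (simp add: norm_power power_le_one)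
  have "(\<lambda>L. LINT \<omega>|M. (\<Sum>k<L. v ^ k * indicator {\<omega>\<in>space M. ?K \<omega> = k} \<omega>)) \<longlonglongrightarrow> (LINT \<omega>|M. v ^ ?K \<omega>)"
  proof (rule integral_dominated_convergence[where w="\<lambda>_. 1"])
    have eq: "(\<Sum>k<L. v ^ k * indicator {\<omega>\<in>space M. ?K \<omega> = k} \<omega>) = (if ?K \<omega> < L then v ^ ?K \<omega> else 0)"
      if "\<omega> \<in> space M" for \<omega> L
    proof -
      have "(\<Sum>k<L. v ^ k * indicator {\<omega>\<in>space M. ?K \<omega> = k} \<omega>) = (\<Sum>k<L. if k = ?K \<omega> then v ^ ?K \<omega> else 0)"
        using that by (intro sum.cong) (auto simp: indicator_def)
      then show ?thesis by simp
    qed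
    show "AE \<omega> in M. (\<lambda>L. \<Sum>k<L. v ^ k * indicator {\<omega>\<in>space M. ?K \<omega> = k} \<omega>) \<longlonglongrightarrow> v ^ ?K \<omega>"
    proof (rule AE_I2)
      fix \<omega> assume \<omega>: "\<omega> \<in> space M"
      show "(\<lambda>L. \<Sum>k<L. v ^ k * indicator {\<omega>\<in>space M. ?K \<omega> = k} \<omega>) \<longlonglongrightarrow> v ^ ?K \<omega>"
        unfolding eq[OF \<omega>]
        by (intro tendsto_eventually eventually_mono[OF eventually_gt_at_top[of "?K \<omega>"]]) auto
    qed
    show "AE \<omega> in M. norm (\<Sum>k<L. v ^ k * indicator {\<omega>\<in>space M. ?K \<omega> = k} \<omega>) \<le> 1" for L
      using nv by (intro AE_I2) (subst eq, auto)
  qed auto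
  moreover have "(LINT \<omega>|M. (\<Sum>k<L. v ^ k * indicator {\<omega>\<in>space M. ?K \<omega> = k} \<omega>))
     = (\<Sum>k<L. (complex_of_real ?l * v) ^ k /\<^sub>R fact k * exp (- complex_of_real ?l))" for L
  proof -
    have i: "integrable M (\<lambda>\<omega>. indicator {\<omega>\<in>space M. ?K \<omega> = k} \<omega> :: complex)" for k
      by (rule integrable_const_bound[of _ 1]) (auto simp: indicator_def)
    have "(LINT \<omega>|M. (\<Sum>k<L. v ^ k * indicator {\<omega>\<in>space M. ?K \<omega> = k} \<omega>))
      = (\<Sum>k<L. v ^ k * (LINT \<omega>|M. indicator {\<omega>\<in>space M. ?K \<omega> = k} \<omega>))"
      using i by (subst Bochner_Integration.integral_sum) (simp_all del: sum_mult_indicator)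
    also have "\<dots> = (\<Sum>k<L. v ^ k * complex_of_real (prob {\<omega>\<in>space M. ?K \<omega> = k}))"
    proof (intro sum.cong refl arg_cong2[where f="(*)"])
      fix k
      have "(LINT \<omega>|M. indicator {\<omega>\<in>space M. ?K \<omega> = k} \<omega> :: complex)
        = (LINT \<omega>|M. complex_of_real (indicator {\<omega>\<in>space M. ?K \<omega> = k} \<omega>))"
        by (intro Bochner_Integration.integral_cong) (auto simp: indicator_def)
      also have "\<dots> = complex_of_real (LINT \<omega>|M. indicator {\<omega>\<in>space M. ?K \<omega> = k} \<omega>)"
        by (rule integral_complex_of_real)
      also have "(LINT \<omega>|M. indicator {\<omega>\<in>space M. ?K \<omega> = k} \<omega>) = prob {\<omega>\<in>space M. ?K \<omega> = k}"
        by (subst Bochner_Integration.integral_indicator) (auto intro!: arg_cong[where f=prob])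
      finally show "(LINT \<omega>|M. indicator {\<omega>\<in>space M. ?K \<omega> = k} \<omega> :: complex) = complex_of_real (prob {\<omega>\<in>space M. ?K \<omega> = k})" .
    qed
    also have "\<dots> = (\<Sum>k<L. (complex_of_real ?l * v) ^ k /\<^sub>R fact k * exp (- complex_of_real ?l))"
      by (intro sum.cong refl)
         (simp add: prob_points_in_eq[OF assms(1,2)] power_mult_distrib scaleR_conv_of_real
           exp_of_real[symmetric] field_simps)
    finally show ?thesis .
  qed
  ultimately have "(\<lambda>k. (complex_of_real ?l * v) ^ k /\<^sub>R fact k * exp (- complex_of_real ?l)) sums (LINT \<omega>|M. v ^ ?K \<omega>)"
    by (simp add: sums_def)
  moreover have "(\<lambda>k. (complex_of_real ?l * v) ^ k /\<^sub>R fact k * exp (- complex_of_real ?l)) sums (exp (complex_of_real ?l * v) * exp (- complex_of_real ?l))"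
    by (intro sums_mult2 exp_converges)
  ultimately have "(LINT \<omega>|M. v ^ ?K \<omega>) = exp (complex_of_real ?l * v) * exp (- complex_of_real ?l)"
    by (rule sums_unique2)
  then show ?thesis by (simp add: exp_add[symmetric] algebra_simps)
qed

text \<open>The level sets B i of the values e i other than 1 have finite intensity, because h - 1
  is integrable and |e i - 1| > 0. Almost surely they contain finitely many points, so the partial
  products become constant, equal to the product of the powers of e i with the counts as exponents.
  The counts are independent, and each factor is a Poisson generating function.\<close>

lemma poisson_functional_simple:
  fixes h :: "'b \<Rightarrow> complex"
  assumes simple: "simple_function \<nu> h" and h1: "\<And>y. y \<in> space \<nu> \<Longrightarrow> norm (h y) \<le> 1"
    and int: "integrable \<nu> (\<lambda>y. h y - 1)"
  shows "(\<lambda>L. LINT \<omega>|M. (\<Prod>n<L. h (x n \<omega>))) \<longlonglongrightarrow> exp (LINT y|\<nu>. h y - 1)"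
proof -
  \<comment> \<open>The value 1 is left out: its level set may have infinite intensity, and it
    changes neither the product nor the exponent.\<close>
  define V where "V = h ` space \<nu> - {1}"
  have "finite V" using simple by (auto simp: V_def simple_function_def)
  then obtain e where e: "bij_betw e {0..<card V} V" using ex_bij_betw_nat_finite by blast
  define m where "m = card V"
  define B where "B i = h -` {e i} \<inter> space \<nu>" for i
  have e': "bij_betw e {..<m} V" using e by (simp add: m_def atLeast0LessThan)
  have eV: "e i \<in> V" if "i < m" for i using e' that by (auto simp: bij_betw_def)
  have e1: "e i \<noteq> 1" if "i < m" for i using eV[OF that] by (auto simp: V_def)
  have en: "norm (e i) \<le> 1" if "i < m" for i using eV[OF that] h1 by (auto simp: V_def)
  have hm [measurable]: "h \<in> borel_measurable \<nu>" using simple by (rule borel_measurable_simple_function)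
  have Bm [measurable]: "B i \<in> sets \<nu>" for i unfolding B_def by measurable
  have uniq: "i = j" if "y \<in> B i" "y \<in> B j" "i < m" "j < m" for i j y
    using that e' by (auto simp: B_def bij_betw_def inj_on_def)
  have Bfin: "emeasure \<nu> (B i) < \<infinity>" if "i < m" for i
  proof -
    have "ennreal (norm (e i - 1)) * emeasure \<nu> (B i) = (\<integral>\<^sup>+y. ennreal (norm (e i - 1)) * indicator (B i) y \<partial>\<nu>)"
      by (simp add: nn_integral_cmult_indicator)
    also have "\<dots> \<le> (\<integral>\<^sup>+y. ennreal (norm (h y - 1)) \<partial>\<nu>)"
      by (intro nn_integral_mono) (auto simp: B_def indicator_def)
    also have "\<dots> < \<infinity>" using int by (simp add: integrable_iff_bounded)
    finally show ?thesis using e1[OF that] by (auto simp: ennreal_mult_less_top)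
  qed
  have hprod: "h y = (\<Prod>i<m. if y \<in> B i then e i else 1)" if y: "y \<in> space \<nu>" for y
  proof (cases "h y = 1")
    case True
    then have "y \<notin> B i" if "i < m" for i using e1[OF that] by (auto simp: B_def)
    then have "(\<Prod>i<m. if y \<in> B i then e i else 1) = (\<Prod>i<m. 1)" by (intro prod.cong) auto
    with True show ?thesis by simp
  next
    case False
    then have "h y \<in> V" using y by (auto simp: V_def)
    then obtain j where j: "j < m" "e j = h y" using e' by (auto simp: bij_betw_def image_iff)
    then have yj: "y \<in> B j" using y by (simp add: B_def)
    have iff: "y \<in> B i \<longleftrightarrow> i = j" if "i < m" for i using uniq[OF yj _ j(1) that] yj by blast
    have "(\<Prod>i<m. if y \<in> B i then e i else 1) = (\<Prod>i<m. if i = j then e j else 1)"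
      by (intro prod.cong) (auto simp: iff)
    then show ?thesis using j by simp
  qed
  have hsum: "h y - 1 = (\<Sum>i<m. (e i - 1) * indicator (B i) y)" if y: "y \<in> space \<nu>" for y
  proof (cases "h y = 1")
    case True
    then have "y \<notin> B i" if "i < m" for i using e1[OF that] by (auto simp: B_def)
    then have "(\<Sum>i<m. (e i - 1) * indicator (B i) y) = (\<Sum>i<m. 0)" by (intro sum.cong) auto
    with True show ?thesis by simp
  next
    case False
    then have "h y \<in> V" using y by (auto simp: V_def)
    then obtain j where j: "j < m" "e j = h y" using e' by (auto simp: bij_betw_def image_iff)
    then have yj: "y \<in> B j" using y by (simp add: B_def)
    have iff: "y \<in> B i \<longleftrightarrow> i = j" if "i < m" for i using uniq[OF yj _ j(1) that] yj by blast
    have "(\<Sum>i<m. (e i - 1) * indicator (B i) y) = (\<Sum>i<m. if i = j then e j - 1 else 0)"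
      by (intro sum.cong) (auto simp: iff indicator_def)
    then show ?thesis using j by simp
  qed
  have ae: "AE \<omega> in M. \<forall>i<m. emeasure (config \<omega>) (B i) = of_nat (points_in (B i) \<omega>)"
    using AE_points_in[OF Bm Bfin] by (auto simp: AE_all_countable)
  have lim: "AE \<omega> in M. (\<lambda>L. \<Prod>n<L. h (x n \<omega>)) \<longlonglongrightarrow> (\<Prod>i<m. e i ^ points_in (B i) \<omega>)"
    using ae AE_space
  proof eventually_elim
    case (elim \<omega>)
    have fin: "finite {n. x n \<omega> \<in> B i}" "card {n. x n \<omega> \<in> B i} = points_in (B i) \<omega>" if "i < m" for i
    proof -
      have *: "emeasure (count_space UNIV) {n. x n \<omega> \<in> B i} = of_nat (points_in (B i) \<omega>)"
        using elim that emeasure_config[OF Bm, of \<omega> i] by simp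
      then show "finite {n. x n \<omega> \<in> B i}"
        by (cases "finite {n. x n \<omega> \<in> B i}") (auto simp: ennreal_of_nat_eq_real_of_nat)
      with * show "card {n. x n \<omega> \<in> B i} = points_in (B i) \<omega>" by simp
    qed
    have "finite (\<Union>i<m. {n. x n \<omega> \<in> B i})" using fin by auto
    then obtain L0 where L0: "\<And>n. n \<in> (\<Union>i<m. {n. x n \<omega> \<in> B i}) \<Longrightarrow> n < L0"
      using finite_nat_bounded by (metis lessThan_iff subsetD)
    have "(\<Prod>n<L. h (x n \<omega>)) = (\<Prod>i<m. e i ^ points_in (B i) \<omega>)" if "L0 \<le> L" for L
    proof -
      have "(\<Prod>n<L. h (x n \<omega>)) = (\<Prod>n<L. \<Prod>i<m. if x n \<omega> \<in> B i then e i else 1)"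
        using elim measurable_space[OF x] by (intro prod.cong hprod) auto
      also have "\<dots> = (\<Prod>i<m. \<Prod>n<L. if x n \<omega> \<in> B i then e i else 1)" by (rule prod.swap)
      also have "\<dots> = (\<Prod>i<m. e i ^ points_in (B i) \<omega>)"
      proof (intro prod.cong refl)
        fix i assume i: "i \<in> {..<m}"
        have "(\<Prod>n<L. if x n \<omega> \<in> B i then e i else 1) = e i ^ card ({..<L} \<inter> {n. x n \<omega> \<in> B i})"
          by (subst prod.If_cases) auto
        also have "{..<L} \<inter> {n. x n \<omega> \<in> B i} = {n. x n \<omega> \<in> B i}"
          using L0 that i by fastforce
        finally show "(\<Prod>n<L. if x n \<omega> \<in> B i then e i else 1) = e i ^ points_in (B i) \<omega>"
          using fin(2) i by simp
      qed
      finally show ?thesis .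
    qed
    then show ?case
      by (intro tendsto_eventually eventually_mono[OF eventually_ge_at_top[of L0]])
  qed
  have "(\<lambda>L. LINT \<omega>|M. (\<Prod>n<L. h (x n \<omega>))) \<longlonglongrightarrow> (LINT \<omega>|M. (\<Prod>i<m. e i ^ points_in (B i) \<omega>))"
  proof (rule integral_dominated_convergence[where w="\<lambda>_. 1"])
    show "AE \<omega> in M. norm (\<Prod>n<L. h (x n \<omega>)) \<le> 1" for L
      using h1 measurable_space[OF x] by (intro AE_I2) (auto simp: prod_norm[symmetric] intro!: prod_le_1)
  qed (auto simp: lim)
  also have "(LINT \<omega>|M. (\<Prod>i<m. e i ^ points_in (B i) \<omega>)) = (\<Prod>i<m. LINT \<omega>|M. e i ^ points_in (B i) \<omega>)"
  proof (rule indep_vars_lebesgue_integral)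
    have "\<forall>(n::nat) C. (\<forall>i<n. C i \<in> sets \<nu>) \<and> disjoint_family_on C {..<n} \<longrightarrow>
        indep_vars (\<lambda>_. borel) (\<lambda>i \<omega>. emeasure (config \<omega>) (C i)) {..<n}"
      using poisson unfolding poisson_random_measure_def by (elim conjE)
    moreover have "disjoint_family_on B {..<m}"
      unfolding disjoint_family_on_def using uniq by fastforce
    ultimately have "indep_vars (\<lambda>_. borel) (\<lambda>i \<omega>. emeasure (config \<omega>) (B i)) {..<m}"
      by simp
    then have "indep_vars (\<lambda>_. borel) (\<lambda>i \<omega>. (\<lambda>u. e i ^ nat \<lfloor>enn2real u\<rfloor>) (emeasure (config \<omega>) (B i))) {..<m}"
      by (rule indep_vars_compose2) auto
    then show "indep_vars (\<lambda>_. borel) (\<lambda>i \<omega>. e i ^ points_in (B i) \<omega>) {..<m}"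
      by (simp add: points_in_def)
    show "integrable M (\<lambda>\<omega>. e i ^ points_in (B i) \<omega>)" if "i \<in> {..<m}" for i
      using en[of i] that by (intro integrable_const_bound[of _ 1]) (auto simp: norm_power power_le_one)
  qed simp
  also have "\<dots> = (\<Prod>i<m. exp (measure \<nu> (B i) * (e i - 1)))"
    by (intro prod.cong refl poisson_generating_function Bm Bfin en) auto
  also have "\<dots> = exp (\<Sum>i<m. measure \<nu> (B i) * (e i - 1))"
    by (simp add: exp_sum)
  also have "(\<Sum>i<m. measure \<nu> (B i) * (e i - 1)) = (LINT y|\<nu>. h y - 1)"
  proof -
    have ind: "has_bochner_integral \<nu> (\<lambda>y. (e i - 1) * indicator (B i) y) ((e i - 1) * measure \<nu> (B i))" if "i < m" for i
    proof -
      have "has_bochner_integral \<nu> (\<lambda>y. complex_of_real (indicator (B i) y)) (complex_of_real (measure \<nu> (B i)))"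
        using Bfin[OF that] by (intro has_bochner_integral_of_real has_bochner_integral_real_indicator) auto
      then show ?thesis
        by (intro has_bochner_integral_mult_right) (simp add: of_real_indicator)
    qed
    have "(LINT y|\<nu>. h y - 1) = (LINT y|\<nu>. (\<Sum>i<m. (e i - 1) * indicator (B i) y))"
      by (intro Bochner_Integration.integral_cong hsum) auto
    also have "\<dots> = (\<Sum>i<m. (e i - 1) * measure \<nu> (B i))"
      using ind by (intro has_bochner_integral_integral_eq has_bochner_integral_sum) auto
    finally show ?thesis by (simp add: mult.commute)
  qed
  finally show ?thesis .
qed

theorem poisson_functional:
  fixes h :: "'b \<Rightarrow> complex"
  assumes [measurable]: "h \<in> borel_measurable \<nu>" and h1: "\<And>y. y \<in> space \<nu> \<Longrightarrow> norm (h y) \<le> 1"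
    and int: "integrable \<nu> (\<lambda>y. h y - 1)"
  shows "(\<lambda>L. LINT \<omega>|M. (\<Prod>n<L. h (x n \<omega>))) \<longlonglongrightarrow> exp (LINT y|\<nu>. h y - 1)"
proof -
  obtain F where F: "\<And>i. simple_function \<nu> (F i)" "\<And>y. y \<in> space \<nu> \<Longrightarrow> (\<lambda>i. F i y) \<longlonglongrightarrow> h y"
    "\<And>i y. y \<in> space \<nu> \<Longrightarrow> dist (F i y) 1 \<le> 2 * dist (h y) 1"
    using borel_measurable_implies_sequence_metric[OF assms(1), of 1] by metis
  \<comment> \<open>The simple approximations satisfy |F i - 1| \<le> 2 |h - 1| but may leave the
    unit disc, where products are controlled. Nearest-point projection onto the disc is 1-Lipschitz
    and fixes both h and 1, so it brings them back without spoiling the estimates.\<close>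
  define \<pi> :: "complex \<Rightarrow> complex" where "\<pi> = closest_point (cball 0 1)"
  have \<pi>: "dist (\<pi> a) (\<pi> b) \<le> dist a b" for a b
    unfolding \<pi>_def by (rule closest_point_lipschitz) auto
  have \<pi>_id: "\<pi> a = a" if "norm a \<le> 1" for a
    unfolding \<pi>_def using that by (intro closest_point_self) auto
  have \<pi>_le: "norm (\<pi> a) \<le> 1" for a
    using closest_point_in_set[of "cball (0::complex) 1" a] by (auto simp: \<pi>_def)
  define H where "H i y = \<pi> (F i y)" for i y
  have Hs: "simple_function \<nu> (H i)" for i
    unfolding H_def by (rule simple_function_compose1[OF F(1)])
  have Hm [measurable]: "H i \<in> borel_measurable \<nu>" for i
    using Hs by (rule borel_measurable_simple_function)
  have Hlim: "(\<lambda>i. H i y) \<longlonglongrightarrow> h y" if "y \<in> space \<nu>" for y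
  proof (rule metric_tendsto_imp_tendsto[OF F(2)[OF that]])
    show "\<forall>\<^sub>F i in sequentially. dist (H i y) (h y) \<le> dist (F i y) (h y)"
      using \<pi>[of _ "h y"] \<pi>_id[OF h1[OF that]] by (simp add: H_def)
  qed
  have Hb: "norm (H i y - 1) \<le> 2 * norm (h y - 1)" if "y \<in> space \<nu>" for i y
    using \<pi>[of "F i y" 1] F(3)[OF that, of i] \<pi>_id[of 1] by (simp add: H_def dist_norm)
  have Hint: "integrable \<nu> (\<lambda>y. H i y - 1)" for i
    by (rule Bochner_Integration.integrable_bound[OF integrable_mult_right[OF integrable_norm[OF int], of 2]])
       (use Hb in \<open>auto intro!: AE_I2\<close>)
  have bint: "integrable \<nu> (\<lambda>y. 3 * norm (h y - 1))" using int by simp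
  have db: "norm (h y - H i y) \<le> 3 * norm (h y - 1)" if "y \<in> space \<nu>" for i y
    using norm_triangle_ineq4[of "h y - 1" "H i y - 1"] Hb[OF that, of i] by simp
  have dint: "integrable \<nu> (\<lambda>y. norm (h y - H i y))" for i
    by (rule Bochner_Integration.integrable_bound[OF bint]) (use db in \<open>auto intro!: AE_I2\<close>)
  have d0: "(\<lambda>i. LINT y|\<nu>. norm (h y - H i y)) \<longlonglongrightarrow> (LINT y|\<nu>. 0)"
  proof (rule integral_dominated_convergence[OF _ _ bint])
    show "AE y in \<nu>. (\<lambda>i. norm (h y - H i y)) \<longlonglongrightarrow> 0"
    proof (rule AE_I2)
      fix y assume "y \<in> space \<nu>"
      from tendsto_norm[OF tendsto_diff[OF tendsto_const[of "h y"] Hlim[OF this]]]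
      show "(\<lambda>i. norm (h y - H i y)) \<longlonglongrightarrow> 0" by simp
    qed
    show "AE y in \<nu>. norm (norm (h y - H i y)) \<le> 3 * norm (h y - 1)" for i
      using db by (intro AE_I2) auto
  qed auto
  have e0: "(\<lambda>i. exp (LINT y|\<nu>. H i y - 1)) \<longlonglongrightarrow> exp (LINT y|\<nu>. h y - 1)"
  proof (intro tendsto_exp integral_dominated_convergence[where w="\<lambda>y. 2 * norm (h y - 1)"])
    show "AE y in \<nu>. (\<lambda>i. H i y - 1) \<longlonglongrightarrow> h y - 1"
      using Hlim by (intro AE_I2 tendsto_intros) auto
  qed (use int Hb in \<open>auto intro!: AE_I2\<close>)
  show ?thesis
  proof (rule LIMSEQ_I)
    fix r :: real assume "r > 0"
    have "eventually (\<lambda>i. (LINT y|\<nu>. norm (h y - H i y)) < r/3) sequentially"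
      using d0 \<open>r > 0\<close> by (intro order_tendstoD(2)[where y="LINT y|\<nu>. 0"]) auto
    moreover have "eventually (\<lambda>i. dist (exp (LINT y|\<nu>. H i y - 1)) (exp (LINT y|\<nu>. h y - 1)) < r/3) sequentially"
      using e0 \<open>r > 0\<close> by (intro tendstoD) auto
    ultimately have "eventually (\<lambda>i. (LINT y|\<nu>. norm (h y - H i y)) < r/3 \<and>
        dist (exp (LINT y|\<nu>. H i y - 1)) (exp (LINT y|\<nu>. h y - 1)) < r/3) sequentially"
      by (rule eventually_conj)
    then obtain i where i: "(LINT y|\<nu>. norm (h y - H i y)) < r/3"
      "dist (exp (LINT y|\<nu>. H i y - 1)) (exp (LINT y|\<nu>. h y - 1)) < r/3"
      by (auto simp: eventually_sequentially)
    obtain L0 where L0: "\<And>L. L \<ge> L0 \<Longrightarrow> norm ((LINT \<omega>|M. (\<Prod>n<L. H i (x n \<omega>))) - exp (LINT y|\<nu>. H i y - 1)) < r/3"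
      using LIMSEQ_D[OF poisson_functional_simple[OF Hs _ Hint], of i "r/3"] \<pi>_le \<open>r > 0\<close> by (auto simp: H_def)
    have "norm ((LINT \<omega>|M. (\<Prod>n<L. h (x n \<omega>))) - exp (LINT y|\<nu>. h y - 1)) < r" if "L \<ge> L0" for L
    proof -
      \<comment> \<open>This comparison is uniform in L, so the index i of the approximation can be
        fixed before L tends to infinity.\<close>
      have "norm ((LINT \<omega>|M. (\<Prod>n<L. h (x n \<omega>))) - (LINT \<omega>|M. (\<Prod>n<L. H i (x n \<omega>)))) \<le> (LINT y|\<nu>. norm (h y - H i y))"
        by (rule expectation_prod_compare) (use h1 \<pi>_le dint in \<open>auto simp: H_def[symmetric]\<close>, simp add: H_def \<pi>_le)
      then have "dist (LINT \<omega>|M. (\<Prod>n<L. h (x n \<omega>))) (LINT \<omega>|M. (\<Prod>n<L. H i (x n \<omega>))) < r/3"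
        using i by (simp add: dist_norm)
      moreover have "dist (LINT \<omega>|M. (\<Prod>n<L. H i (x n \<omega>))) (exp (LINT y|\<nu>. H i y - 1)) < r/3"
        using L0[OF that] by (simp add: dist_norm)
      ultimately have "dist (LINT \<omega>|M. (\<Prod>n<L. h (x n \<omega>))) (exp (LINT y|\<nu>. h y - 1)) < r"
        using i(2) dist_triangle[of "LINT \<omega>|M. (\<Prod>n<L. h (x n \<omega>))" "exp (LINT y|\<nu>. h y - 1)" "LINT \<omega>|M. (\<Prod>n<L. H i (x n \<omega>))"]
          dist_triangle[of "LINT \<omega>|M. (\<Prod>n<L. H i (x n \<omega>))" "exp (LINT y|\<nu>. h y - 1)" "exp (LINT y|\<nu>. H i y - 1)"]
        by linarith
      then show ?thesis by (simp add: dist_norm)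
    qed
    then show "\<exists>no. \<forall>L\<ge>no. norm ((LINT \<omega>|M. (\<Prod>n<L. h (x n \<omega>))) - exp (LINT y|\<nu>. h y - 1)) < r" by blast
  qed
qed

end

section \<open>Moments of occupation times of a stable motion\<close>

context prob_space
begin

text \<open>Unlike \<open>indep_var\<close>, this does not force the two variables to have values of the same type.\<close>

definition indep_pair :: "'b measure \<Rightarrow> ('a \<Rightarrow> 'b) \<Rightarrow> 'c measure \<Rightarrow> ('a \<Rightarrow> 'c) \<Rightarrow> bool" where
  "indep_pair S X T Y \<longleftrightarrow> X \<in> measurable M S \<and> Y \<in> measurable M T \<and>
     (\<forall>A\<in>sets S. \<forall>B\<in>sets T.
        prob ((X -` A \<inter> space M) \<inter> (Y -` B \<inter> space M)) = prob (X -` A \<inter> space M) * prob (Y -` B \<inter> space M))"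

lemma indep_pairD:
  "indep_pair S X T Y \<Longrightarrow> X \<in> measurable M S" "indep_pair S X T Y \<Longrightarrow> Y \<in> measurable M T"
  by (auto simp: indep_pair_def)

lemma indep_pair_compose:
  assumes "indep_pair S X T Y" and f: "f \<in> measurable S S'" and g: "g \<in> measurable T T'"
  shows "indep_pair S' (\<lambda>\<omega>. f (X \<omega>)) T' (\<lambda>\<omega>. g (Y \<omega>))"
  unfolding indep_pair_def
proof safe
  have X [measurable]: "X \<in> measurable M S" and Y [measurable]: "Y \<in> measurable M T"
    using indep_pairD[OF assms(1)] by auto
  show "(\<lambda>\<omega>. f (X \<omega>)) \<in> measurable M S'" "(\<lambda>\<omega>. g (Y \<omega>)) \<in> measurable M T'"
    using measurable_compose[OF X f] measurable_compose[OF Y g] by auto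
  fix A B assume A: "A \<in> sets S'" and B: "B \<in> sets T'"
  have 1: "(\<lambda>\<omega>. f (X \<omega>)) -` A \<inter> space M = X -` (f -` A \<inter> space S) \<inter> space M"
    using measurable_space[OF X] by auto
  have 2: "(\<lambda>\<omega>. g (Y \<omega>)) -` B \<inter> space M = Y -` (g -` B \<inter> space T) \<inter> space M"
    using measurable_space[OF Y] by auto
  show "prob (((\<lambda>\<omega>. f (X \<omega>)) -` A \<inter> space M) \<inter> ((\<lambda>\<omega>. g (Y \<omega>)) -` B \<inter> space M))
    = prob ((\<lambda>\<omega>. f (X \<omega>)) -` A \<inter> space M) * prob ((\<lambda>\<omega>. g (Y \<omega>)) -` B \<inter> space M)"
    unfolding 1 2 using assms(1) measurable_sets[OF f A] measurable_sets[OF g B]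
    unfolding indep_pair_def by blast
qed

lemma indep_pair_if_indep_var:
  assumes "indep_var S X T Y"
  shows "indep_pair S X T Y"
proof -
  have "((\<lambda>x. (X x, Y x)) -` (A \<times> B) \<inter> space M) = (X -` A \<inter> space M) \<inter> (Y -` B \<inter> space M)" for A B
    by auto
  then show ?thesis
    using indep_varD[OF assms] indep_var_rv1[OF assms] indep_var_rv2[OF assms]
    by (auto simp: indep_pair_def)
qed

lemma indep_pair_distr:
  assumes ind: "indep_pair S X T Y"
  shows "distr M S X \<Otimes>\<^sub>M distr M T Y = distr M (S \<Otimes>\<^sub>M T) (\<lambda>\<omega>. (X \<omega>, Y \<omega>))"
proof (rule pair_measure_eqI)
  have [measurable]: "X \<in> measurable M S" "Y \<in> measurable M T"
    using indep_pairD[OF ind] by auto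
  interpret X: prob_space "distr M S X" by (rule prob_space_distr) simp
  interpret Y: prob_space "distr M T Y" by (rule prob_space_distr) simp
  show "sigma_finite_measure (distr M S X)" "sigma_finite_measure (distr M T Y)" ..
  show "sets (distr M S X \<Otimes>\<^sub>M distr M T Y) = sets (distr M (S \<Otimes>\<^sub>M T) (\<lambda>\<omega>. (X \<omega>, Y \<omega>)))"
    by (simp cong: sets_pair_measure_cong)
  fix A B assume A: "A \<in> sets (distr M S X)" and B: "B \<in> sets (distr M T Y)"
  have "(\<lambda>\<omega>. (X \<omega>, Y \<omega>)) -` (A \<times> B) \<inter> space M = (X -` A \<inter> space M) \<inter> (Y -` B \<inter> space M)"
    by auto
  then show "emeasure (distr M S X) A * emeasure (distr M T Y) B
    = emeasure (distr M (S \<Otimes>\<^sub>M T) (\<lambda>\<omega>. (X \<omega>, Y \<omega>))) (A \<times> B)"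
    using ind A B by (simp add: emeasure_distr indep_pair_def emeasure_eq_measure ennreal_mult')
qed

end

text \<open>The inner integral averages over an independent copy \<open>\<omega>'\<close> of the
  outcome; this replaces conditional expectations throughout.\<close>

lemma (in prob_space) nn_integral_indep_pair:
  fixes G :: "'s \<times> 't \<Rightarrow> ennreal"
  assumes ind: "indep_pair S X T Y" and [measurable]: "G \<in> borel_measurable (S \<Otimes>\<^sub>M T)"
  shows "(\<integral>\<^sup>+\<omega>. G (X \<omega>, Y \<omega>) \<partial>M) = (\<integral>\<^sup>+\<omega>. \<integral>\<^sup>+\<omega>'. G (X \<omega>, Y \<omega>') \<partial>M \<partial>M)"
proof -
  have [measurable]: "X \<in> measurable M S" "Y \<in> measurable M T"
    using indep_pairD[OF ind] by auto
  interpret X: prob_space "distr M S X" by (rule prob_space_distr) simp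
  interpret Y: prob_space "distr M T Y" by (rule prob_space_distr) simp
  have "(\<integral>\<^sup>+\<omega>. G (X \<omega>, Y \<omega>) \<partial>M) = (\<integral>\<^sup>+z. G z \<partial>distr M (S \<Otimes>\<^sub>M T) (\<lambda>\<omega>. (X \<omega>, Y \<omega>)))"
    by (subst nn_integral_distr) auto
  also have "\<dots> = (\<integral>\<^sup>+z. G z \<partial>(distr M S X \<Otimes>\<^sub>M distr M T Y))"
    using indep_pair_distr[OF ind] by simp
  also have "\<dots> = (\<integral>\<^sup>+s. \<integral>\<^sup>+t. G (s, t) \<partial>distr M T Y \<partial>distr M S X)"
    by (subst Y.nn_integral_fst[symmetric]) auto
  also have "\<dots> = (\<integral>\<^sup>+\<omega>. \<integral>\<^sup>+\<omega>'. G (X \<omega>, Y \<omega>') \<partial>M \<partial>M)"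
    by (subst nn_integral_distr, simp, measurable)
       (intro nn_integral_cong, subst nn_integral_distr, auto)
  finally show ?thesis .
qed

lemma (in prob_space) integral_indep_pair:
  fixes G :: "'s \<times> 't \<Rightarrow> 'c::{banach, second_countable_topology}"
  assumes ind: "indep_pair S X T Y" and [measurable]: "G \<in> borel_measurable (S \<Otimes>\<^sub>M T)"
    and int: "integrable M (\<lambda>\<omega>. G (X \<omega>, Y \<omega>))"
  shows "(LINT \<omega>|M. G (X \<omega>, Y \<omega>)) = (LINT \<omega>|M. (LINT \<omega>'|M. G (X \<omega>, Y \<omega>')))"
proof -
  have [measurable]: "X \<in> measurable M S" "Y \<in> measurable M T"
    using indep_pairD[OF ind] by auto
  interpret X: prob_space "distr M S X" by (rule prob_space_distr) simp
  interpret Y: prob_space "distr M T Y" by (rule prob_space_distr) simp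
  interpret XY: pair_sigma_finite "distr M S X" "distr M T Y" ..
  have eq: "distr M S X \<Otimes>\<^sub>M distr M T Y = distr M (S \<Otimes>\<^sub>M T) (\<lambda>\<omega>. (X \<omega>, Y \<omega>))"
    using indep_pair_distr[OF ind] by simp
  have i: "integrable (distr M S X \<Otimes>\<^sub>M distr M T Y) G"
    unfolding eq using int by (subst integrable_distr_eq) auto
  have "(LINT \<omega>|M. G (X \<omega>, Y \<omega>)) = (LINT z|distr M (S \<Otimes>\<^sub>M T) (\<lambda>\<omega>. (X \<omega>, Y \<omega>)). G z)"
    by (subst integral_distr) auto
  also have "\<dots> = (LINT s|distr M S X. (LINT t|distr M T Y. G (s, t)))"
    unfolding eq[symmetric] using XY.integral_fst'[OF i] by simp
  also have "\<dots> = (LINT \<omega>|M. (LINT t|distr M T Y. G (X \<omega>, t)))"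
    by (subst integral_distr) auto
  also have "\<dots> = (LINT \<omega>|M. (LINT \<omega>'|M. G (X \<omega>, Y \<omega>')))"
    by (intro Bochner_Integration.integral_cong refl, subst integral_distr) (auto dest: measurable_space)
  finally show ?thesis .
qed

section \<open>The stable law and its Green function\<close>

lemma borel_measurable_stable_density_pair [measurable (raw)]:
  assumes [measurable]: "f \<in> borel_measurable N" "g \<in> borel_measurable N"
  shows "(\<lambda>z. stable_density a (f z) (g z)) \<in> borel_measurable N"
  unfolding stable_density_def by measurable

lemma nn_integral_lborel_shift:
  fixes f :: "real \<Rightarrow> ennreal"
  assumes [measurable]: "f \<in> borel_measurable borel"
  shows "(\<integral>\<^sup>+a. f (x + a) \<partial>lborel) = (\<integral>\<^sup>+a. f a \<partial>lborel)"
  using nn_integral_real_affine[of f 1 x] by simp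

text \<open>The unit mass is discharged later from a process that has these densities
  (\<open>stable_motion_regular_path\<close>), in place of an argument by Fourier inversion.\<close>

locale stable_law =
  fixes \<alpha> :: real
  assumes alpha: "1 < \<alpha>" "\<alpha> \<le> 2"
    and total: "(\<integral>\<^sup>+x. ennreal (stable_density \<alpha> 1 x) \<partial>lborel) = 1"
begin

abbreviation "p \<equiv> stable_density \<alpha>"
abbreviation "p0 \<equiv> stable_density \<alpha> 1 0"

lemma p_nonneg: "t > 0 \<Longrightarrow> 0 \<le> p t x"
  using alpha by (intro stable_density_nonneg) auto

lemma p0_nonneg: "0 \<le> p0" by (rule p_nonneg) simp

lemma p_le: "t > 0 \<Longrightarrow> p t x \<le> t powr (-1/\<alpha>) * p0"
  using stable_density_abs_le[of t \<alpha> x] alpha by auto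

lemma p_abs_le: "t > 0 \<Longrightarrow> \<bar>p t x\<bar> \<le> t powr (-1/\<alpha>) * p0"
  using stable_density_abs_le[of t \<alpha> x] alpha by auto

lemma p_scaling: "t > 0 \<Longrightarrow> p t x = t powr (-1/\<alpha>) * p 1 (t powr (-1/\<alpha>) * x)"
  using alpha by (intro stable_density_scaling) auto

lemma nn_integral_p:
  assumes "t > 0" shows "(\<integral>\<^sup>+x. ennreal (p t x) \<partial>lborel) = 1"
proof -
  let ?c = "t powr (-1/\<alpha>)"
  have c: "?c > 0" using assms by simp
  have "1 = ennreal ?c * (\<integral>\<^sup>+x. ennreal (p 1 (?c * x)) \<partial>lborel)"
    using nn_integral_real_affine[of "\<lambda>x. ennreal (p 1 x)" ?c 0] c total by simp
  also have "\<dots> = (\<integral>\<^sup>+x. ennreal ?c * ennreal (p 1 (?c * x)) \<partial>lborel)"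
    by (rule nn_integral_cmult[symmetric]) simp
  also have "\<dots> = (\<integral>\<^sup>+x. ennreal (p t x) \<partial>lborel)"
    using c by (intro nn_integral_cong) (simp only: p_scaling[OF assms] ennreal_mult' less_imp_le)
  finally show ?thesis by simp
qed

lemma integrable_p: "t > 0 \<Longrightarrow> integrable lborel (p t)"
  using p_nonneg by (intro integrableI_nonneg) (auto simp: nn_integral_p)

text \<open>The expected occupation up to time S of a motion started at x, see
  \<open>nn_expectation_occ\<close>. It is defined from the density alone and hence is the same for
  all particles.\<close>

definition green :: "(real \<Rightarrow> ennreal) \<Rightarrow> real \<Rightarrow> real \<Rightarrow> ennreal" where
  "green f S x = (\<integral>\<^sup>+u. (\<integral>\<^sup>+a. ennreal (p u a) * f (x + a) \<partial>lborel) * indicator {0..S} u \<partial>lborel)"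

text \<open>The integral of u^(-1/\<alpha>) p0 over [0, S], convergent because \<alpha> > 1, times
  the Lebesgue integral of f: a bound for the Green function that is uniform in the starting
  point.\<close>

definition green_bound :: "(real \<Rightarrow> ennreal) \<Rightarrow> real \<Rightarrow> ennreal" where
  "green_bound f S = ennreal (S powr (1 - 1/\<alpha>) / (1 - 1/\<alpha>) * p0) * (\<integral>\<^sup>+y. f y \<partial>lborel)"

lemma nn_integral_time_bound:
  assumes "0 \<le> S"
  shows "(\<integral>\<^sup>+w. ennreal ((w - v) powr (-1/\<alpha>) * p0) * indicator {v..v + S} w \<partial>lborel)
    = ennreal (S powr (1 - 1/\<alpha>) / (1 - 1/\<alpha>) * p0)"
proof -
  have "(\<integral>\<^sup>+w. ennreal ((w - v) powr (-1/\<alpha>) * p0) * indicator {v..v + S} w \<partial>lborel)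
    = (\<integral>\<^sup>+w. ennreal ((v + w - v) powr (-1/\<alpha>) * p0) * indicator {v..v + S} (v + w) \<partial>lborel)"
    by (subst nn_integral_lborel_shift) auto
  also have "\<dots> = (\<integral>\<^sup>+w. ennreal p0 * ennreal (w powr (-1/\<alpha>) * indicator {0..S} w) \<partial>lborel)"
    using p0_nonneg by (intro nn_integral_cong) (auto simp: indicator_def ennreal_mult'[symmetric] mult.commute)
  also have "\<dots> = ennreal p0 * ennreal (S powr (-1/\<alpha> + 1) / (-1/\<alpha> + 1))"
    using alpha assms by (subst nn_integral_cmult, simp, subst nn_integral_powr_from_0) auto
  also have "\<dots> = ennreal (S powr (1 - 1/\<alpha>) / (1 - 1/\<alpha>) * p0)"
    using p0_nonneg by (simp add: ennreal_mult'[symmetric] mult.commute)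
  finally show ?thesis .
qed

lemma green_le:
  assumes [measurable]: "f \<in> borel_measurable borel" and "0 \<le> S"
  shows "green f S x \<le> green_bound f S"
proof -
  have "green f S x \<le> (\<integral>\<^sup>+u. (ennreal ((u - 0) powr (-1/\<alpha>) * p0) * indicator {0..0+S} u) * (\<integral>\<^sup>+y. f y \<partial>lborel) \<partial>lborel)"
    unfolding green_def
  proof (rule nn_integral_mono_AE)
    have "(\<integral>\<^sup>+a. ennreal (p u a) * f (x + a) \<partial>lborel) * indicator {0..S} u
      \<le> (ennreal ((u - 0) powr (-1/\<alpha>) * p0) * indicator {0..0+S} u) * (\<integral>\<^sup>+y. f y \<partial>lborel)" if "u \<noteq> 0" for u
    proof (cases "u \<in> {0..S}")
      case True
      then have "u > 0" using that by auto
      have "(\<integral>\<^sup>+a. ennreal (p u a) * f (x + a) \<partial>lborel) \<le> (\<integral>\<^sup>+a. ennreal (u powr (-1/\<alpha>) * p0) * f (x + a) \<partial>lborel)"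
        using p_le[OF \<open>u > 0\<close>] by (intro nn_integral_mono mult_right_mono ennreal_leI) auto
      also have "\<dots> = ennreal (u powr (-1/\<alpha>) * p0) * (\<integral>\<^sup>+y. f y \<partial>lborel)"
        by (subst nn_integral_cmult) (auto simp: nn_integral_lborel_shift)
      finally show ?thesis using True by simp
    qed simp
    then show "AE u in lborel. (\<integral>\<^sup>+a. ennreal (p u a) * f (x + a) \<partial>lborel) * indicator {0..S} u
      \<le> (ennreal ((u - 0) powr (-1/\<alpha>) * p0) * indicator {0..0+S} u) * (\<integral>\<^sup>+y. f y \<partial>lborel)"
      using AE_lborel_singleton[of 0] by (auto elim!: AE_mp)
  qed
  also have "\<dots> = green_bound f S"
    unfolding green_bound_def nn_integral_time_bound[OF assms(2), of 0, symmetric]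
    by (rule nn_integral_multc) simp
  finally show ?thesis .
qed

end

text \<open>The consequences of the Levy property that moments up to order three call for.
  Independence is from the positions at two earlier times, since in the third moment two factors
  precede the last one; u = v covers the case of a single one. Times are positive because there is
  no density at time 0.\<close>

locale stable_motion = prob_space M + stable_law \<alpha> for M :: "'a measure" and \<alpha> :: real +
  fixes D :: "real \<Rightarrow> 'a \<Rightarrow> real"
  assumes D_pair: "(\<lambda>(u, \<omega>). D u \<omega>) \<in> borel_measurable (borel \<Otimes>\<^sub>M M)"
    and D_density: "\<And>u. 0 < u \<Longrightarrow> distributed M lborel (D u) (\<lambda>x. ennreal (stable_density \<alpha> u x))"
    and D_increment: "\<And>v w. 0 < v \<Longrightarrow> v < w \<Longrightarrow>
        distributed M lborel (\<lambda>\<omega>. D w \<omega> - D v \<omega>) (\<lambda>x. ennreal (stable_density \<alpha> (w - v) x))"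
    and D_indep: "\<And>u v w. 0 < u \<Longrightarrow> u \<le> v \<Longrightarrow> v < w \<Longrightarrow>
        indep_pair (borel \<Otimes>\<^sub>M borel) (\<lambda>\<omega>. (D u \<omega>, D v \<omega>)) borel (\<lambda>\<omega>. D w \<omega> - D v \<omega>)"
begin

lemma D_measurable [measurable (raw)]:
  assumes [measurable]: "f \<in> borel_measurable N" "g \<in> measurable N M"
  shows "(\<lambda>x. D (f x) (g x)) \<in> borel_measurable N"
  using measurable_compose[OF measurable_Pair[OF assms] D_pair] by simp

lemma nn_expectation_D:
  assumes "0 < u" and [measurable]: "f \<in> borel_measurable borel"
  shows "(\<integral>\<^sup>+\<omega>. f (x + D u \<omega>) \<partial>M) = (\<integral>\<^sup>+a. ennreal (p u a) * f (x + a) \<partial>lborel)"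
  using distributed_nn_integral[OF D_density[OF assms(1)], of "\<lambda>a. f (x + a)"] by simp

lemma nn_expectation_increment_le:
  assumes "0 < v" "v < w" and [measurable]: "f \<in> borel_measurable borel"
  shows "(\<integral>\<^sup>+\<omega>. f (x + (D w \<omega> - D v \<omega>)) \<partial>M) \<le> ennreal ((w - v) powr (-1/\<alpha>) * p0) * (\<integral>\<^sup>+y. f y \<partial>lborel)"
proof -
  have "(\<integral>\<^sup>+\<omega>. f (x + (D w \<omega> - D v \<omega>)) \<partial>M) = (\<integral>\<^sup>+a. ennreal (p (w - v) a) * f (x + a) \<partial>lborel)"
    using distributed_nn_integral[OF D_increment[OF assms(1,2)], of "\<lambda>a. f (x + a)"] by simp
  also have "\<dots> \<le> (\<integral>\<^sup>+a. ennreal ((w - v) powr (-1/\<alpha>) * p0) * f (x + a) \<partial>lborel)"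
    using p_le[of "w - v"] assms by (intro nn_integral_mono mult_right_mono ennreal_leI) auto
  also have "\<dots> = ennreal ((w - v) powr (-1/\<alpha>) * p0) * (\<integral>\<^sup>+y. f y \<partial>lborel)"
    by (subst nn_integral_cmult) (auto simp: nn_integral_lborel_shift)
  finally show ?thesis .
qed

text \<open>The increment after v is independent of the past, and its density is at most (w -
  v)^(-1/\<alpha>) p0 wherever it starts from. The last factor is thus replaced by a constant times
  the integral of f.\<close>

lemma nn_expectation_markov_le:
  assumes uvw: "0 < u" "u \<le> v" "v < w" and [measurable]: "f \<in> borel_measurable borel"
    and F [measurable]: "F \<in> borel_measurable (borel \<Otimes>\<^sub>M borel)"
  shows "(\<integral>\<^sup>+\<omega>. F (D u \<omega>, D v \<omega>) * f (x + D w \<omega>) \<partial>M)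
    \<le> ennreal ((w - v) powr (-1/\<alpha>) * p0) * (\<integral>\<^sup>+y. f y \<partial>lborel) * (\<integral>\<^sup>+\<omega>. F (D u \<omega>, D v \<omega>) \<partial>M)"
    (is "_ \<le> ?c * _")
proof -
  have "(\<integral>\<^sup>+\<omega>. F (D u \<omega>, D v \<omega>) * f (x + D w \<omega>) \<partial>M)
    = (\<integral>\<^sup>+\<omega>. (\<lambda>((a, b), c). F (a, b) * f (x + b + c)) ((D u \<omega>, D v \<omega>), D w \<omega> - D v \<omega>) \<partial>M)"
    by simp
  also have "\<dots> = (\<integral>\<^sup>+\<omega>. \<integral>\<^sup>+\<omega>'. (\<lambda>((a, b), c). F (a, b) * f (x + b + c)) ((D u \<omega>, D v \<omega>), D w \<omega>' - D v \<omega>') \<partial>M \<partial>M)"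
    by (rule nn_integral_indep_pair[OF D_indep[OF uvw]]) (auto simp: split_beta')
  also have "\<dots> = (\<integral>\<^sup>+\<omega>. F (D u \<omega>, D v \<omega>) * (\<integral>\<^sup>+\<omega>'. f (x + D v \<omega> + (D w \<omega>' - D v \<omega>')) \<partial>M) \<partial>M)"
    by (intro nn_integral_cong) (simp add: nn_integral_cmult)
  also have "\<dots> \<le> (\<integral>\<^sup>+\<omega>. F (D u \<omega>, D v \<omega>) * ?c \<partial>M)"
    using uvw by (intro nn_integral_mono mult_left_mono nn_expectation_increment_le) auto
  also have "\<dots> = (\<integral>\<^sup>+\<omega>. F (D u \<omega>, D v \<omega>) \<partial>M) * ?c"
    by (rule nn_integral_multc) simp
  finally show ?thesis by (simp add: mult.commute)
qed

text \<open>The reduction behind all moment bounds: the latest time is integrated out at the price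
  of one \<open>green_bound\<close>. As v is positive, [v, S] may be enlarged to [v, v + S], which
  makes the price independent of v.\<close>

lemma nn_expectation_last_le:
  assumes uv: "0 < u" "u \<le> v" and [measurable]: "f \<in> borel_measurable borel" and S: "0 \<le> S"
    and F [measurable]: "F \<in> borel_measurable (borel \<Otimes>\<^sub>M borel)"
  shows "(\<integral>\<^sup>+w. (\<integral>\<^sup>+\<omega>. F (D u \<omega>, D v \<omega>) * f (x + D w \<omega>) \<partial>M) * indicator {v..S} w \<partial>lborel)
    \<le> green_bound f S * (\<integral>\<^sup>+\<omega>. F (D u \<omega>, D v \<omega>) \<partial>M)"
proof -
  let ?E = "\<integral>\<^sup>+\<omega>. F (D u \<omega>, D v \<omega>) \<partial>M" and ?I = "\<integral>\<^sup>+y. f y \<partial>lborel"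
  have "(\<integral>\<^sup>+w. (\<integral>\<^sup>+\<omega>. F (D u \<omega>, D v \<omega>) * f (x + D w \<omega>) \<partial>M) * indicator {v..S} w \<partial>lborel)
    \<le> (\<integral>\<^sup>+w. (ennreal ((w - v) powr (-1/\<alpha>) * p0) * indicator {v..v+S} w) * (?I * ?E) \<partial>lborel)"
  proof (rule nn_integral_mono_AE)
    have "(\<integral>\<^sup>+\<omega>. F (D u \<omega>, D v \<omega>) * f (x + D w \<omega>) \<partial>M) * indicator {v..S} w
      \<le> (ennreal ((w - v) powr (-1/\<alpha>) * p0) * indicator {v..v+S} w) * (?I * ?E)" if "w \<noteq> v" for w
    proof (cases "w \<in> {v..S}")
      case True
      with that uv have "v < w" "w \<in> {v..v+S}" by auto
      then show ?thesis using nn_expectation_markov_le[OF uv \<open>v < w\<close> assms(3) F, of x] True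
        by (simp add: mult.assoc)
    qed simp
    then show "AE w in lborel. (\<integral>\<^sup>+\<omega>. F (D u \<omega>, D v \<omega>) * f (x + D w \<omega>) \<partial>M) * indicator {v..S} w
      \<le> (ennreal ((w - v) powr (-1/\<alpha>) * p0) * indicator {v..v+S} w) * (?I * ?E)"
      using AE_lborel_singleton[of v] by (auto elim!: AE_mp)
  qed
  also have "\<dots> = (\<integral>\<^sup>+w. ennreal ((w - v) powr (-1/\<alpha>) * p0) * indicator {v..v+S} w \<partial>lborel) * (?I * ?E)"
    by (rule nn_integral_multc) simp
  also have "\<dots> = green_bound f S * ?E"
    unfolding green_bound_def nn_integral_time_bound[OF S] by (simp add: mult.assoc)
  finally show ?thesis .
qed

definition occ :: "(real \<Rightarrow> ennreal) \<Rightarrow> real \<Rightarrow> real \<Rightarrow> 'a \<Rightarrow> ennreal" where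
  "occ f S x \<omega> = (\<integral>\<^sup>+u. f (x + D u \<omega>) * indicator {0..S} u \<partial>lborel)"

lemma occ_measurable [measurable (raw)]:
  assumes [measurable]: "f \<in> borel_measurable borel" "g \<in> borel_measurable N" "h \<in> measurable N M"
  shows "(\<lambda>z. occ f S (g z) (h z)) \<in> borel_measurable N"
  unfolding occ_def by measurable

lemma nn_expectation_occ:
  assumes [measurable]: "f \<in> borel_measurable borel"
  shows "(\<integral>\<^sup>+\<omega>. occ f S x \<omega> \<partial>M) = green f S x"
proof -
  interpret pair_sigma_finite lborel M ..
  have "(\<integral>\<^sup>+\<omega>. occ f S x \<omega> \<partial>M) = (\<integral>\<^sup>+u. \<integral>\<^sup>+\<omega>. f (x + D u \<omega>) * indicator {0..S} u \<partial>M \<partial>lborel)"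
    unfolding occ_def by (subst Fubini') auto
  also have "\<dots> = green f S x" unfolding green_def
  proof (rule nn_integral_cong_AE)
    have "(\<integral>\<^sup>+\<omega>. f (x + D u \<omega>) * indicator {0..S} u \<partial>M) = (\<integral>\<^sup>+a. ennreal (p u a) * f (x + a) \<partial>lborel) * indicator {0..S} u"
      if "u \<noteq> 0" for u
      using that nn_expectation_D[of u f x] by (auto simp: indicator_def)
    then show "AE u in lborel. (\<integral>\<^sup>+\<omega>. f (x + D u \<omega>) * indicator {0..S} u \<partial>M)
      = (\<integral>\<^sup>+a. ennreal (p u a) * f (x + a) \<partial>lborel) * indicator {0..S} u"
      using AE_lborel_singleton[of 0] by (auto elim!: AE_mp)
  qed
  finally show ?thesis .
qed

text \<open>Ordering the two times gives the factor 2. The later one is integrated out by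
  \<open>nn_expectation_last_le\<close>, and the first moment remains.\<close>

lemma nn_expectation_occ_square:
  assumes [measurable]: "f \<in> borel_measurable borel" and S: "0 \<le> S"
  shows "(\<integral>\<^sup>+\<omega>. occ f S x \<omega> ^ 2 \<partial>M) \<le> 2 * green_bound f S * green f S x"
proof -
  interpret pair_sigma_finite lborel M ..
  define \<tau> where "\<tau> u w = (\<integral>\<^sup>+\<omega>. f (x + D u \<omega>) * f (x + D w \<omega>) \<partial>M) * indicator {0..S} u * indicator {0..S} w" for u w
  have [measurable]: "(\<lambda>z. \<tau> (g z) (h z)) \<in> borel_measurable N"
    if [measurable]: "g \<in> borel_measurable N" "h \<in> borel_measurable N" for g h and N :: "'z measure"
    unfolding \<tau>_def by measurable
  have sym: "\<tau> u w = \<tau> w u" for u w by (simp add: \<tau>_def mult_ac)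
  have "(\<integral>\<^sup>+\<omega>. occ f S x \<omega> ^ 2 \<partial>M) = (\<integral>\<^sup>+\<omega>. \<integral>\<^sup>+u. \<integral>\<^sup>+w. (f (x + D u \<omega>) * indicator {0..S} u) * (f (x + D w \<omega>) * indicator {0..S} w) \<partial>lborel \<partial>lborel \<partial>M)"
    unfolding occ_def power2_eq_square
    by (intro nn_integral_cong) (simp add: nn_integral_cmult nn_integral_multc)
  also have "\<dots> = (\<integral>\<^sup>+u. \<integral>\<^sup>+\<omega>. \<integral>\<^sup>+w. (f (x + D u \<omega>) * indicator {0..S} u) * (f (x + D w \<omega>) * indicator {0..S} w) \<partial>lborel \<partial>M \<partial>lborel)"
    by (subst Fubini') auto
  also have "\<dots> = (\<integral>\<^sup>+u. \<integral>\<^sup>+w. \<integral>\<^sup>+\<omega>. (f (x + D u \<omega>) * indicator {0..S} u) * (f (x + D w \<omega>) * indicator {0..S} w) \<partial>M \<partial>lborel \<partial>lborel)"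
    by (subst Fubini') auto
  also have "\<dots> = (\<integral>\<^sup>+u. \<integral>\<^sup>+w. \<tau> u w \<partial>lborel \<partial>lborel)"
    by (intro nn_integral_cong) (auto simp: \<tau>_def indicator_def)
  also have "\<dots> \<le> (\<integral>\<^sup>+u. \<integral>\<^sup>+w. \<tau> u w * (if u \<le> w then 1 else 0) + \<tau> w u * (if w \<le> u then 1 else 0) \<partial>lborel \<partial>lborel)"
    by (intro nn_integral_mono) (auto simp: sym indicator_def)
  also have "\<dots> = (\<integral>\<^sup>+u. \<integral>\<^sup>+w. \<tau> u w * (if u \<le> w then 1 else 0) \<partial>lborel \<partial>lborel) + (\<integral>\<^sup>+u. \<integral>\<^sup>+w. \<tau> w u * (if w \<le> u then 1 else 0) \<partial>lborel \<partial>lborel)"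
    by (simp add: nn_integral_add)
  also have "(\<integral>\<^sup>+u. \<integral>\<^sup>+w. \<tau> w u * (if w \<le> u then 1 else 0) \<partial>lborel \<partial>lborel) = (\<integral>\<^sup>+u. \<integral>\<^sup>+w. \<tau> u w * (if u \<le> w then 1 else 0) \<partial>lborel \<partial>lborel)"
    by (rule lborel_pair.Fubini') simp
  also have "(\<integral>\<^sup>+u. \<integral>\<^sup>+w. \<tau> u w * (if u \<le> w then 1 else 0) \<partial>lborel \<partial>lborel) \<le> green_bound f S * green f S x"
  proof -
    have "(\<integral>\<^sup>+u. \<integral>\<^sup>+w. \<tau> u w * (if u \<le> w then 1 else 0) \<partial>lborel \<partial>lborel)
      \<le> (\<integral>\<^sup>+u. green_bound f S * (\<integral>\<^sup>+\<omega>. f (x + D u \<omega>) * indicator {0..S} u \<partial>M) \<partial>lborel)"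
    proof (rule nn_integral_mono_AE)
      have "(\<integral>\<^sup>+w. \<tau> u w * (if u \<le> w then 1 else 0) \<partial>lborel) \<le> green_bound f S * (\<integral>\<^sup>+\<omega>. f (x + D u \<omega>) * indicator {0..S} u \<partial>M)" if "u \<noteq> 0" for u
      proof (cases "u \<in> {0..S}")
        case True
        then have u: "0 < u" using that by auto
        have "(\<integral>\<^sup>+w. \<tau> u w * (if u \<le> w then 1 else 0) \<partial>lborel)
           = (\<integral>\<^sup>+w. (\<integral>\<^sup>+\<omega>. (\<lambda>(a, b). f (x + a)) (D u \<omega>, D u \<omega>) * f (x + D w \<omega>) \<partial>M) * indicator {u..S} w \<partial>lborel)"
          using True by (intro nn_integral_cong) (auto simp: \<tau>_def indicator_def)
        also have "\<dots> \<le> green_bound f S * (\<integral>\<^sup>+\<omega>. (\<lambda>(a, b). f (x + a)) (D u \<omega>, D u \<omega>) \<partial>M)"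
          by (rule nn_expectation_last_le[OF u order_refl assms(1) S]) (simp add: split_beta')
        finally show ?thesis using True by simp
      qed (simp add: \<tau>_def)
      then show "AE u in lborel. (\<integral>\<^sup>+w. \<tau> u w * (if u \<le> w then 1 else 0) \<partial>lborel) \<le> green_bound f S * (\<integral>\<^sup>+\<omega>. f (x + D u \<omega>) * indicator {0..S} u \<partial>M)"
        using AE_lborel_singleton[of 0] by (auto elim!: AE_mp)
    qed
    also have "\<dots> = green_bound f S * (\<integral>\<^sup>+u. \<integral>\<^sup>+\<omega>. f (x + D u \<omega>) * indicator {0..S} u \<partial>M \<partial>lborel)"
      by (rule nn_integral_cmult) simp
    also have "(\<integral>\<^sup>+u. \<integral>\<^sup>+\<omega>. f (x + D u \<omega>) * indicator {0..S} u \<partial>M \<partial>lborel) = (\<integral>\<^sup>+\<omega>. occ f S x \<omega> \<partial>M)"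
      unfolding occ_def by (rule Fubini'[symmetric]) simp
    finally show ?thesis by (simp add: nn_expectation_occ)
  qed
  finally show ?thesis by (simp add: mult_2 distrib_right add_mono)
qed

text \<open>Only the largest of the three times is singled out, whence the factor 3 and not 3!.
  Integrating it out leaves the full second moment.\<close>

lemma nn_expectation_occ_cube:
  assumes [measurable]: "f \<in> borel_measurable borel" and S: "0 \<le> S"
  shows "(\<integral>\<^sup>+\<omega>. occ f S x \<omega> ^ 3 \<partial>M) \<le> 3 * green_bound f S * (\<integral>\<^sup>+\<omega>. occ f S x \<omega> ^ 2 \<partial>M)"
proof -
  interpret pair_sigma_finite lborel M ..
  let ?g = "\<lambda>u \<omega>. f (x + D u \<omega>) * indicator {0..S} u"
  define \<tau> where "\<tau> u v w = (\<integral>\<^sup>+\<omega>. ?g u \<omega> * ?g v \<omega> * ?g w \<omega> \<partial>M)" for u v w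
  define \<sigma> where "\<sigma> u v w = \<tau> u v w * ((if u \<le> w then 1 else 0) * (if v \<le> w then 1 else 0))" for u v w
  have [measurable]: "(\<lambda>z. \<tau> (g z) (h z) (k z)) \<in> borel_measurable N"
    if [measurable]: "g \<in> borel_measurable N" "h \<in> borel_measurable N" "k \<in> borel_measurable N" for g h k and N :: "'z measure"
    unfolding \<tau>_def by measurable
  have [measurable]: "(\<lambda>z. \<sigma> (g z) (h z) (k z)) \<in> borel_measurable N"
    if [measurable]: "g \<in> borel_measurable N" "h \<in> borel_measurable N" "k \<in> borel_measurable N" for g h k and N :: "'z measure"
    unfolding \<sigma>_def by measurable
  have sym1: "\<tau> u v w = \<tau> u w v" for u v w by (simp add: \<tau>_def mult_ac)
  have sym2: "\<tau> u v w = \<tau> w v u" for u v w by (simp add: \<tau>_def mult_ac)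
  have swap: "(\<integral>\<^sup>+v. \<integral>\<^sup>+w. h v w \<partial>lborel \<partial>lborel) = (\<integral>\<^sup>+v. \<integral>\<^sup>+w. h w v \<partial>lborel \<partial>lborel)"
    if "case_prod h \<in> borel_measurable (lborel \<Otimes>\<^sub>M lborel)" for h :: "real \<Rightarrow> real \<Rightarrow> ennreal"
    using lborel_pair.Fubini'[OF that] by simp
  have "(\<integral>\<^sup>+\<omega>. occ f S x \<omega> ^ 3 \<partial>M) = (\<integral>\<^sup>+\<omega>. \<integral>\<^sup>+u. \<integral>\<^sup>+v. \<integral>\<^sup>+w. ?g u \<omega> * ?g v \<omega> * ?g w \<omega> \<partial>lborel \<partial>lborel \<partial>lborel \<partial>M)"
    unfolding occ_def power3_eq_cube
    by (intro nn_integral_cong) (simp add: nn_integral_cmult nn_integral_multc)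
  also have "\<dots> = (\<integral>\<^sup>+u. \<integral>\<^sup>+\<omega>. \<integral>\<^sup>+v. \<integral>\<^sup>+w. ?g u \<omega> * ?g v \<omega> * ?g w \<omega> \<partial>lborel \<partial>lborel \<partial>M \<partial>lborel)"
    by (rule Fubini') measurable
  also have "\<dots> = (\<integral>\<^sup>+u. \<integral>\<^sup>+v. \<integral>\<^sup>+\<omega>. \<integral>\<^sup>+w. ?g u \<omega> * ?g v \<omega> * ?g w \<omega> \<partial>lborel \<partial>M \<partial>lborel \<partial>lborel)"
    by (intro nn_integral_cong Fubini') measurable
  also have "\<dots> = (\<integral>\<^sup>+u. \<integral>\<^sup>+v. \<integral>\<^sup>+w. \<tau> u v w \<partial>lborel \<partial>lborel \<partial>lborel)"
    unfolding \<tau>_def by (intro nn_integral_cong Fubini') measurable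
  also have "\<dots> \<le> (\<integral>\<^sup>+u. \<integral>\<^sup>+v. \<integral>\<^sup>+w. \<sigma> u v w + \<sigma> u w v + \<sigma> w v u \<partial>lborel \<partial>lborel \<partial>lborel)"
  proof (intro nn_integral_mono)
    fix u v w :: real
    consider "u \<le> w" "v \<le> w" | "u \<le> v" "w \<le> v" | "v \<le> u" "w \<le> u" by (meson linear order_trans)
    then show "\<tau> u v w \<le> \<sigma> u v w + \<sigma> u w v + \<sigma> w v u"
    proof cases
      case 1 then have "\<sigma> u v w = \<tau> u v w" by (simp add: \<sigma>_def)
      then show ?thesis by (simp add: add.assoc)
    next
      case 2 then have "\<sigma> u w v = \<tau> u v w" by (simp add: \<sigma>_def sym1[of u w v])
      then show ?thesis by (simp add: add_increasing add_increasing2)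
    next
      case 3 then have "\<sigma> w v u = \<tau> u v w" by (simp add: \<sigma>_def sym2[of w v u])
      then show ?thesis by (simp add: add_increasing)
    qed
  qed
  also have "\<dots> = (\<integral>\<^sup>+u. \<integral>\<^sup>+v. \<integral>\<^sup>+w. \<sigma> u v w \<partial>lborel \<partial>lborel \<partial>lborel)
     + (\<integral>\<^sup>+u. \<integral>\<^sup>+v. \<integral>\<^sup>+w. \<sigma> u w v \<partial>lborel \<partial>lborel \<partial>lborel) + (\<integral>\<^sup>+u. \<integral>\<^sup>+v. \<integral>\<^sup>+w. \<sigma> w v u \<partial>lborel \<partial>lborel \<partial>lborel)"
    by (simp add: nn_integral_add)
  also have "(\<integral>\<^sup>+u. \<integral>\<^sup>+v. \<integral>\<^sup>+w. \<sigma> u w v \<partial>lborel \<partial>lborel \<partial>lborel) = (\<integral>\<^sup>+u. \<integral>\<^sup>+v. \<integral>\<^sup>+w. \<sigma> u v w \<partial>lborel \<partial>lborel \<partial>lborel)"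
    by (intro nn_integral_cong swap) measurable
  also have "(\<integral>\<^sup>+u. \<integral>\<^sup>+v. \<integral>\<^sup>+w. \<sigma> w v u \<partial>lborel \<partial>lborel \<partial>lborel) = (\<integral>\<^sup>+u. \<integral>\<^sup>+v. \<integral>\<^sup>+w. \<sigma> u v w \<partial>lborel \<partial>lborel \<partial>lborel)"
  proof -
    have "(\<integral>\<^sup>+u. \<integral>\<^sup>+v. \<integral>\<^sup>+w. \<sigma> w v u \<partial>lborel \<partial>lborel \<partial>lborel) = (\<integral>\<^sup>+u. \<integral>\<^sup>+v. \<integral>\<^sup>+w. \<sigma> w u v \<partial>lborel \<partial>lborel \<partial>lborel)"
      by (rule swap) measurable
    also have "\<dots> = (\<integral>\<^sup>+u. \<integral>\<^sup>+v. \<integral>\<^sup>+w. \<sigma> v u w \<partial>lborel \<partial>lborel \<partial>lborel)"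
      by (intro nn_integral_cong swap) measurable
    also have "\<dots> = (\<integral>\<^sup>+u. \<integral>\<^sup>+v. \<integral>\<^sup>+w. \<sigma> u v w \<partial>lborel \<partial>lborel \<partial>lborel)"
      by (rule swap) measurable
    finally show ?thesis .
  qed
  also have "(\<integral>\<^sup>+u. \<integral>\<^sup>+v. \<integral>\<^sup>+w. \<sigma> u v w \<partial>lborel \<partial>lborel \<partial>lborel) \<le> green_bound f S * (\<integral>\<^sup>+\<omega>. occ f S x \<omega> ^ 2 \<partial>M)"
  proof -
    let ?h = "\<lambda>u v. \<integral>\<^sup>+\<omega>. ?g u \<omega> * ?g v \<omega> \<partial>M"
    have key: "(\<integral>\<^sup>+w. \<sigma> u v w \<partial>lborel) \<le> green_bound f S * ?h u v" if "0 < u" "u \<le> v" for u v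
    proof (cases "v \<le> S")
      case True
      have "(\<integral>\<^sup>+w. \<sigma> u v w \<partial>lborel) = (\<integral>\<^sup>+w. (\<integral>\<^sup>+\<omega>. (\<lambda>(a, b). f (x + a) * f (x + b)) (D u \<omega>, D v \<omega>) * f (x + D w \<omega>) \<partial>M) * indicator {v..S} w \<partial>lborel)"
        using True that by (intro nn_integral_cong) (auto simp: \<sigma>_def \<tau>_def indicator_def)
      also have "\<dots> \<le> green_bound f S * (\<integral>\<^sup>+\<omega>. (\<lambda>(a, b). f (x + a) * f (x + b)) (D u \<omega>, D v \<omega>) \<partial>M)"
        by (rule nn_expectation_last_le[OF that assms(1) S]) (simp add: split_beta')
      finally show ?thesis using True that by simp
    qed (use that in \<open>simp add: \<sigma>_def \<tau>_def\<close>)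
    \<comment> \<open>The two earlier times are put in order by symmetry. Time 0 is left out since
      no density is available there; a negative time makes the left side vanish.\<close>
    have key': "(\<integral>\<^sup>+w. \<sigma> u v w \<partial>lborel) \<le> green_bound f S * ?h u v" if uv0: "u \<noteq> 0" "v \<noteq> 0" for u v
    proof -
      consider "u < 0 \<or> v < 0" | "0 < u" "u \<le> v" | "0 < v" "v \<le> u" using uv0 by linarith
      then show ?thesis
      proof cases
        case 1 then show ?thesis by (auto simp: \<sigma>_def \<tau>_def)
      next
        case 2 then show ?thesis by (rule key)
      next
        case 3
        have "\<sigma> u v w = \<sigma> v u w" for w by (simp add: \<sigma>_def \<tau>_def mult_ac)
        then show ?thesis using key[OF 3] by (simp add: mult_ac)
      qed
    qed
    have "(\<integral>\<^sup>+u. \<integral>\<^sup>+v. \<integral>\<^sup>+w. \<sigma> u v w \<partial>lborel \<partial>lborel \<partial>lborel) \<le> (\<integral>\<^sup>+u. \<integral>\<^sup>+v. green_bound f S * ?h u v \<partial>lborel \<partial>lborel)"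
    proof (rule nn_integral_mono_AE)
      have "(\<integral>\<^sup>+v. \<integral>\<^sup>+w. \<sigma> u v w \<partial>lborel \<partial>lborel) \<le> (\<integral>\<^sup>+v. green_bound f S * ?h u v \<partial>lborel)" if "u \<noteq> 0" for u
        using AE_lborel_singleton[of 0] by (intro nn_integral_mono_AE) (auto elim!: AE_mp intro!: key' that)
      then show "AE u in lborel. (\<integral>\<^sup>+v. \<integral>\<^sup>+w. \<sigma> u v w \<partial>lborel \<partial>lborel) \<le> (\<integral>\<^sup>+v. green_bound f S * ?h u v \<partial>lborel)"
        using AE_lborel_singleton[of 0] by (auto elim!: AE_mp)
    qed
    also have "\<dots> = green_bound f S * (\<integral>\<^sup>+u. \<integral>\<^sup>+v. ?h u v \<partial>lborel \<partial>lborel)"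
      by (simp add: nn_integral_cmult)
    also have "(\<integral>\<^sup>+u. \<integral>\<^sup>+v. ?h u v \<partial>lborel \<partial>lborel) = (\<integral>\<^sup>+u. \<integral>\<^sup>+\<omega>. \<integral>\<^sup>+v. ?g u \<omega> * ?g v \<omega> \<partial>lborel \<partial>M \<partial>lborel)"
      by (intro nn_integral_cong Fubini'[symmetric]) measurable
    also have "\<dots> = (\<integral>\<^sup>+\<omega>. \<integral>\<^sup>+u. \<integral>\<^sup>+v. ?g u \<omega> * ?g v \<omega> \<partial>lborel \<partial>lborel \<partial>M)"
      by (rule Fubini'[symmetric]) measurable
    also have "\<dots> = (\<integral>\<^sup>+\<omega>. occ f S x \<omega> ^ 2 \<partial>M)"
      unfolding occ_def power2_eq_square
      by (intro nn_integral_cong) (simp add: nn_integral_cmult nn_integral_multc)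
    finally show ?thesis .
  qed
  finally have "(\<integral>\<^sup>+\<omega>. occ f S x \<omega> ^ 3 \<partial>M) \<le> green_bound f S * (\<integral>\<^sup>+\<omega>. occ f S x \<omega> ^ 2 \<partial>M) +
     green_bound f S * (\<integral>\<^sup>+\<omega>. occ f S x \<omega> ^ 2 \<partial>M) + green_bound f S * (\<integral>\<^sup>+\<omega>. occ f S x \<omega> ^ 2 \<partial>M)"
    by (simp add: add_mono)
  also have "\<dots> = 3 * green_bound f S * (\<integral>\<^sup>+\<omega>. occ f S x \<omega> ^ 2 \<partial>M)"
  proof -
    have "c + c + c = 3 * c" for c :: ennreal
    proof -
      have "(3::ennreal) = 1 + 1 + 1" by simp
      then show ?thesis by (simp only: distrib_right mult_1_left)
    qed
    then show ?thesis by (simp add: mult.assoc)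
  qed
  finally show ?thesis .
qed

end

lemma integrable_lborel_shift:
  fixes f :: "real \<Rightarrow> real"
  assumes "integrable lborel f" shows "integrable lborel (\<lambda>b. f (y + b))"
  using lborel_integrable_real_affine[OF assms, of 1 y] by simp

lemma integral_lborel_shift:
  fixes f :: "real \<Rightarrow> real"
  shows "(LINT b|lborel. f (y + b)) = (LINT b|lborel. f b)"
  using lborel_integral_real_affine[of 1 f y] by simp

lemma nn_integral_lborel_reflect:
  fixes f :: "real \<Rightarrow> ennreal"
  assumes [measurable]: "f \<in> borel_measurable borel"
  shows "(\<integral>\<^sup>+a. f (x - a) \<partial>lborel) = (\<integral>\<^sup>+a. f a \<partial>lborel)"
  using nn_integral_real_affine[of f "-1" x] by (simp add: one_ennreal_def[symmetric])

section \<open>Scaling limits of potentials\<close>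

locale stable_functional = stable_law \<alpha> for \<alpha> :: real +
  fixes \<gamma> :: real and \<phi> :: "real \<Rightarrow> real"
  assumes gamma: "0 \<le> \<gamma>" "\<gamma> < 1" and phi: "integrable lborel \<phi>"
begin

lemma phi_measurable [measurable]: "\<phi> \<in> borel_measurable borel"
  using phi by auto

definition phi_norm :: real where "phi_norm = (LINT y|lborel. \<bar>\<phi> y\<bar>)"

lemma phi_norm_nonneg: "0 \<le> phi_norm"
  unfolding phi_norm_def by (intro integral_nonneg_AE AE_I2) simp

lemma nn_integral_phi: "(\<integral>\<^sup>+y. ennreal \<bar>\<phi> y\<bar> \<partial>lborel) = ennreal phi_norm"
  unfolding phi_norm_def using phi by (intro nn_integral_eq_integral) auto

text \<open>The transition semigroup of the motion applied to \<phi>, see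
  \<open>expectation_phi_D\<close>.\<close>

definition trans :: "real \<Rightarrow> real \<Rightarrow> real" where
  "trans r y = (LINT b|lborel. p r b * \<phi> (y + b))"

text \<open>The density at y of the mean particle measure at time u when particles start from
  |x|^(-\<gamma>) dx.\<close>

definition potential :: "real \<Rightarrow> real \<Rightarrow> real" where
  "potential u y = (LINT x|lborel. \<bar>x\<bar> powr (-\<gamma>) * p u (y - x))"

definition potential_bound :: real where
  "potential_bound = (LINT x|lborel. \<bar>x\<bar> powr (-\<gamma>) * indicator {-1..1} x) * p0 + 1"

definition potential_const :: real where
  "potential_const = (LINT x|lborel. p 1 x / \<bar>x\<bar> powr \<gamma>)"

lemma trans_measurable [measurable (raw)]:
  assumes [measurable]: "f \<in> borel_measurable N" "g \<in> borel_measurable N"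
  shows "(\<lambda>z. trans (f z) (g z)) \<in> borel_measurable N"
  unfolding trans_def by measurable

lemma potential_measurable [measurable (raw)]:
  assumes [measurable]: "f \<in> borel_measurable N" "g \<in> borel_measurable N"
  shows "(\<lambda>z. potential (f z) (g z)) \<in> borel_measurable N"
  unfolding potential_def by measurable

lemma integrable_p_phi:
  assumes "r > 0" shows "integrable lborel (\<lambda>b. p r b * \<phi> (y + b))"
proof (rule Bochner_Integration.integrable_bound[OF integrable_mult_right[OF integrable_lborel_shift[OF phi, of y], of "r powr (-1/\<alpha>) * p0"]])
  show "AE b in lborel. norm (p r b * \<phi> (y + b)) \<le> norm (r powr (-1/\<alpha>) * p0 * \<phi> (y + b))"
    using p_abs_le[OF assms] p0_nonneg by (intro AE_I2) (auto simp: abs_mult intro!: mult_right_mono)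
qed simp

lemma trans_abs_le:
  assumes "r > 0" shows "\<bar>trans r y\<bar> \<le> r powr (-1/\<alpha>) * p0 * phi_norm"
proof -
  have "\<bar>trans r y\<bar> \<le> (LINT b|lborel. \<bar>p r b * \<phi> (y + b)\<bar>)"
    unfolding trans_def by (rule integral_abs_bound)
  also have "\<dots> \<le> (LINT b|lborel. r powr (-1/\<alpha>) * p0 * \<bar>\<phi> (y + b)\<bar>)"
  proof (rule integral_mono)
    show "integrable lborel (\<lambda>b. \<bar>p r b * \<phi> (y + b)\<bar>)" using integrable_p_phi[OF assms] by (rule integrable_abs)
    show "integrable lborel (\<lambda>b. r powr (-1/\<alpha>) * p0 * \<bar>\<phi> (y + b)\<bar>)"
      by (intro integrable_mult_right integrable_abs integrable_lborel_shift phi)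
    show "\<bar>p r b * \<phi> (y + b)\<bar> \<le> r powr (-1/\<alpha>) * p0 * \<bar>\<phi> (y + b)\<bar>" for b
      using p_abs_le[OF assms] by (auto simp: abs_mult intro!: mult_right_mono)
  qed
  also have "\<dots> = r powr (-1/\<alpha>) * p0 * phi_norm"
    using integral_lborel_shift[of "\<lambda>b. \<bar>\<phi> b\<bar>" y] by (simp add: phi_norm_def)
  finally show ?thesis .
qed

text \<open>For |x| \<le> 1 the weight is integrable (\<gamma> < 1) and the density is at most p0;
  for |x| > 1 the weight is at most 1 (\<gamma> \<ge> 0) and the density has mass 1. These are the
  two summands of \<open>potential_bound\<close>, uniformly in z.\<close>

lemma nn_potential_1_le:
  "(\<integral>\<^sup>+x. ennreal (\<bar>x\<bar> powr (-\<gamma>) * p 1 (z - x)) \<partial>lborel) \<le> ennreal potential_bound"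
proof -
  let ?i = "\<lambda>x. \<bar>x\<bar> powr (-\<gamma>) * indicator {-1..1} x"
  have int: "integrable lborel ?i" using gamma by (intro integrable_abs_powr_near_0) auto
  have "(\<integral>\<^sup>+x. ennreal (\<bar>x\<bar> powr (-\<gamma>) * p 1 (z - x)) \<partial>lborel)
    \<le> (\<integral>\<^sup>+x. ennreal (?i x) * ennreal p0 + ennreal (p 1 (z - x)) \<partial>lborel)"
  proof (rule nn_integral_mono)
    fix x :: real
    have "\<bar>x\<bar> powr (-\<gamma>) * p 1 (z - x) \<le> ?i x * p0 + p 1 (z - x)"
    proof (cases "x \<in> {-1..1}")
      case True
      have "\<bar>x\<bar> powr (-\<gamma>) * p 1 (z - x) \<le> \<bar>x\<bar> powr (-\<gamma>) * p0"
        using p_le[of 1 "z - x"] by (intro mult_left_mono) auto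
      then show ?thesis using True p_nonneg[of 1 "z - x"] by simp
    next
      case False
      then have "1 < \<bar>x\<bar>" by auto
      then have "\<bar>x\<bar> powr (-\<gamma>) \<le> \<bar>x\<bar> powr 0" using gamma by (intro powr_mono) auto
      moreover have "x \<noteq> 0" using \<open>1 < \<bar>x\<bar>\<close> by auto
      ultimately have "\<bar>x\<bar> powr (-\<gamma>) * p 1 (z - x) \<le> 1 * p 1 (z - x)"
        using p_nonneg[of 1 "z - x"] by (intro mult_right_mono) auto
      then show ?thesis using p0_nonneg False by simp
    qed
    then show "ennreal (\<bar>x\<bar> powr (-\<gamma>) * p 1 (z - x)) \<le> ennreal (?i x) * ennreal p0 + ennreal (p 1 (z - x))"
      using p0_nonneg p_nonneg[of 1 "z - x"] by (simp add: ennreal_mult'[symmetric] ennreal_plus[symmetric] ennreal_leI del: ennreal_plus)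
  qed
  also have "\<dots> = ennreal (LINT x|lborel. ?i x) * ennreal p0 + (\<integral>\<^sup>+x. ennreal (p 1 (z - x)) \<partial>lborel)"
    using int by (subst nn_integral_add, simp, simp, subst nn_integral_multc)
      (simp_all add: nn_integral_eq_integral)
  also have "(\<integral>\<^sup>+x. ennreal (p 1 (z - x)) \<partial>lborel) = 1"
    using nn_integral_lborel_reflect[of "\<lambda>x. ennreal (p 1 x)" z] total by simp
  also have "ennreal (LINT x|lborel. ?i x) * ennreal p0 + 1 = ennreal potential_bound"
  proof -
    have "0 \<le> (LINT x|lborel. ?i x)" by (intro integral_nonneg_AE AE_I2) simp
    then show ?thesis using p0_nonneg
      by (simp add: potential_bound_def ennreal_mult' ennreal_plus)
  qed
  finally show ?thesis .
qed

lemma potential_bound_nonneg: "0 \<le> potential_bound"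
proof -
  have "0 \<le> (LINT x|lborel. \<bar>x\<bar> powr (-\<gamma>) * indicator {-1..1} x)" by (intro integral_nonneg_AE AE_I2) simp
  then show ?thesis using p0_nonneg by (simp add: potential_bound_def)
qed

text \<open>Substitute u^(1/\<alpha>) x for x: the Jacobian cancels the prefactor of the scaled
  density, and the weight contributes u^(-\<gamma>/\<alpha>).\<close>

lemma nn_potential_scaling:
  assumes "u > 0"
  shows "(\<integral>\<^sup>+x. ennreal (\<bar>x\<bar> powr (-\<gamma>) * p u (y - x)) \<partial>lborel)
    = ennreal (u powr (-\<gamma>/\<alpha>)) * (\<integral>\<^sup>+x. ennreal (\<bar>x\<bar> powr (-\<gamma>) * p 1 (u powr (-1/\<alpha>) * y - x)) \<partial>lborel)"
proof -
  let ?c = "u powr (1/\<alpha>)"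
  have c: "?c > 0" using assms by simp
  have inv: "u powr (-(1/\<alpha>)) = inverse ?c" by (rule powr_minus)
  have cg: "?c powr (-\<gamma>) = u powr (-\<gamma>/\<alpha>)" by (simp add: powr_powr)
  have "(\<integral>\<^sup>+x. ennreal (\<bar>x\<bar> powr (-\<gamma>) * p u (y - x)) \<partial>lborel)
     = ennreal ?c * (\<integral>\<^sup>+x. ennreal (\<bar>?c * x\<bar> powr (-\<gamma>) * p u (y - ?c * x)) \<partial>lborel)"
    using nn_integral_real_affine[of "\<lambda>x. ennreal (\<bar>x\<bar> powr (-\<gamma>) * p u (y - x))" ?c 0] c by simp
  also have "\<dots> = (\<integral>\<^sup>+x. ennreal ?c * ennreal (\<bar>?c * x\<bar> powr (-\<gamma>) * p u (y - ?c * x)) \<partial>lborel)"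
    by (rule nn_integral_cmult[symmetric]) simp
  also have "\<dots> = (\<integral>\<^sup>+x. ennreal (u powr (-\<gamma>/\<alpha>)) * ennreal (\<bar>x\<bar> powr (-\<gamma>) * p 1 (u powr (-1/\<alpha>) * y - x)) \<partial>lborel)"
  proof (rule nn_integral_cong)
    fix x
    have "u powr (-1/\<alpha>) * (y - ?c * x) = u powr (-1/\<alpha>) * y - x"
      using c by (simp add: inv right_diff_distrib)
    then have "p u (y - ?c * x) = inverse ?c * p 1 (u powr (-1/\<alpha>) * y - x)"
      by (subst p_scaling[OF assms]) (simp add: inv)
    moreover have "\<bar>?c * x\<bar> powr (-\<gamma>) = u powr (-\<gamma>/\<alpha>) * \<bar>x\<bar> powr (-\<gamma>)"
      using c by (simp add: abs_mult powr_mult cg)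
    ultimately have "?c * (\<bar>?c * x\<bar> powr (-\<gamma>) * p u (y - ?c * x)) = u powr (-\<gamma>/\<alpha>) * (\<bar>x\<bar> powr (-\<gamma>) * p 1 (u powr (-1/\<alpha>) * y - x))"
      using c by simp
    then show "ennreal ?c * ennreal (\<bar>?c * x\<bar> powr (-\<gamma>) * p u (y - ?c * x)) = ennreal (u powr (-\<gamma>/\<alpha>)) * ennreal (\<bar>x\<bar> powr (-\<gamma>) * p 1 (u powr (-1/\<alpha>) * y - x))"
      using c by (simp add: ennreal_mult'[symmetric])
  qed
  also have "\<dots> = ennreal (u powr (-\<gamma>/\<alpha>)) * (\<integral>\<^sup>+x. ennreal (\<bar>x\<bar> powr (-\<gamma>) * p 1 (u powr (-1/\<alpha>) * y - x)) \<partial>lborel)"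
    by (rule nn_integral_cmult) simp
  finally show ?thesis .
qed

lemma nn_potential_le:
  assumes "u > 0"
  shows "(\<integral>\<^sup>+x. ennreal (\<bar>x\<bar> powr (-\<gamma>) * p u (y - x)) \<partial>lborel) \<le> ennreal (u powr (-\<gamma>/\<alpha>) * potential_bound)"
proof -
  have "ennreal (u powr (-\<gamma>/\<alpha>) * potential_bound) = ennreal (u powr (-\<gamma>/\<alpha>)) * ennreal potential_bound"
    by (rule ennreal_mult') simp
  then show ?thesis unfolding nn_potential_scaling[OF assms]
    by (simp only:) (intro mult_left_mono nn_potential_1_le, simp)
qed

lemma integrable_potential:
  assumes "u > 0" shows "integrable lborel (\<lambda>x. \<bar>x\<bar> powr (-\<gamma>) * p u (y - x))"
  using p_nonneg[OF assms] nn_potential_le[OF assms, of y]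
  by (intro integrableI_nonneg) (auto simp: le_less_trans[OF _ ennreal_less_top])

lemma nn_potential_eq:
  assumes "u > 0"
  shows "(\<integral>\<^sup>+x. ennreal (\<bar>x\<bar> powr (-\<gamma>) * p u (y - x)) \<partial>lborel) = ennreal (potential u y)"
  unfolding potential_def using p_nonneg[OF assms] integrable_potential[OF assms]
  by (intro nn_integral_eq_integral) auto

lemma potential_nonneg: "u > 0 \<Longrightarrow> 0 \<le> potential u y"
  unfolding potential_def using p_nonneg by (intro integral_nonneg_AE AE_I2) auto

lemma potential_le: "u > 0 \<Longrightarrow> potential u y \<le> u powr (-\<gamma>/\<alpha>) * potential_bound"
  using nn_potential_le[of u y] potential_bound_nonneg by (simp add: nn_potential_eq)

lemma potential_scaling: "u > 0 \<Longrightarrow> potential u y = u powr (-\<gamma>/\<alpha>) * potential 1 (u powr (-1/\<alpha>) * y)"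
  using nn_potential_scaling[of u y] potential_nonneg
  by (simp add: nn_potential_eq ennreal_mult'[symmetric])

lemma potential_1_0: "potential 1 0 = potential_const"
  unfolding potential_def potential_const_def
  using stable_density_minus[of 1 \<alpha>] alpha
  by (intro Bochner_Integration.integral_cong) (auto simp: powr_minus_divide)

text \<open>
  The singularity at \<open>0\<close> is dominated uniformly since the density is bounded; on the complement
  the translation is moved onto the weight, where it is harmless.
\<close>

lemma potential_tendsto:
  assumes "Z \<longlonglongrightarrow> 0"
  shows "(\<lambda>n. potential 1 (Z n)) \<longlonglongrightarrow> potential_const"
proof -
  let ?w = "\<lambda>x::real. \<bar>x\<bar> powr (-\<gamma>)"
  let ?in = "\<lambda>x::real. ?w x * indicator {-1..1} x"
  let ?out = "\<lambda>x::real. ?w x * indicator (- {-1..1}) x"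
  have out1: "?out x \<le> 1" for x
  proof (cases "x \<in> {-1..1}")
    case False
    then have "\<bar>x\<bar> powr (-\<gamma>) \<le> \<bar>x\<bar> powr 0" using gamma by (intro powr_mono) auto
    then show ?thesis using False by auto
  qed simp
  have int_in: "integrable lborel (\<lambda>x. ?in x * p 1 (z - x))" for z
    by (rule Bochner_Integration.integrable_bound[OF integrable_potential[of 1 z]])
       (use p_nonneg[of 1] in \<open>auto simp: indicator_def abs_mult\<close>)
  have int_out: "integrable lborel (\<lambda>x. ?out x * p 1 (z - x))" for z
    by (rule Bochner_Integration.integrable_bound[OF integrable_potential[of 1 z]])
       (use p_nonneg[of 1] in \<open>auto simp: indicator_def abs_mult\<close>)
  have split: "potential 1 z = (LINT x|lborel. ?in x * p 1 (z - x)) + (LINT x|lborel. ?out (z + x) * p 1 x)" for z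
  proof -
    have "potential 1 z = (LINT x|lborel. ?in x * p 1 (z - x) + ?out x * p 1 (z - x))"
      unfolding potential_def by (intro Bochner_Integration.integral_cong) (auto simp: indicator_def)
    also have "\<dots> = (LINT x|lborel. ?in x * p 1 (z - x)) + (LINT x|lborel. ?out x * p 1 (z - x))"
      by (rule Bochner_Integration.integral_add[OF int_in int_out])
    also have "(LINT x|lborel. ?out x * p 1 (z - x)) = (LINT x|lborel. ?out (z + x) * p 1 x)"
      using lborel_integral_real_affine[of 1 "\<lambda>x. ?out x * p 1 (z - x)" z] stable_density_minus[of 1 \<alpha>] alpha by simp
    finally show ?thesis .
  qed
  have "(\<lambda>n. LINT x|lborel. ?in x * p 1 (Z n - x)) \<longlonglongrightarrow> (LINT x|lborel. ?in x * p 1 (0 - x))"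
  proof (rule integral_dominated_convergence[where w="\<lambda>x. ?in x * p0"])
    show "integrable lborel (\<lambda>x. ?in x * p0)"
      using gamma by (intro integrable_mult_left integrable_abs_powr_near_0) auto
    show "AE x in lborel. (\<lambda>n. ?in x * p 1 (Z n - x)) \<longlonglongrightarrow> ?in x * p 1 (0 - x)"
      using alpha by (intro AE_I2 tendsto_mult tendsto_const stable_density_tendsto tendsto_diff assms) auto
    show "AE x in lborel. norm (?in x * p 1 (Z n - x)) \<le> ?in x * p0" for n
      using p_abs_le[of 1] by (intro AE_I2) (auto simp: abs_mult intro!: mult_left_mono)
  qed auto
  moreover have "(\<lambda>n. LINT x|lborel. ?out (Z n + x) * p 1 x) \<longlonglongrightarrow> (LINT x|lborel. ?out (0 + x) * p 1 x)"
  proof (rule integral_dominated_convergence[where w="p 1"])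
    show "integrable lborel (p 1)" by (rule integrable_p) simp
    \<comment> \<open>The points 1 and -1 are exceptional because the truncated weight jumps there;
      they form a null set.\<close>
    have key: "(\<lambda>n. ?out (Z n + x) * p 1 x) \<longlonglongrightarrow> ?out (0 + x) * p 1 x" if "x \<noteq> 1" "x \<noteq> -1" for x
    proof (rule tendsto_mult[OF _ tendsto_const])
      have lim: "(\<lambda>n. Z n + x) \<longlonglongrightarrow> x" using tendsto_add[OF assms tendsto_const[of x]] by simp
      show "(\<lambda>n. ?out (Z n + x)) \<longlonglongrightarrow> ?out (0 + x)"
      proof (cases "\<bar>x\<bar> < 1")
        case True
        have "eventually (\<lambda>n. \<bar>Z n + x\<bar> < 1) sequentially"
          using tendsto_rabs[OF lim] True by (rule order_tendstoD(2))
        then have "eventually (\<lambda>n. ?out (Z n + x) = ?out (0 + x)) sequentially"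
          by eventually_elim (use True in \<open>auto simp: indicator_def\<close>)
        then show ?thesis by (rule tendsto_eventually)
      next
        case False
        then have x: "1 < \<bar>x\<bar>" using that by auto
        have "eventually (\<lambda>n. 1 < \<bar>Z n + x\<bar>) sequentially"
          using tendsto_rabs[OF lim] x by (rule order_tendstoD(1))
        then have ev: "eventually (\<lambda>n. ?w (Z n + x) = ?out (Z n + x)) sequentially"
          by eventually_elim (auto simp: indicator_def)
        have lw: "(\<lambda>n. ?w (Z n + x)) \<longlonglongrightarrow> ?w x"
          using x by (intro tendsto_powr tendsto_rabs lim tendsto_const) auto
        have eq: "?out (0 + x) = ?w x" using x by (auto simp: indicator_def)
        show ?thesis unfolding eq by (rule Lim_transform_eventually[OF lw ev])
      qed
    qed
    show "AE x in lborel. (\<lambda>n. ?out (Z n + x) * p 1 x) \<longlonglongrightarrow> ?out (0 + x) * p 1 x"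
      using AE_lborel_singleton[of 1] AE_lborel_singleton[of "-1"] by eventually_elim (rule key)
    show "AE x in lborel. norm (?out (Z n + x) * p 1 x) \<le> p 1 x" for n
    proof (rule AE_I2)
      fix x
      have "?out (Z n + x) * p 1 x \<le> 1 * p 1 x" using out1 p_nonneg[of 1] by (intro mult_right_mono) auto
      then show "norm (?out (Z n + x) * p 1 x) \<le> p 1 x" using p_nonneg[of 1 x] by (simp add: abs_mult)
    qed
  qed auto
  ultimately have "(\<lambda>n. potential 1 (Z n)) \<longlonglongrightarrow> potential 1 0"
    unfolding split by (rule tendsto_add)
  then show ?thesis by (simp add: potential_1_0)
qed

lemma powr_at_top_zero: "r > 0 \<Longrightarrow> ((\<lambda>T. (T * r) powr (-1/\<alpha>)) \<longlongrightarrow> 0) at_top"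
proof -
  assume "r > 0"
  have "filterlim (\<lambda>T. T * r) at_top at_top"
    using \<open>r > 0\<close> by (intro filterlim_at_top_mult_tendsto_pos[OF tendsto_const[of r]] filterlim_ident)
  from tendsto_neg_powr[OF _ this, of "-1/\<alpha>"] show ?thesis using alpha by simp
qed

text \<open>After scaling, y enters only through (T r)^(-1/\<alpha>) y, which tends to 0; the limit
  forgets the position.\<close>

lemma potential_scaled_tendsto:
  assumes "r > 0"
  shows "((\<lambda>T. T powr (\<gamma>/\<alpha>) * potential (T * r) y) \<longlongrightarrow> r powr (-\<gamma>/\<alpha>) * potential_const) at_top"
proof -
  have "((\<lambda>T. r powr (-\<gamma>/\<alpha>) * potential 1 ((T * r) powr (-1/\<alpha>) * y)) \<longlongrightarrow> r powr (-\<gamma>/\<alpha>) * potential_const) at_top"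
  proof (intro tendsto_mult tendsto_const tendsto_at_topI_sequentially potential_tendsto)
    fix X :: "nat \<Rightarrow> real" assume "filterlim X at_top sequentially"
    from filterlim_compose[OF powr_at_top_zero[OF assms] this]
    have "(\<lambda>n. (X n * r) powr (-1/\<alpha>) * y) \<longlonglongrightarrow> 0 * y" by (intro tendsto_mult tendsto_const)
    then show "(\<lambda>n. (X n * r) powr (-1/\<alpha>) * y) \<longlonglongrightarrow> 0" by simp
  qed
  moreover have "\<forall>\<^sub>F T in at_top. r powr (-\<gamma>/\<alpha>) * potential 1 ((T * r) powr (-1/\<alpha>) * y) = T powr (\<gamma>/\<alpha>) * potential (T * r) y"
    using eventually_gt_at_top[of 0]
  proof eventually_elim
    case (elim T)
    have "T powr (\<gamma>/\<alpha>) * (T * r) powr (-\<gamma>/\<alpha>) = r powr (-\<gamma>/\<alpha>)"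
      using elim assms powr_minus[of T "\<gamma>/\<alpha>"] by (simp add: powr_mult)
    then show ?case using elim assms by (subst (2) potential_scaling) (auto simp: mult.assoc[symmetric])
  qed
  ultimately show ?thesis by (rule Lim_transform_eventually)
qed

text \<open>The argument of the scaled density tends to 0, so that only the integral of \<phi>
  survives. Boundedness of the density by p0 gives the majorant.\<close>

lemma trans_scaled_tendsto:
  assumes "r > 0"
  shows "((\<lambda>T. T powr (1/\<alpha>) * trans (T * r) y) \<longlongrightarrow> r powr (-1/\<alpha>) * (p0 * (LINT b|lborel. \<phi> b))) at_top"
proof -
  have "((\<lambda>T. LINT b|lborel. p 1 ((T * r) powr (-1/\<alpha>) * b) * \<phi> (y + b)) \<longlongrightarrow> (LINT b|lborel. p0 * \<phi> (y + b))) at_top"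
  proof (rule integral_dominated_convergence_at_top[where w="\<lambda>b. p0 * \<bar>\<phi> (y + b)\<bar>"])
    show "integrable lborel (\<lambda>b. p0 * \<bar>\<phi> (y + b)\<bar>)"
      by (intro integrable_mult_right integrable_abs integrable_lborel_shift phi)
    show "AE b in lborel. ((\<lambda>T. p 1 ((T * r) powr (-1/\<alpha>) * b) * \<phi> (y + b)) \<longlongrightarrow> p0 * \<phi> (y + b)) at_top"
    proof (rule AE_I2, intro tendsto_mult tendsto_const tendsto_at_topI_sequentially stable_density_tendsto)
      fix b and X :: "nat \<Rightarrow> real" assume "filterlim X at_top sequentially"
      from filterlim_compose[OF powr_at_top_zero[OF assms] this]
      have "(\<lambda>n. (X n * r) powr (-1/\<alpha>) * b) \<longlonglongrightarrow> 0 * b" by (intro tendsto_mult tendsto_const)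
      then show "(\<lambda>n. (X n * r) powr (-1/\<alpha>) * b) \<longlonglongrightarrow> 0" by simp
    qed (use alpha in auto)
    show "\<forall>\<^sub>F T in at_top. AE b in lborel. norm (p 1 ((T * r) powr (-1/\<alpha>) * b) * \<phi> (y + b)) \<le> p0 * \<bar>\<phi> (y + b)\<bar>"
      using p_abs_le[of 1] by (intro always_eventually allI AE_I2) (auto simp: abs_mult intro!: mult_right_mono)
  qed auto
  then have "((\<lambda>T. r powr (-1/\<alpha>) * (LINT b|lborel. p 1 ((T * r) powr (-1/\<alpha>) * b) * \<phi> (y + b))) \<longlongrightarrow> r powr (-1/\<alpha>) * (p0 * (LINT b|lborel. \<phi> b))) at_top"
    by (intro tendsto_mult tendsto_const) (simp add: integral_lborel_shift)
  moreover have "\<forall>\<^sub>F T in at_top. r powr (-1/\<alpha>) * (LINT b|lborel. p 1 ((T * r) powr (-1/\<alpha>) * b) * \<phi> (y + b)) = T powr (1/\<alpha>) * trans (T * r) y"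
    using eventually_gt_at_top[of 0]
  proof eventually_elim
    case (elim T)
    have 1: "T powr (1/\<alpha>) * (T * r) powr (-1/\<alpha>) = r powr (-1/\<alpha>)"
      using elim assms powr_minus[of T "1/\<alpha>"] by (simp add: powr_mult)
    have "trans (T * r) y = (T * r) powr (-1/\<alpha>) * (LINT b|lborel. p 1 ((T * r) powr (-1/\<alpha>) * b) * \<phi> (y + b))"
      unfolding trans_def using elim assms by (subst p_scaling) (auto simp: mult.assoc)
    then show ?case using 1 by (simp add: mult.assoc[symmetric])
  qed
  ultimately show ?thesis by (rule Lim_transform_eventually)
qed

text \<open>For u < w, the mean of \<phi>(x + D u) \<phi>(x + D w) integrated over the starts x
  against |x|^(-\<gamma>) dx, with y the position at time u; see
  \<open>integral_weight_two_point\<close>.\<close>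

definition pair_mass :: "real \<Rightarrow> real \<Rightarrow> real" where
  "pair_mass u w = (LINT y|lborel. potential u y * (\<phi> y * trans (w - u) y))"

lemma pair_mass_integrand_le:
  assumes "0 < u" "u < w"
  shows "\<bar>potential u y * (\<phi> y * trans (w - u) y)\<bar>
    \<le> (u powr (-\<gamma>/\<alpha>) * (w - u) powr (-1/\<alpha>) * (potential_bound * p0 * phi_norm)) * \<bar>\<phi> y\<bar>"
proof -
  have "\<bar>potential u y * (\<phi> y * trans (w - u) y)\<bar> = potential u y * \<bar>trans (w - u) y\<bar> * \<bar>\<phi> y\<bar>"
    using potential_nonneg[OF assms(1)] by (simp add: abs_mult)
  also have "\<dots> \<le> (u powr (-\<gamma>/\<alpha>) * potential_bound) * ((w - u) powr (-1/\<alpha>) * p0 * phi_norm) * \<bar>\<phi> y\<bar>"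
    using potential_le[OF assms(1)] trans_abs_le[of "w - u" y] assms potential_bound_nonneg
    by (intro mult_right_mono mult_mono) auto
  finally show ?thesis by (simp add: mult_ac)
qed

lemma pair_mass_abs_le:
  assumes "0 < u" "u < w"
  shows "\<bar>pair_mass u w\<bar> \<le> u powr (-\<gamma>/\<alpha>) * (w - u) powr (-1/\<alpha>) * (potential_bound * p0 * phi_norm * phi_norm)"
proof -
  let ?c = "u powr (-\<gamma>/\<alpha>) * (w - u) powr (-1/\<alpha>) * (potential_bound * p0 * phi_norm)"
  have int: "integrable lborel (\<lambda>y. ?c * \<bar>\<phi> y\<bar>)" using phi by (intro integrable_mult_right) auto
  have "\<bar>pair_mass u w\<bar> \<le> (LINT y|lborel. \<bar>potential u y * (\<phi> y * trans (w - u) y)\<bar>)"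
    unfolding pair_mass_def by (rule integral_abs_bound)
  also have "\<dots> \<le> (LINT y|lborel. ?c * \<bar>\<phi> y\<bar>)"
  proof (rule integral_mono[OF _ int pair_mass_integrand_le[OF assms]])
    show "integrable lborel (\<lambda>y. \<bar>potential u y * (\<phi> y * trans (w - u) y)\<bar>)"
      by (rule Bochner_Integration.integrable_bound[OF int])
         (use pair_mass_integrand_le[OF assms] in \<open>auto intro!: AE_I2 order_trans[OF _ abs_ge_self]\<close>)
  qed
  also have "\<dots> = ?c * phi_norm" by (simp add: phi_norm_def)
  finally show ?thesis by (simp add: mult_ac)
qed

text \<open>The exponent (1 + \<gamma>)/\<alpha> collects \<gamma>/\<alpha> from the potential and
  1/\<alpha> from the transition. The bound \<open>pair_mass_integrand_le\<close> is homogeneous in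
  the times of degree -(1 + \<gamma>)/\<alpha>, so after scaling it is a majorant free of T.\<close>

lemma pair_mass_scaled_tendsto:
  assumes "0 < r" "r < s"
  shows "((\<lambda>T. T powr ((1 + \<gamma>)/\<alpha>) * pair_mass (T * r) (T * s)) \<longlongrightarrow>
    r powr (-\<gamma>/\<alpha>) * (s - r) powr (-1/\<alpha>) * (potential_const * p0 * (LINT b|lborel. \<phi> b)\<^sup>2)) at_top"
proof -
  let ?I = "LINT b|lborel. \<phi> b"
  let ?L = "\<lambda>y. (r powr (-\<gamma>/\<alpha>) * potential_const) * (\<phi> y * ((s - r) powr (-1/\<alpha>) * (p0 * ?I)))"
  let ?f = "\<lambda>T y. (T powr (\<gamma>/\<alpha>) * potential (T * r) y) * (\<phi> y * (T powr (1/\<alpha>) * trans (T * (s - r)) y))"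
  have "((\<lambda>T. LINT y|lborel. ?f T y) \<longlongrightarrow> (LINT y|lborel. ?L y)) at_top"
  proof (rule integral_dominated_convergence_at_top[where
        w="\<lambda>y. (r powr (-\<gamma>/\<alpha>) * (s - r) powr (-1/\<alpha>) * (potential_bound * p0 * phi_norm)) * \<bar>\<phi> y\<bar>"])
    show "integrable lborel (\<lambda>y. (r powr (-\<gamma>/\<alpha>) * (s - r) powr (-1/\<alpha>) * (potential_bound * p0 * phi_norm)) * \<bar>\<phi> y\<bar>)"
      using phi by (intro integrable_mult_right) auto
    show "AE y in lborel. ((\<lambda>T. ?f T y) \<longlongrightarrow> ?L y) at_top"
      using assms by (intro AE_I2 tendsto_mult tendsto_const potential_scaled_tendsto trans_scaled_tendsto) auto
    show "\<forall>\<^sub>F T in at_top. AE y in lborel. norm (?f T y) \<le> (r powr (-\<gamma>/\<alpha>) * (s - r) powr (-1/\<alpha>) * (potential_bound * p0 * phi_norm)) * \<bar>\<phi> y\<bar>"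
      using eventually_gt_at_top[of 0]
    proof (eventually_elim, intro AE_I2)
      fix T y :: real assume T: "0 < T"
      have cancel: "a * b * ((inverse a * x * (inverse b * y) * z) * w) = x * y * z * w"
        if "a \<noteq> 0" "b \<noteq> 0" for a b x y z w :: real
        using that by (simp add: field_simps)
      have "norm (?f T y) = T powr (\<gamma>/\<alpha>) * T powr (1/\<alpha>) * \<bar>potential (T * r) y * (\<phi> y * trans (T * s - T * r) y)\<bar>"
        by (simp add: abs_mult right_diff_distrib)
      also have "\<dots> \<le> T powr (\<gamma>/\<alpha>) * T powr (1/\<alpha>) * (((T * r) powr (-\<gamma>/\<alpha>) * (T * s - T * r) powr (-1/\<alpha>) * (potential_bound * p0 * phi_norm)) * \<bar>\<phi> y\<bar>)"
        using assms T by (intro mult_left_mono pair_mass_integrand_le) auto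
      also have "(T * r) powr (-\<gamma>/\<alpha>) = inverse (T powr (\<gamma>/\<alpha>)) * r powr (-\<gamma>/\<alpha>)"
        using T assms powr_minus[of T "\<gamma>/\<alpha>"] by (simp add: powr_mult)
      also have "(T * s - T * r) powr (-1/\<alpha>) = inverse (T powr (1/\<alpha>)) * (s - r) powr (-1/\<alpha>)"
        using T assms powr_minus[of T "1/\<alpha>"] by (simp add: powr_mult right_diff_distrib[symmetric])
      also have "T powr (\<gamma>/\<alpha>) * T powr (1/\<alpha>) * ((inverse (T powr (\<gamma>/\<alpha>)) * r powr (-\<gamma>/\<alpha>) * (inverse (T powr (1/\<alpha>)) * (s - r) powr (-1/\<alpha>)) * (potential_bound * p0 * phi_norm)) * \<bar>\<phi> y\<bar>)
        = (r powr (-\<gamma>/\<alpha>) * (s - r) powr (-1/\<alpha>) * (potential_bound * p0 * phi_norm)) * \<bar>\<phi> y\<bar>"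
        using T by (intro cancel) auto
      finally show "norm (?f T y) \<le> (r powr (-\<gamma>/\<alpha>) * (s - r) powr (-1/\<alpha>) * (potential_bound * p0 * phi_norm)) * \<bar>\<phi> y\<bar>" .
    qed
  qed auto
  moreover have "(LINT y|lborel. ?f T y) = T powr ((1 + \<gamma>)/\<alpha>) * pair_mass (T * r) (T * s)" for T
  proof -
    have "(LINT y|lborel. ?f T y) = (LINT y|lborel. T powr ((1 + \<gamma>)/\<alpha>) * (potential (T * r) y * (\<phi> y * trans (T * s - T * r) y)))"
      by (intro Bochner_Integration.integral_cong) (auto simp: add_divide_distrib powr_add right_diff_distrib)
    then show ?thesis by (simp add: pair_mass_def)
  qed
  moreover have "(LINT y|lborel. ?L y) = r powr (-\<gamma>/\<alpha>) * (s - r) powr (-1/\<alpha>) * (potential_const * p0 * ?I\<^sup>2)"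
    by (simp add: power2_eq_square mult_ac)
  ultimately show ?thesis by (simp only:)
qed

end

section \<open>The kernel of weighted fractional Brownian motion\<close>

lemma stable_density_0: "stable_density a 0 x = 0"
proof -
  let ?f = "\<lambda>y::real. exp (- (\<i> * complex_of_real (x * y) + complex_of_real (0 * \<bar>y\<bar> powr a)))"
  \<comment> \<open>At time 0 the integrand has modulus 1, so it is not integrable and its integral
    is 0 by convention. Hence density, semigroup and potential vanish at time 0, and degenerate
    pairs of times contribute 0.\<close>
  have "norm (?f y) = 1" for y by simp
  then have "\<not> integrable lborel ?f"
    using integrable_norm[of lborel ?f] by (auto simp: integrable_iff_bounded)
  then show ?thesis unfolding stable_density_def by (subst not_integrable_integral_eq) auto
qed

text \<open>This is min(r,s)^a |r-s|^(b-1), whose integral over [0,u] x [0,v] is the covariance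
  divided by b. With a = -\<gamma>/\<alpha> and b = 1 - 1/\<alpha> it is, up to a constant, the
  limit of the scaled pair masses.\<close>

definition wfb_kernel :: "real \<Rightarrow> real \<Rightarrow> real \<Rightarrow> real \<Rightarrow> real" where
  "wfb_kernel a b r s = (if r \<le> s then r powr a * (s - r) powr (b - 1) else s powr a * (r - s) powr (b - 1))"

lemma wfb_kernel_measurable [measurable (raw)]:
  assumes [measurable]: "f \<in> borel_measurable N" "g \<in> borel_measurable N"
  shows "(\<lambda>z. wfb_kernel a b (f z) (g z)) \<in> borel_measurable N"
  unfolding wfb_kernel_def by measurable

lemma box_measurable [measurable]: "{0..u::real} \<times> {0..v::real} \<in> sets borel"
  by (intro borel_closed closed_Times) auto

lemma borel_measurable_fst_pair [measurable (raw)]: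
  fixes f :: "'a \<Rightarrow> real \<times> real"
  assumes "f \<in> borel_measurable N"
  shows "(\<lambda>z. fst (f z)) \<in> borel_measurable N" "(\<lambda>z. snd (f z)) \<in> borel_measurable N"
  by (rule measurable_compose[OF assms borel_measurable_continuous_onI], intro continuous_intros)+

lemma (in stable_law) green_measurable [measurable (raw)]:
  assumes [measurable]: "f \<in> borel_measurable borel" "h \<in> borel_measurable N"
  shows "(\<lambda>z. green f S (h z)) \<in> borel_measurable N"
  unfolding green_def by measurable

lemma wfb_kernel_nonneg: "0 \<le> wfb_kernel a b r s"
  by (simp add: wfb_kernel_def)

text \<open>The triangle r \<le> s: the integral of (s - r)^(b-1) over s from r to v is (v - r)^b /
  b, and the range is empty for r > v, whence the minimum.\<close>

lemma nn_integral_wfb_kernel_half: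
  assumes "a > -1" "b > 0" "0 \<le> u" "0 \<le> v"
  shows "(\<integral>\<^sup>+r. \<integral>\<^sup>+s. ennreal (r powr a * (s - r) powr (b - 1) * (indicator {0..u} r * (if r \<le> s \<and> s \<le> v then 1 else 0))) \<partial>lborel \<partial>lborel)
    = (\<integral>\<^sup>+r. ennreal (r powr a * (v - r) powr b / b * indicator {0..min u v} r) \<partial>lborel)"
proof (rule nn_integral_cong)
  fix r :: real
  have "(\<integral>\<^sup>+s. ennreal (r powr a * (s - r) powr (b - 1) * (indicator {0..u} r * (if r \<le> s \<and> s \<le> v then 1 else 0))) \<partial>lborel)
    = (\<integral>\<^sup>+s. ennreal (r powr a * indicator {0..u} r) * ennreal ((s - r) powr (b - 1) * (if r \<le> s \<and> s \<le> v then 1 else 0)) \<partial>lborel)"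
    by (intro nn_integral_cong) (auto simp: ennreal_mult'[symmetric] indicator_def)
  also have "\<dots> = ennreal (r powr a * indicator {0..u} r) * (\<integral>\<^sup>+s. ennreal ((s - r) powr (b - 1) * (if r \<le> s \<and> s \<le> v then 1 else 0)) \<partial>lborel)"
    by (rule nn_integral_cmult) simp
  also have "(\<integral>\<^sup>+s. ennreal ((s - r) powr (b - 1) * (if r \<le> s \<and> s \<le> v then 1 else 0)) \<partial>lborel)
    = (\<integral>\<^sup>+s. ennreal (s powr (b - 1) * (if 0 \<le> s \<and> s \<le> v - r then 1 else 0)) \<partial>lborel)"
    using nn_integral_lborel_shift[of "\<lambda>s. ennreal ((s - r) powr (b - 1) * (if r \<le> s \<and> s \<le> v then 1 else 0))" r, symmetric]
    by (simp add: le_diff_eq add.commute)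
  also have "\<dots> = (if r \<le> v then ennreal ((v - r) powr b / b) else 0)"
  proof (cases "r \<le> v")
    case True
    have "(\<integral>\<^sup>+s. ennreal (s powr (b - 1) * (if 0 \<le> s \<and> s \<le> v - r then 1 else 0)) \<partial>lborel)
      = (\<integral>\<^sup>+s. ennreal (s powr (b - 1) * indicator {0..v - r} s) \<partial>lborel)"
      by (intro nn_integral_cong) (auto simp: indicator_def)
    then show ?thesis using True assms nn_integral_powr_from_0[of "b - 1" "v - r"] by simp
  next
    case False
    then have "(\<lambda>s. ennreal (s powr (b - 1) * (if 0 \<le> s \<and> s \<le> v - r then 1 else 0))) = (\<lambda>_. 0)"
      by auto
    with False show ?thesis by simp
  qed
  also have "ennreal (r powr a * indicator {0..u} r) * (if r \<le> v then ennreal ((v - r) powr b / b) else 0)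
    = ennreal (r powr a * (v - r) powr b / b * indicator {0..min u v} r)"
    using assms by (auto simp: ennreal_mult'[symmetric] indicator_def)
  finally show "(\<integral>\<^sup>+s. ennreal (r powr a * (s - r) powr (b - 1) * (indicator {0..u} r * (if r \<le> s \<and> s \<le> v then 1 else 0))) \<partial>lborel)
    = ennreal (r powr a * (v - r) powr b / b * indicator {0..min u v} r)" .
qed

lemma nn_integral_wfb_kernel:
  assumes "a > -1" "b > 0" "0 \<le> u" "0 \<le> v"
  shows "(\<integral>\<^sup>+z. ennreal (indicator ({0..u} \<times> {0..v}) z * wfb_kernel a b (fst z) (snd z)) \<partial>lborel) = ennreal (wfb_covariance a b u v / b)"
proof -
  let ?h = "\<lambda>u v r s. ennreal (r powr a * (s - r) powr (b - 1) * (indicator {0..u} r * (if r \<le> s \<and> s \<le> v then 1 else 0)))"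
  have "(\<integral>\<^sup>+z. ennreal (indicator ({0..u} \<times> {0..v}) z * wfb_kernel a b (fst z) (snd z)) \<partial>lborel)
    = (\<integral>\<^sup>+z. ennreal (indicator ({0..u} \<times> {0..v}) z * wfb_kernel a b (fst z) (snd z)) \<partial>(lborel \<Otimes>\<^sub>M lborel))"
    by (simp add: lborel_prod)
  also have "\<dots> = (\<integral>\<^sup>+r. \<integral>\<^sup>+s. ennreal (indicator ({0..u} \<times> {0..v}) (r, s) * wfb_kernel a b r s) \<partial>lborel \<partial>lborel)"
    by (subst lborel.nn_integral_fst[symmetric]) auto
  \<comment> \<open>The two triangles share the diagonal, but there both terms are 0 because 0
    \<open>powr\<close> x is 0; the equality is exact.\<close>
  also have "\<dots> = (\<integral>\<^sup>+r. \<integral>\<^sup>+s. ?h u v r s + ?h v u s r \<partial>lborel \<partial>lborel)"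
    by (intro nn_integral_cong) (auto simp: wfb_kernel_def indicator_def)
  also have "\<dots> = (\<integral>\<^sup>+r. \<integral>\<^sup>+s. ?h u v r s \<partial>lborel \<partial>lborel) + (\<integral>\<^sup>+r. \<integral>\<^sup>+s. ?h v u s r \<partial>lborel \<partial>lborel)"
    by (subst nn_integral_add[symmetric]) (auto intro!: nn_integral_cong nn_integral_add)
  also have "(\<integral>\<^sup>+r. \<integral>\<^sup>+s. ?h v u s r \<partial>lborel \<partial>lborel) = (\<integral>\<^sup>+s. \<integral>\<^sup>+r. ?h v u s r \<partial>lborel \<partial>lborel)"
    by (rule lborel_pair.Fubini') measurable
  also have "(\<integral>\<^sup>+r. \<integral>\<^sup>+s. ?h u v r s \<partial>lborel \<partial>lborel) = (\<integral>\<^sup>+r. ennreal (r powr a * (v - r) powr b / b * indicator {0..min u v} r) \<partial>lborel)"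
    by (rule nn_integral_wfb_kernel_half[OF assms])
  also have "(\<integral>\<^sup>+r. \<integral>\<^sup>+s. ?h v u r s \<partial>lborel \<partial>lborel) = (\<integral>\<^sup>+r. ennreal (r powr a * (u - r) powr b / b * indicator {0..min v u} r) \<partial>lborel)"
    by (rule nn_integral_wfb_kernel_half[OF assms(1,2,4,3)])
  also have "(\<integral>\<^sup>+r. ennreal (r powr a * (v - r) powr b / b * indicator {0..min u v} r) \<partial>lborel)
     + (\<integral>\<^sup>+r. ennreal (r powr a * (u - r) powr b / b * indicator {0..min v u} r) \<partial>lborel)
     = (\<integral>\<^sup>+r. ennreal (1 / b * (indicator {0..min u v} r * (r powr a * ((u - r) powr b + (v - r) powr b)))) \<partial>lborel)"
    using assms by (subst nn_integral_add[symmetric]) (auto intro!: nn_integral_cong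
        simp: ennreal_plus[symmetric] min.commute indicator_def field_simps simp del: ennreal_plus)
  also have "\<dots> = ennreal (LINT r|lborel. 1 / b * (indicator {0..min u v} r * (r powr a * ((u - r) powr b + (v - r) powr b))))"
  proof (rule nn_integral_eq_integral)
    have i: "integrable lborel (\<lambda>r. 1 / b * (u powr b + v powr b) * (\<bar>r\<bar> powr a * indicator {- min u v..min u v} r))"
      using assms by (intro integrable_mult_right integrable_abs_powr_near_0) auto
    show "integrable lborel (\<lambda>r. 1 / b * (indicator {0..min u v} r * (r powr a * ((u - r) powr b + (v - r) powr b))))"
    proof (rule Bochner_Integration.integrable_bound[OF i])
      have "norm (1 / b * (indicator {0..min u v} r * (r powr a * ((u - r) powr b + (v - r) powr b))))
        \<le> norm (1 / b * (u powr b + v powr b) * (\<bar>r\<bar> powr a * indicator {- min u v..min u v} r))" for r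
      proof (cases "r \<in> {0..min u v}")
        case True
        then have "(u - r) powr b \<le> u powr b" "(v - r) powr b \<le> v powr b"
          using assms by (auto intro!: powr_mono2)
        then have "1 / b * ((u - r) powr b + (v - r) powr b) * r powr a \<le> 1 / b * (u powr b + v powr b) * r powr a"
          using assms by (intro mult_right_mono mult_left_mono) auto
        moreover have "r \<in> {- min u v..min u v}" "\<bar>r\<bar> = r" using True assms by auto
        ultimately show ?thesis using True assms by (simp add: abs_mult mult_ac)
      qed simp
      then show "AE r in lborel. norm (1 / b * (indicator {0..min u v} r * (r powr a * ((u - r) powr b + (v - r) powr b))))
        \<le> norm (1 / b * (u powr b + v powr b) * (\<bar>r\<bar> powr a * indicator {- min u v..min u v} r))" by (intro AE_I2)
    qed simp
  qed (use assms in auto)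
  also have "(LINT r|lborel. 1 / b * (indicator {0..min u v} r * (r powr a * ((u - r) powr b + (v - r) powr b)))) = wfb_covariance a b u v / b"
    by (simp add: wfb_covariance_def set_lebesgue_integral_def)
  finally show ?thesis .
qed

lemma wfb_covariance_nonneg:
  assumes "b > 0" shows "0 \<le> wfb_covariance a b u v"
  unfolding wfb_covariance_def set_lebesgue_integral_def by (intro integral_nonneg_AE AE_I2) auto

lemma wfb_kernel_integral:
  assumes "a > -1" "b > 0" "0 \<le> u" "0 \<le> v"
  shows "integrable lborel (\<lambda>z. indicator ({0..u} \<times> {0..v}) z * wfb_kernel a b (fst z) (snd z))"
    and "(LINT z|lborel. indicator ({0..u} \<times> {0..v}) z * wfb_kernel a b (fst z) (snd z)) = wfb_covariance a b u v / b"
proof -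
  let ?f = "\<lambda>z. indicator ({0..u} \<times> {0..v}) z * wfb_kernel a b (fst z) (snd z)"
  have m: "?f \<in> borel_measurable lborel" by simp
  have 0: "0 \<le> ?f z" for z using wfb_kernel_nonneg by simp
  show "integrable lborel ?f"
    using nn_integral_wfb_kernel[OF assms] 0 m by (intro integrableI_nonneg) auto
  show "(LINT z|lborel. ?f z) = wfb_covariance a b u v / b"
    using nn_integral_wfb_kernel[OF assms] 0 m assms wfb_covariance_nonneg
    by (subst integral_eq_nn_integral) auto
qed

context stable_functional
begin

section \<open>Asymptotics of the second-order term for one type\<close>

lemma p_0: "p 0 x = 0" by (rule stable_density_0)

lemma trans_0: "trans 0 y = 0" by (simp add: trans_def p_0)

lemma potential_0: "potential 0 y = 0" by (simp add: potential_def p_0)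

lemma pair_mass_degenerate: "pair_mass 0 w = 0" "pair_mass u u = 0"
  by (simp_all add: pair_mass_def potential_0 trans_0)

lemma pair_mass_measurable [measurable (raw)]:
  assumes [measurable]: "f \<in> borel_measurable N" "g \<in> borel_measurable N"
  shows "(\<lambda>z. pair_mass (f z) (g z)) \<in> borel_measurable N"
  unfolding pair_mass_def by measurable

definition kern :: "real \<Rightarrow> real \<Rightarrow> real" where
  "kern = wfb_kernel (-\<gamma>/\<alpha>) (1 - 1/\<alpha>)"

lemma kern_measurable [measurable (raw)]:
  assumes [measurable]: "f \<in> borel_measurable N" "g \<in> borel_measurable N"
  shows "(\<lambda>z. kern (f z) (g z)) \<in> borel_measurable N"
  unfolding kern_def by measurable

lemma exponents: "-\<gamma>/\<alpha> > -1" "1 - 1/\<alpha> > 0"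
  using alpha gamma by (auto simp: field_simps)

text \<open>\<open>pair_mass\<close> expects the earlier time first, whereas a product of two time
  integrals runs through both orders.\<close>

definition sym_mass :: "real \<Rightarrow> real \<Rightarrow> real" where
  "sym_mass u w = (if u \<le> w then pair_mass u w else pair_mass w u)"

lemma sym_mass_measurable [measurable (raw)]:
  assumes [measurable]: "f \<in> borel_measurable N" "g \<in> borel_measurable N"
  shows "(\<lambda>z. sym_mass (f z) (g z)) \<in> borel_measurable N"
  unfolding sym_mass_def by measurable

definition mass_bound :: real where
  "mass_bound = potential_bound * p0 * phi_norm * phi_norm"

lemma mass_bound_nonneg: "0 \<le> mass_bound"
  using potential_bound_nonneg p0_nonneg phi_norm_nonneg by (simp add: mass_bound_def)

lemma kern_eq: "r \<le> s \<Longrightarrow> kern r s = r powr (-\<gamma>/\<alpha>) * (s - r) powr (-1/\<alpha>)"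
  by (simp add: kern_def wfb_kernel_def)

lemma kern_nonneg: "0 \<le> kern r s"
  by (simp add: kern_def wfb_kernel_nonneg)

lemma kern_sym: "kern r s = kern s r"
  by (auto simp: kern_def wfb_kernel_def)

lemma sym_mass_abs_le:
  assumes "0 \<le> u" "0 \<le> w"
  shows "\<bar>sym_mass u w\<bar> \<le> mass_bound * kern u w"
proof -
  have *: "\<bar>pair_mass u w\<bar> \<le> mass_bound * kern u w" if "0 \<le> u" "u \<le> w" for u w
  proof (cases "u = 0 \<or> u = w")
    case True
    then show ?thesis using mass_bound_nonneg kern_nonneg by (auto simp: pair_mass_degenerate)
  next
    case False
    then show ?thesis using pair_mass_abs_le[of u w] that
      by (simp add: mass_bound_def kern_eq mult_ac)
  qed
  show ?thesis
  proof (cases "u \<le> w")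
    case False
    then show ?thesis using *[of w u] assms kern_sym[of u w] by (simp add: sym_mass_def)
  qed (use * assms in \<open>simp add: sym_mass_def\<close>)
qed

lemma sym_mass_scaled_tendsto:
  assumes "0 \<le> r" "0 \<le> s"
  shows "((\<lambda>T. T powr ((1 + \<gamma>)/\<alpha>) * sym_mass (T * r) (T * s)) \<longlongrightarrow>
    (potential_const * p0 * (LINT b|lborel. \<phi> b)\<^sup>2) * kern r s) at_top"
proof -
  have *: "((\<lambda>T. T powr ((1 + \<gamma>)/\<alpha>) * pair_mass (T * r) (T * s)) \<longlongrightarrow>
    (potential_const * p0 * (LINT b|lborel. \<phi> b)\<^sup>2) * kern r s) at_top" if "0 \<le> r" "r \<le> s" for r s
  proof (cases "r = 0 \<or> r = s")
    case True
    then show ?thesis using that by (auto simp: pair_mass_degenerate kern_eq)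
  next
    case False
    then show ?thesis using pair_mass_scaled_tendsto[of r s] that by (simp add: kern_eq mult_ac)
  qed
  have ev: "\<forall>\<^sub>F T in at_top. T powr ((1 + \<gamma>)/\<alpha>) * pair_mass (T * min r s) (T * max r s)
      = T powr ((1 + \<gamma>)/\<alpha>) * sym_mass (T * r) (T * s)"
    using eventually_gt_at_top[of 0] by eventually_elim (auto simp: sym_mass_def min_def max_def)
  have "kern (min r s) (max r s) = kern r s" using kern_sym by (auto simp: min_def max_def)
  then show ?thesis
    using Lim_transform_eventually[OF *[of "min r s" "max r s"] ev] assms by simp
qed

definition mass_integral :: "real \<Rightarrow> real \<Rightarrow> real" where
  "mass_integral S S' = (LINT z|lborel. indicator ({0..S} \<times> {0..S'}) z * sym_mass (fst z) (snd z))"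

text \<open>Substituting T z for the pair of times yields T^2, and the pair mass scales like
  T^(-(1+\<gamma>)/\<alpha>). The majorant, a multiple of \<open>kern\<close>, has exactly this
  homogeneity and so does not depend on T after scaling. The divisor 1 - 1/\<alpha> is the b by
  which the kernel integral differs from the covariance.\<close>

theorem mass_integral_tendsto:
  assumes "0 \<le> s" "0 \<le> s'"
  shows "((\<lambda>T. mass_integral (T * s) (T * s') / T powr (2 - (1 + \<gamma>)/\<alpha>)) \<longlongrightarrow>
    potential_const * p0 * (LINT b|lborel. \<phi> b)\<^sup>2 / (1 - 1/\<alpha>) * wfb_covariance (-\<gamma>/\<alpha>) (1 - 1/\<alpha>) s s') at_top"
proof -
  let ?c = "potential_const * p0 * (LINT b|lborel. \<phi> b)\<^sup>2"
  let ?i = "\<lambda>z. indicator ({0..s} \<times> {0..s'}) z :: real"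
  let ?F = "\<lambda>T z. ?i z * (T powr ((1 + \<gamma>)/\<alpha>) * sym_mass (T * fst z) (T * snd z))"
  have "((\<lambda>T. LINT z|lborel. ?F T z) \<longlongrightarrow> (LINT z|lborel. ?i z * (?c * kern (fst z) (snd z)))) at_top"
  proof (rule integral_dominated_convergence_at_top[where w="\<lambda>z. mass_bound * (?i z * kern (fst z) (snd z))"])
    show "integrable lborel (\<lambda>z. mass_bound * (?i z * kern (fst z) (snd z)))"
      by (intro integrable_mult_right wfb_kernel_integral(1)[OF exponents assms, folded kern_def])
    show "AE z in lborel. ((\<lambda>T. ?F T z) \<longlongrightarrow> ?i z * (?c * kern (fst z) (snd z))) at_top"
    proof (rule AE_I2)
      fix z :: "real \<times> real"
      show "((\<lambda>T. ?F T z) \<longlongrightarrow> ?i z * (?c * kern (fst z) (snd z))) at_top"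
      proof (cases "z \<in> {0..s} \<times> {0..s'}")
        case True
        then show ?thesis by (intro tendsto_mult[OF tendsto_const] sym_mass_scaled_tendsto) auto
      qed simp
    qed
    show "\<forall>\<^sub>F T in at_top. AE z in lborel. norm (?F T z) \<le> mass_bound * (?i z * kern (fst z) (snd z))"
      using eventually_gt_at_top[of 0]
    proof (eventually_elim, intro AE_I2)
      fix T :: real and z :: "real \<times> real" assume T: "0 < T"
      show "norm (?F T z) \<le> mass_bound * (?i z * kern (fst z) (snd z))"
      proof (cases "z \<in> {0..s} \<times> {0..s'}")
        case True
        obtain r q where z: "z = (r, q)" by force
        have rq: "0 \<le> r" "0 \<le> q" using True z by auto
        have sc: "T powr ((1 + \<gamma>)/\<alpha>) * kern (T * r) (T * q) = kern r q" if "r \<le> q" "0 \<le> r" for r q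
        proof -
          have e0: "T powr ((1 + \<gamma>)/\<alpha>) = T powr (\<gamma>/\<alpha>) * T powr (1/\<alpha>)"
            by (simp add: add_divide_distrib powr_add)
          have e1: "(T * r) powr (-\<gamma>/\<alpha>) = inverse (T powr (\<gamma>/\<alpha>)) * r powr (-\<gamma>/\<alpha>)"
            using T that powr_minus[of T "\<gamma>/\<alpha>"] by (simp add: powr_mult)
          have e2: "(T * q - T * r) powr (-1/\<alpha>) = inverse (T powr (1/\<alpha>)) * (q - r) powr (-1/\<alpha>)"
            using T that powr_minus[of T "1/\<alpha>"] by (simp add: powr_mult right_diff_distrib[symmetric])
          have cancel: "a * b * ((inverse a * x) * (inverse b * y)) = x * y" if "a \<noteq> 0" "b \<noteq> 0" for a b x y :: real
            using that by (simp add: field_simps)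
          have le: "T * r \<le> T * q" using T that by simp
          show ?thesis unfolding e0 kern_eq[OF le] kern_eq[OF that(1)] e1 e2
            using T by (intro cancel) auto
        qed
        have sc': "T powr ((1 + \<gamma>)/\<alpha>) * kern (T * r) (T * q) = kern r q"
          using sc[of r q] sc[of q r] rq kern_sym[of r q] kern_sym[of "T * r" "T * q"] by (cases "r \<le> q") auto
        have "norm (?F T z) = T powr ((1 + \<gamma>)/\<alpha>) * \<bar>sym_mass (T * r) (T * q)\<bar>"
          using True z by (simp add: abs_mult)
        also have "\<dots> \<le> T powr ((1 + \<gamma>)/\<alpha>) * (mass_bound * kern (T * r) (T * q))"
          using rq T by (intro mult_left_mono sym_mass_abs_le) auto
        also have "\<dots> = mass_bound * kern r q" using sc' by (simp add: mult.left_commute)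
        finally show ?thesis using True z by simp
      qed simp
    qed
  qed auto
  moreover have "\<forall>\<^sub>F T in at_top. (LINT z|lborel. ?F T z) = mass_integral (T * s) (T * s') / T powr (2 - (1 + \<gamma>)/\<alpha>)"
    using eventually_gt_at_top[of 0]
  proof eventually_elim
    case (elim T)
    have "mass_integral (T * s) (T * s') = \<bar>T\<bar> ^ DIM(real \<times> real) *
        (LINT z|lborel. indicator ({0..T * s} \<times> {0..T * s'}) (0 + T *\<^sub>R z) * sym_mass (fst (0 + T *\<^sub>R z)) (snd (0 + T *\<^sub>R z)))"
      unfolding mass_integral_def using elim by (intro lborel_integral_affine) auto
    also have "\<dots> = T\<^sup>2 * (LINT z|lborel. ?i z * sym_mass (T * fst z) (T * snd z))"
      using elim by (intro arg_cong2[where f="(*)"] Bochner_Integration.integral_cong)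
        (auto simp: indicator_def mem_Times_iff power2_eq_square zero_le_mult_iff)
    finally have 1: "mass_integral (T * s) (T * s') = T\<^sup>2 * (LINT z|lborel. ?i z * sym_mass (T * fst z) (T * snd z))" .
    have 2: "T powr (2 - (1 + \<gamma>)/\<alpha>) = T\<^sup>2 / T powr ((1 + \<gamma>)/\<alpha>)"
      using elim by (simp add: powr_diff)
    have "(LINT z|lborel. ?F T z) = T powr ((1 + \<gamma>)/\<alpha>) * (LINT z|lborel. ?i z * sym_mass (T * fst z) (T * snd z))"
      by (simp add: mult.left_commute)
    then show ?case unfolding 1 2 using elim by simp
  qed
  ultimately have "((\<lambda>T. mass_integral (T * s) (T * s') / T powr (2 - (1 + \<gamma>)/\<alpha>)) \<longlongrightarrow> (LINT z|lborel. ?i z * (?c * kern (fst z) (snd z)))) at_top"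
    by (rule Lim_transform_eventually)
  also have "(LINT z|lborel. ?i z * (?c * kern (fst z) (snd z))) = ?c * (LINT z|lborel. ?i z * kern (fst z) (snd z))"
    by (simp add: mult.left_commute[of "indicator _ _"])
  also have "\<dots> = ?c / (1 - 1/\<alpha>) * wfb_covariance (-\<gamma>/\<alpha>) (1 - 1/\<alpha>) s s'"
    by (subst wfb_kernel_integral(2)[OF exponents assms, folded kern_def]) simp
  finally show ?thesis .
qed

section \<open>Moments as functions of the starting point\<close>

definition first_moment :: "real \<Rightarrow> real \<Rightarrow> real" where
  "first_moment S x = (LINT u|lborel. indicator {0..S} u * trans u x)"

text \<open>For u < w, the mean of \<phi>(x + D u) \<phi>(x + D w), evaluated by the Markov property
  at time u; see \<open>expectation_phi_pair\<close>.\<close>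

definition two_point :: "real \<Rightarrow> real \<Rightarrow> real \<Rightarrow> real" where
  "two_point x u w = (LINT a|lborel. p u a * (\<phi> (x + a) * trans (w - u) (x + a)))"

definition sym_two_point :: "real \<Rightarrow> real \<Rightarrow> real \<Rightarrow> real" where
  "sym_two_point x u w = (if u \<le> w then two_point x u w else two_point x w u)"

definition second_moment :: "real \<Rightarrow> real \<Rightarrow> real \<Rightarrow> real" where
  "second_moment S S' x = (LINT z|lborel. indicator ({0..S} \<times> {0..S'}) z * sym_two_point x (fst z) (snd z))"

lemma two_point_measurable [measurable (raw)]:
  assumes [measurable]: "h \<in> borel_measurable N" "f \<in> borel_measurable N" "g \<in> borel_measurable N"
  shows "(\<lambda>z. two_point (h z) (f z) (g z)) \<in> borel_measurable N"
  unfolding two_point_def by measurable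

lemma sym_two_point_measurable [measurable (raw)]:
  assumes [measurable]: "h \<in> borel_measurable N" "f \<in> borel_measurable N" "g \<in> borel_measurable N"
  shows "(\<lambda>z. sym_two_point (h z) (f z) (g z)) \<in> borel_measurable N"
  unfolding sym_two_point_def by measurable

lemma first_moment_measurable [measurable (raw)]:
  assumes [measurable]: "h \<in> borel_measurable N"
  shows "(\<lambda>z. first_moment S (h z)) \<in> borel_measurable N"
  unfolding first_moment_def by measurable

lemma second_moment_measurable [measurable (raw)]:
  assumes [measurable]: "h \<in> borel_measurable N"
  shows "(\<lambda>z. second_moment S S' (h z)) \<in> borel_measurable N"
  unfolding second_moment_def by measurable

lemma two_point_shift: "two_point x u w = (LINT y|lborel. p u (y - x) * (\<phi> y * trans (w - u) y))"
  unfolding two_point_def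
  using integral_lborel_shift[of "\<lambda>y. p u (y - x) * (\<phi> y * trans (w - u) y)" x] by simp

text \<open>Integrating the absolute values over x first produces the potential, of order
  u^(-\<gamma>/\<alpha>). This finiteness justifies the exchange of integrals in
  \<open>integral_weight_two_point\<close>.\<close>

lemma nn_two_point_integrand_le:
  assumes "0 \<le> u" "u \<le> w"
  shows "(\<integral>\<^sup>+x. \<integral>\<^sup>+y. ennreal \<bar>\<bar>x\<bar> powr (-\<gamma>) * (p u (y - x) * (\<phi> y * trans (w - u) y))\<bar> \<partial>lborel \<partial>lborel) \<le> ennreal (mass_bound * kern u w)"
proof (cases "u = 0 \<or> u = w")
  case True
  then have z: "p u (y - x) * (\<phi> y * trans (w - u) y) = 0" for x y by (auto simp: p_0 trans_0)
  show ?thesis unfolding z by simp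
next
  case False
  with assms have uw: "0 < u" "u < w" by auto
  let ?g = "\<lambda>y. \<bar>\<phi> y * trans (w - u) y\<bar>"
  let ?c = "u powr (-\<gamma>/\<alpha>) * (w - u) powr (-1/\<alpha>) * (potential_bound * p0 * phi_norm)"
  have "(\<integral>\<^sup>+x. \<integral>\<^sup>+y. ennreal \<bar>\<bar>x\<bar> powr (-\<gamma>) * (p u (y - x) * (\<phi> y * trans (w - u) y))\<bar> \<partial>lborel \<partial>lborel)
    = (\<integral>\<^sup>+y. \<integral>\<^sup>+x. ennreal \<bar>\<bar>x\<bar> powr (-\<gamma>) * (p u (y - x) * (\<phi> y * trans (w - u) y))\<bar> \<partial>lborel \<partial>lborel)"
    by (rule lborel_pair.Fubini'[symmetric]) measurable
  also have "\<dots> = (\<integral>\<^sup>+y. ennreal (potential u y * ?g y) \<partial>lborel)"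
  proof (rule nn_integral_cong)
    fix y
    have "(\<integral>\<^sup>+x. ennreal \<bar>\<bar>x\<bar> powr (-\<gamma>) * (p u (y - x) * (\<phi> y * trans (w - u) y))\<bar> \<partial>lborel)
      = (\<integral>\<^sup>+x. ennreal (\<bar>x\<bar> powr (-\<gamma>) * p u (y - x)) * ennreal (?g y) \<partial>lborel)"
      using p_nonneg[OF uw(1)] by (intro nn_integral_cong) (simp add: ennreal_mult'[symmetric] abs_mult mult.assoc)
    also have "\<dots> = (\<integral>\<^sup>+x. ennreal (\<bar>x\<bar> powr (-\<gamma>) * p u (y - x)) \<partial>lborel) * ennreal (?g y)"
      by (rule nn_integral_multc) simp
    also have "\<dots> = ennreal (potential u y * ?g y)"
      unfolding nn_potential_eq[OF uw(1)] using potential_nonneg[OF uw(1)] by (simp add: ennreal_mult')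
    finally show "(\<integral>\<^sup>+x. ennreal \<bar>\<bar>x\<bar> powr (-\<gamma>) * (p u (y - x) * (\<phi> y * trans (w - u) y))\<bar> \<partial>lborel) = ennreal (potential u y * ?g y)" .
  qed
  also have "\<dots> \<le> (\<integral>\<^sup>+y. ennreal ?c * ennreal \<bar>\<phi> y\<bar> \<partial>lborel)"
    using pair_mass_integrand_le[OF uw] potential_nonneg[OF uw(1)] potential_bound_nonneg p0_nonneg phi_norm_nonneg
    by (intro nn_integral_mono) (simp add: ennreal_mult'[symmetric] abs_mult)
  also have "\<dots> = ennreal ?c * ennreal phi_norm"
    by (subst nn_integral_cmult) (auto simp: nn_integral_phi)
  also have "\<dots> = ennreal (mass_bound * kern u w)"
    using potential_bound_nonneg p0_nonneg phi_norm_nonneg uw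
    by (subst ennreal_mult'[symmetric]) (auto simp: mass_bound_def kern_eq mult_ac)
  finally show ?thesis .
qed

lemma ennreal_abs_integral_le:
  "ennreal \<bar>LINT y|lborel. f y\<bar> \<le> (\<integral>\<^sup>+y. ennreal \<bar>f y\<bar> \<partial>lborel)" for f :: "real \<Rightarrow> real"
  using integral_norm_bound_ennreal[of lborel f] by (cases "integrable lborel f") (auto simp: not_integrable_integral_eq)

lemma integral_weight_two_point:
  assumes "0 \<le> u" "u \<le> w"
  shows "(LINT x|lborel. \<bar>x\<bar> powr (-\<gamma>) * two_point x u w) = pair_mass u w"
    and "(\<integral>\<^sup>+x. ennreal \<bar>\<bar>x\<bar> powr (-\<gamma>) * two_point x u w\<bar> \<partial>lborel) \<le> ennreal (mass_bound * kern u w)"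
proof -
  let ?F = "\<lambda>x y. \<bar>x\<bar> powr (-\<gamma>) * (p u (y - x) * (\<phi> y * trans (w - u) y))"
  have I: "integrable (lborel \<Otimes>\<^sub>M lborel) (\<lambda>(x, y). ?F x y)"
  proof (rule integrableI_bounded)
    have "(\<integral>\<^sup>+z. ennreal (norm (case z of (x, y) \<Rightarrow> ?F x y)) \<partial>(lborel \<Otimes>\<^sub>M lborel)) = (\<integral>\<^sup>+x. \<integral>\<^sup>+y. ennreal \<bar>?F x y\<bar> \<partial>lborel \<partial>lborel)"
      by (subst lborel.nn_integral_fst[symmetric]) (auto simp: split_beta')
    also have "\<dots> < \<infinity>"
      using nn_two_point_integrand_le[OF assms] by (rule le_less_trans) simp
    finally show "(\<integral>\<^sup>+z. ennreal (norm (case z of (x, y) \<Rightarrow> ?F x y)) \<partial>(lborel \<Otimes>\<^sub>M lborel)) < \<infinity>" .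
  qed (simp add: split_beta')
  have eq: "\<bar>x\<bar> powr (-\<gamma>) * two_point x u w = (LINT y|lborel. ?F x y)" for x
    by (simp add: two_point_shift)
  have "(LINT x|lborel. \<bar>x\<bar> powr (-\<gamma>) * two_point x u w) = (LINT y|lborel. (LINT x|lborel. ?F x y))"
    unfolding eq using lborel_pair.Fubini_integral[OF I] by simp
  also have "\<dots> = pair_mass u w"
    unfolding pair_mass_def potential_def
    by (intro Bochner_Integration.integral_cong) (auto simp: mult.assoc[symmetric])
  finally show "(LINT x|lborel. \<bar>x\<bar> powr (-\<gamma>) * two_point x u w) = pair_mass u w" .
  have "(\<integral>\<^sup>+x. ennreal \<bar>\<bar>x\<bar> powr (-\<gamma>) * two_point x u w\<bar> \<partial>lborel) \<le> (\<integral>\<^sup>+x. \<integral>\<^sup>+y. ennreal \<bar>?F x y\<bar> \<partial>lborel \<partial>lborel)"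
    unfolding eq by (intro nn_integral_mono ennreal_abs_integral_le)
  also have "\<dots> \<le> ennreal (mass_bound * kern u w)" by (rule nn_two_point_integrand_le[OF assms])
  finally show "(\<integral>\<^sup>+x. ennreal \<bar>\<bar>x\<bar> powr (-\<gamma>) * two_point x u w\<bar> \<partial>lborel) \<le> ennreal (mass_bound * kern u w)" .
qed

lemma integral_weight_sym_two_point:
  assumes "0 \<le> u" "0 \<le> w"
  shows "(LINT x|lborel. \<bar>x\<bar> powr (-\<gamma>) * sym_two_point x u w) = sym_mass u w"
    and "(\<integral>\<^sup>+x. ennreal \<bar>\<bar>x\<bar> powr (-\<gamma>) * sym_two_point x u w\<bar> \<partial>lborel) \<le> ennreal (mass_bound * kern u w)"
  unfolding sym_two_point_def sym_mass_def
  using integral_weight_two_point[of u w] integral_weight_two_point[of w u] assms kern_sym[of u w]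
  by (cases "u \<le> w"; simp)+

lemma power_intensity_eq: "power_intensity \<gamma> = density lborel (\<lambda>x. ennreal (\<bar>x\<bar> powr (-\<gamma>)))"
  by (simp add: power_intensity_def powr_minus_divide)

text \<open>Fubini between the starting point and the pair of times. The majorant
  \<open>kern\<close> has a finite integral over the box, by the covariance formula.\<close>

lemma second_moment_integral:
  assumes S: "0 \<le> S" "0 \<le> S'"
  shows "integrable (power_intensity \<gamma>) (second_moment S S')"
    and "(LINT x|power_intensity \<gamma>. second_moment S S' x) = mass_integral S S'"
proof -
  let ?i = "\<lambda>z. indicator ({0..S} \<times> {0..S'}) z :: real"
  let ?F = "\<lambda>x z. \<bar>x\<bar> powr (-\<gamma>) * (?i z * sym_two_point x (fst z) (snd z))"
  have I: "integrable (lborel \<Otimes>\<^sub>M lborel) (\<lambda>(x, z). ?F x z)"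
  proof (rule integrableI_bounded)
    have "(\<integral>\<^sup>+v. ennreal (norm (case v of (x, z) \<Rightarrow> ?F x z)) \<partial>(lborel \<Otimes>\<^sub>M lborel)) = (\<integral>\<^sup>+z. \<integral>\<^sup>+x. ennreal \<bar>?F x z\<bar> \<partial>lborel \<partial>lborel)"
      by (subst lborel_pair.nn_integral_snd[symmetric]) (auto simp: split_beta')
    also have "\<dots> \<le> (\<integral>\<^sup>+z. ennreal mass_bound * ennreal (?i z * kern (fst z) (snd z)) \<partial>lborel)"
    proof (rule nn_integral_mono)
      fix z :: "real \<times> real"
      show "(\<integral>\<^sup>+x. ennreal \<bar>?F x z\<bar> \<partial>lborel) \<le> ennreal mass_bound * ennreal (?i z * kern (fst z) (snd z))"
      proof (cases "z \<in> {0..S} \<times> {0..S'}")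
        case True
        then have "0 \<le> fst z" "0 \<le> snd z" by (auto simp: mem_Times_iff)
        from integral_weight_sym_two_point(2)[OF this] show ?thesis
          using True mass_bound_nonneg by (simp add: ennreal_mult'[symmetric])
      qed simp
    qed
    also have "\<dots> = ennreal mass_bound * (\<integral>\<^sup>+z. ennreal (?i z * kern (fst z) (snd z)) \<partial>lborel)"
      by (rule nn_integral_cmult) simp
    also have "\<dots> < \<infinity>"
      by (subst nn_integral_wfb_kernel[OF exponents S, folded kern_def]) (simp add: ennreal_mult_less_top)
    finally show "(\<integral>\<^sup>+v. ennreal (norm (case v of (x, z) \<Rightarrow> ?F x z)) \<partial>(lborel \<Otimes>\<^sub>M lborel)) < \<infinity>" .
  qed (simp add: split_beta')
  have eq: "\<bar>x\<bar> powr (-\<gamma>) * second_moment S S' x = (LINT z|lborel. ?F x z)" for x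
    by (simp add: second_moment_def)
  have "integrable lborel (\<lambda>x. \<bar>x\<bar> powr (-\<gamma>) * second_moment S S' x)"
    unfolding eq using lborel_pair.integrable_fst'[OF I] by simp
  then show "integrable (power_intensity \<gamma>) (second_moment S S')"
    unfolding power_intensity_eq by (subst integrable_density) auto
  have "(LINT x|power_intensity \<gamma>. second_moment S S' x) = (LINT x|lborel. \<bar>x\<bar> powr (-\<gamma>) * second_moment S S' x)"
    unfolding power_intensity_eq by (subst integral_density) auto
  also have "\<dots> = (LINT z|lborel. (LINT x|lborel. ?F x z))"
    unfolding eq using lborel_pair.Fubini_integral[OF I] by simp
  also have "\<dots> = mass_integral S S'"
    unfolding mass_integral_def
  proof (rule Bochner_Integration.integral_cong[OF refl])
    fix z :: "real \<times> real"
    show "(LINT x|lborel. ?F x z) = ?i z * sym_mass (fst z) (snd z)"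
    proof (cases "z \<in> {0..S} \<times> {0..S'}")
      case True
      then have "0 \<le> fst z" "0 \<le> snd z" by (auto simp: mem_Times_iff)
      from integral_weight_sym_two_point(1)[OF this] show ?thesis using True by simp
    qed simp
  qed
  finally show "(LINT x|power_intensity \<gamma>. second_moment S S' x) = mass_integral S S'" .
qed

text \<open>Integrating out the starting point turns the density into the potential, at most
  u^(-\<gamma>/\<alpha>) \<open>potential_bound\<close>; integration over time gives the power of S.
  This is the first-moment factor in the third-order error.\<close>

lemma nn_integral_green_power_intensity:
  assumes "0 \<le> S"
  shows "(\<integral>\<^sup>+x. green (\<lambda>y. ennreal \<bar>\<phi> y\<bar>) S x \<partial>power_intensity \<gamma>)
    \<le> ennreal (S powr (1 - \<gamma>/\<alpha>) / (1 - \<gamma>/\<alpha>) * (potential_bound * phi_norm))"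
proof -
  let ?f = "\<lambda>y. ennreal \<bar>\<phi> y\<bar>" and ?w = "\<lambda>x::real. ennreal (\<bar>x\<bar> powr (-\<gamma>))"
  have "(\<integral>\<^sup>+x. green ?f S x \<partial>power_intensity \<gamma>) = (\<integral>\<^sup>+x. ?w x * green ?f S x \<partial>lborel)"
    unfolding power_intensity_eq by (subst nn_integral_density) (auto simp: green_def)
  also have "\<dots> = (\<integral>\<^sup>+x. \<integral>\<^sup>+u. \<integral>\<^sup>+y. ?w x * (ennreal (p u (y - x)) * ?f y) * indicator {0..S} u \<partial>lborel \<partial>lborel \<partial>lborel)"
  proof (rule nn_integral_cong)
    fix x
    have "(\<integral>\<^sup>+a. ennreal (p u a) * ?f (x + a) \<partial>lborel) = (\<integral>\<^sup>+y. ennreal (p u (y - x)) * ?f y \<partial>lborel)" for u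
      using nn_integral_lborel_shift[of "\<lambda>y. ennreal (p u (y - x)) * ?f y" x] by simp
    moreover have "(\<integral>\<^sup>+y. ?w x * (ennreal (p u (y - x)) * ?f y) * indicator {0..S} u \<partial>lborel)
      = ?w x * ((\<integral>\<^sup>+y. ennreal (p u (y - x)) * ?f y \<partial>lborel) * indicator {0..S} u)" for u
      by (subst nn_integral_multc, simp, subst nn_integral_cmult) (simp_all add: mult.assoc)
    ultimately show "?w x * green ?f S x = (\<integral>\<^sup>+u. \<integral>\<^sup>+y. ?w x * (ennreal (p u (y - x)) * ?f y) * indicator {0..S} u \<partial>lborel \<partial>lborel)"
      unfolding green_def by (simp add: nn_integral_cmult)
  qed
  also have "\<dots> = (\<integral>\<^sup>+u. \<integral>\<^sup>+x. \<integral>\<^sup>+y. ?w x * (ennreal (p u (y - x)) * ?f y) * indicator {0..S} u \<partial>lborel \<partial>lborel \<partial>lborel)"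
    by (rule lborel_pair.Fubini') measurable
  also have "\<dots> = (\<integral>\<^sup>+u. \<integral>\<^sup>+y. \<integral>\<^sup>+x. ?w x * (ennreal (p u (y - x)) * ?f y) * indicator {0..S} u \<partial>lborel \<partial>lborel \<partial>lborel)"
    by (intro nn_integral_cong lborel_pair.Fubini') measurable
  also have "\<dots> \<le> (\<integral>\<^sup>+u. \<integral>\<^sup>+y. ennreal (u powr (-\<gamma>/\<alpha>) * potential_bound * indicator {0..S} u) * ?f y \<partial>lborel \<partial>lborel)"
  proof (intro nn_integral_mono)
    fix u y :: real
    show "(\<integral>\<^sup>+x. ?w x * (ennreal (p u (y - x)) * ?f y) * indicator {0..S} u \<partial>lborel) \<le> ennreal (u powr (-\<gamma>/\<alpha>) * potential_bound * indicator {0..S} u) * ?f y"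
    proof (cases "0 < u \<and> u \<le> S")
      case True
      have "(\<integral>\<^sup>+x. ?w x * (ennreal (p u (y - x)) * ?f y) * indicator {0..S} u \<partial>lborel) = (\<integral>\<^sup>+x. ennreal (\<bar>x\<bar> powr (-\<gamma>) * p u (y - x)) * ?f y \<partial>lborel)"
        using True by (intro nn_integral_cong) (simp add: ennreal_mult' mult.assoc)
      also have "\<dots> = (\<integral>\<^sup>+x. ennreal (\<bar>x\<bar> powr (-\<gamma>) * p u (y - x)) \<partial>lborel) * ?f y"
        by (rule nn_integral_multc) simp
      also have "\<dots> \<le> ennreal (u powr (-\<gamma>/\<alpha>) * potential_bound) * ?f y"
        using True by (intro mult_right_mono nn_potential_le) auto
      finally show ?thesis using True by simp
    next
      case False
      then have "ennreal (p u (y - x)) * indicator {0..S} u = 0" for x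
        by (cases "u = 0") (auto simp: p_0 indicator_def)
      then have z: "?w x * (ennreal (p u (y - x)) * ?f y) * indicator {0..S} u = 0" for x
        by (metis (no_types, lifting) mult.assoc mult.commute mult_zero_left)
      show ?thesis unfolding z by simp
    qed
  qed
  also have "\<dots> = (\<integral>\<^sup>+u. ennreal (u powr (-\<gamma>/\<alpha>) * potential_bound * indicator {0..S} u) * ennreal phi_norm \<partial>lborel)"
    by (simp add: nn_integral_cmult nn_integral_phi)
  also have "\<dots> = (\<integral>\<^sup>+u. ennreal (potential_bound * phi_norm) * ennreal (u powr (-\<gamma>/\<alpha>) * indicator {0..S} u) \<partial>lborel)"
    using potential_bound_nonneg phi_norm_nonneg
    by (intro nn_integral_cong) (simp add: ennreal_mult'[symmetric] mult_ac)
  also have "\<dots> = ennreal (potential_bound * phi_norm) * ennreal (S powr (-\<gamma>/\<alpha> + 1) / (-\<gamma>/\<alpha> + 1))"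
    using assms exponents by (subst nn_integral_cmult, simp, subst nn_integral_powr_from_0) auto
  also have "\<dots> = ennreal (S powr (1 - \<gamma>/\<alpha>) / (1 - \<gamma>/\<alpha>) * (potential_bound * phi_norm))"
    using potential_bound_nonneg phi_norm_nonneg by (simp add: ennreal_mult'[symmetric] mult.commute)
  finally show ?thesis .
qed

end

section \<open>Moments of the additive functional of a path\<close>

lemma AE_lborel_pair_generic: "AE z::real \<times> real in lborel. fst z \<noteq> 0 \<and> snd z \<noteq> 0 \<and> fst z \<noteq> snd z"
proof -
  have "AE z in (lborel \<Otimes>\<^sub>M lborel :: (real \<times> real) measure). fst z \<noteq> 0 \<and> snd z \<noteq> 0 \<and> fst z \<noteq> snd z"
  proof (rule lborel_pair.AE_pair_measure)
    show "AE u in (lborel::real measure). AE w in lborel. fst (u, w) \<noteq> 0 \<and> snd (u, w) \<noteq> 0 \<and> fst (u, w) \<noteq> snd (u, w)"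
      using AE_lborel_singleton[of "0::real"]
    proof eventually_elim
      case (elim u)
      show ?case using AE_lborel_singleton[of "0::real"] AE_lborel_singleton[of u]
        by eventually_elim (use elim in auto)
    qed
  qed measurable
  then show ?thesis unfolding lborel_prod .
qed

locale stable_motion_functional = stable_motion M \<alpha> D + stable_functional \<alpha> \<gamma> \<phi>
  for M :: "'a measure" and \<alpha> :: real and D :: "real \<Rightarrow> 'a \<Rightarrow> real" and \<gamma> :: real and \<phi> :: "real \<Rightarrow> real"
begin

abbreviation "abs_phi \<equiv> \<lambda>y. ennreal \<bar>\<phi> y\<bar>"

definition additive :: "real \<Rightarrow> real \<Rightarrow> 'a \<Rightarrow> real" where
  "additive S x \<omega> = (LINT u|lborel. indicator {0..S} u * \<phi> (x + D u \<omega>))"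

lemma additive_measurable [measurable (raw)]:
  assumes [measurable]: "g \<in> borel_measurable N" "h \<in> measurable N M"
  shows "(\<lambda>z. additive S (g z) (h z)) \<in> borel_measurable N"
  unfolding additive_def by measurable

lemma additive_abs_le:
  assumes "S \<le> S'"
  shows "ennreal \<bar>additive S x \<omega>\<bar> \<le> occ abs_phi S' x \<omega>"
proof -
  have "ennreal \<bar>additive S x \<omega>\<bar> \<le> (\<integral>\<^sup>+u. ennreal \<bar>indicator {0..S} u * \<phi> (x + D u \<omega>)\<bar> \<partial>lborel)"
    unfolding additive_def by (rule ennreal_abs_integral_le)
  also have "\<dots> \<le> occ abs_phi S' x \<omega>"
    unfolding occ_def using assms by (intro nn_integral_mono) (auto simp: indicator_def)
  finally show ?thesis .
qed

lemma green_bound_phi: "green_bound abs_phi S = ennreal (S powr (1 - 1/\<alpha>) / (1 - 1/\<alpha>) * p0 * phi_norm)"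
proof -
  have "0 \<le> S powr (1 - 1/\<alpha>) / (1 - 1/\<alpha>) * p0" using p0_nonneg exponents by simp
  from ennreal_mult'[OF this, of phi_norm] show ?thesis by (simp only: green_bound_def nn_integral_phi)
qed

lemma green_phi_finite: "0 \<le> S \<Longrightarrow> green abs_phi S x < \<infinity>"
  using green_le[of abs_phi S x] by (simp add: green_bound_phi le_less_trans[OF _ ennreal_less_top])

lemma nn_expectation_occ_cube_le:
  assumes "0 \<le> S"
  shows "(\<integral>\<^sup>+\<omega>. occ abs_phi S x \<omega> ^ 3 \<partial>M) \<le> 6 * (green_bound abs_phi S)\<^sup>2 * green abs_phi S x"
proof -
  have "(\<integral>\<^sup>+\<omega>. occ abs_phi S x \<omega> ^ 3 \<partial>M) \<le> 3 * green_bound abs_phi S * (\<integral>\<^sup>+\<omega>. occ abs_phi S x \<omega> ^ 2 \<partial>M)"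
    using assms by (intro nn_expectation_occ_cube) auto
  also have "\<dots> \<le> 3 * green_bound abs_phi S * (2 * green_bound abs_phi S * green abs_phi S x)"
    using assms by (intro mult_left_mono nn_expectation_occ_square) auto
  also have "\<dots> = 6 * (green_bound abs_phi S)\<^sup>2 * green abs_phi S x"
  proof -
    have "3 * b * (2 * b * c) = (3 * 2) * b\<^sup>2 * c" for b c :: ennreal
      by (simp only: power2_eq_square mult_ac)
    then show ?thesis by simp
  qed
  finally show ?thesis .
qed

lemma expectation_phi_D:
  assumes "0 < u"
  shows "(LINT \<omega>|M. \<phi> (x + D u \<omega>)) = trans u x"
  using distributed_integral[OF D_density[OF assms], of "\<lambda>a. \<phi> (x + a)"] p_nonneg[OF assms]
  by (simp add: trans_def)

lemma expectation_phi_increment: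
  assumes "0 < v" "v < w"
  shows "(LINT \<omega>|M. \<phi> (x + (D w \<omega> - D v \<omega>))) = trans (w - v) x"
  using distributed_integral[OF D_increment[OF assms], of "\<lambda>a. \<phi> (x + a)"] p_nonneg[of "w - v"] assms
  by (simp add: trans_def)

lemma expectation_phi_pair:
  assumes uw: "0 < u" "u < w"
  shows "(LINT \<omega>|M. \<phi> (x + D u \<omega>) * \<phi> (x + D w \<omega>)) = two_point x u w"
proof -
  \<comment> \<open>\<open>D_indep\<close> takes a pair of past positions; here both past times are
    u, so a and b stand for the same number.\<close>
  let ?G = "\<lambda>((a, b), c). \<phi> (x + a) * \<phi> (x + b + c)"
  have fin1: "(\<integral>\<^sup>+\<omega>. abs_phi (x + D u \<omega>) \<partial>M) < \<infinity>"
  proof -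
    have "(\<integral>\<^sup>+\<omega>. abs_phi (x + D u \<omega>) \<partial>M) = (\<integral>\<^sup>+a. ennreal (p u a) * abs_phi (x + a) \<partial>lborel)"
      using uw by (intro nn_expectation_D) auto
    also have "\<dots> \<le> (\<integral>\<^sup>+a. ennreal (u powr (-1/\<alpha>) * p0) * abs_phi (x + a) \<partial>lborel)"
      using p_le[OF uw(1)] by (intro nn_integral_mono mult_right_mono ennreal_leI) auto
    also have "\<dots> = ennreal (u powr (-1/\<alpha>) * p0) * ennreal phi_norm"
      by (subst nn_integral_cmult, simp, subst nn_integral_lborel_shift[of abs_phi]) (auto simp: nn_integral_phi)
    also have "\<dots> < \<infinity>" by (simp add: ennreal_mult_less_top)
    finally show ?thesis .
  qed
  have int: "integrable M (\<lambda>\<omega>. \<phi> (x + D u \<omega>) * \<phi> (x + D w \<omega>))"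
  proof (rule integrableI_bounded)
    have "(\<integral>\<^sup>+\<omega>. ennreal (norm (\<phi> (x + D u \<omega>) * \<phi> (x + D w \<omega>))) \<partial>M)
      = (\<integral>\<^sup>+\<omega>. (\<lambda>(a, b). abs_phi (x + a)) (D u \<omega>, D u \<omega>) * abs_phi (x + D w \<omega>) \<partial>M)"
      by (intro nn_integral_cong) (simp add: abs_mult ennreal_mult')
    also have "\<dots> \<le> ennreal ((w - u) powr (-1/\<alpha>) * p0) * (\<integral>\<^sup>+y. abs_phi y \<partial>lborel) * (\<integral>\<^sup>+\<omega>. (\<lambda>(a, b). abs_phi (x + a)) (D u \<omega>, D u \<omega>) \<partial>M)"
      using uw by (intro nn_expectation_markov_le) (auto simp: split_beta')
    also have "\<dots> < \<infinity>"
      using fin1 by (simp add: nn_integral_phi ennreal_mult_less_top)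
    finally show "(\<integral>\<^sup>+\<omega>. ennreal (norm (\<phi> (x + D u \<omega>) * \<phi> (x + D w \<omega>))) \<partial>M) < \<infinity>" .
  qed simp
  have "(LINT \<omega>|M. \<phi> (x + D u \<omega>) * \<phi> (x + D w \<omega>)) = (LINT \<omega>|M. ?G ((D u \<omega>, D u \<omega>), D w \<omega> - D u \<omega>))"
    by simp
  also have "\<dots> = (LINT \<omega>|M. (LINT \<omega>'|M. ?G ((D u \<omega>, D u \<omega>), D w \<omega>' - D u \<omega>')))"
    using int uw by (intro integral_indep_pair[OF D_indep]) (auto simp: split_beta')
  also have "\<dots> = (LINT \<omega>|M. \<phi> (x + D u \<omega>) * trans (w - u) (x + D u \<omega>))"
    by (simp add: expectation_phi_increment[OF uw])
  also have "\<dots> = two_point x u w"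
    unfolding two_point_def
    using distributed_integral[OF D_density[OF uw(1)], of "\<lambda>a. \<phi> (x + a) * trans (w - u) (x + a)"] p_nonneg[OF uw(1)]
    by simp
  finally show ?thesis .
qed

lemma integrable_additive:
  assumes "0 \<le> S" shows "integrable M (additive S x)"
proof (rule integrableI_bounded)
  have "(\<integral>\<^sup>+\<omega>. ennreal (norm (additive S x \<omega>)) \<partial>M) \<le> (\<integral>\<^sup>+\<omega>. occ abs_phi S x \<omega> \<partial>M)"
    using additive_abs_le by (intro nn_integral_mono) auto
  also have "\<dots> < \<infinity>" using green_phi_finite[OF assms] by (simp add: nn_expectation_occ)
  finally show "(\<integral>\<^sup>+\<omega>. ennreal (norm (additive S x \<omega>)) \<partial>M) < \<infinity>" .
qed simp

lemma expectation_additive: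
  assumes "0 \<le> S"
  shows "(LINT \<omega>|M. additive S x \<omega>) = first_moment S x"
proof -
  interpret P: pair_sigma_finite lborel M ..
  let ?F = "\<lambda>u \<omega>. indicator {0..S} u * \<phi> (x + D u \<omega>)"
  have I: "integrable (lborel \<Otimes>\<^sub>M M) (\<lambda>(u, \<omega>). ?F u \<omega>)"
  proof (rule integrableI_bounded)
    have "(\<integral>\<^sup>+z. ennreal (norm (case z of (u, \<omega>) \<Rightarrow> ?F u \<omega>)) \<partial>(lborel \<Otimes>\<^sub>M M)) = (\<integral>\<^sup>+\<omega>. \<integral>\<^sup>+u. ennreal \<bar>?F u \<omega>\<bar> \<partial>lborel \<partial>M)"
      by (subst P.nn_integral_snd[symmetric]) (auto simp: split_beta')
    also have "\<dots> = (\<integral>\<^sup>+\<omega>. occ abs_phi S x \<omega> \<partial>M)"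
      unfolding occ_def by (intro nn_integral_cong) (auto simp: indicator_def)
    also have "\<dots> < \<infinity>" using green_phi_finite[OF assms] by (simp add: nn_expectation_occ)
    finally show "(\<integral>\<^sup>+z. ennreal (norm (case z of (u, \<omega>) \<Rightarrow> ?F u \<omega>)) \<partial>(lborel \<Otimes>\<^sub>M M)) < \<infinity>" .
  qed (simp add: split_beta')
  have "(LINT \<omega>|M. additive S x \<omega>) = (LINT u|lborel. (LINT \<omega>|M. ?F u \<omega>))"
    unfolding additive_def using P.Fubini_integral[OF I] by simp
  also have "\<dots> = first_moment S x"
    unfolding first_moment_def
  proof (rule integral_cong_AE)
    have "(LINT \<omega>|M. ?F u \<omega>) = indicator {0..S} u * trans u x" if "u \<noteq> 0" for u
      using that expectation_phi_D[of u x] by (cases "u \<in> {0..S}") auto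
    then show "AE u in lborel. (LINT \<omega>|M. ?F u \<omega>) = indicator {0..S} u * trans u x"
      using AE_lborel_singleton[of 0] by (auto elim!: AE_mp)
  qed auto
  finally show ?thesis .
qed

lemma nn_expectation_occ_square_finite:
  assumes "0 \<le> S" shows "(\<integral>\<^sup>+\<omega>. occ abs_phi S x \<omega> ^ 2 \<partial>M) < \<infinity>"
proof -
  have "(\<integral>\<^sup>+\<omega>. occ abs_phi S x \<omega> ^ 2 \<partial>M) \<le> 2 * green_bound abs_phi S * green abs_phi S x"
    using assms by (intro nn_expectation_occ_square) auto
  also have "\<dots> < \<infinity>" using green_phi_finite[OF assms, of x] by (simp add: green_bound_phi ennreal_mult_less_top)
  finally show ?thesis .
qed

lemma additive_mult_abs_le:
  "ennreal \<bar>additive S x \<omega> * additive S' x \<omega>\<bar> \<le> occ abs_phi (max S S') x \<omega> ^ 2"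
  using mult_mono[OF additive_abs_le[of S "max S S'" x \<omega>] additive_abs_le[of S' "max S S'" x \<omega>]]
  by (simp add: abs_mult ennreal_mult' power2_eq_square)

lemma integrable_additive_mult:
  assumes "0 \<le> S" "0 \<le> S'" shows "integrable M (\<lambda>\<omega>. additive S x \<omega> * additive S' x \<omega>)"
proof (rule integrableI_bounded)
  have "(\<integral>\<^sup>+\<omega>. ennreal (norm (additive S x \<omega> * additive S' x \<omega>)) \<partial>M) \<le> (\<integral>\<^sup>+\<omega>. occ abs_phi (max S S') x \<omega> ^ 2 \<partial>M)"
    unfolding real_norm_def by (intro nn_integral_mono additive_mult_abs_le)
  also have "\<dots> < \<infinity>" using assms by (intro nn_expectation_occ_square_finite) auto
  finally show "(\<integral>\<^sup>+\<omega>. ennreal (norm (additive S x \<omega> * additive S' x \<omega>)) \<partial>M) < \<infinity>" .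
qed simp

lemma expectation_additive_mult:
  assumes S: "0 \<le> S" "0 \<le> S'"
  shows "(LINT \<omega>|M. additive S x \<omega> * additive S' x \<omega>) = second_moment S S' x"
proof -
  interpret P: pair_sigma_finite "lborel :: (real \<times> real) measure" M ..
  define m where "m = max S S'"
  let ?f = "\<lambda>S \<omega> u. indicator {0..S} u * \<phi> (x + D u \<omega>)"
  let ?F = "\<lambda>z \<omega>. indicator ({0..S} \<times> {0..S'}) z * (\<phi> (x + D (fst z) \<omega>) * \<phi> (x + D (snd z) \<omega>))"
  have F: "?F z \<omega> = ?f S \<omega> (fst z) * ?f S' \<omega> (snd z)" for z \<omega>
    by (auto simp: indicator_def mem_Times_iff)
  have I: "integrable (lborel \<Otimes>\<^sub>M M) (\<lambda>(z, \<omega>). ?F z \<omega>)"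
  proof (rule integrableI_bounded)
    have "(\<integral>\<^sup>+v. ennreal (norm (case v of (z, \<omega>) \<Rightarrow> ?F z \<omega>)) \<partial>(lborel \<Otimes>\<^sub>M M)) = (\<integral>\<^sup>+\<omega>. \<integral>\<^sup>+z. ennreal \<bar>?F z \<omega>\<bar> \<partial>lborel \<partial>M)"
      by (subst P.nn_integral_snd[symmetric]) (auto simp: split_beta')
    also have "\<dots> \<le> (\<integral>\<^sup>+\<omega>. occ abs_phi m x \<omega> ^ 2 \<partial>M)"
    proof (rule nn_integral_mono)
      fix \<omega> assume [measurable]: "\<omega> \<in> space M"
      let ?h = "\<lambda>u. abs_phi (x + D u \<omega>) * indicator {0..m} u"
      have "(\<integral>\<^sup>+z. ennreal \<bar>?F z \<omega>\<bar> \<partial>lborel) \<le> (\<integral>\<^sup>+z. ?h (fst z) * ?h (snd z) \<partial>lborel)"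
        by (intro nn_integral_mono) (auto simp: m_def indicator_def abs_mult ennreal_mult')
      also have "\<dots> = (\<integral>\<^sup>+z. ?h (fst z) * ?h (snd z) \<partial>(lborel \<Otimes>\<^sub>M lborel))"
        by (simp add: lborel_prod)
      also have "\<dots> = (\<integral>\<^sup>+u. \<integral>\<^sup>+w. ?h u * ?h w \<partial>lborel \<partial>lborel)"
        by (subst lborel.nn_integral_fst[symmetric]) auto
      also have "\<dots> = occ abs_phi m x \<omega> ^ 2"
        unfolding occ_def power2_eq_square by (simp add: nn_integral_cmult nn_integral_multc)
      finally show "(\<integral>\<^sup>+z. ennreal \<bar>?F z \<omega>\<bar> \<partial>lborel) \<le> occ abs_phi m x \<omega> ^ 2" .
    qed
    also have "\<dots> < \<infinity>" using S by (intro nn_expectation_occ_square_finite) (auto simp: m_def)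
    finally show "(\<integral>\<^sup>+v. ennreal (norm (case v of (z, \<omega>) \<Rightarrow> ?F z \<omega>)) \<partial>(lborel \<Otimes>\<^sub>M M)) < \<infinity>" .
  qed (simp add: split_beta')
  have "(LINT \<omega>|M. additive S x \<omega> * additive S' x \<omega>) = (LINT \<omega>|M. (LINT z|lborel. ?F z \<omega>))"
  proof (rule integral_cong_AE)
    show "AE \<omega> in M. additive S x \<omega> * additive S' x \<omega> = (LINT z|lborel. ?F z \<omega>)"
      using P.AE_integrable_snd[OF I] AE_space
    proof eventually_elim
      case (elim \<omega>)
      then have "integrable (lborel \<Otimes>\<^sub>M lborel) (\<lambda>z. ?f S \<omega> (fst z) * ?f S' \<omega> (snd z))"
        by (simp add: F lborel_prod)
      from lborel_pair.integral_fst'[OF this]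
      have "(LINT u|lborel. (LINT w|lborel. ?f S \<omega> u * ?f S' \<omega> w)) = (LINT z|lborel. ?F z \<omega>)"
        by (simp add: F lborel_prod)
      then show ?case by (simp add: additive_def)
    qed
  qed auto
  also have "\<dots> = (LINT z|lborel. (LINT \<omega>|M. ?F z \<omega>))"
    using P.Fubini_integral[OF I] by simp
  also have "\<dots> = second_moment S S' x"
    unfolding second_moment_def
  proof (rule integral_cong_AE)
    \<comment> \<open>Inside the box densities are available for distinct nonzero times only; the
      axes and the diagonal are null sets.\<close>
    have key: "(LINT \<omega>|M. ?F z \<omega>) = indicator ({0..S} \<times> {0..S'}) z * sym_two_point x (fst z) (snd z)"
      if "fst z \<noteq> 0 \<and> snd z \<noteq> 0 \<and> fst z \<noteq> snd z" for z
    proof (cases "z \<in> {0..S} \<times> {0..S'}")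
      case True
      then have "0 \<le> fst z" "0 \<le> snd z" by (auto simp: mem_Times_iff)
      with that have pos: "0 < fst z" "0 < snd z" by auto
      show ?thesis
      proof (cases "fst z \<le> snd z")
        case le: True
        with that have "fst z < snd z" by auto
        then show ?thesis using expectation_phi_pair[OF pos(1), of "snd z" x] True le by (simp add: sym_two_point_def)
      next
        case le: False
        then show ?thesis using expectation_phi_pair[OF pos(2), of "fst z" x] True by (simp add: sym_two_point_def mult.commute)
      qed
    qed simp
    show "AE z in lborel. (LINT \<omega>|M. ?F z \<omega>) = indicator ({0..S} \<times> {0..S'}) z * sym_two_point x (fst z) (snd z)"
      using AE_lborel_pair_generic by eventually_elim (rule key)
  qed auto
  finally show ?thesis .
qed

end

section \<open>Measurability of path functionals\<close>

text \<open>
  The integral of a path is not a measurable function on the product \<open>\<sigma>\<close>-algebra of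
  \<open>path_space\<close>; it becomes one after replacing a path by its limit from the right along the
  dyadic times, which does not change right-continuous paths.
\<close>

definition regular_path :: "(real \<Rightarrow> real) \<Rightarrow> real \<Rightarrow> real" where
  "regular_path q u = lim (\<lambda>k. q (real (nat \<lfloor>2 ^ k * u\<rfloor> + 1) / 2 ^ k))"

lemma regular_path_eq:
  assumes "cadlag q" "0 \<le> u" "\<And>v. 0 \<le> v \<Longrightarrow> q' v = q v"
  shows "regular_path q' u = q u"
proof -
  \<comment> \<open>The added 1 places the dyadic times strictly to the right of u, so that the
    limit from the right applies even when u is dyadic.\<close>
  define \<tau> where "\<tau> k = real (nat \<lfloor>2 ^ k * u\<rfloor> + 1) / 2 ^ k" for k :: nat
  have fl: "real (nat \<lfloor>2 ^ k * u\<rfloor>) = of_int \<lfloor>2 ^ k * u\<rfloor>" for k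
    using assms(2) by simp
  have gt: "u < \<tau> k" for k
    using floor_correct[of "2 ^ k * u"] fl[of k] by (simp add: \<tau>_def field_simps)
  have le: "\<tau> k \<le> u + (1/2) ^ k" for k
    using floor_correct[of "2 ^ k * u"] fl[of k] by (simp add: \<tau>_def field_simps power_divide)
  have "\<tau> \<longlonglongrightarrow> u"
  proof (rule tendsto_sandwich[of "\<lambda>_. u" _ _ "\<lambda>k. u + (1/2) ^ k"])
    show "(\<lambda>k. u + (1/2) ^ k) \<longlonglongrightarrow> u"
      using tendsto_add[OF tendsto_const[of u] LIMSEQ_power_zero[of "1/2::real"]] by simp
  qed (use gt le in \<open>auto intro!: always_eventually simp: less_imp_le\<close>)
  then have "filterlim \<tau> (at_right u) sequentially"
    using gt by (auto simp: filterlim_at intro!: always_eventually)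
  moreover have "(q \<longlongrightarrow> q u) (at_right u)"
    using assms(1,2) by (auto simp: cadlag_def continuous_within)
  ultimately have "(\<lambda>k. q (\<tau> k)) \<longlonglongrightarrow> q u" by (rule filterlim_compose[rotated])
  moreover have "q' (\<tau> k) = q (\<tau> k)" for k using gt[of k] assms(2,3) by simp
  ultimately show ?thesis unfolding regular_path_def \<tau>_def[symmetric] by (simp add: limI)
qed

lemma regular_path_measurable [measurable (raw)]:
  assumes f [measurable]: "f \<in> borel_measurable N" and g: "g \<in> measurable N path_space"
  shows "(\<lambda>z. regular_path (g z) (f z)) \<in> borel_measurable N"
  unfolding regular_path_def
proof (rule borel_measurable_lim_metric)
  fix k :: nat
  have comp: "(\<lambda>z. g z (real (n + 1) / 2 ^ k)) \<in> borel_measurable N" for n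
    by (rule measurable_compose[OF g measurable_component_singleton]) simp
  show "(\<lambda>z. g z (real (nat \<lfloor>2 ^ k * f z\<rfloor> + 1) / 2 ^ k)) \<in> borel_measurable N"
    by (rule measurable_compose_countable[OF comp]) measurable
qed

lemma distributed_cong_space:
  assumes "distributed M N X f" "\<And>\<omega>. \<omega> \<in> space M \<Longrightarrow> X \<omega> = Y \<omega>"
  shows "distributed M N Y f"
  using assms distr_cong[of M M N N X Y] measurable_cong[of M X Y N]
  by (auto simp: distributed_def)

lemma sample_path_measurable:
  assumes "\<And>t. 0 \<le> t \<Longrightarrow> d t \<in> borel_measurable M"
  shows "sample_path d \<in> measurable M path_space"
  unfolding sample_path_def using assms by (intro measurable_restrict) auto

lemma (in prob_space) levy_increments_indep_pair:
  assumes indep: "\<And>n::nat. \<And>r::nat \<Rightarrow> real. 0 \<le> r 0 \<Longrightarrow> (\<forall>k<n. r k \<le> r (Suc k)) \<Longrightarrow>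
        indep_vars (\<lambda>_. borel) (\<lambda>k \<omega>. d (r (Suc k)) \<omega> - d (r k) \<omega>) {..<n}"
    and d0: "\<And>\<omega>. d 0 \<omega> = (0::real)" and uvw: "0 < u" "u \<le> v" "v < w"
  shows "indep_pair (borel \<Otimes>\<^sub>M borel) (\<lambda>\<omega>. (d u \<omega>, d v \<omega>)) borel (\<lambda>\<omega>. d w \<omega> - d v \<omega>)"
proof -
  define r :: "nat \<Rightarrow> real" where "r k = (if k = 0 then 0 else if k = 1 then u else if k = 2 then v else w)" for k
  have "indep_vars (\<lambda>_. borel) (\<lambda>k \<omega>. d (r (Suc k)) \<omega> - d (r k) \<omega>) {..<3}"
    using uvw by (intro indep) (auto simp: r_def)
  from indep_var_restrict[OF this, of "{0, 1}" "{2}"]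
  have "indep_var (PiM {0, 1} (\<lambda>_. borel)) (\<lambda>\<omega>. restrict (\<lambda>k. d (r (Suc k)) \<omega> - d (r k) \<omega>) {0, 1})
     (PiM {2} (\<lambda>_. borel)) (\<lambda>\<omega>. restrict (\<lambda>k. d (r (Suc k)) \<omega> - d (r k) \<omega>) {2})"
    by auto
  from indep_pair_compose[OF indep_pair_if_indep_var[OF this],
      of "\<lambda>y. (y 0, y 0 + y 1)" "borel \<Otimes>\<^sub>M borel" "\<lambda>y. y 2" borel]
  show ?thesis by (simp add: r_def d0 numeral_2_eq_2)
qed

text \<open>At every outcome the regularised path agrees with the process at all nonnegative times.
  Laws and independence carry over, and joint measurability in time and outcome is gained. The unit
  mass of the density is read off from the law at time 1.\<close>

lemma stable_motion_regular_path:
  assumes proc: "symmetric_stable_process M a d" and a: "1 < a" "a \<le> 2" and d0: "\<And>\<omega>. d 0 \<omega> = 0"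
  shows "stable_motion M a (\<lambda>u \<omega>. regular_path (sample_path d \<omega>) u)"
proof -
  have levy: "levy_process M d"
    and dens: "\<And>t. 0 < t \<Longrightarrow> distributed M lborel (d t) (\<lambda>x. ennreal (stable_density a t x))"
    using proc by (auto simp: symmetric_stable_process_def)
  interpret prob_space M using levy by (simp add: levy_process_def)
  have dm: "\<And>t. 0 \<le> t \<Longrightarrow> d t \<in> borel_measurable M"
    and stat: "\<And>r t. 0 \<le> r \<Longrightarrow> 0 \<le> t \<Longrightarrow> distr M borel (\<lambda>\<omega>. d (r + t) \<omega> - d r \<omega>) = distr M borel (d t)"
    and cad: "\<And>\<omega>. \<omega> \<in> space M \<Longrightarrow> cadlag (\<lambda>t. d t \<omega>)"
    and indep: "\<And>n::nat. \<And>r::nat \<Rightarrow> real. 0 \<le> r 0 \<Longrightarrow> (\<forall>k<n. r k \<le> r (Suc k)) \<Longrightarrow>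
        indep_vars (\<lambda>_. borel) (\<lambda>k \<omega>. d (r (Suc k)) \<omega> - d (r k) \<omega>) {..<n}"
    using levy unfolding levy_process_def by blast+
  have reg: "regular_path (sample_path d \<omega>) u = d u \<omega>" if "\<omega> \<in> space M" "0 \<le> u" for \<omega> u
    using regular_path_eq[OF cad[OF that(1)] that(2), of "sample_path d \<omega>"] by (simp add: sample_path_def)
  note [measurable] = sample_path_measurable[OF dm]
  show ?thesis
  proof (unfold_locales)
    show "1 < a" "a \<le> 2" by fact+
    have "(\<integral>\<^sup>+x. ennreal (stable_density a 1 x) \<partial>lborel) = (\<integral>\<^sup>+\<omega>. 1 \<partial>M)"
      using distributed_nn_integral[OF dens[of 1], of "\<lambda>_. 1"] by simp
    then show "(\<integral>\<^sup>+x. ennreal (stable_density a 1 x) \<partial>lborel) = 1" by (simp add: emeasure_space_1)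
    show "(\<lambda>(u, \<omega>). regular_path (sample_path d \<omega>) u) \<in> borel_measurable (borel \<Otimes>\<^sub>M M)"
      unfolding split_beta' by measurable
    show "distributed M lborel (\<lambda>\<omega>. regular_path (sample_path d \<omega>) u) (\<lambda>x. ennreal (stable_density a u x))" if "0 < u" for u
      using that reg by (intro distributed_cong_space[OF dens[OF that]]) auto
    show "distributed M lborel (\<lambda>\<omega>. regular_path (sample_path d \<omega>) w - regular_path (sample_path d \<omega>) v)
        (\<lambda>x. ennreal (stable_density a (w - v) x))" if vw: "0 < v" "v < w" for v w
    proof (rule distributed_cong_space)
      have "distr M lborel (\<lambda>\<omega>. d w \<omega> - d v \<omega>) = distr M borel (\<lambda>\<omega>. d w \<omega> - d v \<omega>)"
        by (rule distr_cong) auto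
      also have "\<dots> = distr M borel (d (w - v))" using stat[of v "w - v"] vw by simp
      also have "\<dots> = distr M lborel (d (w - v))" by (rule distr_cong) auto
      finally show "distributed M lborel (\<lambda>\<omega>. d w \<omega> - d v \<omega>) (\<lambda>x. ennreal (stable_density a (w - v) x))"
        using dens[of "w - v"] vw dm[of w] dm[of v] by (auto simp: distributed_def)
    qed (use reg vw in auto)
    show "indep_pair (borel \<Otimes>\<^sub>M borel) (\<lambda>\<omega>. (regular_path (sample_path d \<omega>) u, regular_path (sample_path d \<omega>) v))
        borel (\<lambda>\<omega>. regular_path (sample_path d \<omega>) w - regular_path (sample_path d \<omega>) v)"
      if uvw: "0 < u" "u \<le> v" "v < w" for u v w
    proof -
      have ip: "indep_pair (borel \<Otimes>\<^sub>M borel) (\<lambda>\<omega>. (d u \<omega>, d v \<omega>)) borel (\<lambda>\<omega>. d w \<omega> - d v \<omega>)"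
        by (rule levy_increments_indep_pair[where d=d, OF indep d0 uvw])
      have eq: "(\<lambda>\<omega>. (regular_path (sample_path d \<omega>) u, regular_path (sample_path d \<omega>) v)) -` A \<inter> space M = (\<lambda>\<omega>. (d u \<omega>, d v \<omega>)) -` A \<inter> space M"
        "(\<lambda>\<omega>. regular_path (sample_path d \<omega>) w - regular_path (sample_path d \<omega>) v) -` B \<inter> space M = (\<lambda>\<omega>. d w \<omega> - d v \<omega>) -` B \<inter> space M" for A B
        using reg uvw by auto
      have "(\<lambda>\<omega>. (regular_path (sample_path d \<omega>) u, regular_path (sample_path d \<omega>) v)) \<in> measurable M (borel \<Otimes>\<^sub>M borel)"
        "(\<lambda>\<omega>. regular_path (sample_path d \<omega>) w - regular_path (sample_path d \<omega>) v) \<in> borel_measurable M"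
        by measurable
      with ip show ?thesis unfolding indep_pair_def eq by blast
    qed
  qed
qed

lemma (in prob_space) indep_pair_if_indep_set_vimage:
  assumes X: "X \<in> measurable M S" and Y: "Y \<in> measurable M T"
    and ind: "indep_set (sets (vimage_algebra (space M) X S)) (sets (vimage_algebra (space M) Y T))"
  shows "indep_pair S X T Y"
  unfolding indep_pair_def
proof (intro conjI X Y ballI)
  fix A B assume "A \<in> sets S" "B \<in> sets T"
  then show "prob (X -` A \<inter> space M \<inter> (Y -` B \<inter> space M)) = prob (X -` A \<inter> space M) * prob (Y -` B \<inter> space M)"
    by (intro indep_setD[OF ind] in_vimage_algebra)
qed

section \<open>The particle system\<close>

declare One_nat_def [simp del]

section \<open>Series of integrals and functionals of paths\<close>

lemma summable_if_suminf_ennreal_finite: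
  assumes "\<And>n. 0 \<le> f n" "(\<Sum>n. ennreal (f n)) < \<infinity>"
  shows "summable f"
  using assms by (intro summable_suminf_not_top) auto

text \<open>A single Tonelli condition gives integrability, almost sure absolute convergence and
  termwise integration. It is applied over outcomes to the sum over particles, and over pairs of
  times at a fixed outcome.\<close>

lemma
  fixes f :: "nat \<Rightarrow> 'a \<Rightarrow> 'b::{banach, second_countable_topology}"
  assumes f [measurable]: "\<And>i. f i \<in> borel_measurable M"
    and fin: "(\<Sum>i. \<integral>\<^sup>+x. ennreal (norm (f i x)) \<partial>M) < \<infinity>"
  shows integrable_if_nn_sum: "\<And>i. integrable M (f i)"
    and AE_summable_if_nn_sum: "AE x in M. summable (\<lambda>i. norm (f i x))"
    and sums_integral_if_nn_sum: "(\<lambda>i. LINT x|M. f i x) sums (LINT x|M. (\<Sum>i. f i x))"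
proof -
  have le: "(\<integral>\<^sup>+x. ennreal (norm (f i x)) \<partial>M) \<le> (\<Sum>i. \<integral>\<^sup>+x. ennreal (norm (f i x)) \<partial>M)" for i
    using sum_le_suminf[of "\<lambda>i. \<integral>\<^sup>+x. ennreal (norm (f i x)) \<partial>M" "{i}"] by simp
  show int: "\<And>i. integrable M (f i)"
    using le_less_trans[OF le fin] by (auto simp: integrable_iff_bounded)
  have "(\<integral>\<^sup>+x. (\<Sum>i. ennreal (norm (f i x))) \<partial>M) < \<infinity>"
    using fin by (subst nn_integral_suminf) auto
  then have "AE x in M. (\<Sum>i. ennreal (norm (f i x))) \<noteq> \<infinity>"
    by (intro nn_integral_noteq_infinite) auto
  then show ae: "AE x in M. summable (\<lambda>i. norm (f i x))"
    by eventually_elim (intro summable_if_suminf_ennreal_finite, auto simp: less_top)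
  have "(\<integral>\<^sup>+x. ennreal (norm (f i x)) \<partial>M) = ennreal (LINT x|M. norm (f i x))" for i
    using int by (intro nn_integral_eq_integral) auto
  then have "summable (\<lambda>i. LINT x|M. norm (f i x))"
    using fin by (intro summable_if_suminf_ennreal_finite integral_nonneg_AE) auto
  then show "(\<lambda>i. LINT x|M. f i x) sums (LINT x|M. (\<Sum>i. f i x))"
    by (intro sums_integral int ae)
qed

text \<open>For reals, \<open>infsum\<close> is 0 unless the series converges absolutely. Rewriting
  that condition with a series in \<open>ennreal\<close> makes measurability in parameters
  evident.\<close>

lemma infsum_eq_suminf:
  fixes f :: "nat \<Rightarrow> real"
  shows "infsum f UNIV = (if (\<Sum>n. ennreal \<bar>f n\<bar>) < \<infinity> then suminf f else 0)"
proof (cases "summable (\<lambda>n. \<bar>f n\<bar>)")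
  case True
  have "f sums suminf f" by (rule summable_sums[OF summable_rabs_cancel[OF True]])
  moreover have "summable (\<lambda>n. norm (f n))" unfolding real_norm_def by (rule True)
  ultimately have "(f has_sum suminf f) UNIV" by (rule norm_summable_imp_has_sum[rotated])
  then have 1: "infsum f UNIV = suminf f" by (rule infsumI)
  have "(\<Sum>n. ennreal \<bar>f n\<bar>) = ennreal (\<Sum>n. \<bar>f n\<bar>)"
    by (rule suminf_ennreal2[OF _ True]) (rule abs_ge_zero)
  then have "(\<Sum>n. ennreal \<bar>f n\<bar>) < \<infinity>" by (simp only: ennreal_less_top infinity_ennreal_def)
  then show ?thesis unfolding 1 by (rule if_P[symmetric])
next
  case False
  have "\<not> f summable_on UNIV"
  proof
    assume "f summable_on UNIV"
    then have "(\<lambda>n. norm (f n)) summable_on UNIV"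
      by (rule iffD1[OF summable_on_iff_abs_summable_on_real])
    then show False using False summable_on_UNIV_nonneg_real_iff[of "\<lambda>n. \<bar>f n\<bar>"] by simp
  qed
  then have 1: "infsum f UNIV = 0" by (rule infsum_not_exists)
  have "\<not> (\<Sum>n. ennreal \<bar>f n\<bar>) < \<infinity>"
    using False summable_if_suminf_ennreal_finite[OF abs_ge_zero] by (rule contrapos_nn)
  then show ?thesis unfolding 1 by (rule if_not_P[symmetric])
qed

lemma (in pair_sigma_finite) integral_pair_mult:
  fixes f :: "'a \<Rightarrow> real" and g :: "'b \<Rightarrow> real"
  assumes f: "integrable M1 f" and g: "integrable M2 g"
  shows "integrable (M1 \<Otimes>\<^sub>M M2) (\<lambda>z. f (fst z) * g (snd z))"
    and "(LINT z|(M1 \<Otimes>\<^sub>M M2). f (fst z) * g (snd z)) = (LINT x|M1. f x) * (LINT y|M2. g y)"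
proof -
  have [measurable]: "f \<in> borel_measurable M1" "g \<in> borel_measurable M2" using f g by auto
  have "integrable (M1 \<Otimes>\<^sub>M M2) (\<lambda>(x, y). f x * g y)"
  proof (rule Fubini_integrable)
    show "integrable M1 (\<lambda>x. LINT y|M2. norm (case (x, y) of (x, y) \<Rightarrow> f x * g y))"
      using f by (simp add: abs_mult)
  qed (use g in \<open>auto simp: split_beta'\<close>)
  then show int: "integrable (M1 \<Otimes>\<^sub>M M2) (\<lambda>z. f (fst z) * g (snd z))" by (simp add: split_beta')
  show "(LINT z|(M1 \<Otimes>\<^sub>M M2). f (fst z) * g (snd z)) = (LINT x|M1. f x) * (LINT y|M2. g y)"
    using integral_fst'[OF int] by simp
qed

text \<open>The additive functional as a function of the path itself. Being measurable on the
  product space, it inherits the independence of the sample paths.\<close>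

definition path_integral :: "(real \<Rightarrow> real) \<Rightarrow> real \<Rightarrow> real \<Rightarrow> (real \<Rightarrow> real) \<Rightarrow> real" where
  "path_integral f S x q = (LINT u|lborel. indicator {0..S} u * f (x + regular_path q u))"

lemma path_integral_measurable [measurable (raw)]:
  assumes [measurable]: "f \<in> borel_measurable borel" "g \<in> borel_measurable N" "h \<in> measurable N path_space"
  shows "(\<lambda>z. path_integral f S (g z) (h z)) \<in> borel_measurable N"
  unfolding path_integral_def by measurable

definition path_occ :: "(real \<Rightarrow> ennreal) \<Rightarrow> real \<Rightarrow> real \<Rightarrow> (real \<Rightarrow> real) \<Rightarrow> ennreal" where
  "path_occ f S x q = (\<integral>\<^sup>+u. f (x + regular_path q u) * indicator {0..S} u \<partial>lborel)"

lemma path_occ_measurable [measurable (raw)]: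
  assumes [measurable]: "f \<in> borel_measurable borel" "g \<in> borel_measurable N" "h \<in> measurable N path_space"
  shows "(\<lambda>z. path_occ f S (g z) (h z)) \<in> borel_measurable N"
  unfolding path_occ_def by measurable

lemma sigma_finite_power_intensity: "sigma_finite_measure (power_intensity g)"
  unfolding power_intensity_def by (subst sigma_finite_measure.sigma_finite_iff_density_finite[OF sigma_finite_lborel]) auto

lemma sets_power_intensity [measurable_cong, simp]: "sets (power_intensity g) = sets borel"
  by (simp add: power_intensity_def)

lemma space_power_intensity [simp]: "space (power_intensity g) = UNIV"
  by (simp add: power_intensity_def)

locale particle_system = prob_space M for M :: "'a measure" +
  fixes \<gamma> \<alpha> :: "nat \<Rightarrow> real" and \<xi> \<zeta> :: "nat \<Rightarrow> real \<Rightarrow> 'a \<Rightarrow> real" and \<phi> \<psi> :: "real \<Rightarrow> real"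
  assumes params: "\<forall>i\<in>{1,2}. 0 \<le> \<gamma> i \<and> \<gamma> i < 1 \<and> 1 < \<alpha> i \<and> \<alpha> i \<le> 2"
    and integrable_phi: "integrable lborel \<phi>" and integrable_psi: "integrable lborel \<psi>"
    and system: "two_type_particle_system M \<gamma> \<alpha> \<xi> \<zeta>"
begin

section \<open>The system as a Poisson process marked by paths\<close>

definition path1 :: "nat \<Rightarrow> 'a \<Rightarrow> real \<Rightarrow> real" where "path1 n = sample_path (displacement (\<xi> n))"
definition path2 :: "nat \<Rightarrow> 'a \<Rightarrow> real \<Rightarrow> real" where "path2 n = sample_path (displacement (\<zeta> n))"
definition pos :: "nat \<Rightarrow> 'a \<Rightarrow> real \<times> real" where "pos n \<omega> = (\<xi> n 0 \<omega>, \<zeta> n 0 \<omega>)"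

abbreviation "D1 n u \<omega> \<equiv> regular_path (path1 n \<omega>) u"
abbreviation "D2 n u \<omega> \<equiv> regular_path (path2 n \<omega>) u"
abbreviation "intensity \<equiv> power_intensity (\<gamma> 1) \<Otimes>\<^sub>M power_intensity (\<gamma> 2)"

lemma phi_psi_measurable [measurable]: "\<phi> \<in> borel_measurable borel" "\<psi> \<in> borel_measurable borel"
  using integrable_phi integrable_psi by auto

lemma start_measurable [measurable]: "\<xi> n 0 \<in> borel_measurable M" "\<zeta> n 0 \<in> borel_measurable M"
  using system by (auto simp: two_type_particle_system_def)

lemma processes:
  "symmetric_stable_process M (\<alpha> 1) (displacement (\<xi> n))" "symmetric_stable_process M (\<alpha> 2) (displacement (\<zeta> n))"
  "indep_var path_space (path1 n) path_space (path2 n)"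
  using system by (auto simp: two_type_particle_system_def path1_def path2_def)

lemma displacement_measurable:
  "0 \<le> t \<Longrightarrow> displacement (\<xi> n) t \<in> borel_measurable M" "0 \<le> t \<Longrightarrow> displacement (\<zeta> n) t \<in> borel_measurable M"
  using processes(1,2)[of n] by (auto simp: symmetric_stable_process_def levy_process_def)

lemma displacement_cadlag:
  "\<omega> \<in> space M \<Longrightarrow> cadlag (\<lambda>t. displacement (\<xi> n) t \<omega>)" "\<omega> \<in> space M \<Longrightarrow> cadlag (\<lambda>t. displacement (\<zeta> n) t \<omega>)"
  using processes(1,2)[of n] by (auto simp: symmetric_stable_process_def levy_process_def)

lemma path_measurable [measurable]: "path1 n \<in> measurable M path_space" "path2 n \<in> measurable M path_space"
  unfolding path1_def path2_def by (auto intro!: sample_path_measurable displacement_measurable)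

lemma particle_position:
  assumes "\<omega> \<in> space M" "0 \<le> u"
  shows "\<xi> n 0 \<omega> + D1 n u \<omega> = \<xi> n u \<omega>" "\<zeta> n 0 \<omega> + D2 n u \<omega> = \<zeta> n u \<omega>"
  using regular_path_eq[OF displacement_cadlag(1)[OF assms(1)] assms(2), of "path1 n \<omega>" n]
    regular_path_eq[OF displacement_cadlag(2)[OF assms(1)] assms(2), of "path2 n \<omega>" n]
  by (auto simp: path1_def path2_def sample_path_def displacement_def)

lemma motion1: "stable_motion_functional M (\<alpha> 1) (D1 n) (\<gamma> 1) \<phi>"
proof -
  interpret stable_motion M "\<alpha> 1" "D1 n"
    unfolding path1_def using params by (intro stable_motion_regular_path processes) (auto simp: displacement_def)
  show ?thesis by unfold_locales (use params integrable_phi in auto)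
qed

lemma motion2: "stable_motion_functional M (\<alpha> 2) (D2 n) (\<gamma> 2) \<psi>"
proof -
  interpret stable_motion M "\<alpha> 2" "D2 n"
    unfolding path2_def using params by (intro stable_motion_regular_path processes) (auto simp: displacement_def)
  show ?thesis by unfold_locales (use params integrable_psi in auto)
qed

sublocale F1: stable_functional "\<alpha> 1" "\<gamma> 1" \<phi>
  using motion1 by (rule stable_motion_functional.axioms(2))

sublocale F2: stable_functional "\<alpha> 2" "\<gamma> 2" \<psi>
  using motion2 by (rule stable_motion_functional.axioms(2))

abbreviation "phi' \<equiv> \<lambda>y. ennreal \<bar>\<phi> y\<bar>"
abbreviation "psi' \<equiv> \<lambda>y. ennreal \<bar>\<psi> y\<bar>"

lemma additive_eq:
  "stable_motion_functional.additive (D1 n) \<phi> S x \<omega> = path_integral \<phi> S x (path1 n \<omega>)"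
  "stable_motion_functional.additive (D2 n) \<psi> S x \<omega> = path_integral \<psi> S x (path2 n \<omega>)"
  by (simp_all add: stable_motion_functional.additive_def[OF motion1] stable_motion_functional.additive_def[OF motion2] path_integral_def)

lemma occ_eq:
  "stable_motion.occ (D1 n) f S x \<omega> = path_occ f S x (path1 n \<omega>)"
  "stable_motion.occ (D2 n) f S x \<omega> = path_occ f S x (path2 n \<omega>)"
  by (simp_all add: stable_motion.occ_def[OF stable_motion_functional.axioms(1)[OF motion1]]
      stable_motion.occ_def[OF stable_motion_functional.axioms(1)[OF motion2]] path_occ_def)

lemma nn_expectation_path_occ:
  "(\<integral>\<^sup>+\<omega>. path_occ phi' S x (path1 n \<omega>) \<partial>M) = F1.green phi' S x"
  "(\<integral>\<^sup>+\<omega>. path_occ psi' S x (path2 n \<omega>) \<partial>M) = F2.green psi' S x"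
  using stable_motion.nn_expectation_occ[OF stable_motion_functional.axioms(1)[OF motion1], of phi' n S x]
    stable_motion.nn_expectation_occ[OF stable_motion_functional.axioms(1)[OF motion2], of psi' n S x]
  by (simp_all add: occ_eq)

lemma nn_expectation_path_occ_cube:
  assumes "0 \<le> S"
  shows "(\<integral>\<^sup>+\<omega>. path_occ phi' S x (path1 n \<omega>) ^ 3 \<partial>M) \<le> 6 * (F1.green_bound phi' S)\<^sup>2 * F1.green phi' S x"
    "(\<integral>\<^sup>+\<omega>. path_occ psi' S x (path2 n \<omega>) ^ 3 \<partial>M) \<le> 6 * (F2.green_bound psi' S)\<^sup>2 * F2.green psi' S x"
  using stable_motion_functional.nn_expectation_occ_cube_le[OF motion1 assms, of n x]
    stable_motion_functional.nn_expectation_occ_cube_le[OF motion2 assms, of n x]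
  by (simp_all add: occ_eq)

lemma path_integral_abs_le:
  assumes "S \<le> S'"
  shows "ennreal \<bar>path_integral \<phi> S x (path1 n \<omega>)\<bar> \<le> path_occ phi' S' x (path1 n \<omega>)"
    "ennreal \<bar>path_integral \<psi> S x (path2 n \<omega>)\<bar> \<le> path_occ psi' S' x (path2 n \<omega>)"
  using stable_motion_functional.additive_abs_le[OF motion1 assms, of n x \<omega>]
    stable_motion_functional.additive_abs_le[OF motion2 assms, of n x \<omega>]
  by (simp_all add: occ_eq additive_eq)

lemma path_integral_moments:
  assumes "0 \<le> S" "0 \<le> S'"
  shows "integrable M (\<lambda>\<omega>. path_integral \<phi> S x (path1 n \<omega>))"
    "integrable M (\<lambda>\<omega>. path_integral \<psi> S x (path2 n \<omega>))"
    "(LINT \<omega>|M. path_integral \<phi> S x (path1 n \<omega>)) = F1.first_moment S x"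
    "(LINT \<omega>|M. path_integral \<psi> S x (path2 n \<omega>)) = F2.first_moment S x"
    "integrable M (\<lambda>\<omega>. path_integral \<phi> S x (path1 n \<omega>) * path_integral \<phi> S' x (path1 n \<omega>))"
    "integrable M (\<lambda>\<omega>. path_integral \<psi> S x (path2 n \<omega>) * path_integral \<psi> S' x (path2 n \<omega>))"
    "(LINT \<omega>|M. path_integral \<phi> S x (path1 n \<omega>) * path_integral \<phi> S' x (path1 n \<omega>)) = F1.second_moment S S' x"
    "(LINT \<omega>|M. path_integral \<psi> S x (path2 n \<omega>) * path_integral \<psi> S' x (path2 n \<omega>)) = F2.second_moment S S' x"
  using stable_motion_functional.integrable_additive[OF motion1 assms(1), of n x]
    stable_motion_functional.integrable_additive[OF motion2 assms(1), of n x]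
    stable_motion_functional.expectation_additive[OF motion1 assms(1), of n x]
    stable_motion_functional.expectation_additive[OF motion2 assms(1), of n x]
    stable_motion_functional.integrable_additive_mult[OF motion1 assms, of n x]
    stable_motion_functional.integrable_additive_mult[OF motion2 assms, of n x]
    stable_motion_functional.expectation_additive_mult[OF motion1 assms, of n x]
    stable_motion_functional.expectation_additive_mult[OF motion2 assms, of n x]
  unfolding additive_eq by simp_all

lemma indep_path_functions:
  assumes "f \<in> borel_measurable path_space" "g \<in> borel_measurable path_space"
  shows "indep_var borel (\<lambda>\<omega>. f (path1 n \<omega>)) borel (\<lambda>\<omega>. g (path2 n \<omega>))"
  using indep_var_compose[OF processes(3)[of n] assms] by (simp add: comp_def)

lemma nn_expectation_path_mult:
  fixes f g :: "(real \<Rightarrow> real) \<Rightarrow> ennreal"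
  assumes [measurable]: "f \<in> borel_measurable path_space" "g \<in> borel_measurable path_space"
  shows "(\<integral>\<^sup>+\<omega>. f (path1 n \<omega>) * g (path2 n \<omega>) \<partial>M) = (\<integral>\<^sup>+\<omega>. f (path1 n \<omega>) \<partial>M) * (\<integral>\<^sup>+\<omega>. g (path2 n \<omega>) \<partial>M)"
  using nn_integral_indep_pair[OF indep_pair_if_indep_var[OF processes(3)[of n]], of "\<lambda>(a, b). f a * g b"]
  by (simp add: split_beta' nn_integral_cmult nn_integral_multc)

lemma pos_measurable [measurable]: "pos n \<in> measurable M (borel \<Otimes>\<^sub>M borel)"
  unfolding pos_def by measurable

lemma sets_intensity [measurable_cong]: "sets intensity = sets (borel \<Otimes>\<^sub>M borel)"
  by (intro sets_pair_measure_cong) auto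

sublocale I: pair_sigma_finite "power_intensity (\<gamma> 1)" "power_intensity (\<gamma> 2)"
  by (intro pair_sigma_finite.intro sigma_finite_power_intensity)

sublocale PP: poisson_points M intensity pos
proof
  show "pos n \<in> measurable M intensity" for n by measurable
  have "initial_configuration \<xi> \<zeta> = (\<lambda>\<omega>. distr (count_space UNIV) intensity (\<lambda>n. pos n \<omega>))"
    unfolding initial_configuration_def pos_def by (intro ext distr_cong refl) (simp add: sets_intensity)
  then show "poisson_random_measure M intensity (\<lambda>\<omega>. distr (count_space UNIV) intensity (\<lambda>n. pos n \<omega>))"
    using system by (simp add: two_type_particle_system_def)
qed

abbreviation "pathpair_space \<equiv> path_space \<Otimes>\<^sub>M path_space"

lemma indep_paths: "indep_vars (\<lambda>_. pathpair_space) (\<lambda>n \<omega>. (path1 n \<omega>, path2 n \<omega>)) UNIV"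
  using system by (auto simp: two_type_particle_system_def path1_def path2_def)

text \<open>Independence of the whole sequences, not particle by particle: all starting points can
  be frozen at once, although they depend on each other.\<close>

lemma indep_pos_paths:
  "indep_pair (PiM UNIV (\<lambda>_. borel \<Otimes>\<^sub>M borel)) (\<lambda>\<omega> n. pos n \<omega>) (PiM UNIV (\<lambda>_. pathpair_space)) (\<lambda>\<omega> n. (path1 n \<omega>, path2 n \<omega>))"
proof (rule indep_pair_if_indep_set_vimage)
  show "indep_set (sets (vimage_algebra (space M) (\<lambda>\<omega> n. pos n \<omega>) (PiM UNIV (\<lambda>_. borel \<Otimes>\<^sub>M borel))))
     (sets (vimage_algebra (space M) (\<lambda>\<omega> n. (path1 n \<omega>, path2 n \<omega>)) (PiM UNIV (\<lambda>_. pathpair_space))))"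
    using system by (auto simp: two_type_particle_system_def path1_def path2_def pos_def)
qed (auto intro!: measurable_abs_UNIV)

lemma indep_pos_path:
  "indep_pair (borel \<Otimes>\<^sub>M borel) (pos n) pathpair_space (\<lambda>\<omega>. (path1 n \<omega>, path2 n \<omega>))"
  using indep_pair_compose[OF indep_pos_paths, of "\<lambda>y. y n" "borel \<Otimes>\<^sub>M borel" "\<lambda>y. y n" pathpair_space] by simp

section \<open>The occupation time as a sum over particles\<close>

definition mark1 :: "real \<Rightarrow> nat \<Rightarrow> 'a \<Rightarrow> real" where
  "mark1 S n \<omega> = path_integral \<phi> S (fst (pos n \<omega>)) (path1 n \<omega>)"

definition mark2 :: "real \<Rightarrow> nat \<Rightarrow> 'a \<Rightarrow> real" where
  "mark2 S n \<omega> = path_integral \<psi> S (snd (pos n \<omega>)) (path2 n \<omega>)"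

lemma mark_measurable [measurable]: "mark1 S n \<in> borel_measurable M" "mark2 S n \<in> borel_measurable M"
  unfolding mark1_def mark2_def by measurable

definition green_product :: "real \<Rightarrow> real \<Rightarrow> real \<times> real \<Rightarrow> ennreal" where
  "green_product S S' x = F1.green phi' S (fst x) * F2.green psi' S' (snd x)"

lemma green_product_measurable [measurable]: "green_product S S' \<in> borel_measurable (borel \<Otimes>\<^sub>M borel)"
  unfolding green_product_def by measurable

lemma nn_integral_green_finite:
  assumes "0 \<le> S"
  shows "(\<integral>\<^sup>+x. F1.green phi' S x \<partial>power_intensity (\<gamma> 1)) < \<infinity>" "(\<integral>\<^sup>+x. F2.green psi' S x \<partial>power_intensity (\<gamma> 2)) < \<infinity>"
  using le_less_trans[OF F1.nn_integral_green_power_intensity[OF assms] ennreal_less_top]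
    le_less_trans[OF F2.nn_integral_green_power_intensity[OF assms] ennreal_less_top] by auto

lemma nn_integral_green_product:
  "(\<integral>\<^sup>+x. green_product S S' x \<partial>intensity)
    = (\<integral>\<^sup>+x. F1.green phi' S x \<partial>power_intensity (\<gamma> 1)) * (\<integral>\<^sup>+x. F2.green psi' S' x \<partial>power_intensity (\<gamma> 2))"
  unfolding green_product_def
  by (subst I.M2.nn_integral_fst[symmetric]) (auto simp: nn_integral_cmult nn_integral_multc)

text \<open>The starting point is frozen by independence, the two paths of a particle are
  independent, and the resulting Green functions do not depend on n. Campbell's formula therefore
  applies to their product.\<close>

lemma nn_expectation_marked_occ:
  "(\<Sum>n. \<integral>\<^sup>+\<omega>. path_occ phi' S (fst (pos n \<omega>)) (path1 n \<omega>) * path_occ psi' S' (snd (pos n \<omega>)) (path2 n \<omega>) \<partial>M)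
    = (\<integral>\<^sup>+x. green_product S S' x \<partial>intensity)"
proof -
  have "(\<integral>\<^sup>+\<omega>. path_occ phi' S (fst (pos n \<omega>)) (path1 n \<omega>) * path_occ psi' S' (snd (pos n \<omega>)) (path2 n \<omega>) \<partial>M)
    = (\<integral>\<^sup>+\<omega>. green_product S S' (pos n \<omega>) \<partial>M)" for n
  proof -
    have "(\<integral>\<^sup>+\<omega>. path_occ phi' S (fst (pos n \<omega>)) (path1 n \<omega>) * path_occ psi' S' (snd (pos n \<omega>)) (path2 n \<omega>) \<partial>M)
      = (\<integral>\<^sup>+\<omega>. (\<lambda>(x, q). path_occ phi' S (fst x) (fst q) * path_occ psi' S' (snd x) (snd q)) (pos n \<omega>, (path1 n \<omega>, path2 n \<omega>)) \<partial>M)"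
      by simp
    also have "\<dots> = (\<integral>\<^sup>+\<omega>. \<integral>\<^sup>+\<omega>'. (\<lambda>(x, q). path_occ phi' S (fst x) (fst q) * path_occ psi' S' (snd x) (snd q)) (pos n \<omega>, (path1 n \<omega>', path2 n \<omega>')) \<partial>M \<partial>M)"
      by (rule nn_integral_indep_pair[OF indep_pos_path]) (simp add: split_beta')
    also have "\<dots> = (\<integral>\<^sup>+\<omega>. green_product S S' (pos n \<omega>) \<partial>M)"
      by (intro nn_integral_cong) (simp add: nn_expectation_path_mult nn_expectation_path_occ green_product_def)
    finally show ?thesis .
  qed
  then show ?thesis using PP.campbell_nn[of "green_product S S'"] by simp
qed

lemma AE_sum_marked_occ_finite:
  assumes "0 \<le> S" "0 \<le> S'"
  shows "AE \<omega> in M. (\<Sum>n. path_occ phi' S (fst (pos n \<omega>)) (path1 n \<omega>) * path_occ psi' S' (snd (pos n \<omega>)) (path2 n \<omega>)) < \<infinity>"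
proof -
  have "(\<integral>\<^sup>+\<omega>. (\<Sum>n. path_occ phi' S (fst (pos n \<omega>)) (path1 n \<omega>) * path_occ psi' S' (snd (pos n \<omega>)) (path2 n \<omega>)) \<partial>M) < \<infinity>"
    using nn_integral_green_finite assms
    by (subst nn_integral_suminf) (simp_all add: nn_expectation_marked_occ nn_integral_green_product ennreal_mult_less_top)
  then have "AE \<omega> in M. (\<Sum>n. path_occ phi' S (fst (pos n \<omega>)) (path1 n \<omega>) * path_occ psi' S' (snd (pos n \<omega>)) (path2 n \<omega>)) \<noteq> \<infinity>"
    by (intro nn_integral_noteq_infinite) auto
  then show ?thesis by (simp add: less_top)
qed

text \<open>The identity holds at every outcome and not only almost surely, so measurability of the
  occupation time can be read off from the right-hand side.\<close>

lemma occupation_time_regular: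
  assumes "\<omega> \<in> space M"
  shows "occupation_time \<xi> \<zeta> \<phi> \<psi> S S' \<omega> = (LINT u|lborel. (LINT v|lborel. infsum (\<lambda>n.
      (indicator {0..S} u * \<phi> (fst (pos n \<omega>) + D1 n u \<omega>)) * (indicator {0..S'} v * \<psi> (snd (pos n \<omega>) + D2 n v \<omega>))) UNIV))"
proof -
  have "indicator {0..S} u * (LINT v|lborel. indicator {0..S'} v * particle_sum \<xi> \<zeta> \<phi> \<psi> u v \<omega>)
    = (LINT v|lborel. infsum (\<lambda>n. (indicator {0..S} u * \<phi> (fst (pos n \<omega>) + D1 n u \<omega>)) * (indicator {0..S'} v * \<psi> (snd (pos n \<omega>) + D2 n v \<omega>))) UNIV)" for u
  proof (cases "u \<in> {0..S}")
    case True
    have "indicator {0..S'} v * particle_sum \<xi> \<zeta> \<phi> \<psi> u v \<omega>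
      = infsum (\<lambda>n. (indicator {0..S} u * \<phi> (fst (pos n \<omega>) + D1 n u \<omega>)) * (indicator {0..S'} v * \<psi> (snd (pos n \<omega>) + D2 n v \<omega>))) UNIV" for v
      using True assms by (cases "v \<in> {0..S'}") (auto simp: particle_sum_def pos_def particle_position)
    with True show ?thesis by simp
  qed simp
  then show ?thesis by (simp add: occupation_time_def set_lebesgue_integral_def)
qed

lemma occupation_time_measurable [measurable]: "occupation_time \<xi> \<zeta> \<phi> \<psi> S S' \<in> borel_measurable M"
proof -
  have "(\<lambda>\<omega>. LINT u|lborel. (LINT v|lborel. infsum (\<lambda>n.
      (indicator {0..S} u * \<phi> (fst (pos n \<omega>) + D1 n u \<omega>)) * (indicator {0..S'} v * \<psi> (snd (pos n \<omega>) + D2 n v \<omega>))) UNIV)) \<in> borel_measurable M"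
    unfolding infsum_eq_suminf by measurable
  then show ?thesis by (subst measurable_cong[OF occupation_time_regular])
qed

text \<open>Almost surely the absolute values, summed over particles and integrated over both times,
  are finite. Sum and integrals may then be exchanged, and each particle contributes the product of
  its two path integrals.\<close>

lemma occupation_time_eq_sum:
  assumes S: "0 \<le> S" "0 \<le> S'"
  shows "AE \<omega> in M. occupation_time \<xi> \<zeta> \<phi> \<psi> S S' \<omega> = (\<Sum>n. mark1 S n \<omega> * mark2 S' n \<omega>)"
  using AE_sum_marked_occ_finite[OF S] AE_space
proof eventually_elim
  case (elim \<omega>)
  note [measurable] = elim(2)
  let ?a = "\<lambda>n u. indicator {0..S} u * \<phi> (fst (pos n \<omega>) + D1 n u \<omega>)"
  let ?b = "\<lambda>n v. indicator {0..S'} v * \<psi> (snd (pos n \<omega>) + D2 n v \<omega>)"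
  let ?f = "\<lambda>n z. ?a n (fst z) * ?b n (snd z)"
  have [measurable]: "path1 n \<omega> \<in> space path_space" "path2 n \<omega> \<in> space path_space" for n
    using measurable_space[OF path_measurable(1) elim(2)] measurable_space[OF path_measurable(2) elim(2)] by auto
  have am [measurable]: "?a n \<in> borel_measurable borel" "?b n \<in> borel_measurable borel" for n
    by measurable
  have nn: "(\<integral>\<^sup>+z. ennreal (norm (?f n z)) \<partial>(lborel \<Otimes>\<^sub>M lborel))
    = path_occ phi' S (fst (pos n \<omega>)) (path1 n \<omega>) * path_occ psi' S' (snd (pos n \<omega>)) (path2 n \<omega>)" for n
  proof -
    have "(\<integral>\<^sup>+z. ennreal (norm (?f n z)) \<partial>(lborel \<Otimes>\<^sub>M lborel)) = (\<integral>\<^sup>+u. \<integral>\<^sup>+v. ennreal \<bar>?a n u\<bar> * ennreal \<bar>?b n v\<bar> \<partial>lborel \<partial>lborel)"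
      by (subst lborel.nn_integral_fst[symmetric]) (auto simp: abs_mult ennreal_mult')
    also have "\<dots> = (\<integral>\<^sup>+u. ennreal \<bar>?a n u\<bar> \<partial>lborel) * (\<integral>\<^sup>+v. ennreal \<bar>?b n v\<bar> \<partial>lborel)"
      by (subst nn_integral_cmult, simp, subst nn_integral_multc) auto
    also have "(\<integral>\<^sup>+u. ennreal \<bar>?a n u\<bar> \<partial>lborel) = path_occ phi' S (fst (pos n \<omega>)) (path1 n \<omega>)"
      unfolding path_occ_def by (intro nn_integral_cong) (auto simp: indicator_def)
    also have "(\<integral>\<^sup>+v. ennreal \<bar>?b n v\<bar> \<partial>lborel) = path_occ psi' S' (snd (pos n \<omega>)) (path2 n \<omega>)"
      unfolding path_occ_def by (intro nn_integral_cong) (auto simp: indicator_def)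
    finally show ?thesis .
  qed
  have fm: "?f n \<in> borel_measurable (lborel \<Otimes>\<^sub>M lborel)" for n by measurable
  have fin: "(\<Sum>n. \<integral>\<^sup>+z. ennreal (norm (?f n z)) \<partial>(lborel \<Otimes>\<^sub>M lborel)) < \<infinity>"
    unfolding nn by (rule elim(1))
  note int = integrable_if_nn_sum[OF fm fin] and ae = AE_summable_if_nn_sum[OF fm fin] and sums = sums_integral_if_nn_sum[OF fm fin]
  have inner: "(LINT z|(lborel \<Otimes>\<^sub>M lborel). ?f n z) = mark1 S n \<omega> * mark2 S' n \<omega>" for n
    using lborel_pair.integral_fst'[OF int[of n]] by (simp add: mark1_def mark2_def path_integral_def)
  \<comment> \<open>The default value 0 of \<open>infsum\<close> is met only on a null set of pairs
    of times, by the absolute convergence established above.\<close>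
  define g where "g z = infsum (\<lambda>n. ?f n z) UNIV" for z
  have gm: "g \<in> borel_measurable (lborel \<Otimes>\<^sub>M lborel)"
    unfolding g_def infsum_eq_suminf by measurable
  have g_eq: "AE z in lborel \<Otimes>\<^sub>M lborel. g z = (\<Sum>n. ?f n z)"
    using ae
  proof eventually_elim
    case (elim z)
    have "(\<lambda>n. ?f n z) sums (\<Sum>n. ?f n z)" by (rule summable_sums[OF summable_norm_cancel[OF elim]])
    then show ?case unfolding g_def by (rule infsumI[OF norm_summable_imp_has_sum[OF elim]])
  qed
  have "integrable (lborel \<Otimes>\<^sub>M lborel) (\<lambda>z. \<Sum>n. ?f n z)"
  proof (rule integrable_suminf[OF int ae])
    have "(\<integral>\<^sup>+z. ennreal (norm (?f n z)) \<partial>(lborel \<Otimes>\<^sub>M lborel)) = ennreal (LINT z|(lborel \<Otimes>\<^sub>M lborel). norm (?f n z))" for n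
      using int by (intro nn_integral_eq_integral) auto
    then show "summable (\<lambda>n. LINT z|(lborel \<Otimes>\<^sub>M lborel). norm (?f n z))"
      using fin by (intro summable_if_suminf_ennreal_finite integral_nonneg_AE) auto
  qed
  then have gi: "integrable (lborel \<Otimes>\<^sub>M lborel) g"
    using integrable_cong_AE[OF gm _ g_eq] by simp
  have "occupation_time \<xi> \<zeta> \<phi> \<psi> S S' \<omega> = (LINT z|(lborel \<Otimes>\<^sub>M lborel). g z)"
  proof -
    have gp: "infsum (\<lambda>n. ?a n u * ?b n v) UNIV = g (u, v)" for u v by (simp add: g_def)
    show ?thesis unfolding occupation_time_regular[OF elim(2), of S S'] gp by (rule lborel_pair.integral_fst'[OF gi])
  qed
  also have "\<dots> = (LINT z|(lborel \<Otimes>\<^sub>M lborel). (\<Sum>n. ?f n z))"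
    by (rule integral_cong_AE[OF gm _ g_eq]) measurable
  also have "\<dots> = (\<Sum>n. mark1 S n \<omega> * mark2 S' n \<omega>)"
    using sums_unique[OF sums] by (simp add: inner)
  finally show ?case .
qed

lemma nn_sum_marks_finite:
  assumes S: "0 \<le> S" "0 \<le> S'"
  shows "(\<Sum>n. \<integral>\<^sup>+\<omega>. ennreal (norm (mark1 S n \<omega> * mark2 S' n \<omega>)) \<partial>M) < \<infinity>"
proof -
  have "(\<Sum>n. \<integral>\<^sup>+\<omega>. ennreal (norm (mark1 S n \<omega> * mark2 S' n \<omega>)) \<partial>M) \<le> (\<integral>\<^sup>+x. green_product S S' x \<partial>intensity)"
    unfolding nn_expectation_marked_occ[symmetric]
  proof (intro suminf_le nn_integral_mono)
    show "ennreal (norm (mark1 S n \<omega> * mark2 S' n \<omega>)) \<le> path_occ phi' S (fst (pos n \<omega>)) (path1 n \<omega>) * path_occ psi' S' (snd (pos n \<omega>)) (path2 n \<omega>)" for n \<omega>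
      using mult_mono[OF path_integral_abs_le(1)[OF order_refl, of S "fst (pos n \<omega>)" n \<omega>] path_integral_abs_le(2)[OF order_refl, of S' "snd (pos n \<omega>)" n \<omega>]]
      by (simp add: mark1_def mark2_def abs_mult ennreal_mult')
  qed auto
  also have "\<dots> < \<infinity>"
    using nn_integral_green_finite assms by (simp add: nn_integral_green_product ennreal_mult_less_top)
  finally show ?thesis .
qed

lemma expectation_marks:
  assumes S: "0 \<le> S" "0 \<le> S'"
  shows "(LINT \<omega>|M. mark1 S n \<omega> * mark2 S' n \<omega>) = (LINT \<omega>|M. F1.first_moment S (fst (pos n \<omega>)) * F2.first_moment S' (snd (pos n \<omega>)))"
proof -
  let ?G = "\<lambda>(x, q). path_integral \<phi> S (fst x) (fst q) * path_integral \<psi> S' (snd x) (snd q)"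
  have int: "integrable M (\<lambda>\<omega>. mark1 S n \<omega> * mark2 S' n \<omega>)"
    by (rule integrable_if_nn_sum[OF _ nn_sum_marks_finite[OF S]]) measurable
  have "(LINT \<omega>|M. mark1 S n \<omega> * mark2 S' n \<omega>) = (LINT \<omega>|M. ?G (pos n \<omega>, (path1 n \<omega>, path2 n \<omega>)))"
    by (simp add: mark1_def mark2_def)
  also have "\<dots> = (LINT \<omega>|M. (LINT \<omega>'|M. ?G (pos n \<omega>, (path1 n \<omega>', path2 n \<omega>'))))"
    using int by (intro integral_indep_pair[OF indep_pos_path]) (auto simp: split_beta' mark1_def mark2_def)
  also have "\<dots> = (LINT \<omega>|M. F1.first_moment S (fst (pos n \<omega>)) * F2.first_moment S' (snd (pos n \<omega>)))"
    using S by (intro Bochner_Integration.integral_cong refl)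
      (simp add: indep_var_lebesgue_integral[OF indep_path_functions] path_integral_moments)
  finally show ?thesis .
qed

lemma first_moment_abs_le:
  assumes "0 \<le> S"
  shows "ennreal \<bar>F1.first_moment S x\<bar> \<le> F1.green phi' S x" "ennreal \<bar>F2.first_moment S x\<bar> \<le> F2.green psi' S x"
proof -
  \<comment> \<open>Particle 0 serves to realise the first moment, a function of the density alone,
    as an expectation.\<close>
  have "ennreal \<bar>F1.first_moment S x\<bar> \<le> (\<integral>\<^sup>+\<omega>. ennreal \<bar>path_integral \<phi> S x (path1 0 \<omega>)\<bar> \<partial>M)"
    using integral_norm_bound_ennreal[OF path_integral_moments(1)[OF assms assms, of x 0]] assms
    by (simp add: path_integral_moments)
  also have "\<dots> \<le> F1.green phi' S x"
    unfolding nn_expectation_path_occ(1)[of S x 0, symmetric] by (intro nn_integral_mono path_integral_abs_le) simp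
  finally show "ennreal \<bar>F1.first_moment S x\<bar> \<le> F1.green phi' S x" .
  have "ennreal \<bar>F2.first_moment S x\<bar> \<le> (\<integral>\<^sup>+\<omega>. ennreal \<bar>path_integral \<psi> S x (path2 0 \<omega>)\<bar> \<partial>M)"
    using integral_norm_bound_ennreal[OF path_integral_moments(2)[OF assms assms, of x 0]] assms
    by (simp add: path_integral_moments)
  also have "\<dots> \<le> F2.green psi' S x"
    unfolding nn_expectation_path_occ(2)[of S x 0, symmetric] by (intro nn_integral_mono path_integral_abs_le) simp
  finally show "ennreal \<bar>F2.first_moment S x\<bar> \<le> F2.green psi' S x" .
qed

lemma integrable_first_moments:
  assumes "0 \<le> S"
  shows "integrable (power_intensity (\<gamma> 1)) (F1.first_moment S)" "integrable (power_intensity (\<gamma> 2)) (F2.first_moment S)"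
proof -
  have "(\<integral>\<^sup>+x. ennreal (norm (F1.first_moment S x)) \<partial>power_intensity (\<gamma> 1)) \<le> (\<integral>\<^sup>+x. F1.green phi' S x \<partial>power_intensity (\<gamma> 1))"
    unfolding real_norm_def by (intro nn_integral_mono first_moment_abs_le assms)
  from le_less_trans[OF this nn_integral_green_finite(1)[OF assms]]
  show "integrable (power_intensity (\<gamma> 1)) (F1.first_moment S)" by (intro integrableI_bounded) auto
  have "(\<integral>\<^sup>+x. ennreal (norm (F2.first_moment S x)) \<partial>power_intensity (\<gamma> 2)) \<le> (\<integral>\<^sup>+x. F2.green psi' S x \<partial>power_intensity (\<gamma> 2))"
    unfolding real_norm_def by (intro nn_integral_mono first_moment_abs_le assms)
  from le_less_trans[OF this nn_integral_green_finite(2)[OF assms]]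
  show "integrable (power_intensity (\<gamma> 2)) (F2.first_moment S)" by (intro integrableI_bounded) auto
qed

text \<open>The series of particle means is summed in two ways: by termwise integration it gives the
  left side, by Campbell's formula the right side.\<close>

lemma expectation_occupation_time:
  assumes S: "0 \<le> S" "0 \<le> S'"
  shows "(LINT \<omega>|M. occupation_time \<xi> \<zeta> \<phi> \<psi> S S' \<omega>) = (LINT x|intensity. F1.first_moment S (fst x) * F2.first_moment S' (snd x))"
proof -
  have 1: "(LINT \<omega>|M. occupation_time \<xi> \<zeta> \<phi> \<psi> S S' \<omega>) = (LINT \<omega>|M. (\<Sum>n. mark1 S n \<omega> * mark2 S' n \<omega>))"
    by (rule integral_cong_AE[OF _ _ occupation_time_eq_sum[OF S]]) measurable
  have 2: "(\<lambda>n. LINT \<omega>|M. mark1 S n \<omega> * mark2 S' n \<omega>) sums (LINT \<omega>|M. (\<Sum>n. mark1 S n \<omega> * mark2 S' n \<omega>))"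
    by (rule sums_integral_if_nn_sum[OF _ nn_sum_marks_finite[OF S]]) measurable
  have 3: "(\<lambda>n. LINT \<omega>|M. mark1 S n \<omega> * mark2 S' n \<omega>) sums (LINT x|intensity. F1.first_moment S (fst x) * F2.first_moment S' (snd x))"
    unfolding expectation_marks[OF S]
    using S by (intro PP.campbell(2) I.integral_pair_mult integrable_first_moments)
  show ?thesis by (rule trans[OF 1 sums_unique2[OF 2 3]])
qed

end

locale particle_functional = particle_system M \<gamma> \<alpha> \<xi> \<zeta> \<phi> \<psi>
  for M :: "'a measure" and \<gamma> \<alpha> :: "nat \<Rightarrow> real" and \<xi> \<zeta> :: "nat \<Rightarrow> real \<Rightarrow> 'a \<Rightarrow> real" and \<phi> \<psi> :: "real \<Rightarrow> real" +
  fixes s t \<theta> :: "'n::finite \<Rightarrow> real" and T :: real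
  assumes s_nonneg: "\<And>j. 0 \<le> s j" and t_nonneg: "\<And>j. 0 \<le> t j" and T_pos: "0 < T"
begin

section \<open>One linear combination of fluctuations at a fixed scale T\<close>

abbreviation "F \<equiv> norming \<gamma> \<alpha> T"

lemma F_pos: "0 < F"
  using T_pos by (simp add: norming_def)

text \<open>A common time horizon for the whole linear combination; since all times are nonnegative,
  their sum dominates each of them.\<close>

abbreviation "S1 \<equiv> T * sum s UNIV"
abbreviation "S2 \<equiv> T * sum t UNIV"
abbreviation "\<Theta> \<equiv> (\<Sum>j\<in>UNIV. \<bar>\<theta> j\<bar>) / F"

lemma times_nonneg: "0 \<le> T * s j" "0 \<le> T * t j" "0 \<le> S1" "0 \<le> S2"
  using T_pos s_nonneg t_nonneg by (auto intro!: mult_nonneg_nonneg sum_nonneg)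

lemma times_le: "T * s j \<le> S1" "T * t j \<le> S2"
  using T_pos s_nonneg t_nonneg by (auto intro!: mult_left_mono member_le_sum)

lemma \<Theta>_nonneg: "0 \<le> \<Theta>"
  using F_pos by (auto intro!: divide_nonneg_pos sum_nonneg)

definition H :: "real \<times> real \<Rightarrow> (real \<Rightarrow> real) \<times> (real \<Rightarrow> real) \<Rightarrow> real" where
  "H x q = (\<Sum>j\<in>UNIV. \<theta> j * (path_integral \<phi> (T * s j) (fst x) (fst q) * path_integral \<psi> (T * t j) (snd x) (snd q))) / F"

abbreviation "paths n \<omega> \<equiv> (path1 n \<omega>, path2 n \<omega>)"

lemma H_measurable [measurable (raw)]:
  assumes [measurable]: "f \<in> measurable N (borel \<Otimes>\<^sub>M borel)" "g \<in> measurable N pathpair_space"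
  shows "(\<lambda>z. H (f z) (g z)) \<in> borel_measurable N"
  unfolding H_def by measurable

lemma H_path_measurable [measurable]: "H x \<in> borel_measurable pathpair_space"
  unfolding H_def by measurable

definition mark_char :: "nat \<Rightarrow> real \<times> real \<Rightarrow> complex" where
  "mark_char n x = (LINT \<omega>|M. cis (H x (paths n \<omega>)))"

definition mean :: "real \<times> real \<Rightarrow> real" where
  "mean x = (\<Sum>j\<in>UNIV. \<theta> j * (F1.first_moment (T * s j) (fst x) * F2.first_moment (T * t j) (snd x))) / F"

text \<open>The second moment of H for a start at x, not its variance: for a Poisson sum, the
  integral of second moments over the intensity is the variance of the sum.\<close>

definition var :: "real \<times> real \<Rightarrow> real" where
  "var x = (\<Sum>j\<in>UNIV. \<Sum>k\<in>UNIV. \<theta> j * \<theta> k *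
     (F1.second_moment (T * s j) (T * s k) (fst x) * F2.second_moment (T * t j) (T * t k) (snd x))) / F\<^sup>2"

definition gb1 :: real where "gb1 = S1 powr (1 - 1/\<alpha> 1) / (1 - 1/\<alpha> 1) * F1.p0 * F1.phi_norm"
definition gb2 :: real where "gb2 = S2 powr (1 - 1/\<alpha> 2) / (1 - 1/\<alpha> 2) * F2.p0 * F2.phi_norm"

lemma gb_nonneg: "0 \<le> gb1" "0 \<le> gb2"
  using F1.p0_nonneg F1.phi_norm_nonneg F1.exponents F2.p0_nonneg F2.phi_norm_nonneg F2.exponents
  by (auto simp: gb1_def gb2_def)

lemma green_bound_eq: "F1.green_bound phi' S1 = ennreal gb1" "F2.green_bound psi' S2 = ennreal gb2"
  using stable_motion_functional.green_bound_phi[OF motion1, of S1] stable_motion_functional.green_bound_phi[OF motion2, of S2]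
  by (simp_all add: gb1_def gb2_def)

definition g1 :: "real \<Rightarrow> real" where "g1 x = enn2real (F1.green phi' S1 x)"
definition g2 :: "real \<Rightarrow> real" where "g2 x = enn2real (F2.green psi' S2 x)"

lemma g_measurable [measurable]: "g1 \<in> borel_measurable borel" "g2 \<in> borel_measurable borel"
  unfolding g1_def g2_def by measurable

lemma g_nonneg: "0 \<le> g1 x" "0 \<le> g2 x"
  by (auto simp: g1_def g2_def)

lemma green_eq: "F1.green phi' S1 x = ennreal (g1 x)" "F2.green psi' S2 x = ennreal (g2 x)"
  using stable_motion_functional.green_phi_finite[OF motion1 times_nonneg(3), of x]
    stable_motion_functional.green_phi_finite[OF motion2 times_nonneg(4), of x]
  by (auto simp: g1_def g2_def)

text \<open>36 = 6 * 6, one factor from the third-moment bound of each type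
  (\<open>nn_expectation_path_occ_cube\<close>); \<Theta> bounds the normed coefficients.\<close>

definition cube_const :: real where "cube_const = \<Theta> ^ 3 * (36 * gb1\<^sup>2 * gb2\<^sup>2)"

definition rho :: "real \<times> real \<Rightarrow> real" where "rho x = cube_const * (g1 (fst x) * g2 (snd x))"

lemma cube_const_nonneg: "0 \<le> cube_const"
  using \<Theta>_nonneg gb_nonneg by (simp add: cube_const_def)

lemma rho_nonneg: "0 \<le> rho x"
  using cube_const_nonneg g_nonneg by (simp add: rho_def)

lemma moment_measurable [measurable]:
  "mean \<in> borel_measurable (borel \<Otimes>\<^sub>M borel)" "var \<in> borel_measurable (borel \<Otimes>\<^sub>M borel)"
  "rho \<in> borel_measurable (borel \<Otimes>\<^sub>M borel)" "mark_char n \<in> borel_measurable (borel \<Otimes>\<^sub>M borel)"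
  unfolding mean_def var_def rho_def mark_char_def by measurable

lemma mark_char_le_1: "norm (mark_char n x) \<le> 1"
proof -
  have "norm (mark_char n x) \<le> (LINT \<omega>|M. norm (cis (H x (paths n \<omega>))))"
    unfolding mark_char_def by (rule integral_norm_bound)
  then show ?thesis by (simp add: prob_space)
qed

lemma H_abs_le:
  "ennreal \<bar>H x (paths n \<omega>)\<bar> \<le> ennreal \<Theta> * (path_occ phi' S1 (fst x) (path1 n \<omega>) * path_occ psi' S2 (snd x) (path2 n \<omega>))"
    (is "_ \<le> _ * (?O1 * ?O2)")
proof -
  let ?U = "\<lambda>j. path_integral \<phi> (T * s j) (fst x) (path1 n \<omega>)" and ?V = "\<lambda>j. path_integral \<psi> (T * t j) (snd x) (path2 n \<omega>)"
  have "\<bar>H x (paths n \<omega>)\<bar> \<le> (\<Sum>j\<in>UNIV. \<bar>\<theta> j\<bar> / F * (\<bar>?U j\<bar> * \<bar>?V j\<bar>))"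
  proof -
    have "\<bar>H x (paths n \<omega>)\<bar> = \<bar>\<Sum>j\<in>UNIV. \<theta> j * (?U j * ?V j)\<bar> / F"
      using F_pos by (simp add: H_def)
    also have "\<dots> \<le> (\<Sum>j\<in>UNIV. \<bar>\<theta> j * (?U j * ?V j)\<bar>) / F"
      using F_pos by (intro divide_right_mono sum_abs) auto
    finally show ?thesis by (simp add: sum_divide_distrib abs_mult)
  qed
  then have "ennreal \<bar>H x (paths n \<omega>)\<bar> \<le> ennreal (\<Sum>j\<in>UNIV. \<bar>\<theta> j\<bar> / F * (\<bar>?U j\<bar> * \<bar>?V j\<bar>))"
    by (rule ennreal_leI)
  also have "\<dots> = (\<Sum>j\<in>UNIV. ennreal (\<bar>\<theta> j\<bar> / F) * (ennreal \<bar>?U j\<bar> * ennreal \<bar>?V j\<bar>))"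
  proof -
    have e: "ennreal (\<bar>\<theta> j\<bar> / F * (\<bar>?U j\<bar> * \<bar>?V j\<bar>)) = ennreal (\<bar>\<theta> j\<bar> / F) * (ennreal \<bar>?U j\<bar> * ennreal \<bar>?V j\<bar>)" for j
      using F_pos by (subst ennreal_mult') (simp_all add: ennreal_mult')
    show ?thesis unfolding e[symmetric] using F_pos by (intro sum_ennreal[symmetric]) auto
  qed
  also have "\<dots> \<le> (\<Sum>j\<in>UNIV. ennreal (\<bar>\<theta> j\<bar> / F) * (?O1 * ?O2))"
    by (intro sum_mono mult_left_mono mult_mono path_integral_abs_le times_le) auto
  also have "\<dots> = (\<Sum>j\<in>UNIV. ennreal (\<bar>\<theta> j\<bar> / F)) * (?O1 * ?O2)"
    by (simp only: sum_distrib_right)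
  also have "(\<Sum>j\<in>UNIV. ennreal (\<bar>\<theta> j\<bar> / F)) = ennreal \<Theta>"
    using F_pos by (subst sum_ennreal) (auto simp: sum_divide_distrib)
  finally show ?thesis .
qed

lemma nn_expectation_H_cube: "(\<integral>\<^sup>+\<omega>. ennreal (\<bar>H x (paths n \<omega>)\<bar> ^ 3) \<partial>M) \<le> ennreal (rho x)"
proof -
  let ?O1 = "\<lambda>\<omega>. path_occ phi' S1 (fst x) (path1 n \<omega>)" and ?O2 = "\<lambda>\<omega>. path_occ psi' S2 (snd x) (path2 n \<omega>)"
  have "(\<integral>\<^sup>+\<omega>. ennreal (\<bar>H x (paths n \<omega>)\<bar> ^ 3) \<partial>M) \<le> (\<integral>\<^sup>+\<omega>. ennreal (\<Theta> ^ 3) * (?O1 \<omega> ^ 3 * ?O2 \<omega> ^ 3) \<partial>M)"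
  proof (rule nn_integral_mono)
    fix \<omega>
    have "ennreal (\<bar>H x (paths n \<omega>)\<bar> ^ 3) = ennreal \<bar>H x (paths n \<omega>)\<bar> ^ 3" by (simp add: ennreal_power)
    also have "\<dots> \<le> (ennreal \<Theta> * (?O1 \<omega> * ?O2 \<omega>)) ^ 3" by (intro power_mono H_abs_le) auto
    also have "\<dots> = ennreal (\<Theta> ^ 3) * (?O1 \<omega> ^ 3 * ?O2 \<omega> ^ 3)"
      by (simp only: power_mult_distrib ennreal_power[OF \<Theta>_nonneg])
    finally show "ennreal (\<bar>H x (paths n \<omega>)\<bar> ^ 3) \<le> ennreal (\<Theta> ^ 3) * (?O1 \<omega> ^ 3 * ?O2 \<omega> ^ 3)" .
  qed
  also have "\<dots> = ennreal (\<Theta> ^ 3) * (\<integral>\<^sup>+\<omega>. ?O1 \<omega> ^ 3 * ?O2 \<omega> ^ 3 \<partial>M)"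
    by (rule nn_integral_cmult) measurable
  also have "(\<integral>\<^sup>+\<omega>. ?O1 \<omega> ^ 3 * ?O2 \<omega> ^ 3 \<partial>M) = (\<integral>\<^sup>+\<omega>. ?O1 \<omega> ^ 3 \<partial>M) * (\<integral>\<^sup>+\<omega>. ?O2 \<omega> ^ 3 \<partial>M)"
    using nn_expectation_path_mult[of "\<lambda>q. path_occ phi' S1 (fst x) q ^ 3" "\<lambda>q. path_occ psi' S2 (snd x) q ^ 3" n] by simp
  also have "ennreal (\<Theta> ^ 3) * (\<dots>) \<le> ennreal (\<Theta> ^ 3) * ((6 * (ennreal gb1)\<^sup>2 * ennreal (g1 (fst x))) * (6 * (ennreal gb2)\<^sup>2 * ennreal (g2 (snd x))))"
    unfolding green_bound_eq[symmetric] green_eq[symmetric]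
    by (intro mult_left_mono mult_mono nn_expectation_path_occ_cube times_nonneg) auto
  also have "\<dots> = ennreal (rho x)"
  proof -
    have "ennreal (6 * gb1\<^sup>2 * g1 (fst x)) = 6 * (ennreal gb1)\<^sup>2 * ennreal (g1 (fst x))"
      "ennreal (6 * gb2\<^sup>2 * g2 (snd x)) = 6 * (ennreal gb2)\<^sup>2 * ennreal (g2 (snd x))"
      using gb_nonneg g_nonneg by (simp_all add: ennreal_mult' ennreal_power)
    moreover have "rho x = \<Theta> ^ 3 * ((6 * gb1\<^sup>2 * g1 (fst x)) * (6 * gb2\<^sup>2 * g2 (snd x)))"
      by (simp add: rho_def cube_const_def)
    moreover have "0 \<le> \<Theta> ^ 3" "0 \<le> 6 * gb1\<^sup>2 * g1 (fst x)" using \<Theta>_nonneg g_nonneg by auto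
    ultimately show ?thesis by (simp only: ennreal_mult')
  qed
  finally show ?thesis .
qed

lemma mult_moments:
  "integrable M (\<lambda>\<omega>. path_integral \<phi> (T * s j) x (path1 n \<omega>) * path_integral \<psi> (T * t j) y (path2 n \<omega>))"
  "(LINT \<omega>|M. path_integral \<phi> (T * s j) x (path1 n \<omega>) * path_integral \<psi> (T * t j) y (path2 n \<omega>))
    = F1.first_moment (T * s j) x * F2.first_moment (T * t j) y"
  "integrable M (\<lambda>\<omega>. (path_integral \<phi> (T * s j) x (path1 n \<omega>) * path_integral \<phi> (T * s k) x (path1 n \<omega>))
     * (path_integral \<psi> (T * t j) y (path2 n \<omega>) * path_integral \<psi> (T * t k) y (path2 n \<omega>)))"
  "(LINT \<omega>|M. (path_integral \<phi> (T * s j) x (path1 n \<omega>) * path_integral \<phi> (T * s k) x (path1 n \<omega>))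
     * (path_integral \<psi> (T * t j) y (path2 n \<omega>) * path_integral \<psi> (T * t k) y (path2 n \<omega>)))
    = F1.second_moment (T * s j) (T * s k) x * F2.second_moment (T * t j) (T * t k) y"
proof -
  have i1: "indep_var borel (\<lambda>\<omega>. path_integral \<phi> (T * s j) x (path1 n \<omega>)) borel (\<lambda>\<omega>. path_integral \<psi> (T * t j) y (path2 n \<omega>))"
    by (rule indep_path_functions) measurable
  have i2: "indep_var borel (\<lambda>\<omega>. path_integral \<phi> (T * s j) x (path1 n \<omega>) * path_integral \<phi> (T * s k) x (path1 n \<omega>))
     borel (\<lambda>\<omega>. path_integral \<psi> (T * t j) y (path2 n \<omega>) * path_integral \<psi> (T * t k) y (path2 n \<omega>))"
    by (rule indep_path_functions[of "\<lambda>q. path_integral \<phi> (T * s j) x q * path_integral \<phi> (T * s k) x q"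
          "\<lambda>q. path_integral \<psi> (T * t j) y q * path_integral \<psi> (T * t k) y q"]) measurable
  note m1 = path_integral_moments[OF times_nonneg(1)[of j] times_nonneg(1)[of k]]
  note m2 = path_integral_moments[OF times_nonneg(2)[of j] times_nonneg(2)[of k]]
  show "integrable M (\<lambda>\<omega>. path_integral \<phi> (T * s j) x (path1 n \<omega>) * path_integral \<psi> (T * t j) y (path2 n \<omega>))"
    by (rule indep_var_integrable[OF i1 m1(1) m2(2)])
  show "(LINT \<omega>|M. path_integral \<phi> (T * s j) x (path1 n \<omega>) * path_integral \<psi> (T * t j) y (path2 n \<omega>))
    = F1.first_moment (T * s j) x * F2.first_moment (T * t j) y"
    unfolding indep_var_lebesgue_integral[OF i1 m1(1) m2(2)] m1(3) m2(4) ..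
  show "integrable M (\<lambda>\<omega>. (path_integral \<phi> (T * s j) x (path1 n \<omega>) * path_integral \<phi> (T * s k) x (path1 n \<omega>))
     * (path_integral \<psi> (T * t j) y (path2 n \<omega>) * path_integral \<psi> (T * t k) y (path2 n \<omega>)))"
    by (rule indep_var_integrable[OF i2 m1(5) m2(6)])
  show "(LINT \<omega>|M. (path_integral \<phi> (T * s j) x (path1 n \<omega>) * path_integral \<phi> (T * s k) x (path1 n \<omega>))
     * (path_integral \<psi> (T * t j) y (path2 n \<omega>) * path_integral \<psi> (T * t k) y (path2 n \<omega>)))
    = F1.second_moment (T * s j) (T * s k) x * F2.second_moment (T * t j) (T * t k) y"
    unfolding indep_var_lebesgue_integral[OF i2 m1(5) m2(6)] m1(7) m2(8) ..
qed

lemma expectation_H: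
  "integrable M (\<lambda>\<omega>. H x (paths n \<omega>))" "(LINT \<omega>|M. H x (paths n \<omega>)) = mean x"
  unfolding H_def mean_def fst_conv snd_conv
  by (auto intro!: integrable_divide Bochner_Integration.integrable_sum integrable_mult_right mult_moments
      simp: mult_moments(1,2))

lemma expectation_H_square:
  "integrable M (\<lambda>\<omega>. (H x (paths n \<omega>))\<^sup>2)" "(LINT \<omega>|M. (H x (paths n \<omega>))\<^sup>2) = var x"
proof -
  let ?U = "\<lambda>j \<omega>. path_integral \<phi> (T * s j) (fst x) (path1 n \<omega>)" and ?V = "\<lambda>j \<omega>. path_integral \<psi> (T * t j) (snd x) (path2 n \<omega>)"
  have eq: "(H x (paths n \<omega>))\<^sup>2 = (\<Sum>j\<in>UNIV. \<Sum>k\<in>UNIV. \<theta> j * \<theta> k * ((?U j \<omega> * ?U k \<omega>) * (?V j \<omega> * ?V k \<omega>))) / F\<^sup>2" for \<omega>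
  proof -
    have "(\<Sum>j\<in>UNIV. \<theta> j * (?U j \<omega> * ?V j \<omega>))\<^sup>2 = (\<Sum>j\<in>UNIV. \<Sum>k\<in>UNIV. (\<theta> j * (?U j \<omega> * ?V j \<omega>)) * (\<theta> k * (?U k \<omega> * ?V k \<omega>)))"
      unfolding power2_eq_square by (rule sum_product)
    also have "\<dots> = (\<Sum>j\<in>UNIV. \<Sum>k\<in>UNIV. \<theta> j * \<theta> k * ((?U j \<omega> * ?U k \<omega>) * (?V j \<omega> * ?V k \<omega>)))"
      by (intro sum.cong refl) (simp only: mult_ac)
    finally show ?thesis by (simp add: H_def power_divide)
  qed
  show "integrable M (\<lambda>\<omega>. (H x (paths n \<omega>))\<^sup>2)"
    unfolding eq by (intro integrable_divide Bochner_Integration.integrable_sum integrable_mult_right mult_moments(3))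
  show "(LINT \<omega>|M. (H x (paths n \<omega>))\<^sup>2) = var x"
    unfolding eq var_def by (simp add: mult_moments(3,4))
qed

lemma cis_taylor: "norm (cis h - (1 + \<i> * complex_of_real h - complex_of_real (h\<^sup>2) / 2)) \<le> \<bar>h\<bar> ^ 3"
proof -
  have "norm (iexp h - (\<Sum>k \<le> 2. (\<i> * h)^k / fact k)) \<le> \<bar>h\<bar>^(Suc 2) / fact (Suc 2)" by (rule iexp_approx1)
  also have "(\<Sum>k \<le> 2. (\<i> * complex_of_real h)^k / fact k) = 1 + \<i> * complex_of_real h - complex_of_real (h\<^sup>2) / 2"
    by (simp add: numeral_2_eq_2 power_mult_distrib)
  also have "\<bar>h\<bar>^(Suc 2) / fact (Suc 2) \<le> \<bar>h\<bar> ^ 3"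
    by (simp add: divide_le_eq fact_numeral)
  finally show ?thesis by (simp add: cis_conv_exp)
qed

text \<open>The Taylor polynomial and the error bound are the same for every n, whereas
  \<open>mark_char n\<close> may vary with n. This is what makes the particles interchangeable up to
  the third order.\<close>

lemma mark_char_approx:
  "norm (mark_char n x - (1 + \<i> * complex_of_real (mean x) - complex_of_real (var x) / 2)) \<le> rho x"
proof -
  let ?h = "\<lambda>\<omega>. H x (paths n \<omega>)"
  let ?r = "\<lambda>\<omega>. cis (?h \<omega>) - (1 + \<i> * complex_of_real (?h \<omega>) - complex_of_real ((?h \<omega>)\<^sup>2) / 2)"
  have ic: "integrable M (\<lambda>\<omega>. cis (?h \<omega>))"
    by (rule integrable_const_bound[of _ 1]) (simp, measurable)
  have i1: "integrable M (\<lambda>\<omega>. \<i> * complex_of_real (?h \<omega>))"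
    by (intro integrable_mult_right integrable_of_real expectation_H)
  have i2: "integrable M (\<lambda>\<omega>. complex_of_real ((?h \<omega>)\<^sup>2) / 2)"
    by (intro integrable_divide integrable_of_real expectation_H_square)
  have i3: "integrable M (\<lambda>\<omega>. 1 + \<i> * complex_of_real (?h \<omega>))" using i1 by simp
  have "(LINT \<omega>|M. ?r \<omega>) = mark_char n x - (LINT \<omega>|M. 1 + \<i> * complex_of_real (?h \<omega>) - complex_of_real ((?h \<omega>)\<^sup>2) / 2)"
    unfolding mark_char_def by (intro Bochner_Integration.integral_diff ic i3 i2 Bochner_Integration.integrable_diff)
  also have "(LINT \<omega>|M. 1 + \<i> * complex_of_real (?h \<omega>) - complex_of_real ((?h \<omega>)\<^sup>2) / 2)
     = (LINT \<omega>|M. 1 + \<i> * complex_of_real (?h \<omega>)) - (LINT \<omega>|M. complex_of_real ((?h \<omega>)\<^sup>2) / 2)"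
    by (intro Bochner_Integration.integral_diff i3 i2)
  also have "(LINT \<omega>|M. 1 + \<i> * complex_of_real (?h \<omega>)) = 1 + \<i> * complex_of_real (mean x)"
    using Bochner_Integration.integral_add[OF integrable_const i1, of 1]
    by (simp add: prob_space expectation_H(2))
  also have "(LINT \<omega>|M. complex_of_real ((?h \<omega>)\<^sup>2) / 2) = complex_of_real (var x) / 2"
    by (subst integral_divide_zero, subst integral_complex_of_real) (simp add: expectation_H_square(2))
  finally have eq: "mark_char n x - (1 + \<i> * complex_of_real (mean x) - complex_of_real (var x) / 2) = (LINT \<omega>|M. ?r \<omega>)"
    by simp
  have ir: "integrable M ?r" by (intro Bochner_Integration.integrable_diff ic i3 i2)
  have "ennreal (norm (LINT \<omega>|M. ?r \<omega>)) \<le> (\<integral>\<^sup>+\<omega>. ennreal (norm (?r \<omega>)) \<partial>M)"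
    by (rule integral_norm_bound_ennreal[OF ir])
  also have "\<dots> \<le> (\<integral>\<^sup>+\<omega>. ennreal (\<bar>?h \<omega>\<bar> ^ 3) \<partial>M)"
    by (intro nn_integral_mono ennreal_leI cis_taylor)
  also have "\<dots> \<le> ennreal (rho x)" by (rule nn_expectation_H_cube)
  finally show ?thesis unfolding eq using rho_nonneg by simp
qed

section \<open>Integration against the intensity\<close>

lemma nn_integral_g:
  "(\<integral>\<^sup>+x. ennreal (g1 x) \<partial>power_intensity (\<gamma> 1)) \<le> ennreal (S1 powr (1 - \<gamma> 1/\<alpha> 1) / (1 - \<gamma> 1/\<alpha> 1) * (F1.potential_bound * F1.phi_norm))"
  "(\<integral>\<^sup>+x. ennreal (g2 x) \<partial>power_intensity (\<gamma> 2)) \<le> ennreal (S2 powr (1 - \<gamma> 2/\<alpha> 2) / (1 - \<gamma> 2/\<alpha> 2) * (F2.potential_bound * F2.phi_norm))"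
  unfolding green_eq[symmetric]
  by (rule F1.nn_integral_green_power_intensity[OF times_nonneg(3)] F2.nn_integral_green_power_intensity[OF times_nonneg(4)])+

lemma integrable_g: "integrable (power_intensity (\<gamma> 1)) g1" "integrable (power_intensity (\<gamma> 2)) g2"
  using le_less_trans[OF nn_integral_g(1) ennreal_less_top] le_less_trans[OF nn_integral_g(2) ennreal_less_top] g_nonneg
  by (auto intro!: integrableI_nonneg)

lemma integral_g_le:
  "(LINT x|power_intensity (\<gamma> 1). g1 x) \<le> S1 powr (1 - \<gamma> 1/\<alpha> 1) / (1 - \<gamma> 1/\<alpha> 1) * (F1.potential_bound * F1.phi_norm)"
  "(LINT x|power_intensity (\<gamma> 2). g2 x) \<le> S2 powr (1 - \<gamma> 2/\<alpha> 2) / (1 - \<gamma> 2/\<alpha> 2) * (F2.potential_bound * F2.phi_norm)"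
proof -
  have e: "1 - \<gamma> 1/\<alpha> 1 > 0" "1 - \<gamma> 2/\<alpha> 2 > 0" using F1.exponents F2.exponents by auto
  have "0 \<le> S1 powr (1 - \<gamma> 1/\<alpha> 1) / (1 - \<gamma> 1/\<alpha> 1) * (F1.potential_bound * F1.phi_norm)"
    "0 \<le> S2 powr (1 - \<gamma> 2/\<alpha> 2) / (1 - \<gamma> 2/\<alpha> 2) * (F2.potential_bound * F2.phi_norm)"
    using e F1.potential_bound_nonneg F1.phi_norm_nonneg F2.potential_bound_nonneg F2.phi_norm_nonneg by auto
  then show "(LINT x|power_intensity (\<gamma> 1). g1 x) \<le> S1 powr (1 - \<gamma> 1/\<alpha> 1) / (1 - \<gamma> 1/\<alpha> 1) * (F1.potential_bound * F1.phi_norm)"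
    "(LINT x|power_intensity (\<gamma> 2). g2 x) \<le> S2 powr (1 - \<gamma> 2/\<alpha> 2) / (1 - \<gamma> 2/\<alpha> 2) * (F2.potential_bound * F2.phi_norm)"
    using nn_integral_g nn_integral_eq_integral[OF integrable_g(1)] nn_integral_eq_integral[OF integrable_g(2)] g_nonneg
    by auto
qed

lemma rho_integral:
  "integrable intensity rho"
  "(LINT x|intensity. rho x) = cube_const * ((LINT x|power_intensity (\<gamma> 1). g1 x) * (LINT x|power_intensity (\<gamma> 2). g2 x))"
  unfolding rho_def using I.integral_pair_mult[OF integrable_g]
  by (auto intro!: integrable_mult_right)

lemma mean_integral:
  "integrable intensity mean"
  "(LINT x|intensity. mean x) = (\<Sum>j\<in>UNIV. \<theta> j * (LINT x|intensity. F1.first_moment (T * s j) (fst x) * F2.first_moment (T * t j) (snd x))) / F"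
proof -
  have i: "integrable intensity (\<lambda>x. F1.first_moment (T * s j) (fst x) * F2.first_moment (T * t j) (snd x))" for j
    by (intro I.integral_pair_mult(1) integrable_first_moments times_nonneg)
  show "integrable intensity mean" unfolding mean_def
    by (intro integrable_divide Bochner_Integration.integrable_sum integrable_mult_right i)
  show "(LINT x|intensity. mean x) = (\<Sum>j\<in>UNIV. \<theta> j * (LINT x|intensity. F1.first_moment (T * s j) (fst x) * F2.first_moment (T * t j) (snd x))) / F"
    unfolding mean_def using i by simp
qed

lemma var_integral:
  "integrable intensity var"
  "(LINT x|intensity. var x) = (\<Sum>j\<in>UNIV. \<Sum>k\<in>UNIV. \<theta> j * \<theta> k *
     (F1.mass_integral (T * s j) (T * s k) * F2.mass_integral (T * t j) (T * t k))) / F\<^sup>2"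
proof -
  have m1: "integrable (power_intensity (\<gamma> 1)) (F1.second_moment (T * s j) (T * s k))" for j k
    by (intro F1.second_moment_integral times_nonneg)
  have m2: "integrable (power_intensity (\<gamma> 2)) (F2.second_moment (T * t j) (T * t k))" for j k
    by (intro F2.second_moment_integral times_nonneg)
  note pm = I.integral_pair_mult[OF m1 m2]
  show "integrable intensity var" unfolding var_def
    by (intro integrable_divide Bochner_Integration.integrable_sum integrable_mult_right pm)
  show "(LINT x|intensity. var x) = (\<Sum>j\<in>UNIV. \<Sum>k\<in>UNIV. \<theta> j * \<theta> k *
     (F1.mass_integral (T * s j) (T * s k) * F2.mass_integral (T * t j) (T * t k))) / F\<^sup>2"
    unfolding var_def using pm F1.second_moment_integral(2)[OF times_nonneg(1,1)] F2.second_moment_integral(2)[OF times_nonneg(2,2)]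
    by simp
qed

text \<open>With the starting points frozen through \<open>indep_pos_paths\<close>, only the paths
  are random; those of different particles are independent, so the expectation factorises.\<close>

lemma expectation_cis_sum:
  "(LINT \<omega>|M. cis (\<Sum>n<L. H (pos n \<omega>) (paths n \<omega>))) = (LINT \<omega>|M. (\<Prod>n<L. mark_char n (pos n \<omega>)))"
proof -
  let ?G = "\<lambda>(y, q). \<Prod>n<L. cis (H (y n) (q n))"
  have Gm: "?G \<in> borel_measurable (PiM UNIV (\<lambda>_. borel \<Otimes>\<^sub>M borel) \<Otimes>\<^sub>M PiM UNIV (\<lambda>_. pathpair_space))"
    unfolding split_beta' by measurable
  have cis_sum: "cis (\<Sum>n<L. h n) = (\<Prod>n<L. cis (h n))" for h :: "nat \<Rightarrow> real"
    by (induction L) (auto simp: cis_mult[symmetric])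
  have "(LINT \<omega>|M. cis (\<Sum>n<L. H (pos n \<omega>) (paths n \<omega>))) = (LINT \<omega>|M. ?G (\<lambda>n. pos n \<omega>, \<lambda>n. paths n \<omega>))"
    by (simp add: cis_sum)
  also have "\<dots> = (LINT \<omega>|M. (LINT \<omega>'|M. ?G (\<lambda>n. pos n \<omega>, \<lambda>n. paths n \<omega>')))"
  proof (rule integral_indep_pair[OF indep_pos_paths Gm])
    show "integrable M (\<lambda>\<omega>. ?G (\<lambda>n. pos n \<omega>, \<lambda>n. paths n \<omega>))"
      by (rule integrable_const_bound[of _ 1]) (auto simp: prod_norm[symmetric])
  qed
  also have "\<dots> = (LINT \<omega>|M. (\<Prod>n<L. mark_char n (pos n \<omega>)))"
  proof (rule Bochner_Integration.integral_cong[OF refl])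
    fix \<omega> assume "\<omega> \<in> space M"
    have "indep_vars (\<lambda>_. borel) (\<lambda>n \<omega>'. cis (H (pos n \<omega>) (paths n \<omega>'))) {..<L}"
      by (rule indep_vars_compose2[OF indep_vars_subset[OF indep_paths], where Y="\<lambda>n q. cis (H (pos n \<omega>) q)"])
         (simp, measurable)
    from indep_vars_lebesgue_integral[OF _ this]
    show "(LINT \<omega>'|M. ?G (\<lambda>n. pos n \<omega>, \<lambda>n. paths n \<omega>')) = (\<Prod>n<L. mark_char n (pos n \<omega>))"
      by (simp add: mark_char_def integrable_const_bound[of _ 1])
  qed
  finally show ?thesis .
qed

text \<open>The sum of the contributions is the uncentred combination; by
  \<open>expectation_occupation_time\<close> its mean is the integral of \<open>mean\<close>, which
  is therefore the constant on the right.\<close>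

lemma fluctuation_eq_sum:
  "AE \<omega> in M. (\<lambda>L. \<Sum>n<L. H (pos n \<omega>) (paths n \<omega>)) \<longlonglongrightarrow>
    (\<Sum>j\<in>UNIV. \<theta> j * occupation_fluctuation M \<gamma> \<alpha> \<xi> \<zeta> \<phi> \<psi> T (s j) (t j) \<omega>) + (LINT x|intensity. mean x)"
proof -
  have "AE \<omega> in M. \<forall>j\<in>UNIV. summable (\<lambda>n. norm (mark1 (T * s j) n \<omega> * mark2 (T * t j) n \<omega>))
      \<and> occupation_time \<xi> \<zeta> \<phi> \<psi> (T * s j) (T * t j) \<omega> = (\<Sum>n. mark1 (T * s j) n \<omega> * mark2 (T * t j) n \<omega>)"
  proof (rule AE_finite_allI)
    fix j
    have "AE \<omega> in M. summable (\<lambda>n. norm (mark1 (T * s j) n \<omega> * mark2 (T * t j) n \<omega>))"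
      by (rule AE_summable_if_nn_sum[OF _ nn_sum_marks_finite[OF times_nonneg(1,2)]]) measurable
    with occupation_time_eq_sum[OF times_nonneg(1)[of j] times_nonneg(2)[of j]]
    show "AE \<omega> in M. summable (\<lambda>n. norm (mark1 (T * s j) n \<omega> * mark2 (T * t j) n \<omega>))
      \<and> occupation_time \<xi> \<zeta> \<phi> \<psi> (T * s j) (T * t j) \<omega> = (\<Sum>n. mark1 (T * s j) n \<omega> * mark2 (T * t j) n \<omega>)"
      by eventually_elim auto
  qed simp
  then show ?thesis
  proof eventually_elim
    case (elim \<omega>)
    have "(\<lambda>n. mark1 (T * s j) n \<omega> * mark2 (T * t j) n \<omega>) sums occupation_time \<xi> \<zeta> \<phi> \<psi> (T * s j) (T * t j) \<omega>" for j
    proof -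
      have "summable (\<lambda>n. norm (mark1 (T * s j) n \<omega> * mark2 (T * t j) n \<omega>))"
        and occ: "occupation_time \<xi> \<zeta> \<phi> \<psi> (T * s j) (T * t j) \<omega> = (\<Sum>n. mark1 (T * s j) n \<omega> * mark2 (T * t j) n \<omega>)"
        using elim by blast+
      then show ?thesis unfolding occ by (intro summable_sums) (rule summable_norm_cancel)
    qed
    then have "(\<lambda>n. (\<Sum>j\<in>UNIV. \<theta> j * (mark1 (T * s j) n \<omega> * mark2 (T * t j) n \<omega>)) / F)
       sums ((\<Sum>j\<in>UNIV. \<theta> j * occupation_time \<xi> \<zeta> \<phi> \<psi> (T * s j) (T * t j) \<omega>) / F)"
      by (intro sums_divide sums_sum sums_mult)
    also have "(\<lambda>n. (\<Sum>j\<in>UNIV. \<theta> j * (mark1 (T * s j) n \<omega> * mark2 (T * t j) n \<omega>)) / F) = (\<lambda>n. H (pos n \<omega>) (paths n \<omega>))"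
      by (simp add: H_def mark1_def mark2_def)
    also have "(\<Sum>j\<in>UNIV. \<theta> j * occupation_time \<xi> \<zeta> \<phi> \<psi> (T * s j) (T * t j) \<omega>) / F
       = (\<Sum>j\<in>UNIV. \<theta> j * occupation_fluctuation M \<gamma> \<alpha> \<xi> \<zeta> \<phi> \<psi> T (s j) (t j) \<omega>) + (LINT x|intensity. mean x)"
      unfolding mean_integral(2) occupation_fluctuation_def expectation_occupation_time[OF times_nonneg(1,2)]
        sum_divide_distrib sum.distrib[symmetric]
      using F_pos by (intro sum.cong refl) (simp add: field_simps)
    finally show ?case by (simp add: sums_def)
  qed
qed

text \<open>Particle 0 represents all others. The subtracted term is the centring; it cancels the
  first-order part of \<open>mark_char 0 x - 1\<close>.\<close>

definition exponent :: complex where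
  "exponent = (LINT x|intensity. mark_char 0 x - 1) - \<i> * complex_of_real (LINT x|intensity. mean x)"

text \<open>The intensity is infinite, so boundedness is of no help; the expansion dominates the
  function by moments that are integrable over the starting points.\<close>

lemma mark_char_integrable: "integrable intensity (\<lambda>x. mark_char 0 x - 1)"
proof (rule Bochner_Integration.integrable_bound)
  show "integrable intensity (\<lambda>x. \<bar>mean x\<bar> + \<bar>var x\<bar> + rho x)"
    using mean_integral(1) var_integral(1) rho_integral(1) by auto
  have "norm (mark_char 0 x - 1) \<le> norm (\<bar>mean x\<bar> + \<bar>var x\<bar> + rho x)" for x
  proof -
    have "norm (mark_char 0 x - 1) \<le> norm (mark_char 0 x - (1 + \<i> * complex_of_real (mean x) - complex_of_real (var x) / 2))
        + norm (\<i> * complex_of_real (mean x) - complex_of_real (var x) / 2)"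
      using norm_triangle_ineq[of "mark_char 0 x - (1 + \<i> * complex_of_real (mean x) - complex_of_real (var x) / 2)"
          "\<i> * complex_of_real (mean x) - complex_of_real (var x) / 2"] by (simp add: algebra_simps)
    also have "norm (\<i> * complex_of_real (mean x) - complex_of_real (var x) / 2) \<le> \<bar>mean x\<bar> + \<bar>var x\<bar>"
      using norm_triangle_ineq4[of "\<i> * complex_of_real (mean x)" "complex_of_real (var x) / 2"]
      by (simp add: norm_mult norm_divide)
    finally show ?thesis using mark_char_approx[of 0 x] rho_nonneg[of x] by simp
  qed
  then show "AE x in intensity. norm (mark_char 0 x - 1) \<le> norm (\<bar>mean x\<bar> + \<bar>var x\<bar> + rho x)" by simp
qed measurable

lemma exponent_approx: "norm (exponent + complex_of_real (LINT x|intensity. var x) / 2) \<le> (LINT x|intensity. rho x)"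
proof -
  have im: "integrable intensity (\<lambda>x. \<i> * complex_of_real (mean x))"
    by (intro integrable_mult_right integrable_of_real mean_integral)
  have iv: "integrable intensity (\<lambda>x. complex_of_real (var x) / 2)"
    by (intro integrable_divide integrable_of_real var_integral)
  let ?r = "\<lambda>x. (mark_char 0 x - 1) - \<i> * complex_of_real (mean x) + complex_of_real (var x) / 2"
  have ir: "integrable intensity ?r"
    by (intro Bochner_Integration.integrable_add Bochner_Integration.integrable_diff mark_char_integrable im iv)
  have e1: "(LINT x|intensity. \<i> * complex_of_real (mean x)) = \<i> * complex_of_real (LINT x|intensity. mean x)"
    by (subst integral_mult_right_zero, subst integral_complex_of_real) simp
  have e2: "(LINT x|intensity. complex_of_real (var x) / 2) = complex_of_real (LINT x|intensity. var x) / 2"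
    by (subst integral_divide_zero, subst integral_complex_of_real) simp
  have eq: "exponent + complex_of_real (LINT x|intensity. var x) / 2 = (LINT x|intensity. ?r x)"
    unfolding exponent_def e1[symmetric] e2[symmetric]
    by (simp only: Bochner_Integration.integral_add[OF Bochner_Integration.integrable_diff[OF mark_char_integrable im] iv]
        Bochner_Integration.integral_diff[OF mark_char_integrable im])
  have "norm (LINT x|intensity. ?r x) \<le> (LINT x|intensity. norm (?r x))" by (rule integral_norm_bound)
  also have "\<dots> \<le> (LINT x|intensity. rho x)"
  proof (rule integral_mono[OF integrable_norm[OF ir] rho_integral(1)])
    fix x
    have "?r x = mark_char 0 x - (1 + \<i> * complex_of_real (mean x) - complex_of_real (var x) / 2)" by simp
    then show "norm (?r x) \<le> rho x" using mark_char_approx[of 0 x] by (simp only:)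
  qed
  finally show ?thesis unfolding eq .
qed

text \<open>The factor 2 arises because \<open>mark_char n\<close> and \<open>mark_char 0\<close>
  are both within \<open>rho\<close> of the same polynomial. The comparison is uniform in the number
  L of particles and so persists in the limit; the centring is a factor of modulus 1.\<close>

theorem char_fluctuation_approx:
  "norm ((LINT \<omega>|M. cis (\<Sum>j\<in>UNIV. \<theta> j * occupation_fluctuation M \<gamma> \<alpha> \<xi> \<zeta> \<phi> \<psi> T (s j) (t j) \<omega>)) - exp exponent)
    \<le> 2 * (LINT x|intensity. rho x)"
proof -
  let ?X = "\<lambda>\<omega>. \<Sum>j\<in>UNIV. \<theta> j * occupation_fluctuation M \<gamma> \<alpha> \<xi> \<zeta> \<phi> \<psi> T (s j) (t j) \<omega>"
  let ?m = "LINT x|intensity. mean x"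
  have Xm [measurable]: "?X \<in> borel_measurable M"
    unfolding occupation_fluctuation_def by measurable
  have lim1: "(\<lambda>L. LINT \<omega>|M. cis (\<Sum>n<L. H (pos n \<omega>) (paths n \<omega>))) \<longlonglongrightarrow> (LINT \<omega>|M. cis (?X \<omega> + ?m))"
  proof (rule integral_dominated_convergence[where w="\<lambda>_. 1"])
    show "AE \<omega> in M. (\<lambda>L. cis (\<Sum>n<L. H (pos n \<omega>) (paths n \<omega>))) \<longlonglongrightarrow> cis (?X \<omega> + ?m)"
      using fluctuation_eq_sum by eventually_elim (intro tendsto_cis)
  qed auto
  have lim2: "(\<lambda>L. LINT \<omega>|M. (\<Prod>n<L. mark_char 0 (pos n \<omega>))) \<longlonglongrightarrow> exp (LINT x|intensity. mark_char 0 x - 1)"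
    using mark_char_le_1 by (intro PP.poisson_functional mark_char_integrable) auto
  have le: "norm ((LINT \<omega>|M. cis (\<Sum>n<L. H (pos n \<omega>) (paths n \<omega>))) - (LINT \<omega>|M. (\<Prod>n<L. mark_char 0 (pos n \<omega>)))) \<le> 2 * (LINT x|intensity. rho x)" for L
  proof -
    have "norm ((LINT \<omega>|M. (\<Prod>n<L. mark_char n (pos n \<omega>))) - (LINT \<omega>|M. (\<Prod>n<L. mark_char 0 (pos n \<omega>)))) \<le> (LINT x|intensity. 2 * rho x)"
    proof (rule PP.expectation_prod_compare)
      show "norm (mark_char n x - mark_char 0 x) \<le> 2 * rho x" for n x
        using norm_triangle_ineq4[of "mark_char n x - (1 + \<i> * complex_of_real (mean x) - complex_of_real (var x) / 2)"
            "mark_char 0 x - (1 + \<i> * complex_of_real (mean x) - complex_of_real (var x) / 2)"]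
          mark_char_approx[of n x] mark_char_approx[of 0 x] by simp
    qed (use mark_char_le_1 rho_nonneg rho_integral in auto)
    then show ?thesis by (simp add: expectation_cis_sum)
  qed
  have "norm ((LINT \<omega>|M. cis (?X \<omega> + ?m)) - exp (LINT x|intensity. mark_char 0 x - 1)) \<le> 2 * (LINT x|intensity. rho x)"
    by (rule tendsto_upperbound[OF tendsto_norm[OF tendsto_diff[OF lim1 lim2]]]) (use le in auto)
  moreover have "(LINT \<omega>|M. cis (?X \<omega>)) - exp exponent = cis (- ?m) * ((LINT \<omega>|M. cis (?X \<omega> + ?m)) - exp (LINT x|intensity. mark_char 0 x - 1))"
  proof -
    have "cis (?X \<omega>) = cis (- ?m) * cis (?X \<omega> + ?m)" for \<omega> by (simp add: cis_mult)
    then have "(LINT \<omega>|M. cis (?X \<omega>)) = cis (- ?m) * (LINT \<omega>|M. cis (?X \<omega> + ?m))"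
      by (simp only: integral_mult_right_zero)
    moreover have "exp exponent = cis (- ?m) * exp (LINT x|intensity. mark_char 0 x - 1)"
      by (simp add: exponent_def exp_diff cis_conv_exp exp_minus divide_inverse mult.commute)
    ultimately show ?thesis by (simp add: right_diff_distrib)
  qed
  ultimately show ?thesis by (simp add: norm_mult)
qed

lemma rho_integral_le:
  "(LINT x|intensity. rho x) \<le> cube_const *
    ((S1 powr (1 - \<gamma> 1/\<alpha> 1) / (1 - \<gamma> 1/\<alpha> 1) * (F1.potential_bound * F1.phi_norm)) *
     (S2 powr (1 - \<gamma> 2/\<alpha> 2) / (1 - \<gamma> 2/\<alpha> 2) * (F2.potential_bound * F2.phi_norm)))"
proof -
  have 0: "0 \<le> (LINT x|power_intensity (\<gamma> 1). g1 x)" "0 \<le> (LINT x|power_intensity (\<gamma> 2). g2 x)"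
    using g_nonneg by (auto intro!: integral_nonneg_AE)
  show ?thesis unfolding rho_integral(2)
    using 0 order_trans[OF 0(1) integral_g_le(1)]
    by (intro mult_left_mono mult_mono integral_g_le cube_const_nonneg) auto
qed

text \<open>What is left of the bound for the integral of \<open>rho\<close> once the powers of T
  have been taken out.\<close>

definition error_const :: real where
  "error_const = (\<Sum>j\<in>UNIV. \<bar>\<theta> j\<bar>) ^ 3 * 36 *
    ((sum s UNIV) powr (1 - 1/\<alpha> 1) / (1 - 1/\<alpha> 1) * F1.p0 * F1.phi_norm)\<^sup>2 *
    ((sum t UNIV) powr (1 - 1/\<alpha> 2) / (1 - 1/\<alpha> 2) * F2.p0 * F2.phi_norm)\<^sup>2 *
    ((sum s UNIV) powr (1 - \<gamma> 1/\<alpha> 1) / (1 - \<gamma> 1/\<alpha> 1) * (F1.potential_bound * F1.phi_norm)) *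
    ((sum t UNIV) powr (1 - \<gamma> 2/\<alpha> 2) / (1 - \<gamma> 2/\<alpha> 2) * (F2.potential_bound * F2.phi_norm))"

lemma F_eq: "F = T powr (1 - (1 + \<gamma> 1) / (2 * \<alpha> 1)) * T powr (1 - (1 + \<gamma> 2) / (2 * \<alpha> 2))"
  by (simp add: norming_def)

text \<open>Each type contributes (T^(1-1/\<alpha>))^2 from the squared Green bound and
  T^(1-\<gamma>/\<alpha>) from the first moment, and F^3 comes from the cube of \<Theta>. The
  resulting exponent is negative since \<gamma> < 1.\<close>

lemma rho_integral_le_powr:
  "(LINT x|intensity. rho x) \<le> error_const * T powr ((\<gamma> 1 - 1) / (2 * \<alpha> 1) + (\<gamma> 2 - 1) / (2 * \<alpha> 2))"
proof -
  let ?b1 = "1 - 1/\<alpha> 1" and ?b2 = "1 - 1/\<alpha> 2" and ?a1 = "1 - \<gamma> 1/\<alpha> 1" and ?a2 = "1 - \<gamma> 2/\<alpha> 2"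
  let ?f1 = "1 - (1 + \<gamma> 1) / (2 * \<alpha> 1)" and ?f2 = "1 - (1 + \<gamma> 2) / (2 * \<alpha> 2)"
  have S: "0 \<le> sum s UNIV" "0 \<le> sum t UNIV" using s_nonneg t_nonneg by (auto intro: sum_nonneg)
  have sp: "S1 powr e = T powr e * (sum s UNIV) powr e" "S2 powr e = T powr e * (sum t UNIV) powr e" for e
    using T_pos S by (auto simp: powr_mult)
  have "cube_const * ((S1 powr ?a1 / ?a1 * (F1.potential_bound * F1.phi_norm)) * (S2 powr ?a2 / ?a2 * (F2.potential_bound * F2.phi_norm)))
    = error_const * ((T powr ?b1)\<^sup>2 * (T powr ?b2)\<^sup>2 * T powr ?a1 * T powr ?a2 / F ^ 3)"
    unfolding cube_const_def gb1_def gb2_def sp error_const_def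
    by (simp only: divide_inverse power_mult_distrib power_inverse mult_ac)
  also have "(T powr ?b1)\<^sup>2 * (T powr ?b2)\<^sup>2 * T powr ?a1 * T powr ?a2 / F ^ 3
    = T powr ((?b1 + ?b1) + (?b2 + ?b2) + ?a1 + ?a2 - ((?f1 + ?f2) + (?f1 + ?f2) + (?f1 + ?f2)))"
    using T_pos unfolding F_eq power2_eq_square power3_eq_cube by (simp only: powr_add powr_diff)
  also have "(?b1 + ?b1) + (?b2 + ?b2) + ?a1 + ?a2 - ((?f1 + ?f2) + (?f1 + ?f2) + (?f1 + ?f2))
    = (\<gamma> 1 - 1) / (2 * \<alpha> 1) + (\<gamma> 2 - 1) / (2 * \<alpha> 2)"
    using F1.alpha F2.alpha by (simp add: field_simps)
  finally show ?thesis using rho_integral_le by simp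
qed

text \<open>The square of the norming is exactly the product of the two growth rates in
  \<open>mass_integral_tendsto\<close>, so the second-order term has a finite limit.\<close>

lemma var_integral_scaled:
  "(LINT x|intensity. var x) = (\<Sum>j\<in>UNIV. \<Sum>k\<in>UNIV. \<theta> j * \<theta> k *
     ((F1.mass_integral (T * s j) (T * s k) / T powr (2 - (1 + \<gamma> 1)/\<alpha> 1)) *
      (F2.mass_integral (T * t j) (T * t k) / T powr (2 - (1 + \<gamma> 2)/\<alpha> 2))))"
proof -
  have "F\<^sup>2 = T powr (2 - (1 + \<gamma> 1)/\<alpha> 1) * T powr (2 - (1 + \<gamma> 2)/\<alpha> 2)"
  proof -
    have "2 - (1 + \<gamma> 1)/\<alpha> 1 = (1 - (1 + \<gamma> 1) / (2 * \<alpha> 1)) + (1 - (1 + \<gamma> 1) / (2 * \<alpha> 1))"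
      "2 - (1 + \<gamma> 2)/\<alpha> 2 = (1 - (1 + \<gamma> 2) / (2 * \<alpha> 2)) + (1 - (1 + \<gamma> 2) / (2 * \<alpha> 2))"
      using F1.alpha F2.alpha by (auto simp: field_simps)
    then show ?thesis unfolding F_eq power2_eq_square by (simp only: powr_add mult_ac)
  qed
  then show ?thesis unfolding var_integral(2) sum_divide_distrib by simp
qed

text \<open>The exponent is hidden behind an existential quantifier and the error is explicit in T,
  so that the estimate can be used for varying T outside the locale that fixes T.\<close>

lemma char_fluctuation_bounds:
  "\<exists>z. norm ((LINT \<omega>|M. cis (\<Sum>j\<in>UNIV. \<theta> j * occupation_fluctuation M \<gamma> \<alpha> \<xi> \<zeta> \<phi> \<psi> T (s j) (t j) \<omega>)) - exp z)
      \<le> 2 * (error_const * T powr ((\<gamma> 1 - 1) / (2 * \<alpha> 1) + (\<gamma> 2 - 1) / (2 * \<alpha> 2))) \<and>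
    norm (z + complex_of_real (LINT x|intensity. var x) / 2)
      \<le> error_const * T powr ((\<gamma> 1 - 1) / (2 * \<alpha> 1) + (\<gamma> 2 - 1) / (2 * \<alpha> 2))"
  using char_fluctuation_approx exponent_approx rho_integral_le_powr
  by (intro exI[of _ exponent] conjI) (auto elim: order_trans intro: order_trans[OF char_fluctuation_approx])

end

context particle_system
begin

section \<open>Passage to the limit in the characteristic function\<close>

definition kappa1 :: real where
  "kappa1 = F1.potential_const * F1.p0 * (LINT b|lborel. \<phi> b)\<^sup>2 / (1 - 1/\<alpha> 1)"
definition kappa2 :: real where
  "kappa2 = F2.potential_const * F2.p0 * (LINT b|lborel. \<psi> b)\<^sup>2 / (1 - 1/\<alpha> 2)"

theorem char_fluctuation_tendsto:
  fixes s t \<theta> :: "'n::finite \<Rightarrow> real"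
  assumes st: "\<And>j. 0 \<le> s j" "\<And>j. 0 \<le> t j"
  shows "((\<lambda>T. LINT \<omega>|M. cis (\<Sum>j\<in>UNIV. \<theta> j * occupation_fluctuation M \<gamma> \<alpha> \<xi> \<zeta> \<phi> \<psi> T (s j) (t j) \<omega>)) \<longlongrightarrow>
    exp (- complex_of_real (\<Sum>j\<in>UNIV. \<Sum>k\<in>UNIV. \<theta> j * \<theta> k *
      ((kappa1 * wfb_covariance (- \<gamma> 1/\<alpha> 1) (1 - 1/\<alpha> 1) (s j) (s k)) *
       (kappa2 * wfb_covariance (- \<gamma> 2/\<alpha> 2) (1 - 1/\<alpha> 2) (t j) (t k)))) / 2)) at_top"
    (is "((\<lambda>T. ?c T) \<longlongrightarrow> exp (- complex_of_real ?V / 2)) at_top")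
proof -
  have pf: "particle_functional M \<gamma> \<alpha> \<xi> \<zeta> \<phi> \<psi> s t T" if "0 < T" for T
    using st that by unfold_locales auto
  define V where "V T = (\<Sum>j\<in>UNIV. \<Sum>k\<in>UNIV. \<theta> j * \<theta> k *
     ((F1.mass_integral (T * s j) (T * s k) / T powr (2 - (1 + \<gamma> 1)/\<alpha> 1)) *
      (F2.mass_integral (T * t j) (T * t k) / T powr (2 - (1 + \<gamma> 2)/\<alpha> 2))))" for T
  have V_lim: "(V \<longlongrightarrow> ?V) at_top"
    unfolding V_def kappa1_def kappa2_def
    by (intro tendsto_sum tendsto_mult tendsto_const F1.mass_integral_tendsto F2.mass_integral_tendsto st)
  let ?e = "(\<gamma> 1 - 1) / (2 * \<alpha> 1) + (\<gamma> 2 - 1) / (2 * \<alpha> 2)"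
  \<comment> \<open>Outside the locale \<open>error_const\<close> does not take T as an argument, so
    K is one constant for all T.\<close>
  define K where "K = particle_functional.error_const \<gamma> \<alpha> \<phi> \<psi> s t \<theta>"
  have ex: "\<exists>z. norm (?c T - exp z) \<le> 2 * (K * T powr ?e) \<and> norm (z + complex_of_real (V T) / 2) \<le> K * T powr ?e" if "0 < T" for T
  proof -
    interpret PF: particle_functional M \<gamma> \<alpha> \<xi> \<zeta> \<phi> \<psi> s t \<theta> T by (rule pf[OF that])
    have "V T = (LINT x|intensity. PF.var x)" unfolding V_def by (rule PF.var_integral_scaled[symmetric])
    then show ?thesis unfolding K_def using PF.char_fluctuation_bounds by (simp only:)
  qed
  have "\<forall>T. \<exists>z. 0 < T \<longrightarrow> norm (?c T - exp z) \<le> 2 * (K * T powr ?e) \<and> norm (z + complex_of_real (V T) / 2) \<le> K * T powr ?e"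
    using ex by blast
  then obtain z where z: "\<And>T. 0 < T \<Longrightarrow> norm (?c T - exp (z T)) \<le> 2 * (K * T powr ?e)"
    "\<And>T. 0 < T \<Longrightarrow> norm (z T + complex_of_real (V T) / 2) \<le> K * T powr ?e"
    unfolding choice_iff by blast
  have "?e < 0"
    using F1.gamma F1.alpha F2.gamma F2.alpha by (intro add_neg_neg divide_neg_pos) auto
  then have "((\<lambda>T. T powr ?e) \<longlongrightarrow> 0) at_top"
    using tendsto_neg_powr[OF _ filterlim_ident] by blast
  then have R1: "((\<lambda>T. K * T powr ?e) \<longlongrightarrow> 0) at_top"
    by (rule tendsto_mult_right_zero)
  then have R2: "((\<lambda>T. 2 * (K * T powr ?e)) \<longlongrightarrow> 0) at_top"
    by (rule tendsto_mult_right_zero)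
  have "((\<lambda>T. z T + complex_of_real (V T) / 2) \<longlongrightarrow> 0) at_top"
    by (rule Lim_null_comparison[OF _ R1]) (use z(2) in \<open>auto intro!: eventually_mono[OF eventually_gt_at_top[of 0]]\<close>)
  from tendsto_diff[OF this tendsto_divide[OF tendsto_of_real[OF V_lim] tendsto_const[of 2]]]
  have "(z \<longlongrightarrow> - complex_of_real ?V / 2) at_top" by simp
  then have lim: "((\<lambda>T. exp (z T)) \<longlongrightarrow> exp (- complex_of_real ?V / 2)) at_top" by (rule tendsto_exp)
  have "((\<lambda>T. ?c T - exp (z T)) \<longlongrightarrow> 0) at_top"
    by (rule Lim_null_comparison[OF _ R2]) (use z(1) in \<open>auto intro!: eventually_mono[OF eventually_gt_at_top[of 0]]\<close>)
  from tendsto_add[OF this lim] show ?thesis by simp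
qed

text \<open>The constant enters the Gaussian characteristic function only through its square. The
  radicand is nonnegative, so squaring undoes the root, and the factors regroup by type.\<close>

lemma limit_constant_square: "(limit_constant \<gamma> \<alpha> \<phi> \<psi>)\<^sup>2 = kappa1 * kappa2"
proof -
  have "0 \<le> F1.potential_const" "0 \<le> F2.potential_const"
    unfolding F1.potential_const_def F2.potential_const_def using F1.p_nonneg F2.p_nonneg
    by (auto intro!: integral_nonneg_AE)
  then have "0 \<le> (\<Prod>i\<in>{1,2}. 1 / (1 - 1 / \<alpha> i) * stable_density (\<alpha> i) 1 0 * (LINT x|lborel. stable_density (\<alpha> i) 1 x / \<bar>x\<bar> powr \<gamma> i))"
    using F1.p0_nonneg F2.p0_nonneg F1.exponents F2.exponents
    by (simp add: F1.potential_const_def F2.potential_const_def)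
  then show ?thesis
    unfolding limit_constant_def power_mult_distrib
    by (simp add: kappa1_def kappa2_def F1.potential_const_def F2.potential_const_def mult_ac)
qed

end

section \<open>The limit\<close>

lemma (in prob_space) centered_gaussian_square_integrable:
  assumes "centered_gaussian M X"
  shows "integrable M (\<lambda>\<omega>. (X \<omega>)\<^sup>2)"
    and "(LINT \<omega>|M. cis (X \<omega>)) = exp (- complex_of_real (LINT \<omega>|M. (X \<omega>)\<^sup>2) / 2)"
proof -
  have X [measurable]: "X \<in> borel_measurable M" using assms by (simp add: centered_gaussian_def)
  consider "AE \<omega> in M. X \<omega> = 0" | \<sigma> where "\<sigma> > 0" "distributed M lborel X (normal_density 0 \<sigma>)"
    using assms by (auto simp: centered_gaussian_def)
  then have "integrable M (\<lambda>\<omega>. (X \<omega>)\<^sup>2) \<and> (LINT \<omega>|M. cis (X \<omega>)) = exp (- complex_of_real (LINT \<omega>|M. (X \<omega>)\<^sup>2) / 2)"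
  proof cases
    case 1
    have 0: "AE \<omega> in M. (X \<omega>)\<^sup>2 = 0" using 1 by eventually_elim simp
    have "integrable M (\<lambda>\<omega>. (X \<omega>)\<^sup>2)" using integrable_cong_AE[OF _ _ 0] by simp
    moreover have "(LINT \<omega>|M. (X \<omega>)\<^sup>2) = (LINT \<omega>|M. 0)" by (rule integral_cong_AE[OF _ _ 0]) auto
    moreover have "(LINT \<omega>|M. cis (X \<omega>)) = (LINT \<omega>|M. 1)"
    proof (rule integral_cong_AE)
      show "AE \<omega> in M. cis (X \<omega>) = 1" using 1 by eventually_elim simp
    qed auto
    ultimately show ?thesis by (simp add: prob_space)
  next
    case (2 \<sigma>)
    define Z where "Z = (\<lambda>\<omega>. X \<omega> / \<sigma>)"
    have Z: "distributed M lborel Z std_normal_density"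
      using normal_standard_normal_convert[OF 2(1), of X 0] 2(2) by (simp add: Z_def)
    have XZ: "X \<omega> = \<sigma> * Z \<omega>" for \<omega> using 2(1) by (simp add: Z_def)
    have [measurable]: "Z \<in> borel_measurable M" unfolding Z_def by measurable
    have i: "integrable M (\<lambda>\<omega>. (Z \<omega>)\<^sup>2)"
      using distributed_integrable[OF Z, of "\<lambda>x. x\<^sup>2"] integrable_std_normal_moment[of 2]
      by (simp add: normal_density_nonneg)
    have E: "(LINT \<omega>|M. (Z \<omega>)\<^sup>2) = 1"
      using distributed_integral[OF Z, of "\<lambda>x. x\<^sup>2"] integral_std_normal_moment_even[of 1]
      by (simp add: normal_density_nonneg fact_numeral)
    have "distr M borel Z = std_normal_distribution"
      using distributed_distr_eq_density[OF Z] distr_cong[of M M lborel borel Z Z] by simp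
    moreover have "(LINT x|distr M borel Z. iexp (\<sigma> * x)) = (LINT \<omega>|M. iexp (\<sigma> * Z \<omega>))"
      by (rule integral_distr) auto
    ultimately have "(LINT \<omega>|M. iexp (\<sigma> * Z \<omega>)) = char std_normal_distribution \<sigma>"
      unfolding char_def by simp
    then have "(LINT \<omega>|M. cis (X \<omega>)) = complex_of_real (exp (- (\<sigma>\<^sup>2) / 2))"
      by (simp add: char_std_normal_distribution XZ cis_conv_exp)
    moreover have "(LINT \<omega>|M. (X \<omega>)\<^sup>2) = \<sigma>\<^sup>2"
      by (simp add: XZ power_mult_distrib E)
    moreover have "integrable M (\<lambda>\<omega>. (X \<omega>)\<^sup>2)"
      unfolding XZ power_mult_distrib using i by (rule integrable_mult_right)
    ultimately show ?thesis by (simp flip: exp_of_real)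
  qed
  then show "integrable M (\<lambda>\<omega>. (X \<omega>)\<^sup>2)" "(LINT \<omega>|M. cis (X \<omega>)) = exp (- complex_of_real (LINT \<omega>|M. (X \<omega>)\<^sup>2) / 2)"
    by auto
qed

lemma gaussian_field_char:
  fixes s t \<theta> :: "'n::finite \<Rightarrow> real"
  assumes W: "weighted_fractional_brownian_sheet N a b W" and st: "\<And>j. 0 \<le> s j" "\<And>j. 0 \<le> t j"
  shows "(LINT \<omega>|N. cis (\<Sum>j\<in>UNIV. \<theta> j * W (s j) (t j) \<omega>)) = exp (- complex_of_real
    (\<Sum>j\<in>UNIV. \<Sum>k\<in>UNIV. \<theta> j * \<theta> k * (wfb_covariance (a 1) (b 1) (s j) (s k) * wfb_covariance (a 2) (b 2) (t j) (t k))) / 2)"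
    and "\<And>j. W (s j) (t j) \<in> borel_measurable N" and "prob_space N"
proof -
  have field: "centered_gaussian_field N ({0..} \<times> {0..}) (\<lambda>(s, t). W s t)"
    and cov: "\<And>s t s' t'. 0 \<le> s \<Longrightarrow> 0 \<le> t \<Longrightarrow> 0 \<le> s' \<Longrightarrow> 0 \<le> t' \<Longrightarrow>
      (LINT \<omega>|N. W s t \<omega> * W s' t' \<omega>) = wfb_covariance (a 1) (b 1) s s' * wfb_covariance (a 2) (b 2) t t'"
    using W by (auto simp: weighted_fractional_brownian_sheet_def)
  show pN: "prob_space N" using field by (simp add: centered_gaussian_field_def)
  interpret prob_space N by fact
  have gauss: "centered_gaussian N (\<lambda>\<omega>. \<Sum>p\<in>J. c p * (case p of (s, t) \<Rightarrow> W s t \<omega>))"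
    if "finite J" "J \<subseteq> {0..} \<times> {0..}" for J c
  proof -
    have "(\<lambda>\<omega>. \<Sum>p\<in>J. c p * (case p of (s, t) \<Rightarrow> W s t \<omega>)) = (\<lambda>\<omega>. \<Sum>p\<in>J. c p * (case p of (s, t) \<Rightarrow> W s t) \<omega>)"
      by (intro ext sum.cong) auto
    then show ?thesis using field that by (simp add: centered_gaussian_field_def)
  qed
  have single: "centered_gaussian N (\<lambda>\<omega>. W (s j) (t j) \<omega>)" for j
    using gauss[of "{(s j, t j)}" "\<lambda>_. 1"] st by simp
  show Wm [measurable]: "\<And>j. W (s j) (t j) \<in> borel_measurable N"
    using single by (simp add: centered_gaussian_def)
  have WW: "integrable N (\<lambda>\<omega>. W (s j) (t j) \<omega> * W (s k) (t k) \<omega>)" for j k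
  proof (rule Bochner_Integration.integrable_bound)
    show "integrable N (\<lambda>\<omega>. (W (s j) (t j) \<omega>)\<^sup>2 + (W (s k) (t k) \<omega>)\<^sup>2)"
      by (intro Bochner_Integration.integrable_add centered_gaussian_square_integrable single)
    have "\<bar>x * y\<bar> \<le> x\<^sup>2 + y\<^sup>2" for x y :: real
    proof -
      have "2 * (\<bar>x\<bar> * \<bar>y\<bar>) \<le> x\<^sup>2 + y\<^sup>2" using sum_squares_bound[of "\<bar>x\<bar>" "\<bar>y\<bar>"] by simp
      moreover have "0 \<le> \<bar>x\<bar> * \<bar>y\<bar>" by simp
      ultimately show ?thesis unfolding abs_mult by linarith
    qed
    then show "AE \<omega> in N. norm (W (s j) (t j) \<omega> * W (s k) (t k) \<omega>) \<le> norm ((W (s j) (t j) \<omega>)\<^sup>2 + (W (s k) (t k) \<omega>)\<^sup>2)"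
      by simp
  qed measurable
  \<comment> \<open>The pairs of times may repeat, whereas a Gaussian field is tested on finite sets
    of indices. Coefficients belonging to the same pair are therefore added up first.\<close>
  define f where "f j = (s j, t j)" for j
  define c where "c p = (\<Sum>j | f j = p. \<theta> j)" for p
  have sum_eq: "(\<Sum>j\<in>UNIV. \<theta> j * W (s j) (t j) \<omega>) = (\<Sum>p\<in>range f. c p * (case p of (s, t) \<Rightarrow> W s t \<omega>))" for \<omega>
  proof -
    have "(\<Sum>j\<in>UNIV. \<theta> j * W (s j) (t j) \<omega>) = (\<Sum>p\<in>range f. \<Sum>j\<in>{j\<in>UNIV. f j = p}. \<theta> j * W (s j) (t j) \<omega>)"
      by (rule sum.image_gen) simp
    also have "\<dots> = (\<Sum>p\<in>range f. c p * (case p of (s, t) \<Rightarrow> W s t \<omega>))"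
    proof (rule sum.cong[OF refl])
      fix p
      have "(\<Sum>j\<in>{j\<in>UNIV. f j = p}. \<theta> j * W (s j) (t j) \<omega>) = (\<Sum>j | f j = p. \<theta> j * (case p of (s, t) \<Rightarrow> W s t \<omega>))"
        by (intro sum.cong) (auto simp: f_def)
      then show "(\<Sum>j\<in>{j\<in>UNIV. f j = p}. \<theta> j * W (s j) (t j) \<omega>) = c p * (case p of (s, t) \<Rightarrow> W s t \<omega>)"
        by (simp add: c_def sum_distrib_right)
    qed
    finally show ?thesis .
  qed
  have "centered_gaussian N (\<lambda>\<omega>. \<Sum>j\<in>UNIV. \<theta> j * W (s j) (t j) \<omega>)"
    unfolding sum_eq using st by (intro gauss) (auto simp: f_def)
  note ch = centered_gaussian_square_integrable(2)[OF this]
  have "(\<Sum>j\<in>UNIV. \<theta> j * W (s j) (t j) \<omega>)\<^sup>2 = (\<Sum>j\<in>UNIV. \<Sum>k\<in>UNIV. \<theta> j * \<theta> k * (W (s j) (t j) \<omega> * W (s k) (t k) \<omega>))" for \<omega>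
    unfolding power2_eq_square sum_product by (intro sum.cong refl) (simp only: mult_ac)
  then have "(LINT \<omega>|N. (\<Sum>j\<in>UNIV. \<theta> j * W (s j) (t j) \<omega>)\<^sup>2) = (\<Sum>j\<in>UNIV. \<Sum>k\<in>UNIV. \<theta> j * \<theta> k * (LINT \<omega>|N. W (s j) (t j) \<omega> * W (s k) (t k) \<omega>))"
    using WW by simp
  then show "(LINT \<omega>|N. cis (\<Sum>j\<in>UNIV. \<theta> j * W (s j) (t j) \<omega>)) = exp (- complex_of_real
    (\<Sum>j\<in>UNIV. \<Sum>k\<in>UNIV. \<theta> j * \<theta> k * (wfb_covariance (a 1) (b 1) (s j) (s k) * wfb_covariance (a 2) (b 2) (t j) (t k))) / 2)"
    unfolding ch by (simp only: cov st)
qed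

lemma borel_measurable_vec_lambda:
  fixes f :: "'n::finite \<Rightarrow> 'a \<Rightarrow> real"
  assumes "\<And>j. f j \<in> borel_measurable M"
  shows "(\<lambda>\<omega>. \<chi> j. f j \<omega>) \<in> borel_measurable M"
  using assms by (subst borel_measurable_euclidean_space) (auto simp: Basis_vec_def inner_axis)

theorem theorem3p1:
  fixes M :: "'a measure" and N :: "'b measure"
    and \<gamma> \<alpha> :: "nat \<Rightarrow> real" and \<phi> \<psi> :: "real \<Rightarrow> real"
    and \<xi> \<zeta> :: "nat \<Rightarrow> real \<Rightarrow> 'a \<Rightarrow> real" and W :: "real \<Rightarrow> real \<Rightarrow> 'b \<Rightarrow> real"
    and s t :: "'n::finite \<Rightarrow> real"
  assumes "\<forall>i\<in>{1,2}. 0 \<le> \<gamma> i \<and> \<gamma> i < 1 \<and> 1 < \<alpha> i \<and> \<alpha> i \<le> 2"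
    and "integrable lborel \<phi>" and "\<not> (AE x in lborel. \<phi> x = 0)"
    and "integrable lborel \<psi>" and "\<not> (AE x in lborel. \<psi> x = 0)"
    and "two_type_particle_system M \<gamma> \<alpha> \<xi> \<zeta>"
    and "weighted_fractional_brownian_sheet N (\<lambda>i. - \<gamma> i / \<alpha> i) (\<lambda>i. 1 - 1 / \<alpha> i) W"
    and "\<forall>j. 0 \<le> s j \<and> 0 \<le> t j"
  shows "converges_in_distribution
           M (\<lambda>T \<omega>. \<chi> j. occupation_fluctuation M \<gamma> \<alpha> \<xi> \<zeta> \<phi> \<psi> T (s j) (t j) \<omega>)
           N (\<lambda>\<omega>. \<chi> j. limit_constant \<gamma> \<alpha> \<phi> \<psi> * W (s j) (t j) \<omega>)
           at_top"
proof -
  interpret prob_space M using assms(6) by (simp add: two_type_particle_system_def)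
  interpret particle_system M \<gamma> \<alpha> \<xi> \<zeta> \<phi> \<psi>
    using assms by unfold_locales auto
  have st: "\<And>j. 0 \<le> s j" "\<And>j. 0 \<le> t j" using assms(8) by auto
  let ?D = "limit_constant \<gamma> \<alpha> \<phi> \<psi>"
  note W = gaussian_field_char[OF assms(7) st]
  note [measurable] = W(2)
  interpret N: prob_space N by (rule W(3))
  interpret char_convergence M N
    "\<lambda>T \<omega>. \<chi> j. occupation_fluctuation M \<gamma> \<alpha> \<xi> \<zeta> \<phi> \<psi> T (s j) (t j) \<omega>"
    "\<lambda>\<omega>. \<chi> j. ?D * W (s j) (t j) \<omega>"
  proof
    show "(\<lambda>\<omega>. \<chi> j. occupation_fluctuation M \<gamma> \<alpha> \<xi> \<zeta> \<phi> \<psi> T (s j) (t j) \<omega>) \<in> borel_measurable M" for T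
      unfolding occupation_fluctuation_def by (intro borel_measurable_vec_lambda) measurable
    show "(\<lambda>\<omega>. \<chi> j. ?D * W (s j) (t j) \<omega>) \<in> borel_measurable N"
      by (intro borel_measurable_vec_lambda) measurable
    fix \<theta> :: "real ^ 'n"
    let ?C = "\<lambda>j k. wfb_covariance (- \<gamma> 1/\<alpha> 1) (1 - 1/\<alpha> 1) (s j) (s k) * wfb_covariance (- \<gamma> 2/\<alpha> 2) (1 - 1/\<alpha> 2) (t j) (t k)"
    \<comment> \<open>The constant is absorbed into the test vector, so that the characteristic
      function of W is evaluated at the multiple of \<theta> by it.\<close>
    have Y: "\<theta> \<bullet> (\<chi> j. ?D * W (s j) (t j) \<omega>) = (\<Sum>j\<in>UNIV. (\<theta> $ j * ?D) * W (s j) (t j) \<omega>)" for \<omega>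
      by (simp add: inner_vec_def mult.assoc)
    have "(LINT \<omega>|N. cis (\<theta> \<bullet> (\<chi> j. ?D * W (s j) (t j) \<omega>)))
      = exp (- complex_of_real (\<Sum>j\<in>UNIV. \<Sum>k\<in>UNIV. (\<theta> $ j * ?D) * (\<theta> $ k * ?D) * ?C j k) / 2)"
      unfolding Y by (rule W(1))
    also have "(\<Sum>j\<in>UNIV. \<Sum>k\<in>UNIV. (\<theta> $ j * ?D) * (\<theta> $ k * ?D) * ?C j k)
      = (\<Sum>j\<in>UNIV. \<Sum>k\<in>UNIV. \<theta> $ j * \<theta> $ k *
      ((kappa1 * wfb_covariance (- \<gamma> 1/\<alpha> 1) (1 - 1/\<alpha> 1) (s j) (s k)) *
       (kappa2 * wfb_covariance (- \<gamma> 2/\<alpha> 2) (1 - 1/\<alpha> 2) (t j) (t k))))"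
    proof (intro sum.cong refl)
      fix j k
      have "(\<theta> $ j * ?D) * (\<theta> $ k * ?D) * ?C j k = \<theta> $ j * \<theta> $ k * (?D\<^sup>2 * ?C j k)"
        by (simp only: power2_eq_square mult_ac)
      then show "(\<theta> $ j * ?D) * (\<theta> $ k * ?D) * ?C j k = \<theta> $ j * \<theta> $ k *
        ((kappa1 * wfb_covariance (- \<gamma> 1/\<alpha> 1) (1 - 1/\<alpha> 1) (s j) (s k)) *
         (kappa2 * wfb_covariance (- \<gamma> 2/\<alpha> 2) (1 - 1/\<alpha> 2) (t j) (t k)))"
        unfolding limit_constant_square by (simp only: mult_ac)
    qed
    finally show "((\<lambda>T. LINT \<omega>|M. cis (\<theta> \<bullet> (\<chi> j. occupation_fluctuation M \<gamma> \<alpha> \<xi> \<zeta> \<phi> \<psi> T (s j) (t j) \<omega>)))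
      \<longlongrightarrow> (LINT \<omega>|N. cis (\<theta> \<bullet> (\<chi> j. ?D * W (s j) (t j) \<omega>)))) at_top"
      using char_fluctuation_tendsto[OF st, of "\<lambda>j. \<theta> $ j"] by (simp add: inner_vec_def)
  qed
  show ?thesis by (rule converges_in_distribution)
qed

end
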